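(* Let $\alpha,\beta\in{}^\theta\mathbb{N}I$, let $M$ be a $\mathfrak{W}_\alpha$-module and $N$ a $\mathfrak{W}_\beta$-module. Let $\gamma,\delta\in\mathbb{N}I^+$, let $P$ be an $\mathbf{R}_\gamma$-module and $Q$ an $\mathbf{R}_\delta$-module. Then there are canonical isomorphisms $$\mathrm{Res}(M\circ_BN)\cong\mathrm{Res}(M)\circ_A\mathrm{Res}(N),\qquad \mathrm{Ind}(P\circ_AQ)\cong\mathrm{Ind}(P)\circ_B\mathrm{Ind}(Q).$$
   Context: Setup. $k$ is a field with $\mathrm{char}(k)\neq 2$; modules are left modules. Fix $p,q\in k^\times$ such that $p$ is not a power of $q$ and vice versa, $p\neq\pm1$, and $\lambda\in k^\times$. Put $I=\{p^{2n}\lambda^{\pm1}\mid n\in\mathbb{Z}\}$ and assume $\pm1,\pm p,\pm q\notin I$. Let $\Gamma$ be the quiver with vertex set $I$ and an arrow $p^2i\to i$ for each $i\in I$; $|i\to j|$ is the number of arrows from $i$ to $j$. Put $I^+=\{p^{2n}\lambda\mid n\in\mathbb{Z}\}$, so that $I$ is the disjoint union of $I^+$ and $\{i^{-1}\mid i\in I^+\}$. Put $Q_{i,j}(x,y)=(-1)^{|i\to j|}(x-y)^{|i\to j|+|j\to i|}$ if $i\ne j$, and $Q_{i,i}=0$. KLR algebras. $\mathbb{N}I$ is the set of finitely supported formal sums $\tilde\nu=\sum_{i\in I}\tilde\nu_i i$, $\tilde\nu_i\in\mathbb{Z}_{\ge0}$, with $|\tilde\nu|=\sum_i\tilde\nu_i$;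 $\mathbb{N}I^+$ is the subset supported on $I^+$. For $|\tilde\nu|=m$ let $I^{\tilde\nu}=\{\mathbf{i}=(i_1,\dots,i_m)\in I^m\mid\sum_k i_k=\tilde\nu\}$ (formal sum). $\mathbf{R}_{\tilde\nu}$ is the $k$-algebra generated by $x_1,\dots,x_m$, $\sigma_1,\dots,\sigma_{m-1}$, $e(\mathbf{i})$ ($\mathbf{i}\in I^{\tilde\nu}$) with relations: (1) $e(\mathbf{i})e(\mathbf{j})=\delta_{\mathbf{i}\mathbf{j}}e(\mathbf{i})$, $\sum_{\mathbf i}e(\mathbf{i})=1$, $\sigma_ke(\mathbf{i})=e(s_k\mathbf{i})\sigma_k$, $x_le(\mathbf{i})=e(\mathbf{i})x_l$; (2) $x_rx_s=x_sx_r$; (3) $\sigma_k^2e(\mathbf{i})=Q_{i_k,i_{k+1}}(x_{k+1},x_k)e(\mathbf{i})$, $\sigma_j\sigma_k=\sigma_k\sigma_j$ for $j\ne k\pm1$, and $(\sigma_{k+1}\sigma_k\sigma_{k+1}-\sigma_k\sigma_{k+1}\sigma_k)e(\mathbf{i})$ equals $\frac{Q_{i_k,i_{k+1}}(x_{k+1},x_k)-Q_{i_k,i_{k+1}}(x_{k+1},x_{k+2})}{x_k-x_{k+2}}e(\mathbf{i})$ if $i_k=i_{k+2}$ and $0$ otherwise; (4) $(\sigma_kx_l-x_{s_k(l)}\sigma_k)e(\mathbf{i})$ equals $-e(\mathbf{i})$ if $l=k$, $i_k=i_{k+1}$; $e(\mathbf{i})$ if $l=k+1$, $i_k=i_{k+1}$;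 and $0$ otherwise. $\mathbf{R}_0=k$. VV algebras. ${}^\theta\mathbb{N}I=\{\nu=\sum_{i\in I}\nu_ii\in\mathbb{N}I\mid\nu_i=\nu_{i^{-1}}\ \forall i\}$; $|\nu|=\sum_i\nu_i$ is even. For $|\nu|=2m$ let ${}^\theta I^\nu=\{\mathbf{i}\in I^m\mid\sum_ki_k+\sum_ki_k^{-1}=\nu\}$ (formal sum). $\mathfrak{W}_\nu$ is the $k$-algebra generated by $x_1,\dots,x_m,\sigma_1,\dots,\sigma_{m-1},\pi$ and $e(\mathbf{i})$ ($\mathbf{i}\in{}^\theta I^\nu$) with relations (1)–(4) (for $\mathbf{i},\mathbf{j}\in{}^\theta I^\nu$) and (since $q^{\pm1}\notin I$) $\pi e(i_1,i_2,\dots,i_m)=e(i_1^{-1},i_2,\dots,i_m)\pi$, $\pi x_1=-x_1\pi$, $\pi x_l=x_l\pi$ ($l>1$), $\pi\sigma_k=\sigma_k\pi$ ($k\ne1$), $\pi^2=1$, $(\sigma_1\pi)^2=(\pi\sigma_1)^2$. $\mathfrak{W}_0=k$. Restriction and induction. For $\alpha\in{}^\theta\mathbb{N}I$ put $\alpha^+=\sum_{i\in I^+}\alpha_ii\in\mathbb{N}I^+$; $\alpha\mapsto\alpha^+$ is a bijection ${}^\theta\mathbb{N}I\to\mathbb{N}I^+$. Put $\mathbf{e}=\sum_{\mathbf{i}\in I^{\alpha^+}}e(\mathbf{i})\in\mathfrak{W}_\alpha$; one has $\mathbf{e}\mathfrak{W}_\alpha\mathbf{e}\cong\mathbf{R}_{\alpha^+}$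 naturally. $\mathrm{Res}(M)=\mathbf{e}M$ for a $\mathfrak{W}_\alpha$-module $M$; $\mathrm{Ind}(P)=\mathfrak{W}_\alpha\mathbf{e}\otimes_{\mathbf{R}_{\alpha^+}}P$ for an $\mathbf{R}_{\alpha^+}$-module $P$. Convolutions. For an $\mathbf{R}_\gamma$-module $P$ and $\mathbf{R}_\delta$-module $Q$, $P\circ_AQ=\mathbf{R}_{\gamma+\delta}e(\gamma,\delta)\otimes_{\mathbf{R}_\gamma\otimes\mathbf{R}_\delta}(P\otimes Q)$, with $e(\gamma,\delta)=\sum_{\mathbf{i}\in I^\gamma,\mathbf{j}\in I^\delta}e(\mathbf{i}\mathbf{j})$. For a $\mathfrak{W}_\alpha$-module $M$ and $\mathfrak{W}_\beta$-module $N$, $M\circ_BN=\mathfrak{W}_{\alpha+\beta}e(\alpha^+,\beta^+)\otimes_{\mathbf{R}_{\alpha^+}\otimes\mathbf{R}_{\beta^+}}(\mathrm{Res}(M)\otimes\mathrm{Res}(N))$. In both cases the tensor product of KLR algebras acts on the right via $e(\mathbf{i})\otimes e(\mathbf{j})\mapsto e(\mathbf{i}\mathbf{j})$, with $x_k,\sigma_k$ of the first factor mapping to $x_k,\sigma_k$ and those of the second factor to the same symbols with index shifted by the height of the first KLR weight. *)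

theory Defs
  imports "HOL-Library.Multiset" "HOL-Algebra.Free_Abelian_Groups" "HOL-Algebra.QuotRing" "HOL-Algebra.Module"
begin

section \<open>Weights\<close>

text \<open>
  A finitely supported formal sum of elements of \<open>k\<^sup>\<times>\<close> with coefficients in the natural numbers
  is a multiset; its height is \<^const>\<open>size\<close>. The parameter \<open>\<lambda>\<close> is written \<open>l\<close> below.
\<close>

definition I_plus :: "'k::field \<Rightarrow> 'k \<Rightarrow> 'k set" where
  "I_plus p l = {p powi (2 * n) * l | n. True}"

definition I_set :: "'k::field \<Rightarrow> 'k \<Rightarrow> 'k set" where
  "I_set p l = {p powi (2 * n) * l | n. True} \<union> {p powi (2 * n) * inverse l | n. True}"

definition NI_plus :: "'k::field \<Rightarrow> 'k \<Rightarrow> 'k multiset set" where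
  "NI_plus p l = {\<gamma>. set_mset \<gamma> \<subseteq> I_plus p l}"

definition theta_NI :: "'k::field \<Rightarrow> 'k \<Rightarrow> 'k multiset set" where
  "theta_NI p l = {\<nu>. set_mset \<nu> \<subseteq> I_set p l \<and> (\<forall>i\<in>I_set p l. count \<nu> i = count \<nu> (inverse i))}"

definition plus_part :: "'k::field \<Rightarrow> 'k \<Rightarrow> 'k multiset \<Rightarrow> 'k multiset" where
  "plus_part p l \<alpha> = filter_mset (\<lambda>i. i \<in> I_plus p l) \<alpha>"

text \<open>The inverse of \<open>\<alpha> \<mapsto> \<alpha>\<^sup>+\<close>; see \<open>plus_part_bij\<close> below.\<close>

definition theta :: "'k::field multiset \<Rightarrow> 'k multiset" where
  "theta \<gamma> = \<gamma> + image_mset inverse \<gamma>"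

text \<open>
  The sets of words do not mention \<open>I\<close>: if \<open>\<nu>\<close> is supported on \<open>I\<close> then every letter of such a
  word lies in \<open>I\<close>.
\<close>

definition words :: "'k multiset \<Rightarrow> 'k list set" where
  "words \<nu> = {w. mset w = \<nu>}"

definition theta_words :: "'k::field multiset \<Rightarrow> 'k list set" where
  "theta_words \<nu> = {w. mset w + image_mset inverse (mset w) = \<nu>}"

section \<open>The quiver and the polynomials \<open>Q\<close>\<close>

definition arrows :: "'k::field \<Rightarrow> 'k \<Rightarrow> 'k \<Rightarrow> nat" where
  "arrows p i j = (if i = p\<^sup>2 * j then 1 else 0)"

definition Qpoly :: "'k::field \<Rightarrow> 'k \<Rightarrow> 'k \<Rightarrow> 'r::ring_1 \<Rightarrow> 'r \<Rightarrow> 'r" where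
  "Qpoly p i j x y =
     (if i = j then 0 else (- 1) ^ arrows p i j * (x - y) ^ (arrows p i j + arrows p j i))"

text \<open>
  The polynomial \<open>(Q\<^sub>i\<^sub>j(y, x) - Q\<^sub>i\<^sub>j(y, z)) / (x - z)\<close>, with the division carried out so that it can
  be evaluated in any ring.
\<close>

definition Qquot :: "'k::field \<Rightarrow> 'k \<Rightarrow> 'k \<Rightarrow> 'r::ring_1 \<Rightarrow> 'r \<Rightarrow> 'r \<Rightarrow> 'r" where
  "Qquot p i j x y z =
     (if i = j then 0
      else - ((- 1) ^ arrows p i j *
        (let n = arrows p i j + arrows p j i
         in \<Sum>t<n. (y - x) ^ (n - Suc t) * (y - z) ^ t)))"

lemma Qquot_correct:
  fixes x y z :: "'r::comm_ring_1"
  shows "(x - z) * Qquot p i j x y z = Qpoly p i j y x - Qpoly p i j y z"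
proof (cases "i = j")
  case False
  define a where "a = arrows p i j"
  define n where "n = a + arrows p j i"
  define S where "S = (\<Sum>t<n. (y - x) ^ (n - Suc t) * (y - z) ^ t)"
  have S: "(x - z) * S = (y - z) ^ n - (y - x) ^ n"
    using power_diff_sumr2[of "y - z" n "y - x"] unfolding S_def by (simp add: mult.commute)
  have "(x - z) * Qquot p i j x y z = - ((- 1) ^ a * ((x - z) * S))"
    using False unfolding Qquot_def Let_def S_def n_def a_def by (simp add: mult.left_commute)
  also have "\<dots> = (- 1) ^ a * (y - x) ^ n - (- 1) ^ a * (y - z) ^ n"
    unfolding S right_diff_distrib by simp
  finally show ?thesis
    using False unfolding Qpoly_def n_def a_def by simp
qed (simp add: Qquot_def Qpoly_def)

section \<open>Algebras given by generators and relations\<close>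

datatype 'g word = Word (letters: "'g list")

instantiation word :: (type) monoid_add
begin
definition zero_word :: "'a word" where "zero_word = Word []"
definition plus_word :: "'a word \<Rightarrow> 'a word \<Rightarrow> 'a word"
  where "plus_word u v = Word (letters u @ letters v)"
instance by standard (auto simp: zero_word_def plus_word_def)
end

text \<open>
  Elements of the free algebra are finitely supported functions from words in the generators to
  the field, with the convolution product. A \<^const>\<open>module\<close> record over \<^typ>\<open>'k\<close> also
  carries a multiplication, so it represents a not necessarily commutative algebra over the field.
\<close>

type_synonym ('g, 'k) falg = "'g word \<Rightarrow>\<^sub>0 'k"
type_synonym ('g, 'k) presentation = "'g set \<times> ('g, 'k) falg set"

definition gen :: "'g \<Rightarrow> ('g, 'k::field) falg" where
  "gen g = Poly_Mapping.single (Word [g]) 1"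

definition free_algebra :: "'g set \<Rightarrow> ('g, 'k::field) falg ring" where
  "free_algebra G =
     \<lparr>carrier = {f. \<forall>w\<in>Poly_Mapping.keys f. set (letters w) \<subseteq> G},
      monoid.mult = (*), one = 1,
       ring.zero = 0, ring.add = (+)\<rparr>"

definition rel_ideal :: "('g, 'k::field) presentation \<Rightarrow> ('g, 'k) falg set" where
  "rel_ideal \<Xi> = genideal (free_algebra (fst \<Xi>)) (snd \<Xi>)"

definition cls :: "('g, 'k::field) presentation \<Rightarrow> ('g, 'k) falg \<Rightarrow> ('g, 'k) falg set" where
  "cls \<Xi> f = rel_ideal \<Xi> +>\<^bsub>free_algebra (fst \<Xi>)\<^esub> f"

definition alg :: "('g, 'k::field) presentation \<Rightarrow> ('k, ('g, 'k) falg set) module" where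
  "alg \<Xi> =
     (let A = free_algebra (fst \<Xi>) Quot rel_ideal \<Xi> in
      \<lparr>carrier = carrier A, monoid.mult = monoid.mult A, one = one A,
       ring.zero = ring.zero A, ring.add = ring.add A,
       smult = (\<lambda>c C. \<Union>f\<in>C. cls \<Xi> (Poly_Mapping.single 0 c * f))\<rparr>)"

text \<open>
  \<open>alg_eval B \<phi>\<close> is the homomorphism from the free algebra to \<open>B\<close> that extends \<open>\<phi>\<close>, and
  \<open>alg_lift B \<phi>\<close> the homomorphism it induces on a quotient.
\<close>

definition alg_eval ::
  "('k::field, 'b, 'z) module_scheme \<Rightarrow> ('g \<Rightarrow> 'b) \<Rightarrow> ('g, 'k) falg \<Rightarrow> 'b" where
  "alg_eval B \<phi> f =
     (\<Oplus>\<^bsub>B\<^esub>w\<in>Poly_Mapping.keys f. Poly_Mapping.lookup f w \<odot>\<^bsub>B\<^esub>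
        foldr (\<lambda>g b. \<phi> g \<otimes>\<^bsub>B\<^esub> b) (letters w) \<one>\<^bsub>B\<^esub>)"

definition alg_lift ::
  "('k::field, 'b, 'z) module_scheme \<Rightarrow> ('g \<Rightarrow> 'b) \<Rightarrow> ('g, 'k) falg set \<Rightarrow> 'b" where
  "alg_lift B \<phi> C = the_elem (alg_eval B \<phi> ` C)"

text \<open>The corner algebra \<open>e A e\<close> and the left ideal \<open>A e\<close> of an idempotent \<open>e\<close>.\<close>

definition corner :: "('k, 'a, 'z) module_scheme \<Rightarrow> 'a \<Rightarrow> ('k, 'a) module" where
  "corner A e =
     \<lparr>carrier = {e \<otimes>\<^bsub>A\<^esub> a \<otimes>\<^bsub>A\<^esub> e | a. a \<in> carrier A},
      monoid.mult = monoid.mult A, one = e,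
       ring.zero = ring.zero A, ring.add = ring.add A, smult = smult A\<rparr>"

definition left_ideal :: "('a, 'z) ring_scheme \<Rightarrow> 'a \<Rightarrow> ('a, 'a) module" where
  "left_ideal A e =
     \<lparr>carrier = {a \<otimes>\<^bsub>A\<^esub> e | a. a \<in> carrier A},
      monoid.mult = monoid.mult A, one = one A,
       ring.zero = ring.zero A, ring.add = ring.add A, smult = monoid.mult A\<rparr>"

section \<open>Left modules over noncommutative rings\<close>

text \<open>
  The locale \<^locale>\<open>module\<close> of the library requires a commutative ring. As there, the fields
  \<^const>\<open>monoid.mult\<close> and \<^const>\<open>one\<close> of the record \<open>M\<close> are irrelevant.
\<close>

locale left_module = R?: ring R + M?: abelian_group M
  for R (structure) and M :: "('a, 'm, 'z) module_scheme" (structure) +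
  assumes lsmult_closed: "\<lbrakk>a \<in> carrier R; x \<in> carrier M\<rbrakk> \<Longrightarrow> a \<odot>\<^bsub>M\<^esub> x \<in> carrier M"
    and lsmult_l_distr: "\<lbrakk>a \<in> carrier R; b \<in> carrier R; x \<in> carrier M\<rbrakk> \<Longrightarrow>
      (a \<oplus>\<^bsub>R\<^esub> b) \<odot>\<^bsub>M\<^esub> x = a \<odot>\<^bsub>M\<^esub> x \<oplus>\<^bsub>M\<^esub> b \<odot>\<^bsub>M\<^esub> x"
    and lsmult_r_distr: "\<lbrakk>a \<in> carrier R; x \<in> carrier M; y \<in> carrier M\<rbrakk> \<Longrightarrow>
      a \<odot>\<^bsub>M\<^esub> (x \<oplus>\<^bsub>M\<^esub> y) = a \<odot>\<^bsub>M\<^esub> x \<oplus>\<^bsub>M\<^esub> a \<odot>\<^bsub>M\<^esub> y"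
    and lsmult_assoc: "\<lbrakk>a \<in> carrier R; b \<in> carrier R; x \<in> carrier M\<rbrakk> \<Longrightarrow>
      (a \<otimes>\<^bsub>R\<^esub> b) \<odot>\<^bsub>M\<^esub> x = a \<odot>\<^bsub>M\<^esub> (b \<odot>\<^bsub>M\<^esub> x)"
    and lsmult_one: "x \<in> carrier M \<Longrightarrow> \<one>\<^bsub>R\<^esub> \<odot>\<^bsub>M\<^esub> x = x"

definition left_module_iso ::
  "('a, 'y) ring_scheme \<Rightarrow> ('a, 'm, 'z) module_scheme \<Rightarrow> ('a, 'n, 'w) module_scheme
    \<Rightarrow> ('m \<Rightarrow> 'n) \<Rightarrow> bool" where
  "left_module_iso R M N h \<longleftrightarrow>
     left_module R M \<and> left_module R N \<and> bij_betw h (carrier M) (carrier N) \<and>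
     (\<forall>x\<in>carrier M. \<forall>y\<in>carrier M. h (x \<oplus>\<^bsub>M\<^esub> y) = h x \<oplus>\<^bsub>N\<^esub> h y) \<and>
     (\<forall>a\<in>carrier R. \<forall>x\<in>carrier M. h (a \<odot>\<^bsub>M\<^esub> x) = a \<odot>\<^bsub>N\<^esub> h x)"

text \<open>The vector space underlying a left module over an algebra \<open>A\<close>.\<close>

definition vspace ::
  "('k, 'a, 'y) module_scheme \<Rightarrow> ('a, 'm, 'z) module_scheme \<Rightarrow> ('k, 'm) module" where
  "vspace A M =
     \<lparr>carrier = carrier M, monoid.mult = monoid.mult M, one = one M,
       ring.zero = ring.zero M, ring.add = ring.add M,
      smult = (\<lambda>c x. (c \<odot>\<^bsub>A\<^esub> \<one>\<^bsub>A\<^esub>) \<odot>\<^bsub>M\<^esub> x)\<rparr>"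

section \<open>Tensor products\<close>

text \<open>
  The tensor product of \<open>X\<close> and \<open>Y\<close> over a ring with carrier \<open>S\<close>, where \<open>S\<close> acts on the right of
  \<open>X\<close> by \<open>ra\<close> and on the left of \<open>Y\<close> by the scalar multiplication of \<open>Y\<close>: the free abelian group on
  \<open>X \<times> Y\<close> modulo bilinearity and balancing. The scalar multiplication of \<open>X\<close> is not used here.
\<close>

type_synonym ('x, 'y) tens = "(('x \<times> 'y) \<Rightarrow>\<^sub>0 int) set"

definition tens_free ::
  "('b, 'x, 'z) module_scheme \<Rightarrow> ('s, 'y, 'w) module_scheme \<Rightarrow> (('x \<times> 'y) \<Rightarrow>\<^sub>0 int) monoid" where
  "tens_free X Y = free_Abelian_group (carrier X \<times> carrier Y)"

definition tens_rels ::
  "'s set \<Rightarrow> ('x \<Rightarrow> 's \<Rightarrow> 'x) \<Rightarrow> ('b, 'x, 'z) module_scheme \<Rightarrow> ('s, 'y, 'w) module_scheme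
    \<Rightarrow> (('x \<times> 'y) \<Rightarrow>\<^sub>0 int) set" where
  "tens_rels S ra X Y = generate (tens_free X Y)
     ({frag_of (x \<oplus>\<^bsub>X\<^esub> x', y) - frag_of (x, y) - frag_of (x', y) | x x' y.
         x \<in> carrier X \<and> x' \<in> carrier X \<and> y \<in> carrier Y} \<union>
      {frag_of (x, y \<oplus>\<^bsub>Y\<^esub> y') - frag_of (x, y) - frag_of (x, y') | x y y'.
         x \<in> carrier X \<and> y \<in> carrier Y \<and> y' \<in> carrier Y} \<union>
      {frag_of (ra x s, y) - frag_of (x, s \<odot>\<^bsub>Y\<^esub> y) | x s y.
         x \<in> carrier X \<and> s \<in> S \<and> y \<in> carrier Y})"

definition tens_group ::
  "'s set \<Rightarrow> ('x \<Rightarrow> 's \<Rightarrow> 'x) \<Rightarrow> ('b, 'x, 'z) module_scheme \<Rightarrow> ('s, 'y, 'w) module_scheme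
    \<Rightarrow> ('x, 'y) tens monoid" where
  "tens_group S ra X Y = tens_free X Y Mod tens_rels S ra X Y"

definition tens_cls ::
  "'s set \<Rightarrow> ('x \<Rightarrow> 's \<Rightarrow> 'x) \<Rightarrow> ('b, 'x, 'z) module_scheme \<Rightarrow> ('s, 'y, 'w) module_scheme
    \<Rightarrow> (('x \<times> 'y) \<Rightarrow>\<^sub>0 int) \<Rightarrow> ('x, 'y) tens" where
  "tens_cls S ra X Y c = tens_rels S ra X Y #>\<^bsub>tens_free X Y\<^esub> c"

definition pure ::
  "'s set \<Rightarrow> ('x \<Rightarrow> 's \<Rightarrow> 'x) \<Rightarrow> ('b, 'x, 'z) module_scheme \<Rightarrow> ('s, 'y, 'w) module_scheme
    \<Rightarrow> 'x \<Rightarrow> 'y \<Rightarrow> ('x, 'y) tens" where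
  "pure S ra X Y x y = tens_cls S ra X Y (frag_of (x, y))"

text \<open>
  The tensor product over \<open>S\<close> as a left module, the scalar multiplication of \<open>X\<close> being a left action
  that commutes with \<open>ra\<close>: \<open>a (x \<otimes> y) = (a x) \<otimes> y\<close>.
\<close>

definition tens_module ::
  "'s set \<Rightarrow> ('x \<Rightarrow> 's \<Rightarrow> 'x) \<Rightarrow> ('b, 'x, 'z) module_scheme \<Rightarrow> ('s, 'y, 'w) module_scheme
    \<Rightarrow> ('b, ('x, 'y) tens) module" where
  "tens_module S ra X Y =
     (let T = tens_group S ra X Y in
      \<lparr>carrier = carrier T, monoid.mult = undefined, one = undefined,
       ring.zero = one T, ring.add = monoid.mult T,
       smult = (\<lambda>a C. \<Union>c\<in>C. tens_cls S ra X Y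
                  (frag_extend (\<lambda>(x, y). frag_of (a \<odot>\<^bsub>X\<^esub> x, y)) c))\<rparr>)"

text \<open>The tensor product over the ground field, for which left and right actions agree.\<close>

abbreviation (input) tensk_group ::
  "('k, 'x, 'z) module_scheme \<Rightarrow> ('k, 'y, 'w) module_scheme \<Rightarrow> ('x, 'y) tens monoid" where
  "tensk_group X Y \<equiv> tens_group UNIV (\<lambda>x c. c \<odot>\<^bsub>X\<^esub> x) X Y"

abbreviation (input) tensk_cls ::
  "('k, 'x, 'z) module_scheme \<Rightarrow> ('k, 'y, 'w) module_scheme \<Rightarrow> (('x \<times> 'y) \<Rightarrow>\<^sub>0 int)
    \<Rightarrow> ('x, 'y) tens" where
  "tensk_cls X Y \<equiv> tens_cls UNIV (\<lambda>x c. c \<odot>\<^bsub>X\<^esub> x) X Y"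

definition purek ::
  "('k, 'x, 'z) module_scheme \<Rightarrow> ('k, 'y, 'w) module_scheme \<Rightarrow> 'x \<Rightarrow> 'y \<Rightarrow> ('x, 'y) tens" where
  "purek X Y x y = pure UNIV (\<lambda>x c. c \<odot>\<^bsub>X\<^esub> x) X Y x y"

text \<open>The biadditive extension of an operation from basis elements to formal sums.\<close>

definition frag_bilin ::
  "('u \<Rightarrow> 'v \<Rightarrow> 'w) \<Rightarrow> ('u \<Rightarrow>\<^sub>0 int) \<Rightarrow> ('v \<Rightarrow>\<^sub>0 int) \<Rightarrow> ('w \<Rightarrow>\<^sub>0 int)" where
  "frag_bilin f c d = frag_extend (\<lambda>u. frag_extend (\<lambda>v. frag_of (f u v)) d) c"

text \<open>\<open>A \<otimes> B\<close> as a ring, and the \<open>A \<otimes> B\<close>-module \<open>P \<otimes> Q\<close>.\<close>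

definition alg_tensor ::
  "('k, 'a, 'z) module_scheme \<Rightarrow> ('k, 'b, 'w) module_scheme \<Rightarrow> ('a, 'b) tens ring" where
  "alg_tensor A B =
     (let T = tensk_group A B in
      \<lparr>carrier = carrier T,
       monoid.mult = (\<lambda>C D. \<Union>c\<in>C. \<Union>d\<in>D. tensk_cls A B
                 (frag_bilin (\<lambda>(a, b) (a', b'). (a \<otimes>\<^bsub>A\<^esub> a', b \<otimes>\<^bsub>B\<^esub> b')) c d)),
       one = purek A B \<one>\<^bsub>A\<^esub> \<one>\<^bsub>B\<^esub>, ring.zero = one T, ring.add = monoid.mult T\<rparr>)"

definition mod_tensor ::
  "('k, 'a, 'z) module_scheme \<Rightarrow> ('k, 'b, 'w) module_scheme \<Rightarrow>
    ('a, 'm, 'z1) module_scheme \<Rightarrow> ('b, 'n, 'w1) module_scheme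
    \<Rightarrow> (('a, 'b) tens, ('m, 'n) tens) module" where
  "mod_tensor A B P Q =
     (let T = tensk_group (vspace A P) (vspace B Q) in
      \<lparr>carrier = carrier T, monoid.mult = undefined, one = undefined,
       ring.zero = one T, ring.add = monoid.mult T,
       smult = (\<lambda>C D. \<Union>c\<in>C. \<Union>d\<in>D. tensk_cls (vspace A P) (vspace B Q)
                  (frag_bilin (\<lambda>(a, b) (x, y). (a \<odot>\<^bsub>P\<^esub> x, b \<odot>\<^bsub>Q\<^esub> y)) c d))\<rparr>)"

text \<open>
  The additive map on a tensor product induced by a balanced map \<open>f\<close>, given on \<open>x \<otimes> y\<close> by
  \<open>f (x, y)\<close>.
\<close>

definition tens_lift ::
  "('b, 'z) ring_scheme \<Rightarrow> ('x \<times> 'y \<Rightarrow> 'b) \<Rightarrow> ('x, 'y) tens \<Rightarrow> 'b" where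
  "tens_lift B f C = the_elem
     ((\<lambda>c. \<Oplus>\<^bsub>B\<^esub>u\<in>Poly_Mapping.keys c. [Poly_Mapping.lookup c u] \<cdot>\<^bsub>B\<^esub> f u) ` C)"

section \<open>KLR and VV algebras\<close>

text \<open>Generators \<open>x\<^sub>k\<close>, \<open>\<sigma>\<^sub>k\<close> (indices starting at 1), \<open>e(i)\<close> and \<open>\<pi>\<close>.\<close>

datatype 'k vvgen = gX nat | gS nat | gE "'k list" | gPi

type_synonym 'k vvfree = "('k vvgen, 'k) falg"

abbreviation xg :: "nat \<Rightarrow> 'k::field vvfree" where "xg k \<equiv> gen (gX k)"
abbreviation sg :: "nat \<Rightarrow> 'k::field vvfree" where "sg k \<equiv> gen (gS k)"
abbreviation eg :: "'k::field list \<Rightarrow> 'k vvfree" where "eg w \<equiv> gen (gE w)"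
abbreviation pig :: "'k::field vvfree" where "pig \<equiv> gen gPi"

text \<open>The \<open>k\<close>-th letter, counted from 1, and the action of simple transpositions.\<close>

definition letter :: "'k list \<Rightarrow> nat \<Rightarrow> 'k" where
  "letter w k = w ! (k - 1)"

definition swap_word :: "nat \<Rightarrow> 'k list \<Rightarrow> 'k list" where
  "swap_word k w = w[k - 1 := letter w (k + 1), k := letter w k]"

definition swap_index :: "nat \<Rightarrow> nat \<Rightarrow> nat" where
  "swap_index k l = (if l = k then k + 1 else if l = k + 1 then k else l)"

text \<open>The relations (1)--(4) for a set \<open>W\<close> of words of length \<open>m\<close>.\<close>

definition klr_rels :: "'k::field \<Rightarrow> nat \<Rightarrow> 'k list set \<Rightarrow> 'k vvfree set" where
  "klr_rels p m W =
     {eg i * eg j - (if i = j then eg i else 0) | i j. i \<in> W \<and> j \<in> W} \<union>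
     {(\<Sum>i\<in>W. eg i) - 1} \<union>
     {sg k * eg i - eg (swap_word k i) * sg k | k i. 1 \<le> k \<and> k < m \<and> i \<in> W} \<union>
     {xg l * eg i - eg i * xg l | l i. 1 \<le> l \<and> l \<le> m \<and> i \<in> W} \<union>
     {xg r * xg s - xg s * xg r | r s. 1 \<le> r \<and> r \<le> m \<and> 1 \<le> s \<and> s \<le> m} \<union>
     {sg k * sg k * eg i - Qpoly p (letter i k) (letter i (k + 1)) (xg (k + 1)) (xg k) * eg i
        | k i. 1 \<le> k \<and> k < m \<and> i \<in> W} \<union>
     {sg j * sg k - sg k * sg j
        | j k. 1 \<le> j \<and> j < m \<and> 1 \<le> k \<and> k < m \<and> j \<noteq> k + 1 \<and> k \<noteq> j + 1} \<union>
     {(sg (k + 1) * sg k * sg (k + 1) - sg k * sg (k + 1) * sg k) * eg i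
        - (if letter i k = letter i (k + 2)
           then Qquot p (letter i k) (letter i (k + 1)) (xg k) (xg (k + 1)) (xg (k + 2)) * eg i
           else 0)
        | k i. 1 \<le> k \<and> k + 1 < m \<and> i \<in> W} \<union>
     {(sg k * xg l - xg (swap_index k l) * sg k) * eg i
        - (if l = k \<and> letter i k = letter i (k + 1) then - eg i
           else if l = k + 1 \<and> letter i k = letter i (k + 1) then eg i
           else 0)
        | k l i. 1 \<le> k \<and> k < m \<and> 1 \<le> l \<and> l \<le> m \<and> i \<in> W}"

definition klr_gens :: "nat \<Rightarrow> 'k list set \<Rightarrow> 'k vvgen set" where
  "klr_gens m W = gX ` {1..m} \<union> gS ` {1..<m} \<union> gE ` W"

definition klr_pres :: "'k::field \<Rightarrow> 'k multiset \<Rightarrow> ('k vvgen, 'k) presentation" where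
  "klr_pres p \<nu> = (klr_gens (size \<nu>) (words \<nu>), klr_rels p (size \<nu>) (words \<nu>))"

definition klr :: "'k::field \<Rightarrow> 'k multiset \<Rightarrow> ('k, 'k vvfree set) module" where
  "klr p \<nu> = alg (klr_pres p \<nu>)"

text \<open>
  There is no generator \<open>\<pi>\<close> for \<open>m = 0\<close>; both presentations then have the single
  generator \<open>e([])\<close> with \<open>e([]) = 1\<close> and define the ground field.
\<close>

definition vv_rels :: "'k::field \<Rightarrow> nat \<Rightarrow> 'k list set \<Rightarrow> 'k vvfree set" where
  "vv_rels p m W =
     klr_rels p m W \<union>
     {pig * eg i - eg (i[0 := inverse (i ! 0)]) * pig | i. 1 \<le> m \<and> i \<in> W} \<union>
     (if 1 \<le> m then {pig * xg 1 + xg 1 * pig, pig * pig - 1} else {}) \<union>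
     {pig * xg l - xg l * pig | l. 1 < l \<and> l \<le> m} \<union>
     {pig * sg k - sg k * pig | k. 1 < k \<and> k < m} \<union>
     (if 2 \<le> m then {(sg 1 * pig) ^ 2 - (pig * sg 1) ^ 2} else {})"

definition vv_pres :: "'k::field \<Rightarrow> 'k multiset \<Rightarrow> ('k vvgen, 'k) presentation" where
  "vv_pres p \<nu> =
     (let m = size \<nu> div 2; W = theta_words \<nu> in
      (klr_gens m W \<union> (if 1 \<le> m then {gPi} else {}), vv_rels p m W))"

definition vv :: "'k::field \<Rightarrow> 'k multiset \<Rightarrow> ('k, 'k vvfree set) module" where
  "vv p \<nu> = alg (vv_pres p \<nu>)"

section \<open>Restriction and induction\<close>

definition e_plus :: "'k::field \<Rightarrow> 'k \<Rightarrow> 'k multiset \<Rightarrow> 'k vvfree set" where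
  "e_plus p l \<alpha> = cls (vv_pres p \<alpha>) (\<Sum>i\<in>words (plus_part p l \<alpha>). eg i)"

text \<open>The natural homomorphism from the KLR algebra of \<open>\<alpha>\<^sup>+\<close> to the corner algebra \<open>e W\<^sub>\<alpha> e\<close>.\<close>

definition incl :: "'k::field \<Rightarrow> 'k \<Rightarrow> 'k multiset \<Rightarrow> 'k vvfree set \<Rightarrow> 'k vvfree set" where
  "incl p l \<alpha> =
     alg_lift (corner (vv p \<alpha>) (e_plus p l \<alpha>))
       (\<lambda>g. cls (vv_pres p \<alpha>) (gen g) \<otimes>\<^bsub>vv p \<alpha>\<^esub> e_plus p l \<alpha>)"

definition Res ::
  "'k::field \<Rightarrow> 'k \<Rightarrow> 'k multiset \<Rightarrow> ('k vvfree set, 'm, 'z) module_scheme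
    \<Rightarrow> ('k vvfree set, 'm) module" where
  "Res p l \<alpha> M =
     \<lparr>carrier = {e_plus p l \<alpha> \<odot>\<^bsub>M\<^esub> x | x. x \<in> carrier M},
      monoid.mult = monoid.mult M, one = one M,
       ring.zero = ring.zero M, ring.add = ring.add M,
      smult = (\<lambda>r x. incl p l \<alpha> r \<odot>\<^bsub>M\<^esub> x)\<rparr>"

definition Ind ::
  "'k::field \<Rightarrow> 'k \<Rightarrow> 'k multiset \<Rightarrow> ('k vvfree set, 'm, 'z) module_scheme
    \<Rightarrow> ('k vvfree set, ('k vvfree set, 'm) tens) module" where
  "Ind p l \<alpha> P =
     tens_module (carrier (klr p (plus_part p l \<alpha>)))
       (\<lambda>w r. w \<otimes>\<^bsub>vv p \<alpha>\<^esub> incl p l \<alpha> r)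
       (left_ideal (vv p \<alpha>) (e_plus p l \<alpha>)) P"

definition Ind_pure ::
  "'k::field \<Rightarrow> 'k \<Rightarrow> 'k multiset \<Rightarrow> ('k vvfree set, 'm, 'z) module_scheme
    \<Rightarrow> 'k vvfree set \<Rightarrow> 'm \<Rightarrow> ('k vvfree set, 'm) tens" where
  "Ind_pure p l \<alpha> P w x =
     pure (carrier (klr p (plus_part p l \<alpha>)))
       (\<lambda>w r. w \<otimes>\<^bsub>vv p \<alpha>\<^esub> incl p l \<alpha> r)
       (left_ideal (vv p \<alpha>) (e_plus p l \<alpha>)) P w x"

section \<open>Convolution products\<close>

text \<open>
  Both convolutions have the form \<open>A e(\<gamma>,\<delta>) \<otimes> (P \<otimes> Q)\<close>, where \<open>A\<close> is a KLR or VV algebra. In what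
  follows \<open>\<Xi>\<close> is its presentation.
\<close>

definition e_pair :: "('k vvgen, 'k) presentation \<Rightarrow> 'k::field multiset \<Rightarrow> 'k multiset
    \<Rightarrow> 'k vvfree set" where
  "e_pair \<Xi> \<gamma> \<delta> = cls \<Xi> (\<Sum>i\<in>words \<gamma>. \<Sum>j\<in>words \<delta>. eg (i @ j))"

fun juxt_gen1 :: "'k::field multiset \<Rightarrow> 'k vvgen \<Rightarrow> 'k vvfree" where
  "juxt_gen1 \<delta> (gE i) = (\<Sum>j\<in>words \<delta>. eg (i @ j))"
| "juxt_gen1 \<delta> g = gen g"

fun juxt_gen2 :: "'k::field multiset \<Rightarrow> 'k vvgen \<Rightarrow> 'k vvfree" where
  "juxt_gen2 \<gamma> (gE j) = (\<Sum>i\<in>words \<gamma>. eg (i @ j))"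
| "juxt_gen2 \<gamma> (gX k) = xg (size \<gamma> + k)"
| "juxt_gen2 \<gamma> (gS k) = sg (size \<gamma> + k)"
| "juxt_gen2 \<gamma> gPi = pig"

text \<open>
  The homomorphism \<open>R\<^sub>\<gamma> \<otimes> R\<^sub>\<delta> \<rightarrow> e(\<gamma>,\<delta>) A e(\<gamma>,\<delta>)\<close> with \<open>e(i) \<otimes> e(j) \<mapsto> e(ij)\<close>: the product of
  the commuting homomorphisms on the two factors. The last case of \<open>juxt_gen1\<close> and of \<open>juxt_gen2\<close>
  for \<open>\<pi>\<close> is never used, since KLR algebras do not have this generator.
\<close>

definition juxt :: "('k vvgen, 'k) presentation \<Rightarrow> 'k::field multiset \<Rightarrow> 'k multiset
    \<Rightarrow> ('k vvfree set, 'k vvfree set) tens \<Rightarrow> 'k vvfree set" where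
  "juxt \<Xi> \<gamma> \<delta> =
     (let e = e_pair \<Xi> \<gamma> \<delta>; B = corner (alg \<Xi>) e in
      tens_lift B (\<lambda>(r, s).
        alg_lift B (\<lambda>g. cls \<Xi> (juxt_gen1 \<delta> g) \<otimes>\<^bsub>alg \<Xi>\<^esub> e) r \<otimes>\<^bsub>B\<^esub>
        alg_lift B (\<lambda>g. cls \<Xi> (juxt_gen2 \<gamma> g) \<otimes>\<^bsub>alg \<Xi>\<^esub> e) s))"

definition conv ::
  "'k::field \<Rightarrow> ('k vvgen, 'k) presentation \<Rightarrow> 'k multiset \<Rightarrow> 'k multiset
    \<Rightarrow> ('k vvfree set, 'm, 'z) module_scheme \<Rightarrow> ('k vvfree set, 'n, 'w) module_scheme
    \<Rightarrow> ('k vvfree set, ('k vvfree set, ('m, 'n) tens) tens) module" where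
  "conv p \<Xi> \<gamma> \<delta> P Q =
     tens_module (carrier (alg_tensor (klr p \<gamma>) (klr p \<delta>)))
       (\<lambda>a t. a \<otimes>\<^bsub>alg \<Xi>\<^esub> juxt \<Xi> \<gamma> \<delta> t)
       (left_ideal (alg \<Xi>) (e_pair \<Xi> \<gamma> \<delta>)) (mod_tensor (klr p \<gamma>) (klr p \<delta>) P Q)"

text \<open>The element \<open>a \<otimes> (x \<otimes> y)\<close> of a convolution product.\<close>

definition conv_pure ::
  "'k::field \<Rightarrow> ('k vvgen, 'k) presentation \<Rightarrow> 'k multiset \<Rightarrow> 'k multiset
    \<Rightarrow> ('k vvfree set, 'm, 'z) module_scheme \<Rightarrow> ('k vvfree set, 'n, 'w) module_scheme
    \<Rightarrow> 'k vvfree set \<Rightarrow> 'm \<Rightarrow> 'n \<Rightarrow> ('k vvfree set, ('m, 'n) tens) tens" where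
  "conv_pure p \<Xi> \<gamma> \<delta> P Q a x y =
     pure (carrier (alg_tensor (klr p \<gamma>) (klr p \<delta>)))
       (\<lambda>a t. a \<otimes>\<^bsub>alg \<Xi>\<^esub> juxt \<Xi> \<gamma> \<delta> t)
       (left_ideal (alg \<Xi>) (e_pair \<Xi> \<gamma> \<delta>)) (mod_tensor (klr p \<gamma>) (klr p \<delta>) P Q)
       a (purek (vspace (klr p \<gamma>) P) (vspace (klr p \<delta>) Q) x y)"

definition convA ::
  "'k::field \<Rightarrow> 'k multiset \<Rightarrow> 'k multiset
    \<Rightarrow> ('k vvfree set, 'm, 'z) module_scheme \<Rightarrow> ('k vvfree set, 'n, 'w) module_scheme
    \<Rightarrow> ('k vvfree set, ('k vvfree set, ('m, 'n) tens) tens) module" where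
  "convA p \<gamma> \<delta> P Q = conv p (klr_pres p (\<gamma> + \<delta>)) \<gamma> \<delta> P Q"

definition convA_pure ::
  "'k::field \<Rightarrow> 'k multiset \<Rightarrow> 'k multiset
    \<Rightarrow> ('k vvfree set, 'm, 'z) module_scheme \<Rightarrow> ('k vvfree set, 'n, 'w) module_scheme
    \<Rightarrow> 'k vvfree set \<Rightarrow> 'm \<Rightarrow> 'n \<Rightarrow> ('k vvfree set, ('m, 'n) tens) tens" where
  "convA_pure p \<gamma> \<delta> P Q = conv_pure p (klr_pres p (\<gamma> + \<delta>)) \<gamma> \<delta> P Q"

definition convB ::
  "'k::field \<Rightarrow> 'k \<Rightarrow> 'k multiset \<Rightarrow> 'k multiset
    \<Rightarrow> ('k vvfree set, 'm, 'z) module_scheme \<Rightarrow> ('k vvfree set, 'n, 'w) module_scheme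
    \<Rightarrow> ('k vvfree set, ('k vvfree set, ('m, 'n) tens) tens) module" where
  "convB p l \<alpha> \<beta> M N =
     conv p (vv_pres p (\<alpha> + \<beta>)) (plus_part p l \<alpha>) (plus_part p l \<beta>) (Res p l \<alpha> M) (Res p l \<beta> N)"

definition convB_pure ::
  "'k::field \<Rightarrow> 'k \<Rightarrow> 'k multiset \<Rightarrow> 'k multiset
    \<Rightarrow> ('k vvfree set, 'm, 'z) module_scheme \<Rightarrow> ('k vvfree set, 'n, 'w) module_scheme
    \<Rightarrow> 'k vvfree set \<Rightarrow> 'm \<Rightarrow> 'n \<Rightarrow> ('k vvfree set, ('m, 'n) tens) tens" where
  "convB_pure p l \<alpha> \<beta> M N =
     conv_pure p (vv_pres p (\<alpha> + \<beta>)) (plus_part p l \<alpha>) (plus_part p l \<beta>)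
       (Res p l \<alpha> M) (Res p l \<beta> N)"

section \<open>The bijection between weights\<close>

lemma I_set_eq: "p \<noteq> 0 \<Longrightarrow> I_set p l = I_plus p l \<union> inverse ` I_plus p l"
proof -
  assume p: "p \<noteq> 0"
  have "{p powi (2 * n) * inverse l | n. True} = inverse ` I_plus p l"
  proof (intro equalityI subsetI)
    fix x assume "x \<in> {p powi (2 * n) * inverse l | n. True}"
    then obtain n where "x = p powi (2 * n) * inverse l" by blast
    then have "x = inverse (p powi (2 * (- n)) * l)"
      by (simp add: power_int_minus)
    then show "x \<in> inverse ` I_plus p l" unfolding I_plus_def by blast
  next
    fix x assume "x \<in> inverse ` I_plus p l"
    then obtain n where "x = inverse (p powi (2 * n) * l)" unfolding I_plus_def by blast
    then have "x = p powi (2 * (- n)) * inverse l"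
      by (simp add: power_int_minus)
    then show "x \<in> {p powi (2 * n) * inverse l | n. True}" by blast
  qed
  then show ?thesis unfolding I_set_def I_plus_def by simp
qed

lemma I_plus_disjoint:
  fixes p l :: "'k::field"
  assumes "p \<noteq> 0" "l \<noteq> 0"
    and "1 \<notin> I_set p l" "- 1 \<notin> I_set p l" "p \<notin> I_set p l" "- p \<notin> I_set p l"
  shows "I_plus p l \<inter> inverse ` I_plus p l = {}"
proof (rule ccontr)
  assume "I_plus p l \<inter> inverse ` I_plus p l \<noteq> {}"
  then obtain a b where ab: "p powi (2 * a) * l = inverse (p powi (2 * b) * l)"
    unfolding I_plus_def by blast
  define c where "c = a + b"
  have "p powi (2 * a) * l * (p powi (2 * b) * l) = 1"
    unfolding ab by (rule left_inverse) (use assms(1,2) in simp)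
  moreover have "p powi (2 * n) = p powi n * p powi n" for n
    unfolding mult_2 using assms(1) by (intro power_int_add) simp
  ultimately have "p powi a * p powi a * l * (p powi b * p powi b * l) = 1"
    by metis
  then have "(p powi c * l) ^ 2 = 1"
    unfolding c_def power_int_add[OF disjI1[OF assms(1)]] power2_eq_square
    by (simp only: mult_ac)
  then have sq: "p powi c * l = 1 \<or> p powi c * l = - 1"
    by (simp add: power2_eq_1_iff)
  have "c = 2 * (c div 2) \<or> c = 2 * (c div 2 + 1) - 1" by presburger
  then obtain n where "c = 2 * n \<or> c = 2 * n - 1" by blast
  then show False
  proof
    assume "c = 2 * n"
    then have "p powi c * l \<in> I_set p l" unfolding I_set_def by blast
    then show False using sq assms by auto
  next
    assume "c = 2 * n - 1"
    then have "p powi (2 * n) * l = p * (p powi c * l)"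
      using assms(1) by (simp add: power_int_diff)
    moreover have "p powi (2 * n) * l \<in> I_set p l" unfolding I_set_def by blast
    ultimately have "p * (p powi c * l) \<in> I_set p l" by metis
    then show False using sq assms by (metis mult.right_neutral mult_minus1_right)
  qed
qed

lemma count_image_inverse: "count (image_mset inverse \<gamma>) i = count \<gamma> (inverse (i::'k::field))"
proof -
  have "inverse -` {i} = {inverse i}" by auto
  then have "count (image_mset inverse \<gamma>) i = sum (count \<gamma>) ({inverse i} \<inter> set_mset \<gamma>)"
    by (simp add: count_image_mset)
  also have "\<dots> = count \<gamma> (inverse i)"
    by (cases "inverse i \<in># \<gamma>") (auto simp: count_eq_zero_iff)
  finally show ?thesis .
qed

lemma plus_part_bij:
  fixes p l :: "'k::field"
  assumes "p \<noteq> 0" "l \<noteq> 0"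
    and "1 \<notin> I_set p l" "- 1 \<notin> I_set p l" "p \<notin> I_set p l" "- p \<notin> I_set p l"
  shows "bij_betw (plus_part p l) (theta_NI p l) (NI_plus p l)"
    and "\<gamma> \<in> NI_plus p l \<Longrightarrow> theta \<gamma> \<in> theta_NI p l \<and> plus_part p l (theta \<gamma>) = \<gamma>"
proof -
  note disj = I_plus_disjoint[OF assms] and I = I_set_eq[OF assms(1), of l]
  have inv: "i \<in> I_plus p l \<Longrightarrow> inverse i \<notin> I_plus p l" for i
    using disj by (metis IntI empty_iff imageI inverse_inverse_eq)
  show *: "theta \<gamma> \<in> theta_NI p l \<and> plus_part p l (theta \<gamma>) = \<gamma>" if "\<gamma> \<in> NI_plus p l" for \<gamma>
  proof
    show "theta \<gamma> \<in> theta_NI p l"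
      using that I unfolding theta_NI_def NI_plus_def theta_def
      by (auto simp: count_image_inverse add.commute)
    have z: "i \<notin> I_plus p l \<Longrightarrow> count \<gamma> i = 0" for i
      using that unfolding NI_plus_def by (auto simp: count_eq_zero_iff)
    show "plus_part p l (theta \<gamma>) = \<gamma>"
      by (rule multiset_eqI) (auto simp: plus_part_def theta_def count_image_inverse z inv)
  qed
  have "theta (plus_part p l \<alpha>) = \<alpha>" if "\<alpha> \<in> theta_NI p l" for \<alpha>
  proof (rule multiset_eqI)
    fix i
    have c: "i \<in> I_set p l \<Longrightarrow> count \<alpha> (inverse i) = count \<alpha> i"
      using that unfolding theta_NI_def by auto
    have z: "i \<notin> I_set p l \<Longrightarrow> count \<alpha> i = 0"
      using that unfolding theta_NI_def by (auto simp: count_eq_zero_iff)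
    have m: "i \<in> I_set p l \<longleftrightarrow> i \<in> I_plus p l \<or> inverse i \<in> I_plus p l"
      unfolding I by (metis UnCI UnE image_iff inverse_inverse_eq)
    show "count (theta (plus_part p l \<alpha>)) i = count \<alpha> i"
      using c z m inv[of i] inv[of "inverse i"]
      by (auto simp: plus_part_def theta_def count_image_inverse)
  qed
  moreover have "plus_part p l \<alpha> \<in> NI_plus p l" for \<alpha>
    by (auto simp: plus_part_def NI_plus_def)
  ultimately show "bij_betw (plus_part p l) (theta_NI p l) (NI_plus p l)"
    using * by (intro bij_betw_byWitness[where f' = theta]) auto
qed

end

theory Submission
  imports Defs "HOL-Library.Function_Algebras"
begin

text \<open>
  Write \<open>W\<close> for the VV algebra of weight \<open>\<alpha>\<close> and \<open>R\<close> for the KLR algebra of weight \<open>\<alpha>\<^sup>+\<close>. Once the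
  canonical map \<open>R \<rightarrow> e W e\<close> is known to be bijective, both isomorphisms are formal:
  \<open>e W' e(\<alpha>\<^sup>+, \<beta>\<^sup>+) = R' e(\<alpha>\<^sup>+, \<beta>\<^sup>+)\<close> in weight \<open>\<alpha> + \<beta>\<close> gives the first one, and the second one is the
  associativity of tensor products together with \<open>e (W e \<otimes> P) = P\<close>.

  The map is injective because \<open>W\<close> acts on the column \<open>W e\<close>, modelled by one copy of \<open>R\<close> for each sign
  pattern: \<open>x\<^sub>k\<close> acts by \<open>\<plusminus>x\<close>, and \<open>\<sigma>\<^sub>k\<close> and \<open>\<pi>\<close> act either by a generator of \<open>R\<close> or by a permutation of the
  patterns; this uses that \<open>I\<^sup>+\<close> is disjoint from its inverse and that no arrow joins the two. On \<open>e W e\<close> this action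
  recovers the element of \<open>R\<close>. The map is surjective because every element of \<open>W e\<close> of sign pattern \<open>\<epsilon>\<close> is, after
  moving \<open>\<epsilon>\<close> to the positive pattern by invertible generators, an element of \<open>R\<close>, and the result does not
  depend on the order in which these generators are applied.
\<close>

section \<open>Free algebras and their quotients\<close>

text \<open>All computations take place with representatives in the free algebra, modulo the ideal
  of relations, because both algebras are given by presentations and no basis of either is at hand.
  The combinatorics is that of the Weyl group of type B: a sign pattern stands for a coset of the
  symmetric group, generators that change the pattern square to 1 on it (there \<open>Q\<close> is 1
  and \<pi> is an involution), and generators that keep it act through a conjugate generator of the
  KLR algebra. The conjugate is read off from the minimal representative of the coset, which puts
  the inverted letters in front in reversed order. This reversal shapes the verification on negative
  letters: x changes sign, neighbouring positions are exchanged, and inversion reverses the arrows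
  of \<Gamma>; these three effects have to cancel in each relation. For surjectivity, simultaneous
  descents of a pattern always commute, so passing from one route to another takes only commuting
  squares; braid relations and the relation of length four between \<sigma>_1 and \<pi> enter only
  when a generator that keeps the pattern is pushed through a route.\<close>

definition sc :: "'k::field \<Rightarrow> ('g, 'k) falg" where
  "sc c = Poly_Mapping.single 0 c"

text \<open>The ambient type of all finitely supported functions on words is already a ring, so
  equations are proved there with the type class laws; \<open>FA G\<close> only records which
  generators occur.\<close>

definition FA :: "'g set \<Rightarrow> ('g, 'k::field) falg set" where
  "FA G = {f. \<forall>w\<in>Poly_Mapping.keys f. set (letters w) \<subseteq> G}"

lemma word_zero [simp]: "Word [] = 0" "letters 0 = []"
  by (simp_all add: zero_word_def)

lemma letters_plus [simp]: "letters (u + v) = letters u @ letters v"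
  by (simp add: plus_word_def)

lemma sc_0 [simp]: "sc 0 = 0" and sc_1 [simp]: "sc 1 = 1"
  and sc_add: "sc (a + b) = sc a + sc b" and sc_mult: "sc (a * b) = sc a * sc b"
  and sc_uminus: "sc (- a) = - sc a"
  by (simp_all add: sc_def single_add mult_single single_uminus)

lemma FA_0 [simp]: "0 \<in> FA G" and FA_1 [simp]: "1 \<in> FA G" and FA_sc [simp]: "sc c \<in> FA G"
  and FA_gen: "g \<in> G \<Longrightarrow> gen g \<in> FA G"
  by (auto simp: FA_def sc_def gen_def)

lemma FA_add [simp]: "f \<in> FA G \<Longrightarrow> g \<in> FA G \<Longrightarrow> f + g \<in> FA G"
  using keys_add[of f g] by (auto simp: FA_def)

lemma FA_uminus [simp]: "f \<in> FA G \<Longrightarrow> - f \<in> FA G"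
  by (auto simp: FA_def in_keys_iff)

lemma FA_diff [simp]: "f \<in> FA G \<Longrightarrow> g \<in> FA G \<Longrightarrow> f - g \<in> FA G"
  using FA_add[of f G "- g"] by simp

lemma FA_mult [simp]: "f \<in> FA G \<Longrightarrow> g \<in> FA G \<Longrightarrow> f * g \<in> FA G"
  using keys_mult[of f g] by (fastforce simp: FA_def)

lemma FA_sum [simp]: "(\<And>i. i \<in> A \<Longrightarrow> f i \<in> FA G) \<Longrightarrow> sum f A \<in> FA G"
  by (induction A rule: infinite_finite_induct) auto

lemma FA_power [simp]: "f \<in> FA G \<Longrightarrow> f ^ n \<in> FA G"
  by (induction n) auto

lemma gen_mult_single: "gen g * Poly_Mapping.single (Word u) c = Poly_Mapping.single (Word (g # u)) c"
  by (simp add: gen_def mult_single plus_word_def)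

lemma sc_mult_single: "sc c * Poly_Mapping.single w d = Poly_Mapping.single w (c * d)"
  by (simp add: sc_def mult_single)

text \<open>Every word arises from the empty one by prepending generators, and every element is a
  finite linear combination of words. There is no case for 0, which is 0 times 1. The rule replaces
  most arguments about supports and coefficients.\<close>

lemma FA_induct [consumes 1, case_names one add scale gen]:
  fixes f :: "('g, 'k::field) falg"
  assumes "f \<in> FA G" and one: "P 1"
    and add: "\<And>f g. f \<in> FA G \<Longrightarrow> g \<in> FA G \<Longrightarrow> P f \<Longrightarrow> P g \<Longrightarrow> P (f + g)"
    and scale: "\<And>c f. f \<in> FA G \<Longrightarrow> P f \<Longrightarrow> P (sc c * f)"
    and gen: "\<And>g f. g \<in> G \<Longrightarrow> f \<in> FA G \<Longrightarrow> P f \<Longrightarrow> P (gen g * f)"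
  shows "P f"
proof -
  have wd: "(Poly_Mapping.single (Word u) 1 :: ('g, 'k) falg) \<in> FA G \<and> P (Poly_Mapping.single (Word u) 1)"
    if "set u \<subseteq> G" for u
    using that
  proof (induction u)
    case Nil
    then show ?case using one by simp
  next
    case (Cons g u)
    then show ?case
      using gen[of g "Poly_Mapping.single (Word u) 1"]
      by (auto simp flip: gen_mult_single intro: FA_mult FA_gen)
  qed
  have sgl: "(Poly_Mapping.single w c :: ('g, 'k) falg) \<in> FA G \<and> P (Poly_Mapping.single w c)"
    if "set (letters w) \<subseteq> G" for w c
    using wd[OF that] scale[of "Poly_Mapping.single w 1" c]
      FA_mult[of "sc c" G "Poly_Mapping.single w 1"]
    by (auto simp: sc_mult_single)
  have P0: "P 0" using scale[of 1 0] one by simp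
  have "sum (\<lambda>w. Poly_Mapping.single w (Poly_Mapping.lookup f w)) K \<in> FA G
      \<and> P (sum (\<lambda>w. Poly_Mapping.single w (Poly_Mapping.lookup f w)) K)"
    if "finite K" "K \<subseteq> Poly_Mapping.keys f" for K
    using that
  proof (induction K)
    case empty
    then show ?case using P0 by simp
  next
    case (insert w K)
    then have "set (letters w) \<subseteq> G" using assms(1) by (auto simp: FA_def)
    then show ?case using insert sgl by (auto intro!: add FA_add)
  qed
  moreover have "sum (\<lambda>w. Poly_Mapping.single w (Poly_Mapping.lookup f w)) (Poly_Mapping.keys f) = f"
    by (rule poly_mapping_eqI)
      (auto simp: lookup_sum lookup_single when_def in_keys_iff sum.delta)
  ultimately show ?thesis by (metis finite_keys subset_refl)
qed

lemma FA_UNIV [simp]: "f \<in> FA UNIV"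
  by (simp add: FA_def)

lemma sc_commute:
  fixes f :: "('g, 'k::field) falg"
  shows "sc c * f = f * sc c"
proof -
  have "f \<in> FA UNIV" by simp
  then show ?thesis
  proof (induction f rule: FA_induct)
    case (scale d f)
    have "sc c * sc d = (sc d * sc c :: ('g, 'k) falg)" by (metis sc_mult mult.commute)
    then have "sc c * (sc d * f) = sc d * (sc c * f)"
      by (simp only: mult.assoc[symmetric])
    then show ?case by (simp add: scale.IH mult.assoc)
  next
    case (gen g f)
    have "sc c * gen g = gen g * sc c" by (simp add: sc_def gen_def mult_single)
    then have "sc c * (gen g * f) = gen g * (sc c * f)"
      by (simp only: mult.assoc[symmetric])
    then show ?case by (simp add: gen.IH mult.assoc)
  qed (simp_all add: algebra_simps)
qed

text \<open>The universal property of the free algebra in the form needed here: linear operators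
  chosen for the generators extend to an action of the whole algebra. It serves twice, for left
  multiplication, where it yields substitution homomorphisms, and for the column model of the VV
  algebra.\<close>

locale falg_op =
  fixes scale :: "'k::field \<Rightarrow> 'v::ab_group_add \<Rightarrow> 'v" and op :: "'g \<Rightarrow> 'v \<Rightarrow> 'v"
  assumes scale_add_left: "scale (a + b) v = scale a v + scale b v"
    and scale_add: "scale a (v + w) = scale a v + scale a w"
    and scale_mult: "scale (a * b) v = scale a (scale b v)"
    and scale_1 [simp]: "scale 1 v = v"
    and op_add: "op g (v + w) = op g v + op g w"
    and op_scale: "op g (scale c v) = scale c (op g v)"
begin

definition act :: "('g, 'k) falg \<Rightarrow> 'v \<Rightarrow> 'v" where
  "act f v = (\<Sum>w\<in>Poly_Mapping.keys f. scale (Poly_Mapping.lookup f w) (foldr op (letters w) v))"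

lemma scale_0 [simp]: "scale 0 v = 0"
  using scale_add_left[of 0 0 v] by simp

lemma op_0 [simp]: "op g 0 = 0" and scale_0_right [simp]: "scale c 0 = 0"
  using op_add[of g 0 0] scale_add[of c 0 0] by simp_all

lemma act_add: "act (f + g) v = act f v + act g v"
  unfolding act_def
  by (rule setsum_keys_plus_distrib[where f = "\<lambda>w c. scale c (foldr op (letters w) v)"])
     (auto simp: scale_add_left)

lemma act_0 [simp]: "act 0 v = 0"
  by (simp add: act_def)

lemma act_single: "act (Poly_Mapping.single w c) v = scale c (foldr op (letters w) v)"
  by (simp add: act_def)

lemma act_1 [simp]: "act 1 v = v"
  using act_single[of 0 1 v] by simp

lemma act_uminus: "act (- f) v = - act f v"
  using act_add[of f "- f" v] by (simp add: eq_neg_iff_add_eq_0 add.commute)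

lemma act_diff: "act (f - g) v = act f v - act g v"
  using act_add[of f "- g" v] by (simp add: act_uminus)

lemma act_sum: "act (sum F A) v = (\<Sum>i\<in>A. act (F i) v)"
  by (induction A rule: infinite_finite_induct) (auto simp: act_add)

lemma sum_decomp: "f = (\<Sum>w\<in>Poly_Mapping.keys f. Poly_Mapping.single w (Poly_Mapping.lookup f w))"
  by (rule poly_mapping_eqI)
    (auto simp: lookup_sum lookup_single when_def in_keys_iff sum.delta)

lemma op_sum: "op g (sum F A) = (\<Sum>i\<in>A. op g (F i))"
  by (induction A rule: infinite_finite_induct) (auto simp: op_add)

lemma scale_sum: "scale c (sum F A) = (\<Sum>i\<in>A. scale c (F i))"
  by (induction A rule: infinite_finite_induct) (auto simp: scale_add)

lemma act_gen_mult: "act (gen g * f) v = op g (act f v)"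
proof -
  have "gen g * f = (\<Sum>w\<in>Poly_Mapping.keys f. gen g * Poly_Mapping.single w (Poly_Mapping.lookup f w))"
    by (subst sum_decomp) (simp add: sum_distrib_left)
  then have "act (gen g * f) v =
      (\<Sum>w\<in>Poly_Mapping.keys f. act (gen g * Poly_Mapping.single w (Poly_Mapping.lookup f w)) v)"
    by (simp add: act_sum)
  also have "\<dots> = op g (act f v)"
    unfolding act_def[of f] op_sum
  proof (rule sum.cong)
    fix w
    have "gen g * Poly_Mapping.single w (Poly_Mapping.lookup f w) = Poly_Mapping.single (Word (g # letters w)) (Poly_Mapping.lookup f w)"
      by (cases w) (simp add: gen_mult_single)
    then show "act (gen g * Poly_Mapping.single w (Poly_Mapping.lookup f w)) v =
        op g (scale (Poly_Mapping.lookup f w) (foldr op (letters w) v))"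
      by (simp add: act_single op_scale)
  qed simp
  finally show ?thesis .
qed

lemma act_sc_mult: "act (sc c * f) v = scale c (act f v)"
proof -
  have "sc c * f = (\<Sum>w\<in>Poly_Mapping.keys f. sc c * Poly_Mapping.single w (Poly_Mapping.lookup f w))"
    by (subst sum_decomp) (simp add: sum_distrib_left)
  then have "act (sc c * f) v =
      (\<Sum>w\<in>Poly_Mapping.keys f. act (sc c * Poly_Mapping.single w (Poly_Mapping.lookup f w)) v)"
    by (simp add: act_sum)
  also have "\<dots> = scale c (act f v)"
    unfolding act_def[of f] scale_sum
    by (intro sum.cong) (auto simp: sc_mult_single act_single scale_mult)
  finally show ?thesis .
qed

lemma act_mult: "act (f * g) v = act f (act g v)"
proof -
  have "f \<in> FA UNIV" by simp
  then show ?thesis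
    by (induction f rule: FA_induct)
      (simp_all add: distrib_right act_add act_sc_mult act_gen_mult mult.assoc)
qed

lemma act_gen [simp]: "act (gen g) v = op g v"
  using act_gen_mult[of g 1 v] by simp

lemma act_sc [simp]: "act (sc c) v = scale c v"
  using act_sc_mult[of c 1 v] by simp

end

lemma sc_left_commute: "f * (sc c * g) = sc c * (f * g)"
  by (simp add: sc_commute[of c f] flip: mult.assoc)

interpretation left_mult: falg_op "\<lambda>c v. sc c * v" "\<lambda>g v. \<psi> g * v"
  for \<psi> :: "'g \<Rightarrow> ('h, 'k::field) falg"
proof
  show "\<psi> g * (sc c * v) = sc c * (\<psi> g * v)" for g c v
    by (rule sc_left_commute)
qed (auto simp: sc_add sc_mult algebra_simps)

text \<open>Acting on 1 turns the left multiplication action into an algebra homomorphism; by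
  \<open>left_mult_act\<close> nothing is lost in this evaluation.\<close>

definition subst :: "('g \<Rightarrow> ('h, 'k::field) falg) \<Rightarrow> ('g, 'k) falg \<Rightarrow> ('h, 'k) falg" where
  "subst \<psi> f = left_mult.act \<psi> f 1"

lemma left_mult_act: "left_mult.act \<psi> f v = subst \<psi> f * v"
proof -
  have "f \<in> FA UNIV" by simp
  then show ?thesis
    unfolding subst_def
    by (induction f rule: FA_induct)
      (simp_all add: left_mult.act_add left_mult.act_sc_mult left_mult.act_gen_mult algebra_simps)
qed

lemma subst_simps [simp]:
  "subst \<psi> 0 = 0" "subst \<psi> 1 = 1" "subst \<psi> (f + g) = subst \<psi> f + subst \<psi> g"
  "subst \<psi> (- f) = - subst \<psi> f" "subst \<psi> (f - g) = subst \<psi> f - subst \<psi> g"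
  "subst \<psi> (f * g) = subst \<psi> f * subst \<psi> g" "subst \<psi> (gen x) = \<psi> x" "subst \<psi> (sc c) = sc c"
  "subst \<psi> (f ^ n) = subst \<psi> f ^ n" "subst \<psi> (sum F A) = (\<Sum>i\<in>A. subst \<psi> (F i))"
proof -
  show mult: "subst \<psi> (f * g) = subst \<psi> f * subst \<psi> g" for f g
    using left_mult.act_mult[of \<psi> f g 1] by (simp add: left_mult_act)
  show one: "subst \<psi> 1 = 1" by (simp add: subst_def)
  show "subst \<psi> (f ^ n) = subst \<psi> f ^ n"
    by (induction n) (auto simp: mult one)
qed (simp_all add: subst_def left_mult.act_add left_mult.act_diff left_mult.act_uminus
    left_mult.act_sum)

lemma subst_FA: "f \<in> FA G \<Longrightarrow> (\<And>g. g \<in> G \<Longrightarrow> \<psi> g \<in> FA H) \<Longrightarrow> subst \<psi> f \<in> FA H"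
  by (induction f rule: FA_induct) auto

lemma subst_gen [simp]: "subst gen f = f"
proof -
  have "f \<in> FA UNIV" by simp
  then show ?thesis by (induction f rule: FA_induct) auto
qed

lemma carrier_free_algebra [simp]: "carrier (free_algebra G) = FA G"
  by (simp add: free_algebra_def FA_def)

lemma free_algebra_simps [simp]:
  "x \<otimes>\<^bsub>free_algebra G\<^esub> y = x * y" "x \<oplus>\<^bsub>free_algebra G\<^esub> y = x + y"
  "\<one>\<^bsub>free_algebra G\<^esub> = 1" "\<zero>\<^bsub>free_algebra G\<^esub> = 0"
  by (simp_all add: free_algebra_def)

lemma ring_free_algebra:
  fixes G :: "'g set"
  shows "ring (free_algebra G :: ('g, 'k::field) falg ring)"
proof (rule ringI)
  let ?A = "free_algebra G :: ('g, 'k) falg ring"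
  show "abelian_group ?A"
  proof (rule abelian_groupI)
    fix x :: "('g, 'k) falg" assume "x \<in> carrier ?A"
    then have "- x \<in> carrier ?A \<and> - x \<oplus>\<^bsub>?A\<^esub> x = \<zero>\<^bsub>?A\<^esub>" by simp
    then show "\<exists>y\<in>carrier ?A. y \<oplus>\<^bsub>?A\<^esub> x = \<zero>\<^bsub>?A\<^esub>" by blast
  qed (auto simp: algebra_simps)
  show "monoid ?A"
    by (rule monoidI) (auto simp: algebra_simps)
qed (auto simp: algebra_simps)

locale pres =
  fixes \<Xi> :: "('g, 'k::field) presentation"
  assumes rels_FA: "snd \<Xi> \<subseteq> FA (fst \<Xi>)"
begin

abbreviation Fr :: "('g, 'k) falg set" where "Fr \<equiv> FA (fst \<Xi>)"
abbreviation "J \<equiv> rel_ideal \<Xi>"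

lemma J_ideal: "ideal J (free_algebra (fst \<Xi>))"
  unfolding rel_ideal_def
  using ring.genideal_ideal[OF ring_free_algebra] rels_FA by simp

lemma J_rel: "r \<in> snd \<Xi> \<Longrightarrow> r \<in> J"
  unfolding rel_ideal_def genideal_def by blast

lemma J_FA: "f \<in> J \<Longrightarrow> f \<in> Fr"
  using ideal.Icarr[OF J_ideal] by simp

lemma J_0 [simp]: "0 \<in> J"
  using additive_subgroup.zero_closed[OF ideal.axioms(1)[OF J_ideal]] by simp

lemma J_add: "f \<in> J \<Longrightarrow> g \<in> J \<Longrightarrow> f + g \<in> J"
  using additive_subgroup.a_closed[OF ideal.axioms(1)[OF J_ideal]] by fastforce

lemma J_lmult: "f \<in> J \<Longrightarrow> a \<in> Fr \<Longrightarrow> a * f \<in> J"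
  using ideal.I_l_closed[OF J_ideal] by fastforce

lemma J_rmult: "f \<in> J \<Longrightarrow> a \<in> Fr \<Longrightarrow> f * a \<in> J"
  using ideal.I_r_closed[OF J_ideal] by fastforce

lemma J_uminus: "f \<in> J \<Longrightarrow> - f \<in> J"
  using J_lmult[of f "- 1"] by simp

lemma J_sum: "(\<And>i. i \<in> A \<Longrightarrow> f i \<in> J) \<Longrightarrow> sum f A \<in> J"
  by (induction A rule: infinite_finite_induct) (auto intro: J_add)

text \<open>Closure under negation follows by multiplying with -1, so the listed conditions make
  \<open>K\<close> an ideal of the free algebra. A proof that a map respects all consequences of the
  relations applies this to the set of elements on which it behaves as desired.\<close>

lemma J_minimal:
  assumes "snd \<Xi> \<subseteq> K" "K \<subseteq> Fr" "0 \<in> K" "\<And>f g. f \<in> K \<Longrightarrow> g \<in> K \<Longrightarrow> f + g \<in> K"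
    and "\<And>f a. f \<in> K \<Longrightarrow> a \<in> Fr \<Longrightarrow> a * f \<in> K" "\<And>f a. f \<in> K \<Longrightarrow> a \<in> Fr \<Longrightarrow> f * a \<in> K"
  shows "J \<subseteq> K"
proof -
  interpret A: ring "free_algebra (fst \<Xi>) :: ('g, 'k) falg ring" by (rule ring_free_algebra)
  have "f \<in> K \<Longrightarrow> - f \<in> K" for f using assms(5)[of f "- 1"] by simp
  moreover have "\<ominus>\<^bsub>free_algebra (fst \<Xi>)\<^esub> f = - f" if "f \<in> Fr" for f
    using that A.minus_equality[of "- f" f] by simp
  ultimately have "subgroup K (add_monoid (free_algebra (fst \<Xi>)))"
    using assms by (intro A.add.subgroupI) (auto simp flip: a_inv_def)
  then have "ideal K (free_algebra (fst \<Xi>))"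
    using assms by (intro idealI ring_free_algebra) auto
  then show ?thesis
    unfolding rel_ideal_def genideal_def using assms(1) by blast
qed

text \<open>Equality in the quotient, stated for representatives. Membership in \<open>Fr\<close> is
  part of the relation, so that a chain of congruences never leaves the subring in which
  \<open>J\<close> is an ideal.\<close>

definition eqv :: "('g, 'k) falg \<Rightarrow> ('g, 'k) falg \<Rightarrow> bool" (infix \<open>\<doteq>\<close> 50) where
  "f \<doteq> g \<longleftrightarrow> f \<in> Fr \<and> g \<in> Fr \<and> f - g \<in> J"

lemma eqv_FA: "f \<doteq> g \<Longrightarrow> f \<in> Fr" "f \<doteq> g \<Longrightarrow> g \<in> Fr"
  by (simp_all add: eqv_def)

lemma eqv_refl [simp]: "f \<doteq> f \<longleftrightarrow> f \<in> Fr"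
  by (simp add: eqv_def)

lemma eqv_sym: "f \<doteq> g \<Longrightarrow> g \<doteq> f"
  unfolding eqv_def using J_uminus[of "f - g"] by simp

lemma eqv_trans [trans]: "f \<doteq> g \<Longrightarrow> g \<doteq> h \<Longrightarrow> f \<doteq> h"
  unfolding eqv_def using J_add[of "f - g" "g - h"] by simp

lemma eqv_add: "f \<doteq> g \<Longrightarrow> f' \<doteq> g' \<Longrightarrow> f + f' \<doteq> g + g'"
  unfolding eqv_def using J_add[of "f - g" "f' - g'"] by (simp add: algebra_simps)

lemma eqv_uminus: "f \<doteq> g \<Longrightarrow> - f \<doteq> - g"
  unfolding eqv_def using J_uminus[of "f - g"] by (simp add: algebra_simps)

lemma eqv_mult: "f \<doteq> g \<Longrightarrow> f' \<doteq> g' \<Longrightarrow> f * f' \<doteq> g * g'"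
  unfolding eqv_def
  using J_add[of "(f - g) * f'" "g * (f' - g')"] J_rmult[of "f - g" f'] J_lmult[of "f' - g'" g]
  by (simp add: algebra_simps)

lemma eqv_multl: "f' \<doteq> g' \<Longrightarrow> f \<in> Fr \<Longrightarrow> f * f' \<doteq> f * g'"
  by (rule eqv_mult) auto

lemma eqv_multr: "f \<doteq> g \<Longrightarrow> f' \<in> Fr \<Longrightarrow> f * f' \<doteq> g * f'"
  by (rule eqv_mult) auto

lemma eqv_sum: "(\<And>i. i \<in> A \<Longrightarrow> f i \<doteq> g i) \<Longrightarrow> sum f A \<doteq> sum g A"
  by (induction A rule: infinite_finite_induct) (auto intro: eqv_add)

lemma eqvI: "f - g \<in> J \<Longrightarrow> g \<in> Fr \<Longrightarrow> f \<doteq> g"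
  unfolding eqv_def using J_FA[of "f - g"] FA_add[of "f - g" "fst \<Xi>" g] by simp

lemma eqv_0_iff: "f \<doteq> 0 \<longleftrightarrow> f \<in> J"
  unfolding eqv_def using J_FA[of f] by auto

lemma cls_def': "cls \<Xi> f = {j + f | j. j \<in> J}"
  by (auto simp: cls_def a_r_coset_def r_coset_def)

lemma cls_eq_iff: "f \<in> Fr \<Longrightarrow> g \<in> Fr \<Longrightarrow> cls \<Xi> f = cls \<Xi> g \<longleftrightarrow> f \<doteq> g"
proof
  assume FA: "f \<in> Fr" "g \<in> Fr"
  {
    assume "cls \<Xi> f = cls \<Xi> g"
    moreover have "f \<in> cls \<Xi> f" unfolding cls_def' using J_0 by force
    ultimately obtain j where "j \<in> J" "f = j + g" unfolding cls_def' by auto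
    then show "f \<doteq> g" using FA by (simp add: eqv_def)
  }
  have *: "cls \<Xi> f \<subseteq> cls \<Xi> g" if "f \<doteq> g" for f g
  proof
    fix x assume "x \<in> cls \<Xi> f"
    then obtain j where "j \<in> J" "x = j + f" unfolding cls_def' by auto
    then have "x = (j + (f - g)) + g" "j + (f - g) \<in> J"
      using that J_add by (auto simp: eqv_def)
    then show "x \<in> cls \<Xi> g" unfolding cls_def' by blast
  qed
  assume "f \<doteq> g"
  then show "cls \<Xi> f = cls \<Xi> g" using *[of f g] *[of g f] eqv_sym by blast
qed

lemma cls_eqI: "f \<doteq> g \<Longrightarrow> cls \<Xi> f = cls \<Xi> g"
  using cls_eq_iff eqv_FA by blast

lemma mem_cls: "f \<in> Fr \<Longrightarrow> g \<in> cls \<Xi> f \<longleftrightarrow> g \<doteq> f"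
proof -
  assume f: "f \<in> Fr"
  have "g \<in> cls \<Xi> f \<longleftrightarrow> g - f \<in> J"
    unfolding cls_def' by (auto intro: exI[of _ "g - f"])
  then show ?thesis using f eqvI[of g f] by (auto simp: eqv_def)
qed

lemma carrier_alg: "carrier (alg \<Xi>) = cls \<Xi> ` Fr"
  by (auto simp: alg_def Let_def FactRing_def A_RCOSETS_def' cls_def)

lemma cls_closed [simp]: "f \<in> Fr \<Longrightarrow> cls \<Xi> f \<in> carrier (alg \<Xi>)"
  by (simp add: carrier_alg)

lemma mult_cls: "f \<in> Fr \<Longrightarrow> g \<in> Fr \<Longrightarrow> cls \<Xi> f \<otimes>\<^bsub>alg \<Xi>\<^esub> cls \<Xi> g = cls \<Xi> (f * g)"
  using ideal.rcoset_mult_add[OF J_ideal, of f g]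
  by (simp add: alg_def Let_def FactRing_def cls_def)

lemma add_cls: "f \<in> Fr \<Longrightarrow> g \<in> Fr \<Longrightarrow> cls \<Xi> f \<oplus>\<^bsub>alg \<Xi>\<^esub> cls \<Xi> g = cls \<Xi> (f + g)"
  using abelian_subgroup.a_rcos_sum[OF _ , of J "free_algebra (fst \<Xi>)" f g]
    abelian_subgroupI3[OF ideal.axioms(1)[OF J_ideal]
      ring.is_abelian_group[OF ring_free_algebra]]
  by (simp add: alg_def Let_def FactRing_def cls_def)

lemma one_alg: "\<one>\<^bsub>alg \<Xi>\<^esub> = cls \<Xi> 1"
  by (simp add: alg_def Let_def FactRing_def cls_def)

lemma zero_alg: "\<zero>\<^bsub>alg \<Xi>\<^esub> = cls \<Xi> 0"
  by (simp add: alg_def Let_def FactRing_def cls_def')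

lemma smult_cls: "f \<in> Fr \<Longrightarrow> c \<odot>\<^bsub>alg \<Xi>\<^esub> cls \<Xi> f = cls \<Xi> (sc c * f)"
proof -
  assume f: "f \<in> Fr"
  have "cls \<Xi> (sc c * g) = cls \<Xi> (sc c * f)" if "g \<in> cls \<Xi> f" for g
    using that f by (intro cls_eqI eqv_multl) (auto simp: mem_cls)
  moreover have "f \<in> cls \<Xi> f" using f by (simp add: mem_cls)
  ultimately have "(\<Union>g\<in>cls \<Xi> f. cls \<Xi> (sc c * g)) = cls \<Xi> (sc c * f)" by blast
  then show ?thesis by (simp add: alg_def Let_def sc_def)
qed

lemma ring_alg: "ring (alg \<Xi>)"
proof -
  interpret Q: ring "free_algebra (fst \<Xi>) Quot J" by (rule ideal.quotient_is_ring[OF J_ideal])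
  show ?thesis
  proof (rule ringI)
    show "abelian_group (alg \<Xi>)"
      by (rule abelian_groupI)
        (auto simp: alg_def Let_def Q.a_ac Q.l_neg intro: Q.a_inv_closed)
    show "monoid (alg \<Xi>)"
      by (rule monoidI) (auto simp: alg_def Let_def Q.m_assoc)
  qed (auto simp: alg_def Let_def Q.l_distr Q.r_distr)
qed

end

lemma carrier_corner:
  fixes R :: "('k, 'a, 'z) module_scheme" (structure)
  assumes "ring R" "e \<in> carrier R" "e \<otimes> e = e"
  shows "x \<in> carrier (corner R e) \<longleftrightarrow> x \<in> carrier R \<and> e \<otimes> x = x \<and> x \<otimes> e = x"
proof
  interpret ring R by fact
  note [simp] = assms
  have e1 [simp]: "e \<otimes> (e \<otimes> a) = e \<otimes> a" if "a \<in> carrier R" for a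
    using that by (simp flip: m_assoc)
  {
    assume "x \<in> carrier (corner R e)"
    then obtain a where "a \<in> carrier R" "x = e \<otimes> a \<otimes> e" by (auto simp: corner_def)
    then show "x \<in> carrier R \<and> e \<otimes> x = x \<and> x \<otimes> e = x" by (simp add: m_assoc)
  }
  assume "x \<in> carrier R \<and> e \<otimes> x = x \<and> x \<otimes> e = x"
  then have "x = e \<otimes> x \<otimes> e" "x \<in> carrier R" by simp_all
  then show "x \<in> carrier (corner R e)" unfolding corner_def by auto
qed

lemma ring_corner:
  fixes R :: "('k, 'a, 'z) module_scheme" (structure)
  assumes "ring R" "e \<in> carrier R" "e \<otimes> e = e"
  shows "ring (corner R e)"
proof -
  interpret ring R by fact
  note [simp] = assms
  have e1 [simp]: "e \<otimes> (e \<otimes> a) = e \<otimes> a" if "a \<in> carrier R" for a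
    using that by (simp flip: m_assoc)
  note c = carrier_corner[OF assms]
  show ?thesis
  proof (rule ringI)
    show "abelian_group (corner R e)"
    proof (rule abelian_groupI)
      fix x assume "x \<in> carrier (corner R e)"
      then have "\<ominus> x \<in> carrier (corner R e) \<and> \<ominus> x \<oplus> x = \<zero>"
        unfolding c by (simp add: l_minus r_minus l_neg)
      then show "\<exists>y\<in>carrier (corner R e). y \<oplus>\<^bsub>corner R e\<^esub> x = \<zero>\<^bsub>corner R e\<^esub>"
        by (auto simp: corner_def)
    next
      show "\<zero>\<^bsub>corner R e\<^esub> \<in> carrier (corner R e)"
        unfolding c by (simp add: corner_def)
    next
      fix x y assume "x \<in> carrier (corner R e)" "y \<in> carrier (corner R e)"
      then show "x \<oplus>\<^bsub>corner R e\<^esub> y \<in> carrier (corner R e)"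
        unfolding c by (simp add: corner_def l_distr r_distr)
    qed (auto simp: c, auto simp: corner_def a_ac)
    show "monoid (corner R e)"
    proof (rule monoidI)
      show "\<one>\<^bsub>corner R e\<^esub> \<in> carrier (corner R e)"
        unfolding c by (simp add: corner_def)
      fix x y assume "x \<in> carrier (corner R e)" "y \<in> carrier (corner R e)"
      then show "x \<otimes>\<^bsub>corner R e\<^esub> y \<in> carrier (corner R e)"
        unfolding c using m_assoc[of e x y] by (simp add: corner_def) (simp add: m_assoc)
    qed (auto simp: c, auto simp: corner_def m_assoc)
  qed (auto simp: c, auto simp: corner_def l_distr r_distr)
qed

text \<open>Homomorphisms from a presented algebra to the corner of \<open>E\<close> in the algebra
  presented by \<open>\<Xi>\<close>, sending a generator h to \<psi>(h) E. The unit goes to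
  \<open>E\<close> and not to 1, so relations are required only after multiplication by
  \<open>E\<close>; commuting with \<open>E\<close> makes the assignment multiplicative. The locale
  covers the map from R to e W e and both factors of a juxtaposition.\<close>

locale corner_lift = src: pres \<Upsilon> + tgt: pres \<Xi>
  for \<Upsilon> :: "('h, 'k::field) presentation" and \<Xi> :: "('g, 'k) presentation" +
  fixes \<psi> :: "'h \<Rightarrow> ('g, 'k) falg" and E :: "('g, 'k) falg"
  assumes E_FA: "E \<in> tgt.Fr" and E_idem: "tgt.eqv (E * E) E"
    and \<psi>_FA: "h \<in> fst \<Upsilon> \<Longrightarrow> \<psi> h \<in> tgt.Fr"
    and \<psi>_comm: "h \<in> fst \<Upsilon> \<Longrightarrow> tgt.eqv (E * \<psi> h) (\<psi> h * E)"
    and \<psi>_rel: "r \<in> snd \<Upsilon> \<Longrightarrow> subst \<psi> r * E \<in> tgt.J"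
begin

lemma subst_closed: "f \<in> src.Fr \<Longrightarrow> subst \<psi> f \<in> tgt.Fr"
  by (rule subst_FA) (auto intro: \<psi>_FA)

lemma subst_comm: "f \<in> src.Fr \<Longrightarrow> tgt.eqv (E * subst \<psi> f) (subst \<psi> f * E)"
proof (induction f rule: FA_induct)
  case one
  then show ?case by (simp add: E_FA)
next
  case (add f g)
  then show ?case by (simp add: tgt.eqv_add algebra_simps)
next
  case (scale c f)
  have "E * (sc c * subst \<psi> f) = sc c * (E * subst \<psi> f)" by (rule sc_left_commute)
  then show ?case using scale tgt.eqv_multl[OF scale(2), of "sc c"] by (simp add: mult.assoc)
next
  case (gen g f)
  have "tgt.eqv (E * \<psi> g * subst \<psi> f) (\<psi> g * E * subst \<psi> f)"
    using gen by (intro tgt.eqv_multr \<psi>_comm subst_closed) auto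
  also have "tgt.eqv (\<psi> g * E * subst \<psi> f) (\<psi> g * (subst \<psi> f * E))"
    unfolding mult.assoc using gen by (intro tgt.eqv_multl) (auto simp: \<psi>_FA)
  finally show ?case by (simp add: mult.assoc)
qed

lemma subst_mult: "f \<in> src.Fr \<Longrightarrow> g \<in> src.Fr \<Longrightarrow>
  tgt.eqv (subst \<psi> f * E * (subst \<psi> g * E)) (subst \<psi> (f * g) * E)"
proof -
  assume fg: "f \<in> src.Fr" "g \<in> src.Fr"
  have "tgt.eqv (subst \<psi> f * (E * subst \<psi> g) * E) (subst \<psi> f * (subst \<psi> g * E) * E)"
    using fg by (intro tgt.eqv_multr tgt.eqv_multl subst_comm subst_closed E_FA) auto
  also have "tgt.eqv \<dots> (subst \<psi> f * (subst \<psi> g * E))"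
    unfolding mult.assoc using fg by (intro tgt.eqv_multl E_idem subst_closed) auto
  finally show ?thesis by (simp add: mult.assoc)
qed

lemma subst_J: "f \<in> src.J \<Longrightarrow> subst \<psi> f * E \<in> tgt.J"
proof -
  let ?K = "{f \<in> src.Fr. subst \<psi> f * E \<in> tgt.J}"
  have "src.J \<subseteq> ?K"
  proof (rule src.J_minimal)
    show "snd \<Upsilon> \<subseteq> ?K" using src.rels_FA \<psi>_rel by auto
    fix f a assume f: "f \<in> ?K" and a: "a \<in> src.Fr"
    show "a * f \<in> ?K"
      using f a tgt.J_lmult[of "subst \<psi> f * E" "subst \<psi> a"] subst_closed by (auto simp: mult.assoc)
    \<comment> \<open>For closure on the right, \<open>E\<close> has to cross the image of a: modulo
      \<open>J\<close>, the image of f a times \<open>E\<close> is the product of the images of f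
      and a, each followed by \<open>E\<close>.\<close>
    have "subst \<psi> f * E * (subst \<psi> a * E) \<in> tgt.J"
      using f a E_FA by (intro tgt.J_rmult[OF _ FA_mult]) (auto intro: subst_closed)
    then show "f * a \<in> ?K"
      using f a tgt.eqv_trans[OF tgt.eqv_sym[OF subst_mult[of f a]]] by (auto simp flip: tgt.eqv_0_iff)
  qed (auto simp: algebra_simps intro: tgt.J_add)
  then show "f \<in> src.J \<Longrightarrow> subst \<psi> f * E \<in> tgt.J" by blast
qed

abbreviation "B \<equiv> corner (alg \<Xi>) (cls \<Xi> E)"

lemma ring_B: "ring B"
  using E_FA E_idem by (intro ring_corner tgt.ring_alg) (auto simp: tgt.mult_cls tgt.cls_eq_iff)

lemma carrier_B: "f \<in> tgt.Fr \<Longrightarrow> cls \<Xi> f \<in> carrier B \<longleftrightarrow> tgt.eqv (E * f) f \<and> tgt.eqv (f * E) f"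
  using E_FA E_idem by (simp add: carrier_corner[OF tgt.ring_alg] tgt.mult_cls tgt.cls_eq_iff)

lemma subst_B: "f \<in> src.Fr \<Longrightarrow> cls \<Xi> (subst \<psi> f * E) \<in> carrier B"
proof -
  assume f: "f \<in> src.Fr"
  have "tgt.eqv (E * subst \<psi> f * E) (subst \<psi> f * E * E)"
    using f E_FA by (intro tgt.eqv_multr subst_comm)
  moreover have "tgt.eqv (subst \<psi> f * E * E) (subst \<psi> f * E)"
    unfolding mult.assoc using f E_idem by (intro tgt.eqv_multl subst_closed)
  ultimately show ?thesis
    using f E_FA by (subst carrier_B) (auto simp: subst_closed mult.assoc intro: tgt.eqv_trans)
qed

abbreviation "\<phi> \<equiv> \<lambda>h. cls \<Xi> (\<psi> h) \<otimes>\<^bsub>alg \<Xi>\<^esub> cls \<Xi> E"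

text \<open>A finite sum in the corner ring, taken word by word, is matched with a single
  substitution in the free algebra: words are handled by induction along their letters, the sum by
  induction on the set of words in the support.\<close>

lemma alg_eval_B:
  assumes f: "f \<in> src.Fr"
  shows "alg_eval B \<phi> f = cls \<Xi> (subst \<psi> f * E)"
proof -
  interpret B: ring B by (rule ring_B)
  have word: "foldr (\<lambda>g b. \<phi> g \<otimes>\<^bsub>B\<^esub> b) u \<one>\<^bsub>B\<^esub> =
      cls \<Xi> (subst \<psi> (Poly_Mapping.single (Word u) 1) * E)" if "set u \<subseteq> fst \<Upsilon>" for u
    using that
  proof (induction u)
    case Nil
    then show ?case by (simp add: corner_def)
  next
    case (Cons g u)
    let ?f = "Poly_Mapping.single (Word u) 1 :: ('h, 'k) falg"
    have FA: "gen g \<in> src.Fr" "?f \<in> src.Fr" "\<psi> g \<in> tgt.Fr"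
      using Cons by (auto intro: FA_gen \<psi>_FA) (auto simp: FA_def)
    then have "foldr (\<lambda>g b. \<phi> g \<otimes>\<^bsub>B\<^esub> b) (g # u) \<one>\<^bsub>B\<^esub> = cls \<Xi> (\<psi> g * E * (subst \<psi> ?f * E))"
      using Cons E_FA subst_closed[of ?f] by (simp add: corner_def tgt.mult_cls)
    also have "\<dots> = cls \<Xi> (subst \<psi> (gen g * ?f) * E)"
      using subst_mult[OF FA(1,2)] by (intro tgt.cls_eqI) simp
    finally show ?case by (simp only: gen_mult_single)
  qed
  let ?t = "\<lambda>w. Poly_Mapping.single w (Poly_Mapping.lookup f w) :: ('h, 'k) falg"
  have t: "?t w \<in> src.Fr" if "w \<in> Poly_Mapping.keys f" for w
    using f that by (auto simp: FA_def)
  have "alg_eval B \<phi> f = (\<Oplus>\<^bsub>B\<^esub>w\<in>Poly_Mapping.keys f. cls \<Xi> (subst \<psi> (?t w) * E))"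
    unfolding alg_eval_def
  proof (rule B.finsum_cong')
    show "(\<lambda>w. cls \<Xi> (subst \<psi> (?t w) * E)) \<in> Poly_Mapping.keys f \<rightarrow> carrier B"
      using t subst_B by auto
    fix w assume w: "w \<in> Poly_Mapping.keys f"
    let ?f = "Poly_Mapping.single w 1 :: ('h, 'k) falg"
    have *: "set (letters w) \<subseteq> fst \<Upsilon>" "?f \<in> src.Fr" using f w by (auto simp: FA_def)
    have "Poly_Mapping.lookup f w \<odot>\<^bsub>B\<^esub> foldr (\<lambda>g b. \<phi> g \<otimes>\<^bsub>B\<^esub> b) (letters w) \<one>\<^bsub>B\<^esub>
        = cls \<Xi> (sc (Poly_Mapping.lookup f w) * (subst \<psi> ?f * E))"
      using word[OF *(1)] subst_closed[OF *(2)] E_FA by (simp add: corner_def tgt.smult_cls)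
    also have "sc (Poly_Mapping.lookup f w) * (subst \<psi> ?f * E) = subst \<psi> (sc (Poly_Mapping.lookup f w) * ?f) * E"
      by (simp add: mult.assoc)
    also have "sc (Poly_Mapping.lookup f w) * ?f = ?t w" by (simp add: sc_mult_single)
    finally show "Poly_Mapping.lookup f w \<odot>\<^bsub>B\<^esub> foldr (\<lambda>g b. \<phi> g \<otimes>\<^bsub>B\<^esub> b) (letters w) \<one>\<^bsub>B\<^esub>
        = cls \<Xi> (subst \<psi> (?t w) * E)" .
  qed simp
  also have "\<dots> = cls \<Xi> (subst \<psi> (sum ?t (Poly_Mapping.keys f)) * E)"
  proof -
    have "(\<Oplus>\<^bsub>B\<^esub>w\<in>K. cls \<Xi> (subst \<psi> (?t w) * E)) = cls \<Xi> (subst \<psi> (sum ?t K) * E)"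
      if "finite K" "K \<subseteq> Poly_Mapping.keys f" for K
      using that
    proof (induction K)
      case empty
      then show ?case by (simp only: B.finsum_empty sum.empty) (simp add: corner_def tgt.zero_alg)
    next
      case (insert w K)
      then have 1: "(\<lambda>w. cls \<Xi> (subst \<psi> (?t w) * E)) \<in> K \<rightarrow> carrier B"
        and 2: "?t w \<in> src.Fr" and 3: "sum ?t K \<in> src.Fr"
        using t by (auto intro!: subst_B FA_sum)
      then show ?case
        using insert subst_B[OF 2] subst_closed[OF 2] subst_closed[OF 3] E_FA
        by (subst B.finsum_insert) (auto simp: corner_def tgt.add_cls distrib_right)
    qed
    then show ?thesis by simp
  qed
  also have "sum ?t (Poly_Mapping.keys f) = f"
    by (rule left_mult.sum_decomp[symmetric])
  finally show ?thesis .
qed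

text \<open>\<open>subst_J\<close> makes the image of a coset under evaluation a singleton, which
  gives \<open>the_elem\<close> in \<open>alg_lift\<close> its meaning. From here on the map is
  computed on representatives.\<close>

lemma alg_lift_cls:
  assumes f: "f \<in> src.Fr"
  shows "alg_lift B \<phi> (cls \<Upsilon> f) = cls \<Xi> (subst \<psi> f * E)"
proof -
  have "alg_eval B \<phi> g = cls \<Xi> (subst \<psi> f * E)" if "g \<in> cls \<Upsilon> f" for g
  proof -
    have gf: "src.eqv g f" using f that by (simp add: src.mem_cls)
    then have "subst \<psi> g * E - subst \<psi> f * E \<in> tgt.J"
      using subst_J[of "g - f"] by (simp add: src.eqv_def algebra_simps)
    then have "tgt.eqv (subst \<psi> g * E) (subst \<psi> f * E)"
      using gf f E_FA by (auto intro!: tgt.eqvI subst_closed FA_mult)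
    then show ?thesis
      using alg_eval_B[of g] gf by (simp add: tgt.cls_eqI src.eqv_def)
  qed
  moreover have "f \<in> cls \<Upsilon> f" using f by (simp add: src.mem_cls)
  ultimately have "alg_eval B \<phi> ` cls \<Upsilon> f = {cls \<Xi> (subst \<psi> f * E)}" by blast
  then show ?thesis by (simp add: alg_lift_def)
qed

end

section \<open>Tensor products\<close>

lemma frag_cmul_diff_right: "frag_cmul n (a - b) = frag_cmul n a - frag_cmul n b"
  using frag_cmul_distrib2[of n "a - b" b] by (simp add: algebra_simps)

lemma frag_extend_diff_fun: "frag_extend (\<lambda>u. g u - h u) c = frag_extend g c - frag_extend h c"
  by (simp add: frag_extend_def frag_cmul_diff_right sum_subtractf)

lemma frag_bilin_diff:
  "frag_bilin f (c - c') d = frag_bilin f c d - frag_bilin f c' d"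
  "frag_bilin f c (d - d') = frag_bilin f c d - frag_bilin f c d'"
  by (simp_all add: frag_bilin_def frag_extend_diff frag_extend_diff_fun)

lemma frag_bilin_add:
  "frag_bilin h (c + c') d = frag_bilin h c d + frag_bilin h c' d"
  "frag_bilin h c (d + d') = frag_bilin h c d + frag_bilin h c d'"
proof -
  show "frag_bilin h (c + c') d = frag_bilin h c d + frag_bilin h c' d"
    using frag_bilin_diff(1)[of h "c + c'" c' d] by (simp add: algebra_simps)
  show "frag_bilin h c (d + d') = frag_bilin h c d + frag_bilin h c d'"
    using frag_bilin_diff(2)[of h c "d + d'" d'] by (simp add: algebra_simps)
qed

lemma add_pow_0_int: "[(0::int)] \<cdot>\<^bsub>B\<^esub> x = \<zero>\<^bsub>B\<^esub>"
  by (simp add: add_pow_def)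

lemma frag_bilin_0 [simp]: "frag_bilin f 0 d = 0" "frag_bilin f c 0 = 0"
  using frag_bilin_diff(1)[of f 0 0 d] frag_bilin_diff(2)[of f c 0 0] by simp_all

lemma frag_bilin_of [simp]:
  "frag_bilin f (frag_of u) (frag_of v) = frag_of (f u v)"
  by (simp add: frag_bilin_def)

text \<open>Two abelian groups with closed operations of \<open>S\<close> on them. In this
  generality the construction covers tensor products over the field, induction and both
  convolutions, which differ in \<open>S\<close> and \<open>ra\<close>.\<close>

locale tens_data =
  fixes S :: "'s set" and ra :: "'x \<Rightarrow> 's \<Rightarrow> 'x"
    and X :: "('b, 'x, 'z) module_scheme" and Y :: "('s, 'y, 'w) module_scheme"
  assumes X: "abelian_group X" and Y: "abelian_group Y"
    and ra_closed: "x \<in> carrier X \<Longrightarrow> s \<in> S \<Longrightarrow> ra x s \<in> carrier X"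
    and sm_closed: "y \<in> carrier Y \<Longrightarrow> s \<in> S \<Longrightarrow> s \<odot>\<^bsub>Y\<^esub> y \<in> carrier Y"
begin

sublocale X: abelian_group X by (rule X)
sublocale Y: abelian_group Y by (rule Y)

definition F :: "(('x \<times> 'y) \<Rightarrow>\<^sub>0 int) set" where
  "F = {c. Poly_Mapping.keys c \<subseteq> carrier X \<times> carrier Y}"

abbreviation "N \<equiv> tens_rels S ra X Y"
abbreviation "tc \<equiv> tens_cls S ra X Y"
abbreviation "tp \<equiv> pure S ra X Y"

definition tens_gens :: "(('x \<times> 'y) \<Rightarrow>\<^sub>0 int) set" where
  "tens_gens = {frag_of (x \<oplus>\<^bsub>X\<^esub> x', y) - frag_of (x, y) - frag_of (x', y) | x x' y.
         x \<in> carrier X \<and> x' \<in> carrier X \<and> y \<in> carrier Y} \<union>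
      {frag_of (x, y \<oplus>\<^bsub>Y\<^esub> y') - frag_of (x, y) - frag_of (x, y') | x y y'.
         x \<in> carrier X \<and> y \<in> carrier Y \<and> y' \<in> carrier Y} \<union>
      {frag_of (ra x s, y) - frag_of (x, s \<odot>\<^bsub>Y\<^esub> y) | x s y.
         x \<in> carrier X \<and> s \<in> S \<and> y \<in> carrier Y}"

lemma carrier_tens_free: "carrier (tens_free X Y) = F"
  by (simp add: tens_free_def F_def free_Abelian_group_def)

lemma F_0 [simp]: "0 \<in> F"
  and F_of [simp]: "frag_of (x, y) \<in> F \<longleftrightarrow> x \<in> carrier X \<and> y \<in> carrier Y"
  by (auto simp: F_def)

lemma F_add: "c \<in> F \<Longrightarrow> d \<in> F \<Longrightarrow> c + d \<in> F"
  using keys_add[of c d] by (auto simp: F_def)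

lemma F_uminus: "c \<in> F \<Longrightarrow> - c \<in> F"
  by (simp add: F_def)

lemma F_diff: "c \<in> F \<Longrightarrow> d \<in> F \<Longrightarrow> c - d \<in> F"
  using F_add[of c "- d"] F_uminus[of d] by simp

lemma F_induct [consumes 1, case_names zero of diff]:
  assumes "c \<in> F" "P 0" "\<And>x y. x \<in> carrier X \<Longrightarrow> y \<in> carrier Y \<Longrightarrow> P (frag_of (x, y))"
    and "\<And>c d. P c \<Longrightarrow> P d \<Longrightarrow> P (c - d)"
  shows "P c"
  using assms(1) unfolding F_def mem_Collect_eq
  by (induction c rule: frag_induction) (use assms in auto)

lemma tens_gens_F: "tens_gens \<subseteq> F"
  by (auto simp: tens_gens_def intro!: F_diff ra_closed sm_closed)

lemma N_def': "N = generate (tens_free X Y) tens_gens"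
  by (simp add: tens_rels_def tens_gens_def)

lemma inv_tens_free: "c \<in> F \<Longrightarrow> inv\<^bsub>tens_free X Y\<^esub> c = - c"
  unfolding tens_free_def F_def by simp

lemma N_F: "c \<in> N \<Longrightarrow> c \<in> F"
  unfolding N_def'
proof (induction rule: generate.induct)
  case (inv h)
  then show ?case using tens_gens_F by (auto simp: inv_tens_free F_uminus)
qed (use tens_gens_F in \<open>auto simp: F_add tens_free_def\<close>)

lemma N_0 [simp]: "0 \<in> N"
  using generate.one[of "tens_free X Y" tens_gens] by (simp add: N_def' tens_free_def)

lemma N_add: "c \<in> N \<Longrightarrow> d \<in> N \<Longrightarrow> c + d \<in> N"
  using generate.eng[of c "tens_free X Y" tens_gens d] by (simp add: N_def' tens_free_def)

lemma N_gens: "c \<in> tens_gens \<Longrightarrow> c \<in> N"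
  unfolding N_def' by (rule generate.incl)

lemma N_induct [consumes 1, case_names zero gens uminus add]:
  assumes "c \<in> N" "P 0" "\<And>c. c \<in> tens_gens \<Longrightarrow> P c" "\<And>c. c \<in> tens_gens \<Longrightarrow> P (- c)"
    and "\<And>c d. P c \<Longrightarrow> P d \<Longrightarrow> P (c + d)"
  shows "P c"
  using assms(1) unfolding N_def'
proof (induction rule: generate.induct)
  case (inv h)
  then have "h \<in> F" using tens_gens_F by blast
  then show ?case using inv assms(4) by (simp add: inv_tens_free)
qed (use assms in \<open>auto simp: tens_free_def\<close>)

lemma N_uminus: "c \<in> N \<Longrightarrow> - c \<in> N"
proof (induction rule: N_induct)
  case (uminus c)
  then show ?case by (simp add: N_gens)
next
  case (gens c)
  then have "inv\<^bsub>tens_free X Y\<^esub> c \<in> N" unfolding N_def' by (rule generate.inv)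
  then show ?case using gens tens_gens_F by (simp add: inv_tens_free subset_iff)
next
  case (add c d)
  then show ?case using N_add[of "- c" "- d"] by simp
qed auto

lemma N_diff: "c \<in> N \<Longrightarrow> d \<in> N \<Longrightarrow> c - d \<in> N"
  using N_add[of c "- d"] N_uminus[of d] by simp

text \<open>\<open>N\<close> is generated by \<open>tens_gens\<close>, so additivity reduces the
  well-definedness of an operation on tensors to the three kinds of bilinearity and balancing
  elements.\<close>

lemma N_image:
  assumes "c \<in> N" and h: "\<And>c d. h (c - d) = h c - h d"
    and gens: "\<And>c. c \<in> tens_gens \<Longrightarrow> h c \<in> N'"
    and N': "0 \<in> N'" "\<And>c d. c \<in> N' \<Longrightarrow> d \<in> N' \<Longrightarrow> c - d \<in> (N' :: ('u \<Rightarrow>\<^sub>0 int) set)"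
  shows "h c \<in> N'"
proof -
  have h0: "h 0 = 0" using h[of 0 0] by simp
  then have hm: "h (- c) = - h c" for c using h[of 0 c] by simp
  have m: "- c \<in> N'" if "c \<in> N'" for c using N'(2)[OF N'(1) that] by simp
  have p: "c + d \<in> N'" if "c \<in> N'" "d \<in> N'" for c d using N'(2)[OF that(1) m[OF that(2)]] by simp
  have hp: "h (c + d) = h c + h d" for c d using h[of c "- d"] by (simp add: hm)
  from assms(1) show ?thesis
    by (induction rule: N_induct) (auto simp: h0 hm hp N' intro: gens m p)
qed

lemma normal_N: "normal N (tens_free X Y)"
proof -
  interpret comm_group "tens_free X Y"
    by (simp add: tens_free_def abelian_free_Abelian_group)
  have "subgroup N (tens_free X Y)"
    unfolding N_def' using tens_gens_F
    by (intro generate_is_subgroup) (simp add: carrier_tens_free)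
  then show ?thesis by (rule subgroup_imp_normal)
qed

lemma tc_def: "tc c = {n + c | n. n \<in> N}"
  by (auto simp: tens_cls_def r_coset_def tens_free_def)

lemma mem_tc: "d \<in> tc c \<longleftrightarrow> d - c \<in> N"
  unfolding tc_def by (auto intro: exI[of _ "d - c"])

lemma tc_eq_iff: "tc c = tc d \<longleftrightarrow> c - d \<in> N"
proof
  assume "tc c = tc d"
  then show "c - d \<in> N" using mem_tc[of c c] mem_tc[of c d] by simp
next
  assume *: "c - d \<in> N"
  have "e - c \<in> N \<longleftrightarrow> e - d \<in> N" for e
    using N_add[OF _ *, of "e - c"] N_diff[OF _ *, of "e - d"] by auto
  then show "tc c = tc d" by (auto simp: mem_tc)
qed

lemma tens_group_simps:
  "carrier (tens_group S ra X Y) = tc ` F"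
  "\<one>\<^bsub>tens_group S ra X Y\<^esub> = tc 0"
  "c \<in> F \<Longrightarrow> d \<in> F \<Longrightarrow> tc c \<otimes>\<^bsub>tens_group S ra X Y\<^esub> tc d = tc (c + d)"
proof -
  show "carrier (tens_group S ra X Y) = tc ` F"
    by (auto simp: tens_group_def FactGroup_def RCOSETS_def carrier_tens_free tens_cls_def)
  show "\<one>\<^bsub>tens_group S ra X Y\<^esub> = tc 0"
    by (auto simp: tens_group_def FactGroup_def tc_def)
  show "c \<in> F \<Longrightarrow> d \<in> F \<Longrightarrow> tc c \<otimes>\<^bsub>tens_group S ra X Y\<^esub> tc d = tc (c + d)"
    using normal.rcos_sum[OF normal_N, of c d]
    by (simp add: tens_group_def FactGroup_def tens_cls_def carrier_tens_free)
      (simp add: tens_free_def)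
qed

lemma tp_def: "tp x y = tc (frag_of (x, y))"
  by (simp add: pure_def)

lemma tp_add_left: "\<lbrakk>x \<in> carrier X; x' \<in> carrier X; y \<in> carrier Y\<rbrakk> \<Longrightarrow>
    tc (frag_of (x \<oplus>\<^bsub>X\<^esub> x', y)) = tc (frag_of (x, y) + frag_of (x', y))"
  unfolding tc_eq_iff by (rule N_gens) (auto simp: tens_gens_def algebra_simps)

lemma tp_add_right: "\<lbrakk>x \<in> carrier X; y \<in> carrier Y; y' \<in> carrier Y\<rbrakk> \<Longrightarrow>
    tc (frag_of (x, y \<oplus>\<^bsub>Y\<^esub> y')) = tc (frag_of (x, y) + frag_of (x, y'))"
  unfolding tc_eq_iff by (rule N_gens) (auto simp: tens_gens_def algebra_simps)

lemma tp_balanced: "\<lbrakk>x \<in> carrier X; s \<in> S; y \<in> carrier Y\<rbrakk> \<Longrightarrow> tp (ra x s) y = tp x (s \<odot>\<^bsub>Y\<^esub> y)"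
  unfolding tp_def tc_eq_iff by (rule N_gens) (auto simp: tens_gens_def)

lemma tp_uminus: "\<lbrakk>x \<in> carrier X; y \<in> carrier Y\<rbrakk> \<Longrightarrow> tp (\<ominus>\<^bsub>X\<^esub> x) y = tc (- frag_of (x, y))"
proof -
  assume xy: "x \<in> carrier X" "y \<in> carrier Y"
  have 0: "- frag_of (\<zero>\<^bsub>X\<^esub>, y) \<in> N"
    using tp_add_left[of "\<zero>\<^bsub>X\<^esub>" "\<zero>\<^bsub>X\<^esub>" y] xy by (simp add: tc_eq_iff)
  have "frag_of (\<zero>\<^bsub>X\<^esub>, y) - (frag_of (\<ominus>\<^bsub>X\<^esub> x, y) + frag_of (x, y)) \<in> N"
    using tp_add_left[of "\<ominus>\<^bsub>X\<^esub> x" x y] xy by (simp add: tc_eq_iff X.l_neg)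
  from N_diff[OF 0 this[THEN N_uminus]] have "- (frag_of (\<ominus>\<^bsub>X\<^esub> x, y) + frag_of (x, y)) \<in> N"
    by simp
  from N_uminus[OF this] show ?thesis
    unfolding tp_def tc_eq_iff by (simp add: add.commute)
qed

lemma tp_zero: "y \<in> carrier Y \<Longrightarrow> tp \<zero>\<^bsub>X\<^esub> y = tc 0"
  using tp_add_left[of "\<zero>\<^bsub>X\<^esub>" "\<zero>\<^bsub>X\<^esub>" y] N_uminus[of "- frag_of (\<zero>\<^bsub>X\<^esub>, y)"]
  by (simp add: tc_eq_iff tp_def)

text \<open>\<open>tens_module\<close>, \<open>alg_tensor\<close> and \<open>mod_tensor\<close> are
  different records on the same kind of additive group. The predicate isolates that group, so that
  induction and the lifting of balanced maps are proved once for all three.\<close>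

definition is_tens :: "(('x, 'y) tens, 'r) ring_scheme \<Rightarrow> bool" where
  "is_tens T \<longleftrightarrow> carrier T = carrier (tens_group S ra X Y) \<and>
     \<zero>\<^bsub>T\<^esub> = \<one>\<^bsub>tens_group S ra X Y\<^esub> \<and> ring.add T = monoid.mult (tens_group S ra X Y)"

context
  fixes T :: "(('x, 'y) tens, 'r) ring_scheme"
  assumes T: "is_tens T"
begin

lemma carrier_T: "carrier T = tc ` F"
  and zero_T: "\<zero>\<^bsub>T\<^esub> = tc 0"
  and add_tc: "c \<in> F \<Longrightarrow> d \<in> F \<Longrightarrow> tc c \<oplus>\<^bsub>T\<^esub> tc d = tc (c + d)"
  using T by (auto simp: is_tens_def tens_group_simps)

lemma abelian_group_T: "abelian_group T"
proof (rule abelian_groupI)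
  fix x assume "x \<in> carrier T"
  then obtain c where c: "c \<in> F" "x = tc c" by (auto simp: carrier_T)
  then have "tc (- c) \<oplus>\<^bsub>T\<^esub> x = \<zero>\<^bsub>T\<^esub>" by (simp add: add_tc F_uminus zero_T)
  moreover have "tc (- c) \<in> carrier T" using c by (auto simp: carrier_T F_uminus)
  ultimately show "\<exists>y\<in>carrier T. y \<oplus>\<^bsub>T\<^esub> x = \<zero>\<^bsub>T\<^esub>" by blast
qed (auto simp: carrier_T add_tc zero_T F_add add_ac)

lemma tp_closed [simp]: "x \<in> carrier X \<Longrightarrow> y \<in> carrier Y \<Longrightarrow> tp x y \<in> carrier T"
  by (simp add: carrier_T tp_def)

lemma tp_add:
  "\<lbrakk>x \<in> carrier X; x' \<in> carrier X; y \<in> carrier Y\<rbrakk> \<Longrightarrow> tp (x \<oplus>\<^bsub>X\<^esub> x') y = tp x y \<oplus>\<^bsub>T\<^esub> tp x' y"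
  "\<lbrakk>x \<in> carrier X; y \<in> carrier Y; y' \<in> carrier Y\<rbrakk> \<Longrightarrow> tp x (y \<oplus>\<^bsub>Y\<^esub> y') = tp x y \<oplus>\<^bsub>T\<^esub> tp x y'"
  by (simp_all add: tp_def tp_add_left tp_add_right add_tc)

text \<open>Integer coefficients reduce to plain sums of pure tensors, since the negative of x
  \<otimes> y is the pure tensor of -x and y. For this reason the inner induction carries the class
  of c and the class of -c together.\<close>

lemma T_induct [consumes 1, case_names pure add]:
  assumes "C \<in> carrier T"
    and pure: "\<And>x y. x \<in> carrier X \<Longrightarrow> y \<in> carrier Y \<Longrightarrow> P (tp x y)"
    and add: "\<And>C D. C \<in> carrier T \<Longrightarrow> D \<in> carrier T \<Longrightarrow> P C \<Longrightarrow> P D \<Longrightarrow> P (C \<oplus>\<^bsub>T\<^esub> D)"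
  shows "P C"
proof -
  have P0: "P (tc 0)" using pure[of "\<zero>\<^bsub>X\<^esub>" "\<zero>\<^bsub>Y\<^esub>"] by (simp add: tp_zero)
  have "c \<in> F \<and> P (tc c) \<and> P (tc (- c))" if "c \<in> F" for c
    using that
  proof (induction rule: F_induct)
    case zero
    then show ?case using P0 by simp
  next
    case (of x y)
    then show ?case using pure[of x y] pure[of "\<ominus>\<^bsub>X\<^esub> x" y] tp_uminus[of x y] by (simp add: tp_def)
  next
    case (diff c d)
    have "P (tc c \<oplus>\<^bsub>T\<^esub> tc (- d))" "P (tc (- c) \<oplus>\<^bsub>T\<^esub> tc d)"
      using diff by (auto intro!: add simp: carrier_T F_uminus)
    then show ?case using diff by (simp add: add_tc F_uminus F_diff)
  qed
  then show ?thesis using assms(1) by (auto simp: carrier_T)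
qed

end

definition balanced :: "('c, 'r) ring_scheme \<Rightarrow> ('x \<times> 'y \<Rightarrow> 'c) \<Rightarrow> bool" where
  "balanced B f \<longleftrightarrow> abelian_group B \<and>
    (\<forall>x\<in>carrier X. \<forall>y\<in>carrier Y. f (x, y) \<in> carrier B \<and>
      (\<forall>x'\<in>carrier X. f (x \<oplus>\<^bsub>X\<^esub> x', y) = f (x, y) \<oplus>\<^bsub>B\<^esub> f (x', y)) \<and>
      (\<forall>y'\<in>carrier Y. f (x, y \<oplus>\<^bsub>Y\<^esub> y') = f (x, y) \<oplus>\<^bsub>B\<^esub> f (x, y')) \<and>
      (\<forall>s\<in>S. f (ra x s, y) = f (x, s \<odot>\<^bsub>Y\<^esub> y)))"

context
  fixes B :: "('c, 'r) ring_scheme" and f :: "'x \<times> 'y \<Rightarrow> 'c"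
  assumes bal: "balanced B f"
begin

interpretation B: abelian_group B
  using bal by (simp add: balanced_def)

definition ev :: "(('x \<times> 'y) \<Rightarrow>\<^sub>0 int) \<Rightarrow> 'c" where
  "ev c = (\<Oplus>\<^bsub>B\<^esub>u\<in>Poly_Mapping.keys c. [Poly_Mapping.lookup c u] \<cdot>\<^bsub>B\<^esub> f u)"

lemma f_closed: "u \<in> carrier X \<times> carrier Y \<Longrightarrow> f u \<in> carrier B"
  using bal by (auto simp: balanced_def)

lemma ev_superset:
  assumes "Poly_Mapping.keys c \<subseteq> K" "finite K" "K \<subseteq> carrier X \<times> carrier Y"
  shows "ev c = (\<Oplus>\<^bsub>B\<^esub>u\<in>K. [Poly_Mapping.lookup c u] \<cdot>\<^bsub>B\<^esub> f u)"
  unfolding ev_def using assms f_closed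
  by (intro B.add.finprod_mono_neutral_cong_left) (auto simp: in_keys_iff add_pow_0_int)

lemma ev_closed: "c \<in> F \<Longrightarrow> ev c \<in> carrier B"
  unfolding ev_def F_def using f_closed by (intro B.finsum_closed) auto

lemma ev_add: "c \<in> F \<Longrightarrow> d \<in> F \<Longrightarrow> ev (c + d) = ev c \<oplus>\<^bsub>B\<^esub> ev d"
proof -
  assume cd: "c \<in> F" "d \<in> F"
  let ?K = "Poly_Mapping.keys c \<union> Poly_Mapping.keys d"
  have K: "finite ?K" "?K \<subseteq> carrier X \<times> carrier Y" using cd by (auto simp: F_def)
  have cl: "(\<lambda>u. [n u] \<cdot>\<^bsub>B\<^esub> f u) \<in> ?K \<rightarrow> carrier B" for n :: "'x \<times> 'y \<Rightarrow> int"
    using K(2) f_closed by auto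
  have "ev (c + d) = (\<Oplus>\<^bsub>B\<^esub>u\<in>?K. [Poly_Mapping.lookup (c + d) u] \<cdot>\<^bsub>B\<^esub> f u)"
    using K keys_add by (intro ev_superset)
  also have "\<dots> = (\<Oplus>\<^bsub>B\<^esub>u\<in>?K. [Poly_Mapping.lookup c u] \<cdot>\<^bsub>B\<^esub> f u
      \<oplus>\<^bsub>B\<^esub> [Poly_Mapping.lookup d u] \<cdot>\<^bsub>B\<^esub> f u)"
    using K(2) f_closed by (intro B.finsum_cong') (auto simp: lookup_add B.add.int_pow_mult)
  also have "\<dots> = ev c \<oplus>\<^bsub>B\<^esub> ev d"
    using K cl by (simp add: B.finsum_addf ev_superset[of _ ?K])
  finally show ?thesis .
qed

lemma ev_of: "u \<in> carrier X \<times> carrier Y \<Longrightarrow> ev (frag_of u) = f u"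
  unfolding ev_def using f_closed[of u] by simp

lemma ev_0 [simp]: "ev 0 = \<zero>\<^bsub>B\<^esub>"
  by (simp add: ev_def)

lemma ev_uminus: "c \<in> F \<Longrightarrow> ev (- c) = \<ominus>\<^bsub>B\<^esub> ev c"
  using ev_add[of "- c" c] ev_closed[of c] ev_closed[of "- c"] F_uminus[of c]
  by (simp add: B.minus_equality)

lemma ev_diff: "c \<in> F \<Longrightarrow> d \<in> F \<Longrightarrow> ev (c - d) = ev c \<ominus>\<^bsub>B\<^esub> ev d"
  using ev_add[of c "- d"] ev_uminus[of d] F_uminus[of d] by (simp add: B.minus_eq)

lemma ev_N: "c \<in> N \<Longrightarrow> ev c = \<zero>\<^bsub>B\<^esub>"
proof -
  have gens: "c \<in> F \<and> ev c = \<zero>\<^bsub>B\<^esub>" if "c \<in> tens_gens" for c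
  proof -
    have *: "a \<oplus>\<^bsub>B\<^esub> b \<ominus>\<^bsub>B\<^esub> a \<ominus>\<^bsub>B\<^esub> b = \<zero>\<^bsub>B\<^esub>" if "a \<in> carrier B" "b \<in> carrier B" for a b
      using that by (metis B.add.inv_solve_right' B.add.m_closed B.add.m_comm B.minus_eq
          B.r_neg B.add.inv_closed)
    have fc: "f (x, y) \<in> carrier B" if "x \<in> carrier X" "y \<in> carrier Y" for x y
      using that f_closed by auto
    from that show ?thesis
      unfolding tens_gens_def
    proof (elim UnE CollectE exE conjE; hypsubst)
      fix x s y assume a: "x \<in> carrier X" "s \<in> S" "y \<in> carrier Y"
      have "f (ra x s, y) = f (x, s \<odot>\<^bsub>Y\<^esub> y)"
        using bal a unfolding balanced_def by blast
      then show "frag_of (ra x s, y) - frag_of (x, s \<odot>\<^bsub>Y\<^esub> y) \<in> F \<and>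
          ev (frag_of (ra x s, y) - frag_of (x, s \<odot>\<^bsub>Y\<^esub> y)) = \<zero>\<^bsub>B\<^esub>"
        using a fc by (auto simp: ev_diff ev_of ra_closed sm_closed F_diff B.minus_eq B.r_neg)
    next
      fix x x' y assume a: "x \<in> carrier X" "x' \<in> carrier X" "y \<in> carrier Y"
      have "f (x \<oplus>\<^bsub>X\<^esub> x', y) = f (x, y) \<oplus>\<^bsub>B\<^esub> f (x', y)"
        using bal a unfolding balanced_def by blast
      then show "frag_of (x \<oplus>\<^bsub>X\<^esub> x', y) - frag_of (x, y) - frag_of (x', y) \<in> F \<and>
          ev (frag_of (x \<oplus>\<^bsub>X\<^esub> x', y) - frag_of (x, y) - frag_of (x', y)) = \<zero>\<^bsub>B\<^esub>"
        using a fc * by (auto simp: ev_diff ev_of F_diff)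
    next
      fix x y y' assume a: "x \<in> carrier X" "y \<in> carrier Y" "y' \<in> carrier Y"
      have "f (x, y \<oplus>\<^bsub>Y\<^esub> y') = f (x, y) \<oplus>\<^bsub>B\<^esub> f (x, y')"
        using bal a unfolding balanced_def by blast
      then show "frag_of (x, y \<oplus>\<^bsub>Y\<^esub> y') - frag_of (x, y) - frag_of (x, y') \<in> F \<and>
          ev (frag_of (x, y \<oplus>\<^bsub>Y\<^esub> y') - frag_of (x, y) - frag_of (x, y')) = \<zero>\<^bsub>B\<^esub>"
        using a fc * by (auto simp: ev_diff ev_of F_diff)
    qed
  qed
  assume "c \<in> N"
  then have "c \<in> F \<and> ev c = \<zero>\<^bsub>B\<^esub>"
  proof (induction rule: N_induct)
    case (gens c)
    then show ?case using \<open>\<And>c. c \<in> tens_gens \<Longrightarrow> _\<close> by blast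
  next
    case (uminus c)
    then show ?case using gens[of c] by (simp add: F_uminus ev_uminus)
  next
    case (add c d)
    then show ?case by (simp add: F_add ev_add)
  qed simp
  then show ?thesis by simp
qed

text \<open>A coset of \<open>N\<close> is mapped to a single value because \<open>ev\<close>
  vanishes on \<open>N\<close>; this is the existence half of the universal property for the
  concrete map \<open>tens_lift\<close>.\<close>

lemma tens_lift_tc: "c \<in> F \<Longrightarrow> tens_lift B f (tc c) = ev c"
proof -
  assume c: "c \<in> F"
  have "ev d = ev c" if "d \<in> tc c" for d
  proof -
    have n: "d - c \<in> N" using that by (simp add: mem_tc)
    have "ev ((d - c) + c) = ev (d - c) \<oplus>\<^bsub>B\<^esub> ev c"
      by (rule ev_add[OF N_F[OF n] c])
    then show ?thesis using ev_N[OF n] ev_closed[OF c] by simp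
  qed
  moreover have "c \<in> tc c" by (simp add: mem_tc)
  ultimately have "ev ` tc c = {ev c}" by blast
  then show ?thesis unfolding tens_lift_def ev_def by simp
qed

lemma tens_lift_pure [simp]:
  "x \<in> carrier X \<Longrightarrow> y \<in> carrier Y \<Longrightarrow> tens_lift B f (tp x y) = f (x, y)"
  by (simp add: tp_def tens_lift_tc ev_of)

lemma tens_lift_closed: "is_tens T \<Longrightarrow> C \<in> carrier T \<Longrightarrow> tens_lift B f C \<in> carrier B"
  by (auto simp: carrier_T tens_lift_tc ev_closed)

lemma tens_lift_add: "is_tens T \<Longrightarrow> C \<in> carrier T \<Longrightarrow> D \<in> carrier T \<Longrightarrow>
    tens_lift B f (C \<oplus>\<^bsub>T\<^esub> D) = tens_lift B f C \<oplus>\<^bsub>B\<^esub> tens_lift B f D"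
  by (auto simp: carrier_T add_tc tens_lift_tc ev_add F_add)

end

abbreviation "TM \<equiv> tens_module S ra X Y"

lemma is_tens_TM: "is_tens TM"
  by (simp add: is_tens_def tens_module_def Let_def)

lemmas TM_induct [consumes 1, case_names pure add] = T_induct[OF is_tens_TM]

text \<open>Bilinearity elements are preserved because \<open>X\<close> is a module, and balancing
  elements because the left action commutes with the right action \<open>ra\<close>, which is
  \<open>ra_lin\<close>. The module laws are then inherited from \<open>X\<close> by induction over
  sums of pure tensors.\<close>

lemma left_module_TM:
  assumes RX: "left_module R X"
    and ra_lin: "\<And>a x s. a \<in> carrier R \<Longrightarrow> x \<in> carrier X \<Longrightarrow> s \<in> S \<Longrightarrow>
      a \<odot>\<^bsub>X\<^esub> ra x s = ra (a \<odot>\<^bsub>X\<^esub> x) s"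
  shows "left_module R TM"
    and "a \<in> carrier R \<Longrightarrow> x \<in> carrier X \<Longrightarrow> y \<in> carrier Y \<Longrightarrow> a \<odot>\<^bsub>TM\<^esub> tp x y = tp (a \<odot>\<^bsub>X\<^esub> x) y"
proof -
  interpret L: left_module R X by fact
  let ?h = "\<lambda>a. frag_extend (\<lambda>(x, y). frag_of (a \<odot>\<^bsub>X\<^esub> x, y)) :: (('x \<times> 'y) \<Rightarrow>\<^sub>0 int) \<Rightarrow> _"
  have hF: "?h a c \<in> F" if "a \<in> carrier R" "c \<in> F" for a c
    using that(2) by (induction rule: F_induct)
      (auto simp: frag_extend_diff F_diff L.lsmult_closed that(1))
  have hN: "?h a c \<in> N" if a: "a \<in> carrier R" and c: "c \<in> N" for a c
    using c
  proof (rule N_image)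
    fix d assume "d \<in> tens_gens"
    then show "?h a d \<in> N"
      unfolding tens_gens_def
    proof (elim UnE CollectE exE conjE; hypsubst)
      fix x s y assume "x \<in> carrier X" "s \<in> S" "y \<in> carrier Y"
      then show "?h a (frag_of (ra x s, y) - frag_of (x, s \<odot>\<^bsub>Y\<^esub> y)) \<in> N"
        using tp_balanced[of "a \<odot>\<^bsub>X\<^esub> x" s y] a
        by (simp add: frag_extend_diff ra_lin L.lsmult_closed tp_def tc_eq_iff)
    next
      fix x x' y assume "x \<in> carrier X" "x' \<in> carrier X" "y \<in> carrier Y"
      then show "?h a (frag_of (x \<oplus>\<^bsub>X\<^esub> x', y) - frag_of (x, y) - frag_of (x', y)) \<in> N"
        using tp_add_left[of "a \<odot>\<^bsub>X\<^esub> x" "a \<odot>\<^bsub>X\<^esub> x'" y] a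
        by (simp add: frag_extend_diff L.lsmult_r_distr L.lsmult_closed tc_eq_iff diff_diff_eq frag_extend_add frag_bilin_add)
    next
      fix x y y' assume "x \<in> carrier X" "y \<in> carrier Y" "y' \<in> carrier Y"
      then show "?h a (frag_of (x, y \<oplus>\<^bsub>Y\<^esub> y') - frag_of (x, y) - frag_of (x, y')) \<in> N"
        using tp_add_right[of "a \<odot>\<^bsub>X\<^esub> x" y y'] a
        by (simp add: frag_extend_diff L.lsmult_closed tc_eq_iff diff_diff_eq frag_extend_add frag_bilin_add)
    qed
  qed (auto simp: frag_extend_diff N_diff)
  have sm: "a \<odot>\<^bsub>TM\<^esub> tc c = tc (?h a c)" if a: "a \<in> carrier R" for a c
  proof -
    have "tc (?h a d) = tc (?h a c)" if "d \<in> tc c" for d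
      using that hN[OF a, of "d - c"] by (simp add: mem_tc tc_eq_iff frag_extend_diff)
    moreover have "c \<in> tc c" by (simp add: mem_tc)
    ultimately have "(\<Union>d\<in>tc c. tc (?h a d)) = tc (?h a c)" by blast
    then show ?thesis by (simp add: tens_module_def Let_def)
  qed
  show tp: "a \<odot>\<^bsub>TM\<^esub> tp x y = tp (a \<odot>\<^bsub>X\<^esub> x) y"
    if "a \<in> carrier R" "x \<in> carrier X" "y \<in> carrier Y" for a x y
    using sm[OF that(1)] by (simp add: tp_def)
  interpret T: abelian_group TM by (rule abelian_group_T[OF is_tens_TM])
  note tp_closed = tp_closed[OF is_tens_TM] and tp_add = tp_add[OF is_tens_TM]
  have cl: "a \<odot>\<^bsub>TM\<^esub> C \<in> carrier TM" if "a \<in> carrier R" "C \<in> carrier TM" for a C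
    using that sm hF by (auto simp: carrier_T[OF is_tens_TM])
  have add: "a \<odot>\<^bsub>TM\<^esub> (C \<oplus>\<^bsub>TM\<^esub> D) = a \<odot>\<^bsub>TM\<^esub> C \<oplus>\<^bsub>TM\<^esub> a \<odot>\<^bsub>TM\<^esub> D"
    if "a \<in> carrier R" "C \<in> carrier TM" "D \<in> carrier TM" for a C D
    using that sm hF
    by (auto simp: carrier_T[OF is_tens_TM] add_tc[OF is_tens_TM] frag_extend_add)
  show "left_module R TM"
  proof (intro left_module.intro left_module_axioms.intro)
    show "ring R" "abelian_group TM" by (rule L.ring_axioms, rule T.abelian_group_axioms)
    fix a b C assume ab: "a \<in> carrier R" "b \<in> carrier R" and C: "C \<in> carrier TM"
    from C show "(a \<oplus>\<^bsub>R\<^esub> b) \<odot>\<^bsub>TM\<^esub> C = a \<odot>\<^bsub>TM\<^esub> C \<oplus>\<^bsub>TM\<^esub> b \<odot>\<^bsub>TM\<^esub> C"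
      by (induction rule: TM_induct)
        (use ab in \<open>auto simp: tp L.lsmult_l_distr L.lsmult_closed tp_add add cl T.a_ac\<close>)
    from C show "(a \<otimes>\<^bsub>R\<^esub> b) \<odot>\<^bsub>TM\<^esub> C = a \<odot>\<^bsub>TM\<^esub> (b \<odot>\<^bsub>TM\<^esub> C)"
      by (induction rule: TM_induct)
        (use ab in \<open>auto simp: tp L.lsmult_assoc L.lsmult_closed add cl\<close>)
  next
    fix C assume "C \<in> carrier TM"
    then show "\<one>\<^bsub>R\<^esub> \<odot>\<^bsub>TM\<^esub> C = C"
      by (induction rule: TM_induct)
        (auto simp: tp L.lsmult_one add)
  qed (use cl add in auto)
qed

end

text \<open>The uniqueness half of the universal property, in a form suited to identities between
  composed maps.\<close>

lemma (in tens_data) T_ext: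
  assumes "is_tens T" "C \<in> carrier T"
    and "\<And>x y. x \<in> carrier X \<Longrightarrow> y \<in> carrier Y \<Longrightarrow> f (tp x y) = g (tp x y)"
    and "\<And>C D. C \<in> carrier T \<Longrightarrow> D \<in> carrier T \<Longrightarrow> f (C \<oplus>\<^bsub>T\<^esub> D) = f C \<oplus>\<^bsub>B\<^esub> f D"
    and "\<And>C D. C \<in> carrier T \<Longrightarrow> D \<in> carrier T \<Longrightarrow> g (C \<oplus>\<^bsub>T\<^esub> D) = g C \<oplus>\<^bsub>B\<^esub> g D"
  shows "f C = g C"
  using assms(2) by (induction rule: T_induct[OF assms(1)]) (auto simp: assms)

section \<open>Tensor products of algebras and modules over a field\<close>

text \<open>The field enters the tensor products through the central elements c 1, because
  \<open>vspace\<close> lets a scalar c act on a module as c 1 does.\<close>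

locale kalg = ring A for A :: "('k, 'a, 'z) module_scheme" (structure) +
  assumes ksmult_closed: "a \<in> carrier A \<Longrightarrow> c \<odot> a \<in> carrier A"
    and ksmult_l: "a \<in> carrier A \<Longrightarrow> c \<odot> a = (c \<odot> \<one>) \<otimes> a"
    and ksmult_r: "a \<in> carrier A \<Longrightarrow> c \<odot> a = a \<otimes> (c \<odot> \<one>)"

lemma (in pres) kalg_alg: "kalg (alg \<Xi>)"
proof (intro kalg.intro kalg_axioms.intro ring_alg)
  fix a c assume "a \<in> carrier (alg \<Xi>)"
  then obtain f where "f \<in> Fr" "a = cls \<Xi> f" by (auto simp: carrier_alg)
  then show "c \<odot>\<^bsub>alg \<Xi>\<^esub> a \<in> carrier (alg \<Xi>)"
    "c \<odot>\<^bsub>alg \<Xi>\<^esub> a = (c \<odot>\<^bsub>alg \<Xi>\<^esub> \<one>\<^bsub>alg \<Xi>\<^esub>) \<otimes>\<^bsub>alg \<Xi>\<^esub> a"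
    "c \<odot>\<^bsub>alg \<Xi>\<^esub> a = a \<otimes>\<^bsub>alg \<Xi>\<^esub> (c \<odot>\<^bsub>alg \<Xi>\<^esub> \<one>\<^bsub>alg \<Xi>\<^esub>)"
    by (simp_all add: smult_cls one_alg mult_cls sc_commute)
qed

lemma vspace_simps [simp]:
  "carrier (vspace A P) = carrier P" "\<zero>\<^bsub>vspace A P\<^esub> = \<zero>\<^bsub>P\<^esub>" "ring.add (vspace A P) = ring.add P"
  by (simp_all add: vspace_def)

lemma vspace_smult: "c \<odot>\<^bsub>vspace A P\<^esub> x = (c \<odot>\<^bsub>A\<^esub> \<one>\<^bsub>A\<^esub>) \<odot>\<^bsub>P\<^esub> x"
  by (simp add: vspace_def)

lemma abelian_group_cong:
  assumes "abelian_group G" "carrier H = carrier G" "\<zero>\<^bsub>H\<^esub> = \<zero>\<^bsub>G\<^esub>" "ring.add H = ring.add G"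
  shows "abelian_group H"
proof -
  interpret G: abelian_group G by fact
  show ?thesis
    by (rule abelian_groupI) (auto simp: assms G.a_ac G.l_neg intro!: bexI[of _ "\<ominus>\<^bsub>G\<^esub> _"])
qed

abbreviation (input) tensk_ra :: "('k, 'x, 'z) module_scheme \<Rightarrow> 'x \<Rightarrow> 'k \<Rightarrow> 'x" where
  "tensk_ra X \<equiv> \<lambda>x c. c \<odot>\<^bsub>X\<^esub> x"

locale kmods = A: kalg A + B: kalg B + P: left_module A P + Q: left_module B Q
  for A :: "('k, 'a, 'z) module_scheme" and B :: "('k, 'b, 'z1) module_scheme"
    and P :: "('a, 'm, 'z2) module_scheme" and Q :: "('b, 'n, 'z3) module_scheme"
begin

lemma tens_data_alg: "tens_data UNIV (tensk_ra A) A B"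
  by (intro tens_data.intro A.abelian_group_axioms B.abelian_group_axioms)
    (auto simp: A.ksmult_closed B.ksmult_closed)

lemma tens_data_mod: "tens_data UNIV (tensk_ra (vspace A P)) (vspace A P) (vspace B Q)"
  by (intro tens_data.intro)
    (auto simp: vspace_smult A.ksmult_closed B.ksmult_closed P.lsmult_closed Q.lsmult_closed
      intro: abelian_group_cong[OF P.abelian_group_axioms] abelian_group_cong[OF Q.abelian_group_axioms])

sublocale alg: tens_data UNIV "tensk_ra A" A B by (rule tens_data_alg)
sublocale mod: tens_data UNIV "tensk_ra (vspace A P)" "vspace A P" "vspace B Q"
  by (rule tens_data_mod)

abbreviation "AB \<equiv> alg_tensor A B"
abbreviation "PQ \<equiv> mod_tensor A B P Q"

lemma is_tens_AB: "alg.is_tens AB"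
  by (simp add: alg.is_tens_def alg_tensor_def Let_def)

lemma is_tens_PQ: "mod.is_tens PQ"
  by (simp add: mod.is_tens_def mod_tensor_def Let_def)

abbreviation "pA \<equiv> purek A B"
abbreviation "pM \<equiv> purek (vspace A P) (vspace B Q)"

lemma pA_def: "pA = alg.tp" and pM_def: "pM = mod.tp"
  by (intro ext; simp add: purek_def)+

lemmas AB_induct [consumes 1, case_names pure add] = alg.T_induct[OF is_tens_AB, folded pA_def]
lemmas PQ_induct [consumes 1, case_names pure add] =
  mod.T_induct[OF is_tens_PQ, folded pM_def, simplified]
lemmas pA_closed = alg.tp_closed[OF is_tens_AB, folded pA_def]
lemmas pM_closed = mod.tp_closed[OF is_tens_PQ, folded pM_def, simplified]
lemmas pM_add = mod.tp_add[OF is_tens_PQ, folded pM_def, simplified]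
lemmas abelian_group_PQ = mod.abelian_group_T[OF is_tens_PQ]
abbreviation "g \<equiv> \<lambda>(a, b) (x, y). (a \<odot>\<^bsub>P\<^esub> x, b \<odot>\<^bsub>Q\<^esub> y)"

lemma frag_bilin_F: "c \<in> alg.F \<Longrightarrow> d \<in> mod.F \<Longrightarrow> frag_bilin g c d \<in> mod.F"
proof (induction rule: alg.F_induct)
  case (of a b)
  from of(3,1,2) show ?case
    by (induction rule: mod.F_induct)
      (auto simp: frag_bilin_diff mod.F_diff P.lsmult_closed Q.lsmult_closed)
qed (auto simp: frag_bilin_diff mod.F_diff)

text \<open>Together with \<open>frag_bilin_N2\<close> this makes the action of A \<otimes> B on P
  \<otimes> Q independent of representatives. With a pure tensor fixed in the other argument, only
  generators of the relations remain to be checked.\<close>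

lemma frag_bilin_N1: "c \<in> alg.N \<Longrightarrow> d \<in> mod.F \<Longrightarrow> frag_bilin g c d \<in> mod.N"
proof -
  assume c: "c \<in> alg.N"
  assume "d \<in> mod.F"
  then show ?thesis
  proof (induction rule: mod.F_induct)
    case (of x y)
    then have xy: "x \<in> carrier P" "y \<in> carrier Q" by simp_all
    show ?case
      using c
    proof (rule alg.N_image)
      fix c assume "c \<in> alg.tens_gens"
      then show "frag_bilin g c (frag_of (x, y)) \<in> mod.N"
        unfolding alg.tens_gens_def
      proof (elim UnE CollectE exE conjE; hypsubst)
        fix a s b assume ab: "a \<in> carrier A" "b \<in> carrier B"
        have "(s \<odot>\<^bsub>A\<^esub> a) \<odot>\<^bsub>P\<^esub> x = s \<odot>\<^bsub>vspace A P\<^esub> (a \<odot>\<^bsub>P\<^esub> x)"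
          "(s \<odot>\<^bsub>B\<^esub> b) \<odot>\<^bsub>Q\<^esub> y = s \<odot>\<^bsub>vspace B Q\<^esub> (b \<odot>\<^bsub>Q\<^esub> y)"
          using ab xy A.ksmult_l[of a s] B.ksmult_l[of b s] P.lsmult_assoc[of "s \<odot>\<^bsub>A\<^esub> \<one>\<^bsub>A\<^esub>" a x]
            Q.lsmult_assoc[of "s \<odot>\<^bsub>B\<^esub> \<one>\<^bsub>B\<^esub>" b y] A.ksmult_closed B.ksmult_closed by (auto simp: vspace_smult)
        then show "frag_bilin g (frag_of (s \<odot>\<^bsub>A\<^esub> a, b) - frag_of (a, s \<odot>\<^bsub>B\<^esub> b)) (frag_of (x, y)) \<in> mod.N"
          using mod.tp_balanced[of "a \<odot>\<^bsub>P\<^esub> x" s "b \<odot>\<^bsub>Q\<^esub> y"] ab xy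
          by (simp add: frag_bilin_diff P.lsmult_closed Q.lsmult_closed mod.tp_def mod.tc_eq_iff)
      next
        fix a a' b assume ab: "a \<in> carrier A" "a' \<in> carrier A" "b \<in> carrier B"
        then show "frag_bilin g (frag_of (a \<oplus>\<^bsub>A\<^esub> a', b) - frag_of (a, b) - frag_of (a', b))
            (frag_of (x, y)) \<in> mod.N"
          using mod.tp_add_left[of "a \<odot>\<^bsub>P\<^esub> x" "a' \<odot>\<^bsub>P\<^esub> x" "b \<odot>\<^bsub>Q\<^esub> y"] xy
          by (simp add: frag_bilin_diff P.lsmult_closed Q.lsmult_closed P.lsmult_l_distr
              mod.tc_eq_iff diff_diff_eq frag_extend_add frag_bilin_add)
      next
        fix a b b' assume ab: "a \<in> carrier A" "b \<in> carrier B" "b' \<in> carrier B"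
        then show "frag_bilin g (frag_of (a, b \<oplus>\<^bsub>B\<^esub> b') - frag_of (a, b) - frag_of (a, b'))
            (frag_of (x, y)) \<in> mod.N"
          using mod.tp_add_right[of "a \<odot>\<^bsub>P\<^esub> x" "b \<odot>\<^bsub>Q\<^esub> y" "b' \<odot>\<^bsub>Q\<^esub> y"] xy
          by (simp add: frag_bilin_diff P.lsmult_closed Q.lsmult_closed Q.lsmult_l_distr
              mod.tc_eq_iff diff_diff_eq frag_extend_add frag_bilin_add)
      qed
    qed (auto simp: frag_bilin_diff mod.N_diff)
  qed (auto simp: frag_bilin_diff mod.N_diff)
qed

lemma frag_bilin_N2: "c \<in> alg.F \<Longrightarrow> d \<in> mod.N \<Longrightarrow> frag_bilin g c d \<in> mod.N"
proof -
  assume d: "d \<in> mod.N"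
  assume "c \<in> alg.F"
  then show ?thesis
  proof (induction rule: alg.F_induct)
    case (of a b)
    show ?case
      using d
    proof (rule mod.N_image)
      fix d assume "d \<in> mod.tens_gens"
      then show "frag_bilin g (frag_of (a, b)) d \<in> mod.N"
        unfolding mod.tens_gens_def
      proof (elim UnE CollectE exE conjE; hypsubst)
        fix x s y assume "x \<in> carrier (vspace A P)" "y \<in> carrier (vspace B Q)"
        then have xy: "x \<in> carrier P" "y \<in> carrier Q" by simp_all
        \<comment> \<open>Scalars are central in A, so a acts on P linearly over the field.\<close>
        have "a \<odot>\<^bsub>P\<^esub> (s \<odot>\<^bsub>vspace A P\<^esub> x) = s \<odot>\<^bsub>vspace A P\<^esub> (a \<odot>\<^bsub>P\<^esub> x)"
          using of xy A.ksmult_l[of a s] A.ksmult_r[of a s] P.lsmult_assoc[of "s \<odot>\<^bsub>A\<^esub> \<one>\<^bsub>A\<^esub>" a x]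
            P.lsmult_assoc[of a "s \<odot>\<^bsub>A\<^esub> \<one>\<^bsub>A\<^esub>" x] A.ksmult_closed by (auto simp: vspace_smult)
        moreover have "b \<odot>\<^bsub>Q\<^esub> (s \<odot>\<^bsub>vspace B Q\<^esub> y) = s \<odot>\<^bsub>vspace B Q\<^esub> (b \<odot>\<^bsub>Q\<^esub> y)"
          using of xy B.ksmult_l[of b s] B.ksmult_r[of b s] Q.lsmult_assoc[of "s \<odot>\<^bsub>B\<^esub> \<one>\<^bsub>B\<^esub>" b y]
            Q.lsmult_assoc[of b "s \<odot>\<^bsub>B\<^esub> \<one>\<^bsub>B\<^esub>" y] B.ksmult_closed by (auto simp: vspace_smult)
        ultimately show "frag_bilin g (frag_of (a, b))
            (frag_of (s \<odot>\<^bsub>vspace A P\<^esub> x, y) - frag_of (x, s \<odot>\<^bsub>vspace B Q\<^esub> y)) \<in> mod.N"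
          using mod.tp_balanced[of "a \<odot>\<^bsub>P\<^esub> x" s "b \<odot>\<^bsub>Q\<^esub> y"] of xy
          by (simp add: frag_bilin_diff P.lsmult_closed Q.lsmult_closed mod.tp_def mod.tc_eq_iff)
      next
        fix x x' y
        assume "x \<in> carrier (vspace A P)" "x' \<in> carrier (vspace A P)" "y \<in> carrier (vspace B Q)"
        then show "frag_bilin g (frag_of (a, b))
            (frag_of (x \<oplus>\<^bsub>vspace A P\<^esub> x', y) - frag_of (x, y) - frag_of (x', y)) \<in> mod.N"
          using mod.tp_add_left[of "a \<odot>\<^bsub>P\<^esub> x" "a \<odot>\<^bsub>P\<^esub> x'" "b \<odot>\<^bsub>Q\<^esub> y"] of
          by (simp add: frag_bilin_diff P.lsmult_closed Q.lsmult_closed P.lsmult_r_distr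
              mod.tc_eq_iff diff_diff_eq frag_extend_add frag_bilin_add)
      next
        fix x y y'
        assume "x \<in> carrier (vspace A P)" "y \<in> carrier (vspace B Q)" "y' \<in> carrier (vspace B Q)"
        then show "frag_bilin g (frag_of (a, b))
            (frag_of (x, y \<oplus>\<^bsub>vspace B Q\<^esub> y') - frag_of (x, y) - frag_of (x, y')) \<in> mod.N"
          using mod.tp_add_right[of "a \<odot>\<^bsub>P\<^esub> x" "b \<odot>\<^bsub>Q\<^esub> y" "b \<odot>\<^bsub>Q\<^esub> y'"] of
          by (simp add: frag_bilin_diff P.lsmult_closed Q.lsmult_closed Q.lsmult_r_distr
              mod.tc_eq_iff diff_diff_eq frag_extend_add frag_bilin_add)
      qed
    qed (auto simp: frag_bilin_diff mod.N_diff)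
  qed (auto simp: frag_bilin_diff mod.N_diff)
qed

lemma smult_tc: "c \<in> alg.F \<Longrightarrow> d \<in> mod.F \<Longrightarrow> alg.tc c \<odot>\<^bsub>PQ\<^esub> mod.tc d = mod.tc (frag_bilin g c d)"
proof -
  assume cd: "c \<in> alg.F" "d \<in> mod.F"
  have "mod.tc (frag_bilin g c' d') = mod.tc (frag_bilin g c d)"
    if "c' \<in> alg.tc c" "d' \<in> mod.tc d" for c' d'
  proof -
    have n: "c' - c \<in> alg.N" "d' - d \<in> mod.N"
      using that by (simp_all add: alg.mem_tc mod.mem_tc)
    have "d' \<in> mod.F" using mod.F_add[OF mod.N_F[OF n(2)] cd(2)] by simp
    then have "frag_bilin g (c' - c) d' + frag_bilin g c (d' - d) \<in> mod.N"
      using n cd by (intro mod.N_add frag_bilin_N1 frag_bilin_N2)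
    then show ?thesis by (simp add: mod.tc_eq_iff frag_bilin_diff)
  qed
  moreover have "c \<in> alg.tc c" "d \<in> mod.tc d" by (simp_all add: alg.mem_tc mod.mem_tc)
  ultimately have "(\<Union>c'\<in>alg.tc c. \<Union>d'\<in>mod.tc d. mod.tc (frag_bilin g c' d')) =
      mod.tc (frag_bilin g c d)" by blast
  then show ?thesis by (simp add: mod_tensor_def Let_def)
qed

lemma smult_PQ_closed: "C \<in> carrier AB \<Longrightarrow> D \<in> carrier PQ \<Longrightarrow> C \<odot>\<^bsub>PQ\<^esub> D \<in> carrier PQ"
  by (auto simp: alg.carrier_T[OF is_tens_AB] mod.carrier_T[OF is_tens_PQ] smult_tc frag_bilin_F)

lemma smult_PQ_add:
  "\<lbrakk>C \<in> carrier AB; C' \<in> carrier AB; D \<in> carrier PQ\<rbrakk> \<Longrightarrow>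
    (C \<oplus>\<^bsub>AB\<^esub> C') \<odot>\<^bsub>PQ\<^esub> D = C \<odot>\<^bsub>PQ\<^esub> D \<oplus>\<^bsub>PQ\<^esub> C' \<odot>\<^bsub>PQ\<^esub> D"
  "\<lbrakk>C \<in> carrier AB; D \<in> carrier PQ; D' \<in> carrier PQ\<rbrakk> \<Longrightarrow>
    C \<odot>\<^bsub>PQ\<^esub> (D \<oplus>\<^bsub>PQ\<^esub> D') = C \<odot>\<^bsub>PQ\<^esub> D \<oplus>\<^bsub>PQ\<^esub> C \<odot>\<^bsub>PQ\<^esub> D'"
  by (auto simp: alg.carrier_T[OF is_tens_AB] mod.carrier_T[OF is_tens_PQ] smult_tc frag_bilin_F
      alg.add_tc[OF is_tens_AB] mod.add_tc[OF is_tens_PQ] alg.F_add mod.F_add frag_bilin_add)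

lemma smult_pure: "\<lbrakk>a \<in> carrier A; b \<in> carrier B; x \<in> carrier P; y \<in> carrier Q\<rbrakk> \<Longrightarrow>
    pA a b \<odot>\<^bsub>PQ\<^esub> pM x y = pM (a \<odot>\<^bsub>P\<^esub> x) (b \<odot>\<^bsub>Q\<^esub> y)"
  by (simp add: pA_def pM_def alg.tp_def mod.tp_def smult_tc)

end

section \<open>Words and sign patterns\<close>

lemma letter_ext:
  assumes "length u = length v" "\<And>l. 1 \<le> l \<Longrightarrow> l \<le> length v \<Longrightarrow> letter u l = letter v l"
  shows "u = v"
proof (rule nth_equalityI)
  fix i assume "i < length u"
  then show "u ! i = v ! i" using assms(1) assms(2)[of "Suc i"] by (simp add: letter_def)
qed (rule assms(1))

lemma length_swap_word [simp]: "length (swap_word k w) = length w"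
  by (simp add: swap_word_def)

lemma swap_index_invol [simp]: "swap_index k (swap_index k l) = l"
  by (simp add: swap_index_def)

lemma swap_index_inj [simp]: "swap_index k i = swap_index k j \<longleftrightarrow> i = j"
  by (metis swap_index_invol)

lemma swap_index_range: "1 \<le> k \<Longrightarrow> k < m \<Longrightarrow> swap_index k l \<in> {1..m} \<longleftrightarrow> l \<in> {1..m}"
  by (auto simp: swap_index_def)

lemma letter_swap:
  "\<lbrakk>1 \<le> k; k < length w; 1 \<le> l; l \<le> length w\<rbrakk> \<Longrightarrow> letter (swap_word k w) l = letter w (swap_index k l)"
  by (auto simp: letter_def swap_word_def swap_index_def nth_list_update)

lemma swap_swap: "1 \<le> k \<Longrightarrow> k < length w \<Longrightarrow> swap_word k (swap_word k w) = w"
proof (rule letter_ext)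
  fix l assume "1 \<le> k" "k < length w" "1 \<le> l" "l \<le> length w"
  then show "letter (swap_word k (swap_word k w)) l = letter w l"
    using swap_index_range[of k "length w" l] by (simp add: letter_swap)
qed simp

lemma swap_same:
  "1 \<le> k \<Longrightarrow> k < length w \<Longrightarrow> letter w k = letter w (k + 1) \<Longrightarrow> swap_word k w = w"
  by (rule letter_ext) (auto simp: letter_swap swap_index_def)

lemma mset_swap_word: "1 \<le> k \<Longrightarrow> k < length w \<Longrightarrow> mset (swap_word k w) = mset w"
  using mset_swap[of k w "k - 1"] by (simp add: swap_word_def letter_def)

lemma map_swap_word: "1 \<le> k \<Longrightarrow> k < length w \<Longrightarrow> map f (swap_word k w) = swap_word k (map f w)"
  by (simp add: swap_word_def letter_def map_update)

lemma letter_map: "1 \<le> l \<Longrightarrow> l \<le> length w \<Longrightarrow> letter (map f w) l = f (letter w l)"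
  by (simp add: letter_def)

lemma letter_mem: "1 \<le> l \<Longrightarrow> l \<le> length w \<Longrightarrow> letter w l \<in> set w"
  by (simp add: letter_def)

lemma letter_append1: "1 \<le> l \<Longrightarrow> l \<le> length u \<Longrightarrow> letter (u @ v) l = letter u l"
  by (cases l) (simp_all add: letter_def nth_append)

lemma letter_append2: "1 \<le> l \<Longrightarrow> letter (u @ v) (length u + l) = letter v l"
  by (cases l) (simp_all add: letter_def nth_append)

lemma swap_word_append1: "1 \<le> k \<Longrightarrow> k < length u \<Longrightarrow> swap_word k (u @ v) = swap_word k u @ v"
  by (cases k) (simp_all add: swap_word_def letter_def nth_append list_update_append)

lemma swap_word_append2:
  "1 \<le> k \<Longrightarrow> swap_word (length u + k) (u @ v) = u @ swap_word k v"
  by (cases k) (simp_all add: swap_word_def letter_def nth_append list_update_append)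

lemma length_words: "w \<in> words \<nu> \<Longrightarrow> length w = size \<nu>"
  by (auto simp: words_def)

lemma finite_words: "finite (words \<nu>)"
proof -
  have "words \<nu> \<subseteq> {w. set w \<subseteq> set_mset \<nu> \<and> length w = size \<nu>}"
    by (auto simp: words_def)
  then show ?thesis using finite_lists_length_eq[of "set_mset \<nu>"] finite_subset by blast
qed

text \<open>Extend a word to the positions -m, ..., -1, 1, ..., m by writing the inverse of letter l
  at -l. Of these two letters the positive one stands at position \<open>bkey\<close>. Reading the
  positive letters of the extended word from left to right gives the sorted word.\<close>

definition bkey :: "bool list \<Rightarrow> nat \<Rightarrow> int" where
  "bkey \<epsilon> l = (if letter \<epsilon> l then int l else - int l)"

text \<open>
  The position to which the minimal coset representative sorting the sign pattern \<open>\<epsilon>\<close> takes the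
  letter at position \<open>l\<close>: inverted letters come first, in reversed order.
\<close>

definition bpos :: "bool list \<Rightarrow> nat \<Rightarrow> nat" where
  "bpos \<epsilon> l = card {i \<in> {1..length \<epsilon>}. bkey \<epsilon> i \<le> bkey \<epsilon> l}"

lemma bkey_inj: "1 \<le> i \<Longrightarrow> bkey \<epsilon> i = bkey \<epsilon> j \<longleftrightarrow> i = j"
  by (auto simp: bkey_def split: if_splits)

lemma bpos_le_iff:
  assumes "i \<in> {1..length \<epsilon>}" "j \<in> {1..length \<epsilon>}"
  shows "bpos \<epsilon> i \<le> bpos \<epsilon> j \<longleftrightarrow> bkey \<epsilon> i \<le> bkey \<epsilon> j"
proof
  assume "bkey \<epsilon> i \<le> bkey \<epsilon> j"
  then show "bpos \<epsilon> i \<le> bpos \<epsilon> j" unfolding bpos_def by (intro card_mono) auto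
next
  assume le: "bpos \<epsilon> i \<le> bpos \<epsilon> j"
  show "bkey \<epsilon> i \<le> bkey \<epsilon> j"
  proof (rule ccontr)
    assume "\<not> ?thesis"
    then have "bpos \<epsilon> j < bpos \<epsilon> i"
      unfolding bpos_def using assms by (intro psubset_card_mono) (auto intro!: psubsetI)
    then show False using le by simp
  qed
qed

lemma bpos_eq_iff:
  assumes "i \<in> {1..length \<epsilon>}" "j \<in> {1..length \<epsilon>}"
  shows "bpos \<epsilon> i = bpos \<epsilon> j \<longleftrightarrow> i = j"
  using bpos_le_iff[OF assms] bpos_le_iff[OF assms(2,1)] assms bkey_inj[of i \<epsilon> j]
  by (metis antisym_conv atLeastAtMost_iff order_refl)

lemma bpos_range:
  assumes "l \<in> {1..length \<epsilon>}"
  shows "bpos \<epsilon> l \<in> {1..length \<epsilon>}"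
proof -
  have "bpos \<epsilon> l \<le> card {1..length \<epsilon>}" unfolding bpos_def by (intro card_mono) auto
  moreover have "bpos \<epsilon> l > 0" unfolding bpos_def using assms by (auto simp: card_gt_0_iff)
  ultimately show ?thesis by simp
qed

lemma bpos_bij: "bij_betw (bpos \<epsilon>) {1..length \<epsilon>} {1..length \<epsilon>}"
proof -
  have "bpos \<epsilon> ` {1..length \<epsilon>} \<subseteq> {1..length \<epsilon>}" using bpos_range by blast
  moreover have "inj_on (bpos \<epsilon>) {1..length \<epsilon>}" by (rule inj_onI) (simp add: bpos_eq_iff)
  ultimately show ?thesis using endo_inj_surj[of "{1..length \<epsilon>}" "bpos \<epsilon>"] by (simp add: bij_betw_def)
qed

lemma bpos_step:
  assumes "i \<in> {1..length \<epsilon>}" "j \<in> {1..length \<epsilon>}" "bkey \<epsilon> i < bkey \<epsilon> j"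
    and "\<And>h. h \<in> {1..length \<epsilon>} \<Longrightarrow> bkey \<epsilon> h \<le> bkey \<epsilon> j \<Longrightarrow> bkey \<epsilon> i < bkey \<epsilon> h \<Longrightarrow> h = j"
  shows "bpos \<epsilon> j = bpos \<epsilon> i + 1"
proof -
  have "{h \<in> {1..length \<epsilon>}. bkey \<epsilon> h \<le> bkey \<epsilon> j} =
      insert j {h \<in> {1..length \<epsilon>}. bkey \<epsilon> h \<le> bkey \<epsilon> i}"
    using assms by fastforce
  then show ?thesis unfolding bpos_def using assms(3) by simp
qed

lemma bpos_pos:
  assumes "1 \<le> k" "k < length \<epsilon>" "letter \<epsilon> k" "letter \<epsilon> (k + 1)"
  shows "bpos \<epsilon> (k + 1) = bpos \<epsilon> k + 1"
  by (rule bpos_step) (use assms in \<open>auto simp: bkey_def split: if_splits\<close>)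

lemma bpos_neg:
  assumes "1 \<le> k" "k < length \<epsilon>" "\<not> letter \<epsilon> k" "\<not> letter \<epsilon> (k + 1)"
  shows "bpos \<epsilon> k = bpos \<epsilon> (k + 1) + 1"
  by (rule bpos_step) (use assms in \<open>auto simp: bkey_def split: if_splits\<close>)

text \<open>Ranks depend only on the order of the keys, so an involution of the positions that
  respects this order carries ranks to ranks. It is used for the swap of a mixed pair and, with the
  identity as involution, for the flip of the first sign.\<close>

lemma bpos_image_cong:
  assumes "length \<epsilon>' = length \<epsilon>" "\<And>i. i \<in> {1..length \<epsilon>} \<Longrightarrow> s i \<in> {1..length \<epsilon>} \<and> s (s i) = i"
    and "\<And>i. i \<in> {1..length \<epsilon>} \<Longrightarrow> bkey \<epsilon>' (s i) \<le> bkey \<epsilon>' (s l) \<longleftrightarrow> bkey \<epsilon> i \<le> bkey \<epsilon> l"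
  shows "bpos \<epsilon>' (s l) = bpos \<epsilon> l"
proof -
  have "{i \<in> {1..length \<epsilon>'}. bkey \<epsilon>' i \<le> bkey \<epsilon>' (s l)} =
      s ` {i \<in> {1..length \<epsilon>}. bkey \<epsilon> i \<le> bkey \<epsilon> l}" (is "?L = s ` ?R")
  proof (intro equalityI subsetI)
    fix i assume i: "i \<in> ?L"
    then have "s i \<in> ?R" "i = s (s i)" using assms(1) assms(2)[of i] assms(3)[of "s i"] by auto
    then show "i \<in> s ` ?R" by blast
  qed (use assms in auto)
  moreover have "inj_on s ?R" using assms(2) by (intro inj_on_inverseI[where g = s]) auto
  ultimately show ?thesis unfolding bpos_def by (simp add: card_image)
qed

text \<open>The keys of a mixed pair have opposite signs, and exchanging the letters only exchanges
  their absolute values k and k+1. No key passes another one, so sorting still puts each letter at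
  the same place.\<close>

lemma bpos_mixed:
  assumes "1 \<le> k" "k < length \<epsilon>" "letter \<epsilon> k \<noteq> letter \<epsilon> (k + 1)" "l \<in> {1..length \<epsilon>}"
  shows "bpos (swap_word k \<epsilon>) (swap_index k l) = bpos \<epsilon> l"
proof (rule bpos_image_cong)
  fix i assume i: "i \<in> {1..length \<epsilon>}"
  have r: "swap_index k j \<in> {1..length \<epsilon>}" if "j \<in> {1..length \<epsilon>}" for j
    using that swap_index_range[of k "length \<epsilon>" j] assms by simp
  then show "swap_index k i \<in> {1..length \<epsilon>} \<and> swap_index k (swap_index k i) = i" using i by simp
  have l: "letter (swap_word k \<epsilon>) (swap_index k j) = letter \<epsilon> j" if "j \<in> {1..length \<epsilon>}" for j
    using letter_swap[of k \<epsilon> "swap_index k j"] r[OF that] assms by simp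
  show "bkey (swap_word k \<epsilon>) (swap_index k i) \<le> bkey (swap_word k \<epsilon>) (swap_index k l)
      \<longleftrightarrow> bkey \<epsilon> i \<le> bkey \<epsilon> l"
    unfolding bkey_def l[OF i] l[OF assms(4)] using assms i by (auto simp: swap_index_def)
qed simp

text \<open>Letters of equal sign at k and k+1 have neighbouring ranks, in this order if positive
  and in the opposite order if negative. Sorting therefore conjugates one simple transposition to
  another, and \<open>min\<close> names its index in both cases.\<close>

lemma bpos_same_swap:
  assumes k: "1 \<le> k" "k < length \<epsilon>" "letter \<epsilon> k = letter \<epsilon> (k + 1)" and l: "l \<in> {1..length \<epsilon>}"
  shows "swap_index (min (bpos \<epsilon> k) (bpos \<epsilon> (k + 1))) (bpos \<epsilon> l) = bpos \<epsilon> (swap_index k l)"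
proof -
  have eq: "bpos \<epsilon> l = bpos \<epsilon> k \<longleftrightarrow> l = k" "bpos \<epsilon> l = bpos \<epsilon> (k + 1) \<longleftrightarrow> l = k + 1"
    using k l by (simp_all add: bpos_eq_iff)
  show ?thesis
  proof (cases "letter \<epsilon> k")
    case True
    then show ?thesis using bpos_pos[of k \<epsilon>] k eq by (auto simp: swap_index_def)
  next
    case False
    then show ?thesis using bpos_neg[of k \<epsilon>] k eq by (auto simp: swap_index_def)
  qed
qed

lemma min_bpos_range:
  assumes k: "1 \<le> k" "k < length \<epsilon>" "letter \<epsilon> k = letter \<epsilon> (k + 1)"
  shows "1 \<le> min (bpos \<epsilon> k) (bpos \<epsilon> (k + 1))" "min (bpos \<epsilon> k) (bpos \<epsilon> (k + 1)) < length \<epsilon>"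
proof -
  have "bpos \<epsilon> k \<in> {1..length \<epsilon>}" "bpos \<epsilon> (k + 1) \<in> {1..length \<epsilon>}"
    by (rule bpos_range, use k in simp)+
  moreover have "bpos \<epsilon> (k + 1) = bpos \<epsilon> k + 1 \<or> bpos \<epsilon> k = bpos \<epsilon> (k + 1) + 1"
    using bpos_pos bpos_neg k by blast
  ultimately show "1 \<le> min (bpos \<epsilon> k) (bpos \<epsilon> (k + 1))" "min (bpos \<epsilon> k) (bpos \<epsilon> (k + 1)) < length \<epsilon>"
    by auto
qed

definition bflip :: "bool list \<Rightarrow> bool list" where
  "bflip \<epsilon> = \<epsilon>[0 := \<not> \<epsilon> ! 0]"

lemma length_bflip [simp]: "length (bflip \<epsilon>) = length \<epsilon>"
  by (simp add: bflip_def)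

lemma letter_upd0: "1 \<le> l \<Longrightarrow> l \<le> length w \<Longrightarrow> letter (w[0 := a]) l = (if l = 1 then a else letter w l)"
  by (cases w) (auto simp: letter_def nth_list_update)

lemma letter_bflip:
  "1 \<le> l \<Longrightarrow> l \<le> length \<epsilon> \<Longrightarrow> letter (bflip \<epsilon>) l = (if l = 1 then \<not> letter \<epsilon> 1 else letter \<epsilon> l)"
  by (simp add: bflip_def letter_upd0) (simp add: letter_def)

lemma bflip_bflip [simp]: "bflip (bflip \<epsilon>) = \<epsilon>"
  by (cases \<epsilon>) (simp_all add: bflip_def)

text \<open>The key at position 1 changes between 1 and -1, and every other key has absolute value
  at least 2.\<close>

lemma bpos_bflip:
  assumes "l \<in> {1..length \<epsilon>}"
  shows "bpos (bflip \<epsilon>) l = bpos \<epsilon> l"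
  using assms by (intro bpos_image_cong[where s = id, simplified])
    (auto simp: bkey_def letter_bflip split: if_splits)

lemma bpos_True:
  assumes "l \<in> {1..m}"
  shows "bpos (replicate m True) l = l"
proof -
  have "letter (replicate m True) i" if "i \<in> {1..m}" for i
    using that by (auto simp: letter_def)
  then have "{i \<in> {1..m}. bkey (replicate m True) i \<le> bkey (replicate m True) l} = {1..l}"
    using assms by (auto simp: bkey_def)
  then show ?thesis by (simp add: bpos_def)
qed

section \<open>Consequences of the relations\<close>

lemma Qpoly_FA: "x \<in> FA G \<Longrightarrow> y \<in> FA G \<Longrightarrow> Qpoly p i j x y \<in> FA G"
  by (simp add: Qpoly_def)

lemma Qquot_FA: "x \<in> FA G \<Longrightarrow> y \<in> FA G \<Longrightarrow> z \<in> FA G \<Longrightarrow> Qquot p i j x y z \<in> FA G"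
  by (simp add: Qquot_def Let_def)

lemma subst_Qpoly: "subst \<psi> (Qpoly p i j x y) = Qpoly p i j (subst \<psi> x) (subst \<psi> y)"
  by (simp add: Qpoly_def)

lemma subst_Qquot: "subst \<psi> (Qquot p i j x y z) = Qquot p i j (subst \<psi> x) (subst \<psi> y) (subst \<psi> z)"
  by (simp add: Qquot_def Let_def)

lemma klr_gens_mem:
  "gX k \<in> klr_gens m W \<longleftrightarrow> 1 \<le> k \<and> k \<le> m" "gS k \<in> klr_gens m W \<longleftrightarrow> 1 \<le> k \<and> k < m"
  "gE i \<in> klr_gens m W \<longleftrightarrow> i \<in> W" "gPi \<notin> klr_gens m W"
  by (auto simp: klr_gens_def)

lemma klr_rels_FA:
  assumes swap: "\<And>k w. 1 \<le> k \<Longrightarrow> k < m \<Longrightarrow> w \<in> W \<Longrightarrow> swap_word k w \<in> W"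
    and G: "klr_gens m W \<subseteq> G"
  shows "klr_rels p m W \<subseteq> FA G"
proof -
  have X: "xg k \<in> FA G" if "1 \<le> k" "k \<le> m" for k
    using that G klr_gens_mem(1)[of k m W] by (auto intro!: FA_gen)
  have S: "sg k \<in> FA G" if "1 \<le> k" "k < m" for k
    using that G klr_gens_mem(2)[of k m W] by (auto intro!: FA_gen)
  have E: "eg i \<in> FA G" if "i \<in> W" for i
    using that G klr_gens_mem(3)[of i m W] by (auto intro!: FA_gen)
  have sw: "swap_index k l \<in> {1..m}" if "1 \<le> k" "k < m" "l \<in> {1..m}" for k l
    using that swap_index_range[of k m l] by simp
  show ?thesis
    unfolding klr_rels_def
  proof (intro Un_least subsetI)
    fix r assume "r \<in> {(sg k * xg l - xg (swap_index k l) * sg k) * eg i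
        - (if l = k \<and> letter i k = letter i (k + 1) then - eg i
           else if l = k + 1 \<and> letter i k = letter i (k + 1) then eg i
           else 0)
        | k l i. 1 \<le> k \<and> k < m \<and> 1 \<le> l \<and> l \<le> m \<and> i \<in> W}"
    then show "r \<in> FA G" using sw by (auto intro!: FA_diff FA_mult FA_uminus X S E)
  qed (auto intro!: FA_diff FA_mult FA_sum X S E Qpoly_FA Qquot_FA swap)
qed

text \<open>The KLR relations for any finite set of words of length m closed under transpositions.
  The VV presentation contains such relations as well, so their consequences, and later the
  juxtaposition maps, are available over both algebras.\<close>

locale klr_like = pres \<Xi> for \<Xi> :: "('k::field vvgen, 'k) presentation" +
  fixes p :: 'k and m :: nat and W :: "'k list set"
  assumes gens: "klr_gens m W \<subseteq> fst \<Xi>" and rels: "klr_rels p m W \<subseteq> snd \<Xi>"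
    and finW: "finite W" and lenW: "w \<in> W \<Longrightarrow> length w = m"
    and swapW: "1 \<le> k \<Longrightarrow> k < m \<Longrightarrow> w \<in> W \<Longrightarrow> swap_word k w \<in> W"
begin

lemma X_FA: "1 \<le> k \<Longrightarrow> k \<le> m \<Longrightarrow> xg k \<in> Fr"
  and S_FA: "1 \<le> k \<Longrightarrow> k < m \<Longrightarrow> sg k \<in> Fr"
  and E_FA: "i \<in> W \<Longrightarrow> eg i \<in> Fr"
  using gens by (auto intro!: FA_gen simp: klr_gens_def)

lemmas gen_FA = X_FA S_FA E_FA

lemma rel: "r \<in> klr_rels p m W \<Longrightarrow> r \<in> J"
  using rels J_rel by blast

lemma rel_ee: "i \<in> W \<Longrightarrow> j \<in> W \<Longrightarrow> eg i * eg j - (if i = j then eg i else 0) \<in> J"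
  by (rule rel) (unfold klr_rels_def, blast)

lemma rel_sum: "(\<Sum>i\<in>W. eg i) - 1 \<in> J"
  by (rule rel) (unfold klr_rels_def, blast)

lemma rel_se: "1 \<le> k \<Longrightarrow> k < m \<Longrightarrow> i \<in> W \<Longrightarrow> sg k * eg i - eg (swap_word k i) * sg k \<in> J"
  by (rule rel) (unfold klr_rels_def, blast)

lemma rel_xe: "1 \<le> l \<Longrightarrow> l \<le> m \<Longrightarrow> i \<in> W \<Longrightarrow> xg l * eg i - eg i * xg l \<in> J"
  by (rule rel) (unfold klr_rels_def, blast)

lemma rel_xx: "1 \<le> r \<Longrightarrow> r \<le> m \<Longrightarrow> 1 \<le> s \<Longrightarrow> s \<le> m \<Longrightarrow> xg r * xg s - xg s * xg r \<in> J"
  by (rule rel) (unfold klr_rels_def, blast)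

lemma rel_s2: "1 \<le> k \<Longrightarrow> k < m \<Longrightarrow> i \<in> W \<Longrightarrow>
    sg k * sg k * eg i - Qpoly p (letter i k) (letter i (k + 1)) (xg (k + 1)) (xg k) * eg i \<in> J"
  by (rule rel) (unfold klr_rels_def, blast)

lemma rel_ss: "\<lbrakk>1 \<le> j; j < m; 1 \<le> k; k < m; j \<noteq> k + 1; k \<noteq> j + 1\<rbrakk> \<Longrightarrow> sg j * sg k - sg k * sg j \<in> J"
  by (rule rel) (unfold klr_rels_def, blast)

lemma rel_braid: "1 \<le> k \<Longrightarrow> k + 1 < m \<Longrightarrow> i \<in> W \<Longrightarrow>
    (sg (k + 1) * sg k * sg (k + 1) - sg k * sg (k + 1) * sg k) * eg i
        - (if letter i k = letter i (k + 2)
           then Qquot p (letter i k) (letter i (k + 1)) (xg k) (xg (k + 1)) (xg (k + 2)) * eg i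
           else 0) \<in> J"
  by (rule rel) (unfold klr_rels_def, blast)

lemma rel_sx: "\<lbrakk>1 \<le> k; k < m; 1 \<le> l; l \<le> m; i \<in> W\<rbrakk> \<Longrightarrow>
    (sg k * xg l - xg (swap_index k l) * sg k) * eg i
        - (if l = k \<and> letter i k = letter i (k + 1) then - eg i
           else if l = k + 1 \<and> letter i k = letter i (k + 1) then eg i
           else 0) \<in> J"
  by (rule rel) (unfold klr_rels_def, blast)

end

lemma swap_words: "1 \<le> k \<Longrightarrow> k < size \<nu> \<Longrightarrow> w \<in> words \<nu> \<Longrightarrow> swap_word k w \<in> words \<nu>"
  by (auto simp: words_def mset_swap_word)

lemma klr_like_klr: "klr_like (klr_pres p \<nu>) p (size \<nu>) (words \<nu>)"
proof
  show "snd (klr_pres p \<nu>) \<subseteq> FA (fst (klr_pres p \<nu>))"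
    unfolding klr_pres_def fst_conv snd_conv by (rule klr_rels_FA) (auto intro: swap_words)
qed (auto simp: klr_pres_def finite_words length_words intro: swap_words)

section \<open>The KLR algebra inside the VV algebra\<close>

locale params =
  fixes p l :: "'k::field"
  assumes p0: "p \<noteq> 0" and l0: "l \<noteq> 0"
    and I1: "1 \<notin> I_set p l" and I2: "- 1 \<notin> I_set p l" and I3: "p \<notin> I_set p l" and I4: "- p \<notin> I_set p l"
begin

abbreviation Pos :: "'k \<Rightarrow> bool" where "Pos i \<equiv> i \<in> I_plus p l"

lemma Pos_nz: "Pos i \<Longrightarrow> i \<noteq> 0"
  using p0 l0 by (auto simp: I_plus_def)

lemma I_set_iff: "i \<in> I_set p l \<longleftrightarrow> Pos i \<or> Pos (inverse i)"
  unfolding I_set_eq[OF p0] by (metis UnCI UnE image_iff inverse_inverse_eq)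

lemma Pos_inverse: "i \<in> I_set p l \<Longrightarrow> Pos (inverse i) \<longleftrightarrow> \<not> Pos i"
  using I_plus_disjoint[OF p0 l0 I1 I2 I3 I4] unfolding I_set_iff
  by (metis IntI empty_iff image_eqI inverse_inverse_eq)

lemma I_set_nz: "i \<in> I_set p l \<Longrightarrow> i \<noteq> 0"
  using Pos_nz[of i] Pos_nz[of "inverse i"] by (auto simp: I_set_iff)

text \<open>Multiplication by \<open>p\<^sup>2\<close> shifts the exponent by one step of the
  progression, and the shift can be undone. Consequently no arrow of \<Gamma> joins letters of
  different sign.\<close>

lemma Pos_p2: "Pos (p\<^sup>2 * j) \<longleftrightarrow> Pos j"
proof -
  have *: "p\<^sup>2 * (p powi (2 * n) * l) = p powi (2 * (n + 1)) * l" for n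
    using p0 by (simp add: power_int_add distrib_left power2_eq_square mult_ac)
  show ?thesis
  proof
    assume "Pos j"
    then show "Pos (p\<^sup>2 * j)" unfolding I_plus_def using * by blast
  next
    assume "Pos (p\<^sup>2 * j)"
    then obtain n where "p\<^sup>2 * j = p powi (2 * n) * l" unfolding I_plus_def by blast
    moreover have "2 * (n - 1 + 1) = 2 * n" by simp
    ultimately have "p\<^sup>2 * j = p\<^sup>2 * (p powi (2 * (n - 1)) * l)" using *[of "n - 1"] by metis
    then have "j = p powi (2 * (n - 1)) * l" using p0 by simp
    then show "Pos j" unfolding I_plus_def by blast
  qed
qed

lemma arrows_mixed: "Pos i \<noteq> Pos j \<Longrightarrow> arrows p i j = 0"
  using Pos_p2 by (auto simp: arrows_def)

lemma arrows_inverse: "i \<noteq> 0 \<Longrightarrow> j \<noteq> 0 \<Longrightarrow> arrows p (inverse i) (inverse j) = arrows p j i"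
  using p0 by (auto simp: arrows_def field_simps)

text \<open>The letters differ and there is no arrow in either direction, so an empty product
  remains. Hence \<sigma>_k is its own inverse on words whose letters at k and k+1 have different
  signs.\<close>

lemma Qpoly_mixed: "Pos i \<noteq> Pos j \<Longrightarrow> Qpoly p i j x y = 1"
  using arrows_mixed[of i j] arrows_mixed[of j i] by (auto simp: Qpoly_def)

lemma Qquot_mixed: "Pos i \<noteq> Pos j \<Longrightarrow> Qquot p i j x y z = 0"
  using arrows_mixed[of i j] arrows_mixed[of j i] by (auto simp: Qquot_def)

text \<open>Inversion reverses the arrows, which is compensated by exchanging i with j, and negating
  both variables exchanges them in the difference. So a pair of negative letters behaves like the
  reversed pair of positive ones.\<close>

lemma Qpoly_inverse:
  "i \<noteq> 0 \<Longrightarrow> j \<noteq> 0 \<Longrightarrow> Qpoly p (inverse i) (inverse j) (- x) (- y) = Qpoly p j i y x"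
  by (auto simp: Qpoly_def arrows_inverse add.commute)

text \<open>The letters keep their order, so the sign exponent changes from one direction of arrows
  to the other. With a single arrow this gives the minus sign; with arrows both ways the exponent
  stays and the sum, linear in the variables, changes sign. The outer variables are exchanged
  because sorting reverses negative letters.\<close>

lemma Qquot_inverse:
  "i \<noteq> 0 \<Longrightarrow> j \<noteq> 0 \<Longrightarrow>
    Qquot p (inverse i) (inverse j) (- z) (- y) (- x) = - Qquot p i j x y z"
  unfolding Qquot_def Let_def arrows_inverse
  by (auto simp: arrows_def lessThan_Suc)

section \<open>Sign patterns and sorted words\<close>

definition sgn :: "'k list \<Rightarrow> bool list" where
  "sgn w = map Pos w"

definition pm :: "'k \<Rightarrow> 'k" where
  "pm i = (if Pos i then i else inverse i)"

text \<open>The word of positive letters into which the minimal coset representative sorts \<open>w\<close>.\<close>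

definition nrm :: "'k list \<Rightarrow> 'k list" where
  "nrm w = map (\<lambda>c. pm (letter w (inv_into {1..length w} (bpos (sgn w)) c))) [1..<length w + 1]"

lemma length_sgn [simp]: "length (sgn w) = length w" and length_nrm [simp]: "length (nrm w) = length w"
  by (simp_all add: sgn_def nrm_def del: upt_Suc)

lemma letter_sgn: "1 \<le> k \<Longrightarrow> k \<le> length w \<Longrightarrow> letter (sgn w) k = Pos (letter w k)"
  by (simp add: sgn_def letter_map)

lemma letter_nrm:
  assumes "k \<in> {1..length w}"
  shows "letter (nrm w) (bpos (sgn w) k) = pm (letter w k)"
proof -
  have b: "bij_betw (bpos (sgn w)) {1..length w} {1..length w}" using bpos_bij[of "sgn w"] by simp
  then have r: "bpos (sgn w) k \<in> {1..length w}" using assms by (auto simp: bij_betw_def)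
  then have "letter (nrm w) (bpos (sgn w) k) =
      pm (letter w (inv_into {1..length w} (bpos (sgn w)) (bpos (sgn w) k)))"
    by (auto simp: nrm_def letter_def simp del: upt_Suc)
  also have "inv_into {1..length w} (bpos (sgn w)) (bpos (sgn w) k) = k"
    using b assms by (intro inv_into_f_f) (auto simp: bij_betw_def)
  finally show ?thesis .
qed

text \<open>Every position is the rank of exactly one letter, so the letters at the positions given
  by \<open>bpos\<close> determine the word. This keeps the inverse permutation out of the later
  proofs.\<close>

lemma nrm_eqI:
  assumes "length v = length w"
    and "\<And>k. k \<in> {1..length w} \<Longrightarrow> letter v (bpos (sgn w) k) = pm (letter w k)"
  shows "v = nrm w"
proof (rule letter_ext)
  fix c assume "1 \<le> c" "c \<le> length (nrm w)"
  then have "c \<in> bpos (sgn w) ` {1..length w}"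
    using bpos_bij[of "sgn w"] by (simp add: bij_betw_def)
  then obtain k where "k \<in> {1..length w}" "c = bpos (sgn w) k" by blast
  then show "letter v c = letter (nrm w) c" using assms(2) letter_nrm by simp
qed (use assms(1) in simp)

lemma mset_via_letter: "mset w = image_mset (letter w) (mset_set {1..length w})"
proof -
  have "w = map (letter w) [1..<length w + 1]"
    by (rule nth_equalityI) (auto simp: letter_def simp del: upt_Suc)
  then have "mset w = image_mset (letter w) (mset [1..<length w + 1])" by (metis mset_map)
  also have "mset [1..<length w + 1] = mset_set {1..length w}"
    by (simp only: mset_upt atLeastLessThanSuc_atLeastAtMost Suc_eq_plus1[symmetric])
  finally show ?thesis .
qed

lemma mset_nrm: "mset (nrm w) = image_mset pm (mset w)"
proof -
  let ?b = "bpos (sgn w)"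
  have b: "bij_betw ?b {1..length w} {1..length w}" using bpos_bij[of "sgn w"] by simp
  then have "mset_set {1..length w} = image_mset ?b (mset_set {1..length w})"
    by (metis bij_betw_def image_mset_mset_set)
  then have "mset (nrm w) = image_mset (letter (nrm w)) (image_mset ?b (mset_set {1..length w}))"
    using mset_via_letter[of "nrm w"] by simp
  also have "\<dots> = image_mset (\<lambda>k. pm (letter w k)) (mset_set {1..length w})"
    unfolding image_mset.compositionality
    by (rule image_mset_cong) (use letter_nrm in \<open>auto simp: o_def\<close>)
  also have "\<dots> = image_mset pm (mset w)"
    using mset_via_letter[of w] by (simp add: image_mset.compositionality o_def)
  finally show ?thesis .
qed

lemma sgn_swap: "1 \<le> k \<Longrightarrow> k < length w \<Longrightarrow> sgn (swap_word k w) = swap_word k (sgn w)"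
  by (simp add: sgn_def map_swap_word)

lemma nrm_swap_mixed:
  assumes k: "1 \<le> k" "k < length w" "letter (sgn w) k \<noteq> letter (sgn w) (k + 1)"
  shows "nrm (swap_word k w) = nrm w"
proof (rule nrm_eqI[symmetric])
  fix j assume "j \<in> {1..length (swap_word k w)}"
  then have j: "j \<in> {1..length w}" "swap_index k j \<in> {1..length w}"
    using k swap_index_range[of k "length w" j] by auto
  have "bpos (swap_word k (sgn w)) j = bpos (sgn w) (swap_index k j)"
    using bpos_mixed[of k "sgn w" "swap_index k j"] k j by simp
  then show "letter (nrm w) (bpos (sgn (swap_word k w)) j) = pm (letter (swap_word k w) j)"
    using letter_nrm[of "swap_index k j" w] j k by (simp add: sgn_swap letter_swap)
qed simp

lemma nrm_swap_same:
  assumes k: "1 \<le> k" "k < length w" "letter (sgn w) k = letter (sgn w) (k + 1)"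
  shows "nrm (swap_word k w) = swap_word (min (bpos (sgn w) k) (bpos (sgn w) (k + 1))) (nrm w)"
    (is "_ = swap_word ?c _")
proof (rule nrm_eqI[symmetric])
  have s: "sgn (swap_word k w) = sgn w" using k by (simp add: sgn_swap swap_same)
  fix j assume "j \<in> {1..length (swap_word k w)}"
  then have j: "j \<in> {1..length w}" "swap_index k j \<in> {1..length w}"
    using k swap_index_range[of k "length w" j] by auto
  have "letter (swap_word ?c (nrm w)) (bpos (sgn w) j) = letter (nrm w) (swap_index ?c (bpos (sgn w) j))"
    using min_bpos_range[of k "sgn w"] bpos_range[of j "sgn w"] j k by (intro letter_swap) auto
  also have "swap_index ?c (bpos (sgn w) j) = bpos (sgn w) (swap_index k j)"
    using bpos_same_swap[of k "sgn w" j] k j by simp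
  finally show "letter (swap_word ?c (nrm w)) (bpos (sgn (swap_word k w)) j) =
      pm (letter (swap_word k w) j)"
    using letter_nrm[of "swap_index k j" w] j k by (simp add: s letter_swap)
qed simp

definition wflip :: "'k list \<Rightarrow> 'k list" where
  "wflip w = w[0 := inverse (w ! 0)]"

lemma length_wflip [simp]: "length (wflip w) = length w"
  by (simp add: wflip_def)

lemma letter_wflip:
  "1 \<le> k \<Longrightarrow> k \<le> length w \<Longrightarrow> letter (wflip w) k = (if k = 1 then inverse (letter w 1) else letter w k)"
  by (simp add: wflip_def letter_upd0) (simp add: letter_def)

lemma sgn_wflip: "set w \<subseteq> I_set p l \<Longrightarrow> sgn (wflip w) = bflip (sgn w)"
  by (cases w) (auto simp: sgn_def wflip_def bflip_def Pos_inverse)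

lemma pm_inverse: "i \<in> I_set p l \<Longrightarrow> pm (inverse i) = pm i"
  by (auto simp: pm_def Pos_inverse)

lemma nrm_wflip:
  assumes "set w \<subseteq> I_set p l"
  shows "nrm (wflip w) = nrm w"
proof (rule nrm_eqI[symmetric])
  fix k assume "k \<in> {1..length (wflip w)}"
  then show "letter (nrm w) (bpos (sgn (wflip w)) k) = pm (letter (wflip w) k)"
    using letter_nrm[of k w] assms letter_mem[of 1 w]
    by (auto simp: sgn_wflip bpos_bflip letter_wflip pm_inverse)
qed simp

text \<open>For a given sign pattern sorting is a fixed permutation, and a letter is recovered from
  its positive version and its sign.\<close>

lemma nrm_inj:
  assumes "length w = length w'" "sgn w = sgn w'" "nrm w = nrm w'"
  shows "w = w'"
proof (rule letter_ext)
  fix k assume k: "1 \<le> k" "k \<le> length w'"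
  have "pm (letter w k) = pm (letter w' k)"
    using letter_nrm[of k w] letter_nrm[of k w'] assms k by simp
  moreover have "Pos (letter w k) = Pos (letter w' k)"
    using letter_sgn[of k w] letter_sgn[of k w'] assms k by simp
  ultimately show "letter w k = letter w' k" by (auto simp: pm_def split: if_splits)
qed (rule assms(1))

end

section \<open>The words and presentations attached to one weight\<close>

locale wt = params p l for p l :: "'k::field" +
  fixes \<gamma> :: "'k multiset"
  assumes \<gamma>: "\<gamma> \<in> NI_plus p l"
begin

abbreviation "m \<equiv> size \<gamma>"
abbreviation "W \<equiv> words \<gamma>"
abbreviation "WW \<equiv> theta_words (theta \<gamma>)"

lemma plus_part_theta: "plus_part p l (theta \<gamma>) = \<gamma>"
  using plus_part_bij(2)[OF p0 l0 I1 I2 I3 I4 \<gamma>] by blast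

lemma theta_pm: "mset w + image_mset inverse (mset w) = theta (image_mset pm (mset w))"
  by (induction w) (auto simp: theta_def pm_def)

text \<open>A weight symmetric under inversion is determined by its positive part, and for a word
  taken together with its inverse this part is the image of the word under \<open>pm\<close>. The
  symmetric weight condition thus becomes weight \<gamma> for the positive versions of the
  letters.\<close>

lemma WW_iff: "w \<in> WW \<longleftrightarrow> set w \<subseteq> I_set p l \<and> image_mset pm (mset w) = \<gamma>"
proof
  assume w: "w \<in> WW"
  then have e: "mset w + image_mset inverse (mset w) = theta \<gamma>" by (simp add: theta_words_def)
  have s: "set w \<subseteq> I_set p l"
  proof
    fix i assume "i \<in> set w"
    then have "i \<in># theta \<gamma>" by (simp flip: e)
    then show "i \<in> I_set p l"
      using \<gamma> by (auto simp: theta_def NI_plus_def I_set_iff)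
  qed
  have "image_mset pm (mset w) \<in> NI_plus p l"
    using s by (auto simp: NI_plus_def pm_def I_set_iff)
  then have "plus_part p l (theta (image_mset pm (mset w))) = image_mset pm (mset w)"
    using plus_part_bij(2)[OF p0 l0 I1 I2 I3 I4] by blast
  then show "set w \<subseteq> I_set p l \<and> image_mset pm (mset w) = \<gamma>"
    using s e plus_part_theta by (simp add: theta_pm)
qed (simp add: theta_words_def theta_pm)

lemma W_iff: "w \<in> W \<longleftrightarrow> w \<in> WW \<and> (\<forall>i\<in>set w. Pos i)"
proof
  assume w: "w \<in> W"
  then have "\<forall>i\<in>set w. Pos i" using \<gamma> by (auto simp: words_def NI_plus_def)
  moreover have "image_mset pm (mset w) = mset w"
    using \<open>\<forall>i\<in>set w. Pos i\<close> by (intro image_mset_cong[where g = id, simplified]) (auto simp: pm_def)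
  ultimately show "w \<in> WW \<and> (\<forall>i\<in>set w. Pos i)"
    using w by (auto simp: WW_iff words_def I_set_iff)
next
  assume w: "w \<in> WW \<and> (\<forall>i\<in>set w. Pos i)"
  then have "image_mset pm (mset w) = mset w"
    by (intro image_mset_cong[where g = id, simplified]) (auto simp: pm_def)
  then show "w \<in> W" using w by (auto simp: WW_iff words_def)
qed

lemma W_WW: "w \<in> W \<Longrightarrow> w \<in> WW"
  by (simp add: W_iff)

lemma WW_I: "w \<in> WW \<Longrightarrow> set w \<subseteq> I_set p l"
  by (simp add: WW_iff)

lemma length_WW: "w \<in> WW \<Longrightarrow> length w = m"
  by (metis WW_iff size_image_mset size_mset)

lemma nrm_W: "w \<in> WW \<Longrightarrow> nrm w \<in> W"
  by (simp add: words_def mset_nrm WW_iff)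

lemma finite_WW: "finite WW"
proof -
  have "WW \<subseteq> {w. set w \<subseteq> set_mset (theta \<gamma>) \<and> length w = m}"
    using length_WW by (auto simp: theta_words_def) (metis UnI1 set_mset_mset set_mset_union)
  then show ?thesis using finite_lists_length_eq[of "set_mset (theta \<gamma>)"] finite_subset by blast
qed

lemma swap_WW: "1 \<le> k \<Longrightarrow> k < m \<Longrightarrow> w \<in> WW \<Longrightarrow> swap_word k w \<in> WW"
  using mset_swap_word[of k w] length_WW[of w] by (simp add: theta_words_def)

lemma wflip_WW:
  assumes "w \<in> WW"
  shows "wflip w \<in> WW"
proof (cases w)
  case (Cons i u)
  then have "image_mset pm (mset (wflip w)) = image_mset pm (mset w)" "inverse i \<in> I_set p l"
    using WW_I[OF assms] by (auto simp: wflip_def pm_inverse I_set_iff)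
  then show ?thesis using assms Cons unfolding WW_iff by (auto simp: wflip_def)
qed (use assms in \<open>simp add: wflip_def\<close>)

text \<open>Matches the idempotents of row \<epsilon> with those of the KLR algebra, which is what
  makes the sum of all e(i) act as the identity on every row.\<close>

lemma nrm_bij:
  assumes "length \<epsilon> = m"
  shows "bij_betw nrm {i \<in> WW. sgn i = \<epsilon>} W"
  unfolding bij_betw_def
proof (intro conjI inj_onI equalityI subsetI)
  fix j assume j: "j \<in> W"
  then have lj: "length j = m" by (simp add: length_words)
  \<comment> \<open>The inverse of sorting: the letter that stands at
    \<open>bpos \<epsilon> k\<close> is put back at k, with the sign that \<epsilon>
    prescribes.\<close>
  define i where "i = map (\<lambda>k. let c = letter j (bpos \<epsilon> k) in if letter \<epsilon> k then c else inverse c) [1..<m + 1]"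
  have li: "length i = m" by (simp add: i_def del: upt_Suc)
  have letter_i: "letter i k = (let c = letter j (bpos \<epsilon> k) in if letter \<epsilon> k then c else inverse c)"
    if "k \<in> {1..m}" for k
    using that unfolding i_def by (subst letter_def) (auto simp del: upt_Suc)
  have P: "Pos (letter j (bpos \<epsilon> k))" if "k \<in> {1..m}" for k
    using bpos_range[of k \<epsilon>] that assms letter_mem[of "bpos \<epsilon> k" j] j lj by (auto simp: W_iff)
  have pmi: "pm (letter i k) = letter j (bpos \<epsilon> k) \<and> Pos (letter i k) = letter \<epsilon> k
      \<and> letter i k \<in> I_set p l" if "k \<in> {1..m}" for k
    using P[OF that] Pos_inverse[of "letter j (bpos \<epsilon> k)"]
    by (auto simp: letter_i[OF that] pm_def I_set_iff Let_def)
  have s: "sgn i = \<epsilon>"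
    by (rule letter_ext) (use pmi in \<open>auto simp: li assms letter_sgn\<close>)
  have n: "j = nrm i"
    by (rule nrm_eqI) (use pmi in \<open>auto simp: li lj s\<close>)
  have "set i \<subseteq> I_set p l"
  proof
    fix a assume "a \<in> set i"
    then obtain k where "k < m" "a = letter i (Suc k)" by (auto simp: in_set_conv_nth letter_def li)
    then show "a \<in> I_set p l" using pmi[of "Suc k"] by simp
  qed
  then have "i \<in> WW" using j n mset_nrm[of i] by (simp add: WW_iff words_def)
  then show "j \<in> nrm ` {i \<in> WW. sgn i = \<epsilon>}" using s n by blast
qed (auto intro!: nrm_inj nrm_W simp: length_WW)

abbreviation "R \<equiv> klr_pres p \<gamma>"
abbreviation "V \<equiv> vv_pres p (theta \<gamma>)"

lemma size_theta: "size (theta \<gamma>) div 2 = m"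
  by (simp add: theta_def)

lemma fst_V: "fst V = klr_gens m WW \<union> (if 1 \<le> m then {gPi} else {})"
  and snd_V: "snd V = vv_rels p m WW"
  by (simp_all add: vv_pres_def Let_def size_theta)

lemma fst_R: "fst R = klr_gens m W" and snd_R: "snd R = klr_rels p m W"
  by (simp_all add: klr_pres_def)

lemma gens_V: "1 \<le> k \<Longrightarrow> k \<le> m \<Longrightarrow> xg k \<in> FA (fst V)" "1 \<le> k \<Longrightarrow> k < m \<Longrightarrow> sg k \<in> FA (fst V)"
  "i \<in> WW \<Longrightarrow> eg i \<in> FA (fst V)" "1 \<le> m \<Longrightarrow> pig \<in> FA (fst V)"
  by (auto intro!: FA_gen simp: fst_V klr_gens_def)

lemma vv_rels_FA: "vv_rels p m WW \<subseteq> FA (fst V)"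
proof -
  have "klr_rels p m WW \<subseteq> FA (fst V)"
    by (rule klr_rels_FA) (auto simp: fst_V intro: swap_WW)
  then show ?thesis
    unfolding vv_rels_def wflip_def[symmetric]
    by (auto intro!: FA_diff FA_mult FA_add FA_power gens_V wflip_WW)
qed

sublocale R: klr_like R p m W
  by (rule klr_like_klr)

sublocale V: klr_like V p m WW
proof
  show "snd V \<subseteq> FA (fst V)" unfolding snd_V by (rule vv_rels_FA)
  show "klr_rels p m WW \<subseteq> snd V" by (auto simp: snd_V vv_rels_def)
qed (auto simp: fst_V length_WW finite_WW swap_WW)

lemma V_relI: "r \<in> vv_rels p m WW \<Longrightarrow> r \<in> V.J"
  by (rule V.J_rel) (simp add: snd_V)

lemma rel_pe: "1 \<le> m \<Longrightarrow> i \<in> WW \<Longrightarrow> pig * eg i - eg (wflip i) * pig \<in> V.J"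
  by (rule V_relI) (unfold vv_rels_def wflip_def, blast)

lemma rel_pp: "1 \<le> m \<Longrightarrow> pig * pig - 1 \<in> V.J" and rel_px1: "1 \<le> m \<Longrightarrow> pig * xg 1 + xg 1 * pig \<in> V.J"
  by (rule V_relI; simp add: vv_rels_def)+

lemma rel_px: "1 < k \<Longrightarrow> k \<le> m \<Longrightarrow> pig * xg k - xg k * pig \<in> V.J"
  by (rule V_relI) (unfold vv_rels_def, blast)

lemma rel_ps: "1 < k \<Longrightarrow> k < m \<Longrightarrow> pig * sg k - sg k * pig \<in> V.J"
  by (rule V_relI) (unfold vv_rels_def, blast)

lemma rel_sp: "2 \<le> m \<Longrightarrow> (sg 1 * pig)\<^sup>2 - (pig * sg 1)\<^sup>2 \<in> V.J"
  by (rule V_relI) (simp add: vv_rels_def)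

text \<open>
  Left multiplication on the column of the idempotent \<open>e\<close> of the matrix algebra over the KLR
  algebra whose rows are indexed by sign patterns.
\<close>

fun opg :: "'k vvgen \<Rightarrow> (bool list \<Rightarrow> 'k vvfree) \<Rightarrow> bool list \<Rightarrow> 'k vvfree" where
  "opg (gX k) v \<epsilon> = (if letter \<epsilon> k then xg (bpos \<epsilon> k) * v \<epsilon> else - (xg (bpos \<epsilon> k) * v \<epsilon>))"
| "opg (gS k) v \<epsilon> = (if letter \<epsilon> k = letter \<epsilon> (k + 1)
     then sg (min (bpos \<epsilon> k) (bpos \<epsilon> (k + 1))) * v \<epsilon> else v (swap_word k \<epsilon>))"
| "opg (gE i) v \<epsilon> = (if sgn i = \<epsilon> then eg (nrm i) * v \<epsilon> else 0)"
| "opg gPi v \<epsilon> = v (bflip \<epsilon>)"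

sublocale A: falg_op "\<lambda>c v \<epsilon>. sc c * v \<epsilon>" opg
proof
  show "opg g (v + w) = opg g v + opg g w" for g v w
    by (cases g) (auto simp: fun_eq_iff algebra_simps)
  show "opg g (\<lambda>\<epsilon>. sc c * v \<epsilon>) = (\<lambda>\<epsilon>. sc c * opg g v \<epsilon>)" for g c v
    by (cases g) (auto simp: fun_eq_iff sc_left_commute)
qed (auto simp: fun_eq_iff algebra_simps sc_add sc_mult)

abbreviation "act \<equiv> A.act"

lemmas act_simps = A.act_mult A.act_add A.act_diff A.act_uminus

text \<open>Polynomials in the x_k preserve each row of the column and act on it by left
  multiplication. The predicate records the multiplier, so that \<open>Qpoly\<close> and
  \<open>Qquot\<close> are evaluated by structural rules.\<close>

definition diag :: "bool list \<Rightarrow> 'k vvfree \<Rightarrow> 'k vvfree \<Rightarrow> bool" where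
  "diag \<epsilon> f h \<longleftrightarrow> (\<forall>v. act f v \<epsilon> = h * v \<epsilon>)"

lemma diag_intros:
  "diag \<epsilon> 1 1" "diag \<epsilon> 0 0"
  "diag \<epsilon> f h \<Longrightarrow> diag \<epsilon> f' h' \<Longrightarrow> diag \<epsilon> (f + f') (h + h')"
  "diag \<epsilon> f h \<Longrightarrow> diag \<epsilon> f' h' \<Longrightarrow> diag \<epsilon> (f - f') (h - h')"
  "diag \<epsilon> f h \<Longrightarrow> diag \<epsilon> f' h' \<Longrightarrow> diag \<epsilon> (f * f') (h * h')"
  "diag \<epsilon> f h \<Longrightarrow> diag \<epsilon> (- f) (- h)"
  by (auto simp: diag_def act_simps algebra_simps)

lemma diag_power: "diag \<epsilon> f h \<Longrightarrow> diag \<epsilon> (f ^ n) (h ^ n)"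
  by (induction n) (auto intro: diag_intros)

lemma diag_sum: "(\<And>i. i \<in> I \<Longrightarrow> diag \<epsilon> (f i) (h i)) \<Longrightarrow> diag \<epsilon> (sum f I) (sum h I)"
  by (induction I rule: infinite_finite_induct) (auto intro: diag_intros)

lemma diag_xg: "diag \<epsilon> (xg k) (if letter \<epsilon> k then xg (bpos \<epsilon> k) else - xg (bpos \<epsilon> k))"
  by (simp add: diag_def)

lemma diag_Qpoly: "diag \<epsilon> x x' \<Longrightarrow> diag \<epsilon> y y' \<Longrightarrow> diag \<epsilon> (Qpoly p i j x y) (Qpoly p i j x' y')"
  unfolding Qpoly_def by (auto intro!: diag_intros diag_power)

lemma diag_Qquot: "diag \<epsilon> x x' \<Longrightarrow> diag \<epsilon> y y' \<Longrightarrow> diag \<epsilon> z z' \<Longrightarrow>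
    diag \<epsilon> (Qquot p i j x y z) (Qquot p i j x' y' z')"
  unfolding Qquot_def Let_def by (auto intro!: diag_intros diag_power diag_sum)

lemma diagD: "diag \<epsilon> f h \<Longrightarrow> act f v \<epsilon> = h * v \<epsilon>"
  by (simp add: diag_def)

text \<open>Entries have to lie in \<open>R.Fr\<close> because \<open>R.J\<close> absorbs only such
  factors; the rows in question are those indexed by patterns of length m.\<close>

definition good :: "(bool list \<Rightarrow> 'k vvfree) \<Rightarrow> bool" where
  "good v \<longleftrightarrow> (\<forall>\<epsilon>. length \<epsilon> = m \<longrightarrow> v \<epsilon> \<in> R.Fr)"

section \<open>The relations of the VV algebra hold on columns\<close>

context
  fixes v :: "bool list \<Rightarrow> 'k vvfree" and \<epsilon> :: "bool list"
  assumes v: "good v" and \<epsilon>: "length \<epsilon> = m"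
begin

lemma v\<epsilon>: "v \<epsilon> \<in> R.Fr"
  using v \<epsilon> by (simp add: good_def)

lemma Jv: "r \<in> R.J \<Longrightarrow> r * v \<epsilon> \<in> R.J"
  using v\<epsilon> by (rule R.J_rmult[rotated])

lemma bp: "1 \<le> k \<Longrightarrow> k \<le> m \<Longrightarrow> 1 \<le> bpos \<epsilon> k \<and> bpos \<epsilon> k \<le> m"
  using bpos_range[of k \<epsilon>] \<epsilon> by simp

lemma act_ee:
  assumes ij: "i \<in> WW" "j \<in> WW"
  shows "act (eg i * eg j - (if i = j then eg i else 0)) v \<epsilon> \<in> R.J"
proof (cases "sgn i = \<epsilon> \<and> sgn j = \<epsilon>")
  case True
  then have "i = j \<longleftrightarrow> nrm i = nrm j" using nrm_inj[of i j] ij length_WW by auto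
  then have "act (eg i * eg j - (if i = j then eg i else 0)) v \<epsilon> =
      (eg (nrm i) * eg (nrm j) - (if nrm i = nrm j then eg (nrm i) else 0)) * v \<epsilon>"
    using True by (auto simp: act_simps algebra_simps)
  then show ?thesis using ij by (simp only:) (intro Jv R.rel_ee nrm_W)
qed (auto simp: act_simps)

text \<open>On row \<epsilon> only words with this sign pattern survive, and \<open>nrm_bij\<close>
  turns their sum into the sum of all idempotents of R.\<close>

lemma act_sum1: "act ((\<Sum>i\<in>WW. eg i) - 1) v \<epsilon> \<in> R.J"
proof -
  have sum_app: "(sum f A) \<epsilon> = (\<Sum>i\<in>A. f i \<epsilon>)"
    for f :: "'k list \<Rightarrow> bool list \<Rightarrow> 'k vvfree" and A
    by (induction A rule: infinite_finite_induct) auto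
  have "act ((\<Sum>i\<in>WW. eg i) - 1) v \<epsilon> = (\<Sum>i\<in>WW. if sgn i = \<epsilon> then eg (nrm i) * v \<epsilon> else 0) - v \<epsilon>"
    by (simp add: act_simps A.act_sum sum_app)
  also have "(\<Sum>i\<in>WW. if sgn i = \<epsilon> then eg (nrm i) * v \<epsilon> else 0) =
      (\<Sum>i\<in>{i \<in> WW. sgn i = \<epsilon>}. eg (nrm i) * v \<epsilon>)"
    by (intro sum.mono_neutral_cong_right) (auto simp: finite_WW)
  also have "\<dots> = (\<Sum>j\<in>W. eg j * v \<epsilon>)"
    by (rule sum.reindex_bij_betw[OF nrm_bij[OF \<epsilon>]])
  finally have "act ((\<Sum>i\<in>WW. eg i) - 1) v \<epsilon> = ((\<Sum>j\<in>W. eg j) - 1) * v \<epsilon>"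
    by (simp add: left_diff_distrib sum_distrib_right)
  then show ?thesis by (simp only:) (intro Jv R.rel_sum)
qed

text \<open>For equal signs at k and k+1 this is a KLR relation at the index obtained by sorting.
  For a mixed pair \<sigma>_k permutes the rows while the sorted word stays the same, so the two
  terms cancel.\<close>

lemma act_se:
  assumes k: "1 \<le> k" "k < m" and i: "i \<in> WW"
  shows "act (sg k * eg i - eg (swap_word k i) * sg k) v \<epsilon> \<in> R.J"
proof (cases "letter \<epsilon> k = letter \<epsilon> (k + 1)")
  case True
  then have sw: "swap_word k \<epsilon> = \<epsilon>" using k \<epsilon> by (simp add: swap_same)
  have li: "length i = m" using i by (rule length_WW)
  have "sgn (swap_word k i) = \<epsilon> \<longleftrightarrow> sgn i = \<epsilon>"
    using sgn_swap[of k i] k li swap_swap[of k "sgn i"] sw by (metis length_sgn)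
  moreover have "nrm (swap_word k i) = swap_word (min (bpos \<epsilon> k) (bpos \<epsilon> (k + 1))) (nrm i)"
    if "sgn i = \<epsilon>" using nrm_swap_same[of k i] that True k li by simp
  ultimately have eq: "act (sg k * eg i - eg (swap_word k i) * sg k) v \<epsilon> =
      (if sgn i = \<epsilon> then (sg (min (bpos \<epsilon> k) (bpos \<epsilon> (k + 1))) * eg (nrm i) -
        eg (swap_word (min (bpos \<epsilon> k) (bpos \<epsilon> (k + 1))) (nrm i)) *
        sg (min (bpos \<epsilon> k) (bpos \<epsilon> (k + 1)))) * v \<epsilon> else 0)"
    using True by (simp add: act_simps algebra_simps)
  have "1 \<le> min (bpos \<epsilon> k) (bpos \<epsilon> (k + 1))" "min (bpos \<epsilon> k) (bpos \<epsilon> (k + 1)) < m"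
    using min_bpos_range[of k \<epsilon>] k \<epsilon> True by simp_all
  note J = Jv[OF R.rel_se[OF this nrm_W[OF i]]]
  show ?thesis
    by (cases "sgn i = \<epsilon>") (simp_all only: eq J R.J_0 if_True if_False simp_thms)
next
  case False
  have li: "length i = m" using i by (rule length_WW)
  have "sgn (swap_word k i) = \<epsilon> \<longleftrightarrow> sgn i = swap_word k \<epsilon>"
    using sgn_swap[of k i] k li swap_swap[of k "sgn i"] swap_swap[of k \<epsilon>] \<epsilon> by (metis length_sgn)
  moreover have "nrm (swap_word k i) = nrm i" if "sgn i = swap_word k \<epsilon>"
    using nrm_swap_mixed[of k i] that False k li \<epsilon> by (auto simp: letter_swap swap_index_def)
  ultimately show ?thesis using False by (auto simp: act_simps)
qed

lemma act_xe:
  assumes "1 \<le> k" "k \<le> m" "i \<in> WW"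
  shows "act (xg k * eg i - eg i * xg k) v \<epsilon> \<in> R.J"
proof -
  have eq: "act (xg k * eg i - eg i * xg k) v \<epsilon> = (if sgn i = \<epsilon> then
      (if letter \<epsilon> k then (xg (bpos \<epsilon> k) * eg (nrm i) - eg (nrm i) * xg (bpos \<epsilon> k)) * v \<epsilon>
       else - ((xg (bpos \<epsilon> k) * eg (nrm i) - eg (nrm i) * xg (bpos \<epsilon> k)) * v \<epsilon>)) else 0)"
    by (simp add: act_simps algebra_simps)
  have J: "(xg (bpos \<epsilon> k) * eg (nrm i) - eg (nrm i) * xg (bpos \<epsilon> k)) * v \<epsilon> \<in> R.J"
    using bp[of k] assms by (intro Jv R.rel_xe nrm_W) auto
  show ?thesis
    by (cases "sgn i = \<epsilon>"; cases "letter \<epsilon> k")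
      (simp_all only: eq J R.J_uminus R.J_0 if_True if_False simp_thms)
qed

lemma act_xx:
  assumes "1 \<le> r" "r \<le> m" "1 \<le> s" "s \<le> m"
  shows "act (xg r * xg s - xg s * xg r) v \<epsilon> \<in> R.J"
proof -
  let ?r = "(xg (bpos \<epsilon> r) * xg (bpos \<epsilon> s) - xg (bpos \<epsilon> s) * xg (bpos \<epsilon> r)) * v \<epsilon>"
  have "?r \<in> R.J" using bp[of r] bp[of s] assms by (auto intro!: Jv R.rel_xx)
  moreover have "act (xg r * xg s - xg s * xg r) v \<epsilon> = ?r \<or>
      act (xg r * xg s - xg s * xg r) v \<epsilon> = - ?r"
    by (auto simp: act_simps algebra_simps)
  ultimately show ?thesis using R.J_uminus by metis
qed

lemma letters_nz: "i \<in> WW \<Longrightarrow> 1 \<le> k \<Longrightarrow> k \<le> m \<Longrightarrow> letter i k \<noteq> 0"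
  using letter_mem[of k i] WW_I[of i] length_WW[of i] I_set_nz by auto

lemma letter_nrm': "i \<in> WW \<Longrightarrow> sgn i = \<epsilon> \<Longrightarrow> 1 \<le> k \<Longrightarrow> k \<le> m \<Longrightarrow>
    letter i k = (if letter \<epsilon> k then letter (nrm i) (bpos \<epsilon> k) else inverse (letter (nrm i) (bpos \<epsilon> k)))"
  using letter_nrm[of k i] letter_sgn[of k i] length_WW[of i] by (auto simp: pm_def)

text \<open>On a mixed pair \<sigma>_k is a permutation of rows of order two and \<open>Q\<close> is
  1. On a pair of equal signs the polynomial has to turn into the one for the sorted
  letters.\<close>

lemma act_s2:
  assumes k: "1 \<le> k" "k < m" and i: "i \<in> WW"
  shows "act (sg k * sg k * eg i - Qpoly p (letter i k) (letter i (k + 1)) (xg (k + 1)) (xg k) * eg i) v \<epsilon>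
    \<in> R.J"
proof (cases "sgn i = \<epsilon>")
  case True
  have li: "length i = m" using i by (rule length_WW)
  show ?thesis
  proof (cases "letter \<epsilon> k = letter \<epsilon> (k + 1)")
    case False
    then have "Pos (letter i k) \<noteq> Pos (letter i (k + 1))"
      using True k li letter_sgn[of k i] letter_sgn[of "k + 1" i] by auto
    moreover have "letter (swap_word k \<epsilon>) k \<noteq> letter (swap_word k \<epsilon>) (k + 1)"
      using False k \<epsilon> by (simp add: letter_swap swap_index_def)
    ultimately show ?thesis
      using False k \<epsilon> by (auto simp: act_simps Qpoly_mixed swap_swap)
  next
    case same: True
    define c where "c = min (bpos \<epsilon> k) (bpos \<epsilon> (k + 1))"
    let ?j = "nrm i"
    have nz: "letter ?j (bpos \<epsilon> k) \<noteq> 0" "letter ?j (bpos \<epsilon> (k + 1)) \<noteq> 0"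
      using letter_nrm'[OF i True, of k] letter_nrm'[OF i True, of "k + 1"] letters_nz[OF i, of k]
        letters_nz[OF i, of "k + 1"] k by (auto split: if_splits)
    have "diag \<epsilon> (Qpoly p (letter i k) (letter i (k + 1)) (xg (k + 1)) (xg k))
        (Qpoly p (letter ?j c) (letter ?j (c + 1)) (xg (c + 1)) (xg c))"
    proof (cases "letter \<epsilon> k")
      case T: True
      then have "bpos \<epsilon> (k + 1) = c + 1" "bpos \<epsilon> k = c"
        using bpos_pos[of k \<epsilon>] same k \<epsilon> by (auto simp: c_def)
      then show ?thesis
        using diag_Qpoly[OF diag_xg[of \<epsilon> "k + 1"] diag_xg[of \<epsilon> k]] T same
          letter_nrm'[OF i True, of k] letter_nrm'[OF i True, of "k + 1"] k by simp
    next
      case F: False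
      then have b: "bpos \<epsilon> (k + 1) = c" "bpos \<epsilon> k = c + 1"
        using bpos_neg[of k \<epsilon>] same k \<epsilon> by (auto simp: c_def)
      \<comment> \<open>Negative pair: sorting has exchanged the two positions, negated both
        variables and inverted both letters; \<open>Qpoly_inverse\<close> undoes all three.\<close>
      have "Qpoly p (letter i k) (letter i (k + 1)) (- xg c) (- xg (c + 1)) =
          Qpoly p (letter ?j c) (letter ?j (c + 1)) (xg (c + 1)) (xg c :: 'k vvfree)"
        using letter_nrm'[OF i True, of k] letter_nrm'[OF i True, of "k + 1"] k F same b nz
        by (simp add: Qpoly_inverse)
      then show ?thesis
        using diag_Qpoly[OF diag_xg[of \<epsilon> "k + 1"] diag_xg[of \<epsilon> k], of "letter i k" "letter i (k + 1)"]
          F same b by simp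
    qed
    note dQ = diagD[OF this, of "opg (gE i) v"]
    have op: "opg (gS k) u \<epsilon> = sg c * u \<epsilon>" for u
      using same by (simp add: c_def)
    have eq: "act (sg k * sg k * eg i - Qpoly p (letter i k) (letter i (k + 1)) (xg (k + 1)) (xg k) * eg i) v \<epsilon>
        = (sg c * sg c * eg ?j - Qpoly p (letter ?j c) (letter ?j (c + 1)) (xg (c + 1)) (xg c) * eg ?j) * v \<epsilon>"
      using dQ by (simp add: act_simps op True algebra_simps del: opg.simps(2))
    have "1 \<le> c" "c < m"
      using min_bpos_range[of k \<epsilon>] k \<epsilon> same by (simp_all add: c_def)
    from Jv[OF R.rel_s2[OF this nrm_W[OF i]]] show ?thesis by (simp only: eq)
  qed
next
  case False
  have "act (Qpoly p (letter i k) (letter i (k + 1)) (xg (k + 1)) (xg k)) (opg (gE i) v) \<epsilon> = 0"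
    using diagD[OF diag_Qpoly[OF diag_xg diag_xg]] False by simp
  moreover have "swap_word k (swap_word k \<epsilon>) = \<epsilon>" using k \<epsilon> by (simp add: swap_swap)
  moreover have "letter (swap_word k \<epsilon>) k = letter \<epsilon> (k + 1)" "letter (swap_word k \<epsilon>) (k + 1) = letter \<epsilon> k"
    using k \<epsilon> by (simp_all add: letter_swap swap_index_def)
  ultimately show ?thesis using False by (auto simp: act_simps)
qed

text \<open>If both generators stay in the row, they go to generators at disjoint pairs of
  consecutive ranks, which are distant again. Otherwise at least one of them permutes rows and
  leaves the ranks used by the other one unchanged.\<close>

lemma act_ss:
  assumes j: "1 \<le> j" "j < m" and k: "1 \<le> k" "k < m" and jk: "j \<noteq> k + 1" "k \<noteq> j + 1"
  shows "act (sg j * sg k - sg k * sg j) v \<epsilon> \<in> R.J"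
proof (cases "j = k")
  case False
  note far = False jk
  have comm: "swap_word j (swap_word k \<epsilon>) = swap_word k (swap_word j \<epsilon>)"
  proof (rule letter_ext)
    fix i assume i: "1 \<le> i" "i \<le> length (swap_word k (swap_word j \<epsilon>))"
    then have "1 \<le> swap_index h i" "swap_index h i \<le> m" if "1 \<le> h" "h < m" for h
      using swap_index_range[of h m i] that \<epsilon> by auto
    then show "letter (swap_word j (swap_word k \<epsilon>)) i = letter (swap_word k (swap_word j \<epsilon>)) i"
      using i j k \<epsilon> far by (simp add: letter_swap) (auto simp: swap_index_def)
  qed simp
  have lj: "letter (swap_word k \<epsilon>) j = letter \<epsilon> j" "letter (swap_word k \<epsilon>) (j + 1) = letter \<epsilon> (j + 1)"
    and lk: "letter (swap_word j \<epsilon>) k = letter \<epsilon> k" "letter (swap_word j \<epsilon>) (k + 1) = letter \<epsilon> (k + 1)"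
    using j k \<epsilon> far by (simp_all add: letter_swap swap_index_def)
  have bj: "bpos (swap_word k \<epsilon>) j = bpos \<epsilon> j" "bpos (swap_word k \<epsilon>) (j + 1) = bpos \<epsilon> (j + 1)"
    if "letter \<epsilon> k \<noteq> letter \<epsilon> (k + 1)"
    using bpos_mixed[of k \<epsilon> j] bpos_mixed[of k \<epsilon> "j + 1"] that j k \<epsilon> far
    by (simp_all add: swap_index_def)
  have bk: "bpos (swap_word j \<epsilon>) k = bpos \<epsilon> k" "bpos (swap_word j \<epsilon>) (k + 1) = bpos \<epsilon> (k + 1)"
    if "letter \<epsilon> j \<noteq> letter \<epsilon> (j + 1)"
    using bpos_mixed[of j \<epsilon> k] bpos_mixed[of j \<epsilon> "k + 1"] that j k \<epsilon> far
    by (simp_all add: swap_index_def)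
  show ?thesis
  proof (cases "letter \<epsilon> j = letter \<epsilon> (j + 1) \<and> letter \<epsilon> k = letter \<epsilon> (k + 1)")
    case True
    let ?c = "min (bpos \<epsilon> j) (bpos \<epsilon> (j + 1))" and ?d = "min (bpos \<epsilon> k) (bpos \<epsilon> (k + 1))"
    have "bpos \<epsilon> (j + 1) = bpos \<epsilon> j + 1 \<or> bpos \<epsilon> j = bpos \<epsilon> (j + 1) + 1"
      "bpos \<epsilon> (k + 1) = bpos \<epsilon> k + 1 \<or> bpos \<epsilon> k = bpos \<epsilon> (k + 1) + 1"
      using bpos_pos[of j \<epsilon>] bpos_neg[of j \<epsilon>] bpos_pos[of k \<epsilon>] bpos_neg[of k \<epsilon>] True j k \<epsilon> by auto
    moreover have "bpos \<epsilon> j \<noteq> bpos \<epsilon> k" "bpos \<epsilon> (j + 1) \<noteq> bpos \<epsilon> k" "bpos \<epsilon> j \<noteq> bpos \<epsilon> (k + 1)"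
      "bpos \<epsilon> (j + 1) \<noteq> bpos \<epsilon> (k + 1)"
      using bpos_eq_iff[of _ \<epsilon>] j k \<epsilon> far by auto
    ultimately have "?c \<noteq> ?d + 1" "?d \<noteq> ?c + 1" by auto
    then have "(sg ?c * sg ?d - sg ?d * sg ?c) * v \<epsilon> \<in> R.J"
      using min_bpos_range[of k \<epsilon>] min_bpos_range[of j \<epsilon>] j k \<epsilon> True by (intro Jv R.rel_ss) auto
    moreover have "act (sg j * sg k - sg k * sg j) v \<epsilon> = (sg ?c * sg ?d - sg ?d * sg ?c) * v \<epsilon>"
      using True by (simp add: act_simps algebra_simps)
    ultimately show ?thesis by simp
  next
    case False
    then have "act (sg j * sg k - sg k * sg j) v \<epsilon> = 0"
      using lj lk bj bk comm by (auto simp: act_simps)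
    then show ?thesis by simp
  qed
qed simp

text \<open>On either side each pair among the three letters meets exactly once. If the signs are
  not all equal, two of the pairs are mixed and permute rows, and the remaining pair contributes one
  KLR generator, at the same rank on both sides. The sign triples are checked one by one.\<close>

lemma braid_mixed:
  assumes k: "1 \<le> k" "k + 1 < m"
    and mixed: "\<not> (letter \<epsilon> k = letter \<epsilon> (k + 1) \<and> letter \<epsilon> (k + 1) = letter \<epsilon> (k + 2))"
  shows "act (sg (k + 1) * sg k * sg (k + 1)) u \<epsilon> = act (sg k * sg (k + 1) * sg k) u \<epsilon>"
proof -
  define k' where "k' = Suc k"
  define k'' where "k'' = Suc k'"
  note kdefs = k'_def k''_def
  have lt: "letter (swap_word k \<delta>) k = letter \<delta> k'" "letter (swap_word k \<delta>) k' = letter \<delta> k"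
    "letter (swap_word k \<delta>) k'' = letter \<delta> k''" "letter (swap_word k' \<delta>) k = letter \<delta> k"
    "letter (swap_word k' \<delta>) k' = letter \<delta> k''"
    "letter (swap_word k' \<delta>) k'' = letter \<delta> k'" if "length \<delta> = m" for \<delta> :: "bool list"
    using k that by (simp_all add: letter_swap swap_index_def kdefs)
  have b1: "bpos (swap_word k \<delta>) k = bpos \<delta> k'" "bpos (swap_word k \<delta>) k' = bpos \<delta> k"
    "bpos (swap_word k \<delta>) k'' = bpos \<delta> k''"
    if "length \<delta> = m" "letter \<delta> k \<noteq> letter \<delta> k'" for \<delta>
    using bpos_mixed[of k \<delta> k] bpos_mixed[of k \<delta> k'] bpos_mixed[of k \<delta> k''] that k
    by (simp_all add: swap_index_def kdefs)
  have b2: "bpos (swap_word k' \<delta>) k = bpos \<delta> k" "bpos (swap_word k' \<delta>) k' = bpos \<delta> k''"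
    "bpos (swap_word k' \<delta>) k'' = bpos \<delta> k'"
    if "length \<delta> = m" "letter \<delta> k' \<noteq> letter \<delta> k''" for \<delta>
    using bpos_mixed[of k' \<delta> k] bpos_mixed[of k' \<delta> k'] bpos_mixed[of k' \<delta> k''] that k
    by (simp_all add: swap_index_def kdefs)
  have ss: "swap_word k (swap_word k \<epsilon>) = \<epsilon>" "swap_word k' (swap_word k' \<epsilon>) = \<epsilon>"
    using k \<epsilon> by (simp_all add: swap_swap kdefs)
  have kk: "k + 1 = k'" "k' + 1 = k''" "k + 2 = k''" by (simp_all add: kdefs)
  have op: "opg (gS k) v \<delta> = (if letter \<delta> k = letter \<delta> k'
      then sg (min (bpos \<delta> k) (bpos \<delta> k')) * v \<delta> else v (swap_word k \<delta>))"
    "opg (gS k') v \<delta> = (if letter \<delta> k' = letter \<delta> k''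
      then sg (min (bpos \<delta> k') (bpos \<delta> k'')) * v \<delta> else v (swap_word k' \<delta>))" for v \<delta>
    by (simp_all only: opg.simps kk)
  show ?thesis
    using mixed unfolding kk
    by (cases "letter \<epsilon> k"; cases "letter \<epsilon> k'"; cases "letter \<epsilon> k''")
      (simp_all add: act_simps op lt \<epsilon> b1 b2 ss min.commute del: opg.simps(2))
qed

lemma act_braid:
  assumes k: "1 \<le> k" "k + 1 < m" and i: "i \<in> WW"
  shows "act ((sg (k + 1) * sg k * sg (k + 1) - sg k * sg (k + 1) * sg k) * eg i
        - (if letter i k = letter i (k + 2)
           then Qquot p (letter i k) (letter i (k + 1)) (xg k) (xg (k + 1)) (xg (k + 2)) * eg i
           else 0)) v \<epsilon> \<in> R.J"
proof -
  have li: "length i = m" using i by (rule length_WW)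
  have dQ: "diag \<epsilon> (Qquot p (letter i k) (letter i (k + 1)) (xg k) (xg (k + 1)) (xg (k + 2)))
    (Qquot p (letter i k) (letter i (k + 1)) (if letter \<epsilon> k then xg (bpos \<epsilon> k) else - xg (bpos \<epsilon> k))
      (if letter \<epsilon> (k + 1) then xg (bpos \<epsilon> (k + 1)) else - xg (bpos \<epsilon> (k + 1)))
      (if letter \<epsilon> (k + 2) then xg (bpos \<epsilon> (k + 2)) else - xg (bpos \<epsilon> (k + 2))))"
    by (intro diag_Qquot diag_xg)
  have L: "Pos (letter i h) = letter \<epsilon> h" if "sgn i = \<epsilon>" "h \<in> {k, k + 1, k + 2}" for h
    using that letter_sgn[of h i] li k by auto
  show ?thesis
  proof (cases "letter \<epsilon> k = letter \<epsilon> (k + 1) \<and> letter \<epsilon> (k + 1) = letter \<epsilon> (k + 2)")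
    case False
    have "act ((sg (k + 1) * sg k * sg (k + 1) - sg k * sg (k + 1) * sg k) * eg i) v \<epsilon> = 0"
      using braid_mixed[OF k False, of "act (eg i) v"] by (simp add: A.act_diff A.act_mult)
    moreover have "act (Qquot p (letter i k) (letter i (k + 1)) (xg k) (xg (k + 1)) (xg (k + 2)) * eg i) v \<epsilon> = 0"
      if "letter i k = letter i (k + 2)"
    proof (cases "sgn i = \<epsilon>")
      case True
      \<comment> \<open>Equal letters at k and k+2 have equal signs, so in a row whose three signs
        are not all equal the odd one stands at k+1, and \<open>Qquot_mixed\<close> removes the
        correction term.\<close>
      then have "Pos (letter i k) \<noteq> Pos (letter i (k + 1))" using False L that by (metis insertCI)
      then show ?thesis by (simp add: Qquot_mixed)
    next
      case False
      then show ?thesis using diagD[OF dQ, of "opg (gE i) v"] by (simp add: A.act_mult)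
    qed
    ultimately show ?thesis by (simp add: A.act_diff)
  next
    case same: True
    then have e1: "letter \<epsilon> k = letter \<epsilon> (k + 1)" "letter \<epsilon> (k + 1) = letter \<epsilon> (k + 2)" by simp_all
    show ?thesis
    proof (cases "sgn i = \<epsilon>")
      case False
      have m0: "act ((sg (k + 1) * sg k * sg (k + 1) - sg k * sg (k + 1) * sg k) * eg i) v \<epsilon> = 0"
        using e1 False by (simp add: act_simps)
      have q0: "act (Qquot p (letter i k) (letter i (k + 1)) (xg k) (xg (k + 1)) (xg (k + 2)) * eg i) v \<epsilon> = 0"
        using diagD[OF dQ, of "opg (gE i) v"] False by (simp add: A.act_mult)
      show ?thesis
        by (simp only: A.act_diff minus_apply m0 if_distrib[of "\<lambda>f. act f v \<epsilon>"] q0 A.act_0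
            zero_fun_apply if_cancel diff_self R.J_0)
    next
      case True
      let ?j = "nrm i"
      have ij: "letter i h = (if letter \<epsilon> h then letter ?j (bpos \<epsilon> h) else inverse (letter ?j (bpos \<epsilon> h)))"
        if "h \<in> {k, k + 1, k + 2}" for h
        using letter_nrm'[OF i True, of h] k that by auto
      have nz: "letter ?j (bpos \<epsilon> h) \<noteq> 0" if "h \<in> {k, k + 1, k + 2}" for h
        using ij[OF that] letters_nz[OF i, of h] k that by (auto split: if_splits)
      define c where "c = min (bpos \<epsilon> k) (bpos \<epsilon> (k + 2))"
      let ?r = "(sg (c + 1) * sg c * sg (c + 1) - sg c * sg (c + 1) * sg c) * eg ?j
        - (if letter ?j c = letter ?j (c + 2)
           then Qquot p (letter ?j c) (letter ?j (c + 1)) (xg c) (xg (c + 1)) (xg (c + 2)) * eg ?j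
           else 0)"
      show ?thesis
      proof (cases "letter \<epsilon> k")
        case T: True
        then have b: "bpos \<epsilon> k = c" "bpos \<epsilon> (k + 1) = c + 1" "bpos \<epsilon> (k + 2) = c + 2"
          using bpos_pos[of k \<epsilon>] bpos_pos[of "k + 1" \<epsilon>] e1 k \<epsilon> by (auto simp: c_def)
        have "1 \<le> c" "c + 1 < m" using bp[of k] bp[of "k + 2"] k b by auto
        then have "?r * v \<epsilon> \<in> R.J" using i by (intro Jv R.rel_braid nrm_W)
        moreover have "act ((sg (k + 1) * sg k * sg (k + 1) - sg k * sg (k + 1) * sg k) * eg i
          - (if letter i k = letter i (k + 2)
             then Qquot p (letter i k) (letter i (k + 1)) (xg k) (xg (k + 1)) (xg (k + 2)) * eg i
             else 0)) v \<epsilon> = ?r * v \<epsilon>"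
        proof -
          have m1: "act ((sg (k + 1) * sg k * sg (k + 1) - sg k * sg (k + 1) * sg k) * eg i) v \<epsilon> =
              (sg (c + 1) * sg c * sg (c + 1) - sg c * sg (c + 1) * sg c) * eg ?j * v \<epsilon>"
            using T e1 b True by (simp add: act_simps algebra_simps)
          have q: "act (Qquot p (letter i k) (letter i (k + 1)) (xg k) (xg (k + 1)) (xg (k + 2)) * eg i) v \<epsilon> =
              Qquot p (letter ?j c) (letter ?j (c + 1)) (xg c) (xg (c + 1)) (xg (c + 2)) * eg ?j * v \<epsilon>"
            using diagD[OF dQ, of "opg (gE i) v"] T e1 b True ij[of k] ij[of "k + 1"]
            by (simp add: A.act_mult mult.assoc)
          have L: "letter i k = letter i (k + 2) \<longleftrightarrow> letter ?j c = letter ?j (c + 2)"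
            using ij[of k] ij[of "k + 2"] T e1 b by simp
          show ?thesis
            by (simp only: A.act_diff minus_apply m1 if_distrib[of "\<lambda>f. act f v \<epsilon>"] q A.act_0
                zero_fun_apply L)
              (simp only: left_diff_distrib if_distrib[of "\<lambda>f. f * v \<epsilon>"] mult_zero_left)
        qed
        ultimately show ?thesis by simp
      next
        case F: False
        then have b: "bpos \<epsilon> (k + 2) = c" "bpos \<epsilon> (k + 1) = c + 1" "bpos \<epsilon> k = c + 2"
          using bpos_neg[of k \<epsilon>] bpos_neg[of "k + 1" \<epsilon>] e1 k \<epsilon> by (auto simp: c_def)
        have "1 \<le> c" "c + 1 < m" using bp[of k] bp[of "k + 2"] k b by auto
        \<comment> \<open>For three negative letters the generators at k and k+1 exchange roles, so
          the braid difference becomes the negative of the KLR one.\<close>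
        then have r: "- (?r * v \<epsilon>) \<in> R.J" using i by (intro Jv R.rel_braid nrm_W R.J_uminus)
        have m1: "act ((sg (k + 1) * sg k * sg (k + 1) - sg k * sg (k + 1) * sg k) * eg i) v \<epsilon> =
            - ((sg (c + 1) * sg c * sg (c + 1) - sg c * sg (c + 1) * sg c) * eg ?j * v \<epsilon>)"
          using F e1 b True by (simp add: act_simps algebra_simps)
        have q: "act (Qquot p (letter i k) (letter i (k + 1)) (xg k) (xg (k + 1)) (xg (k + 2)) * eg i) v \<epsilon> =
            - (Qquot p (letter ?j c) (letter ?j (c + 1)) (xg c) (xg (c + 1)) (xg (c + 2)) * eg ?j * v \<epsilon>)"
          if "letter i k = letter i (k + 2)"
        proof -
          have *: "letter i k = inverse (letter ?j c)" "letter i (k + 1) = inverse (letter ?j (c + 1))"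
            using that ij[of "k + 1"] ij[of "k + 2"] F e1 b by auto
          have nz': "letter ?j c \<noteq> 0" "letter ?j (c + 1) \<noteq> 0"
            using nz[of "k + 1"] nz[of "k + 2"] b by auto
          \<comment> \<open>\<open>Qquot_inverse\<close> provides the matching minus sign and
            restores the order of the three variables.\<close>
          have "Qquot p (letter i k) (letter i (k + 1)) (- xg (c + 2)) (- xg (c + 1)) (- xg c) =
              - Qquot p (letter ?j c) (letter ?j (c + 1)) (xg c) (xg (c + 1)) (xg (c + 2) :: 'k vvfree)"
            unfolding * using nz' by (rule Qquot_inverse)
          then show ?thesis
            using diagD[OF dQ, of "opg (gE i) v"] F e1 b True by (simp add: A.act_mult mult.assoc)
        qed
        have L: "letter i k = letter i (k + 2) \<longleftrightarrow> letter ?j c = letter ?j (c + 2)"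
          using ij[of k] ij[of "k + 2"] F e1 b by auto
        show ?thesis
        proof (cases "letter ?j c = letter ?j (c + 2)")
          case True
          then have "letter i k = letter i (k + 2)" using L by simp
          show ?thesis
            using r unfolding if_P[OF True] if_P[OF \<open>letter i k = letter i (k + 2)\<close>] A.act_diff minus_apply
              m1 q[OF \<open>letter i k = letter i (k + 2)\<close>] left_diff_distrib[of _ _ "v \<epsilon>"]
            by simp
        next
          case False
          then have "letter i k \<noteq> letter i (k + 2)" using L by simp
          show ?thesis
            using r unfolding if_not_P[OF False] if_not_P[OF \<open>letter i k \<noteq> letter i (k + 2)\<close>]
              A.act_diff minus_apply m1 by simp
        qed
      qed
    qed
  qed
qed

lemma act_sx:
  assumes k: "1 \<le> k" "k < m" and j: "1 \<le> j" "j \<le> m" and i: "i \<in> WW"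
  shows "act ((sg k * xg j - xg (swap_index k j) * sg k) * eg i
        - (if j = k \<and> letter i k = letter i (k + 1) then - eg i
           else if j = k + 1 \<and> letter i k = letter i (k + 1) then eg i
           else 0)) v \<epsilon> \<in> R.J" (is "act ?rel v \<epsilon> \<in> _")
proof -
  have li: "length i = m" using i by (rule length_WW)
  have sj: "1 \<le> swap_index k j" "swap_index k j \<le> m"
    using swap_index_range[of k m j] k j by auto
  show ?thesis
  proof (cases "letter \<epsilon> k = letter \<epsilon> (k + 1)")
    case False
    have "letter (swap_word k \<epsilon>) j = letter \<epsilon> (swap_index k j)"
      using k j \<epsilon> by (simp add: letter_swap)
    moreover have "bpos (swap_word k \<epsilon>) j = bpos \<epsilon> (swap_index k j)"
      using bpos_mixed[of k \<epsilon> "swap_index k j"] k False sj \<epsilon> by simp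
    moreover have "letter i k \<noteq> letter i (k + 1)" if "sgn i = \<epsilon>"
      using that False letter_sgn[of k i] letter_sgn[of "k + 1" i] li k by auto
    ultimately have "act ?rel v \<epsilon> = 0" using False by (auto simp: act_simps)
    then show ?thesis by simp
  next
    case same: True
    show ?thesis
    proof (cases "sgn i = \<epsilon>")
      case False
      then show ?thesis using same by (auto simp: act_simps)
    next
      case True
      define c where "c = min (bpos \<epsilon> k) (bpos \<epsilon> (k + 1))"
      let ?j = "nrm i" and ?b = "bpos \<epsilon> j"
      have bs: "bpos \<epsilon> (swap_index k j) = swap_index c ?b"
        using bpos_same_swap[of k \<epsilon> j] k j \<epsilon> same by (simp add: c_def)
      have eq: "?b = bpos \<epsilon> k \<longleftrightarrow> j = k" "?b = bpos \<epsilon> (k + 1) \<longleftrightarrow> j = k + 1"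
        using bpos_eq_iff[of j \<epsilon> k] bpos_eq_iff[of j \<epsilon> "k + 1"] k j \<epsilon> by auto
      have ls: "letter \<epsilon> (swap_index k j) = letter \<epsilon> j"
        using same by (auto simp: swap_index_def)
      have c: "1 \<le> c" "c < m" using min_bpos_range[of k \<epsilon>] k \<epsilon> same by (auto simp: c_def)
      let ?r = "(sg c * xg ?b - xg (swap_index c ?b) * sg c) * eg ?j
        - (if ?b = c \<and> letter ?j c = letter ?j (c + 1) then - eg ?j
           else if ?b = c + 1 \<and> letter ?j c = letter ?j (c + 1) then eg ?j
           else 0)"
      have op: "opg (gS k) u \<epsilon> = sg c * u \<epsilon>" for u
        using same by (simp add: c_def)
      have r: "?r * v \<epsilon> \<in> R.J" using bp[of j] j c i by (intro Jv R.rel_sx nrm_W) auto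
      have ij: "letter i h = (if letter \<epsilon> h then letter ?j (bpos \<epsilon> h) else inverse (letter ?j (bpos \<epsilon> h)))"
        if "h \<in> {k, k + 1}" for h
        using letter_nrm'[OF i True, of h] k that by auto
      have "act ?rel v \<epsilon> = (if letter \<epsilon> j then ?r * v \<epsilon> else - (?r * v \<epsilon>))"
      proof (cases "letter \<epsilon> k")
        case T: True
        then have b: "bpos \<epsilon> k = c" "bpos \<epsilon> (k + 1) = c + 1"
          using bpos_pos[of k \<epsilon>] same k \<epsilon> by (auto simp: c_def)
        have lij: "letter i k = letter i (k + 1) \<longleftrightarrow> letter ?j c = letter ?j (c + 1)"
          using ij[of k] ij[of "k + 1"] T same b by simp
        have jk: "j = k \<longleftrightarrow> ?b = c" "j = k + 1 \<longleftrightarrow> ?b = c + 1" using eq b by simp_all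
        have "letter \<epsilon> j" if "?b = c \<or> ?b = c + 1" using that jk T same by auto
        then show ?thesis
          unfolding lij jk by (simp add: act_simps op bs ls True algebra_simps del: opg.simps(2))
      next
        case F: False
        then have b: "bpos \<epsilon> (k + 1) = c" "bpos \<epsilon> k = c + 1"
          using bpos_neg[of k \<epsilon>] same k \<epsilon> by (auto simp: c_def)
        have lij: "letter i k = letter i (k + 1) \<longleftrightarrow> letter ?j c = letter ?j (c + 1)"
          using ij[of k] ij[of "k + 1"] F same b by auto
        \<comment> \<open>Negative pair: the correction terms for \<open>j = k\<close> and
          \<open>j = k + 1\<close> trade places and thus signs, and the minus sign with which x acts
          on this row compensates.\<close>
        have jk: "j = k \<longleftrightarrow> ?b = c + 1" "j = k + 1 \<longleftrightarrow> ?b = c" using eq b by simp_all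
        have "\<not> letter \<epsilon> j" if "?b = c \<or> ?b = c + 1" using that jk F same by auto
        then show ?thesis
          unfolding lij jk by (simp add: act_simps op bs ls True algebra_simps del: opg.simps(2))
      qed
      then show ?thesis using r R.J_uminus by simp
    qed
  qed
qed

lemma act_klr_rels: "r \<in> klr_rels p m WW \<Longrightarrow> act r v \<epsilon> \<in> R.J"
  unfolding klr_rels_def
  by (elim UnE CollectE singletonE exE conjE; hypsubst)
    (rule act_ee act_sum1 act_se act_xe act_xx act_s2 act_ss act_braid act_sx; assumption)+

lemma act_vv_rels:
  assumes "r \<in> vv_rels p m WW"
  shows "act r v \<epsilon> \<in> R.J"
proof -
  have l1: "letter (bflip \<epsilon>) j = (if j = 1 then \<not> letter \<epsilon> 1 else letter \<epsilon> j)" if "1 \<le> j" "j \<le> m" for j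
    using that \<epsilon> by (simp add: letter_bflip)
  have b1: "bpos (bflip \<epsilon>) j = bpos \<epsilon> j" if "1 \<le> j" "j \<le> m" for j
    using that \<epsilon> by (simp add: bpos_bflip)
  have sgn_flip: "sgn (wflip i) = \<epsilon> \<longleftrightarrow> sgn i = bflip \<epsilon>" if "i \<in> WW" for i
    using sgn_wflip[OF WW_I[OF that]] bflip_bflip by metis
  from assms consider "r \<in> klr_rels p m WW"
    | i where "1 \<le> m" "i \<in> WW" "r = pig * eg i - eg (wflip i) * pig"
    | "1 \<le> m" "r = pig * xg 1 + xg 1 * pig" | "1 \<le> m" "r = pig * pig - 1"
    | j where "1 < j" "j \<le> m" "r = pig * xg j - xg j * pig"
    | k where "1 < k" "k < m" "r = pig * sg k - sg k * pig"
    | "2 \<le> m" "r = (sg 1 * pig)\<^sup>2 - (pig * sg 1)\<^sup>2"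
    unfolding vv_rels_def wflip_def by (auto split: if_splits)
  then show ?thesis
  proof cases
    case 1
    then show ?thesis by (rule act_klr_rels)
  next
    case 2
    then have "act r v \<epsilon> = 0" by (auto simp: act_simps sgn_flip nrm_wflip WW_I)
    then show ?thesis by simp
  next
    case 3
    then have "act r v \<epsilon> = 0" by (auto simp: act_simps l1 b1 simp del: One_nat_def)
    then show ?thesis by simp
  next
    case 4
    then show ?thesis by (simp add: act_simps)
  next
    case 5
    then have "act r v \<epsilon> = 0" by (auto simp: act_simps l1 b1)
    then show ?thesis by simp
  next
    case 6
    have "bflip (swap_word k \<epsilon>) = swap_word k (bflip \<epsilon>)"
    proof (rule letter_ext)
      fix j assume j: "1 \<le> j" "j \<le> length (swap_word k (bflip \<epsilon>))"
      then have "1 \<le> swap_index k j" "swap_index k j \<le> m"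
        using swap_index_range[of k m j] 6 \<epsilon> by auto
      then show "letter (bflip (swap_word k \<epsilon>)) j = letter (swap_word k (bflip \<epsilon>)) j"
        using j 6 \<epsilon> by (simp add: letter_swap letter_bflip) (auto simp: swap_index_def)
    qed simp
    then have "act r v \<epsilon> = 0" using 6 by (auto simp: act_simps l1 b1)
    then show ?thesis by simp
  next
    case 7
    have lt: "letter (swap_word 1 \<delta>) 1 = letter \<delta> 2" "letter (swap_word 1 \<delta>) 2 = letter \<delta> 1"
      "letter (bflip \<delta>) 1 = (\<not> letter \<delta> 1)" "letter (bflip \<delta>) 2 = letter \<delta> 2"
      "bpos (bflip \<delta>) 1 = bpos \<delta> 1" "bpos (bflip \<delta>) 2 = bpos \<delta> 2" if "length \<delta> = m" for \<delta>
      using 7 that by (simp_all add: letter_swap swap_index_def letter_bflip bpos_bflip numeral_2_eq_2)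
    have b: "bpos (swap_word 1 \<delta>) 1 = bpos \<delta> 2" "bpos (swap_word 1 \<delta>) 2 = bpos \<delta> 1"
      if "length \<delta> = m" "letter \<delta> 1 \<noteq> letter \<delta> 2" for \<delta>
      using bpos_mixed[of 1 \<delta> 1] bpos_mixed[of 1 \<delta> 2] that 7
      by (simp_all add: swap_index_def numeral_2_eq_2)
    have 2: "(1::nat) + 1 = 2" by simp
    have fs: "bflip (swap_word 1 (bflip (swap_word 1 \<delta>))) = swap_word 1 (bflip (swap_word 1 (bflip \<delta>)))"
      if "length \<delta> = m" for \<delta> :: "bool list"
    proof (rule letter_ext)
      fix j assume "1 \<le> j" "j \<le> length (swap_word 1 (bflip (swap_word 1 (bflip \<delta>))))"
      then show "letter (bflip (swap_word 1 (bflip (swap_word 1 \<delta>)))) j =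
          letter (swap_word 1 (bflip (swap_word 1 (bflip \<delta>)))) j"
        using that 7 by (auto simp: letter_swap letter_bflip swap_index_def)
    qed simp
    \<comment> \<open>In each of the four sign patterns either side meets one mixed pair and one
      pair of equal signs, so both sides are one KLR generator at the same rank combined with the
      same permutation of rows.\<close>
    have "act r v \<epsilon> = 0"
      using 7 fs[OF \<epsilon>] fs[of "bflip \<epsilon>"] \<epsilon>
      by (cases "letter \<epsilon> 1"; cases "letter \<epsilon> 2")
        (simp_all add: act_simps power2_eq_square 2 lt b min.commute del: One_nat_def)
    then show ?thesis by simp
  qed
qed

end

end

section \<open>Injectivity of the map from the KLR algebra\<close>

context wt
begin

text \<open>The model uses only permutations of rows and left multiplication by KLR elements, up to
  sign, so any left ideal of entries is preserved. Applied to \<open>R.Fr\<close> this keeps columns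
  \<open>good\<close>; applied to \<open>R.J\<close> it lets VV elements act on columns whose
  entries vanish in R.\<close>

lemma act_closed:
  assumes f: "f \<in> V.Fr"
    and K: "0 \<in> K" "\<And>a b. a \<in> K \<Longrightarrow> b \<in> K \<Longrightarrow> a + b \<in> K" "\<And>a b. a \<in> R.Fr \<Longrightarrow> b \<in> K \<Longrightarrow> a * b \<in> K"
    and u: "\<And>\<epsilon>. length \<epsilon> = m \<Longrightarrow> u \<epsilon> \<in> K" and \<epsilon>: "length \<epsilon> = m"
  shows "act f u \<epsilon> \<in> K"
  using f \<epsilon>
proof (induction f arbitrary: \<epsilon> rule: FA_induct)
  case (gen g f)
  have neg: "- a \<in> K" if "a \<in> K" for a
    using K(3)[of "- 1" a] that by simp
  let ?u = "act f u"
  have "opg g ?u \<epsilon> \<in> K"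
  proof (cases g)
    case (gX k)
    then have "1 \<le> k" "k \<le> m" using gen.hyps by (auto simp: fst_V klr_gens_mem split: if_splits)
    then have "xg (bpos \<epsilon> k) \<in> R.Fr"
      using bpos_range[of k \<epsilon>] gen.prems by (intro R.X_FA) auto
    then show ?thesis using gX gen.IH gen.prems K(3) neg by auto
  next
    case (gS k)
    then have k: "1 \<le> k" "k < m" using gen.hyps by (auto simp: fst_V klr_gens_mem split: if_splits)
    then have "sg (min (bpos \<epsilon> k) (bpos \<epsilon> (k + 1))) \<in> R.Fr" if "letter \<epsilon> k = letter \<epsilon> (k + 1)"
      using min_bpos_range[of k \<epsilon>] that gen.prems by (intro R.S_FA) auto
    then show ?thesis using gS gen.IH gen.prems K(3) by auto
  next
    case (gE i)
    then have "i \<in> WW" using gen.hyps by (auto simp: fst_V klr_gens_mem split: if_splits)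
    then have "eg (nrm i) \<in> R.Fr" by (intro R.E_FA nrm_W)
    then show ?thesis using gE gen.IH gen.prems K by auto
  next
    case gPi
    then show ?thesis using gen.IH gen.prems by simp
  qed
  then show ?case by (simp add: A.act_mult)
qed (auto simp: A.act_add A.act_sc_mult K u)

text \<open>The relations hold on arbitrary good columns, hence also after another element has
  acted; and acting afterwards preserves columns with entries in \<open>R.J\<close>. These are the
  two closure conditions of an ideal.\<close>

lemma act_J: "f \<in> V.J \<Longrightarrow> good v \<Longrightarrow> length \<epsilon> = m \<Longrightarrow> act f v \<epsilon> \<in> R.J"
proof -
  let ?K = "{f \<in> V.Fr. \<forall>v \<epsilon>. good v \<longrightarrow> length \<epsilon> = m \<longrightarrow> act f v \<epsilon> \<in> R.J}"
  have "V.J \<subseteq> ?K"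
  proof (rule V.J_minimal)
    show "snd V \<subseteq> ?K"
      using act_vv_rels vv_rels_FA by (auto simp: snd_V)
    fix f a assume f: "f \<in> ?K" and a: "a \<in> V.Fr"
    show "f * a \<in> ?K"
    proof -
      have "good (act a v)" if "good v" for v
        using that a act_closed[where K = "R.Fr" and f = a and u = v] by (auto simp: good_def)
      then show ?thesis using f a by (auto simp: A.act_mult)
    qed
    have "act a (act f v) \<epsilon> \<in> R.J" if "good v" "length \<epsilon> = m" for v \<epsilon>
      by (rule act_closed[OF a, where K = "R.J"]) (use that f in \<open>auto intro: R.J_add R.J_lmult\<close>)
    then show "a * f \<in> ?K"
      using f a by (auto simp: A.act_mult)
  qed (auto simp: A.act_add intro: R.J_add)
  then show "f \<in> V.J \<Longrightarrow> good v \<Longrightarrow> length \<epsilon> = m \<Longrightarrow> act f v \<epsilon> \<in> R.J" by blast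
qed

abbreviation pls :: "bool list" where "pls \<equiv> replicate m True"

lemma sgn_W: "i \<in> WW \<Longrightarrow> sgn i = pls \<longleftrightarrow> i \<in> W"
  using length_WW[of i] all_set_conv_all_nth[of i Pos] by (auto simp: W_iff sgn_def list_eq_iff_nth_eq)

lemma letter_pls: "1 \<le> k \<Longrightarrow> k \<le> m \<Longrightarrow> letter pls k"
  by (simp add: letter_def)

lemma nrm_id: "i \<in> W \<Longrightarrow> nrm i = i"
proof (rule nrm_eqI[symmetric])
  fix k assume i: "i \<in> W" and k: "k \<in> {1..length i}"
  then have "length i = m" by (simp add: length_words)
  then show "letter i (bpos (sgn i) k) = pm (letter i k)"
    using i k sgn_W[of i] W_iff[of i] letter_mem[of k i] by (auto simp: bpos_True pm_def)
qed simp

text \<open>On the positive row no sign occurs and sorting is the identity, so the generators of R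
  act by themselves.\<close>

lemma act_pls: "f \<in> R.Fr \<Longrightarrow> act f u pls = f * u pls"
proof (induction f rule: FA_induct)
  case (gen g f)
  then show ?case
  proof (cases g)
    case (gX k)
    then show ?thesis using gen letter_pls[of k] by (simp add: A.act_mult fst_R klr_gens_mem bpos_True mult.assoc)
  next
    case (gS k)
    then show ?thesis using gen letter_pls[of k] letter_pls[of "k + 1"]
      by (simp add: A.act_mult fst_R klr_gens_mem bpos_True mult.assoc)
  next
    case (gE i)
    then show ?thesis using gen sgn_W[of i] by (simp add: A.act_mult fst_R klr_gens_mem nrm_id W_WW mult.assoc)
  qed (auto simp: fst_R klr_gens_mem)
qed (auto simp: A.act_add A.act_sc_mult algebra_simps)

definition esum :: "bool list \<Rightarrow> 'k vvfree" where
  "esum \<epsilon> = (\<Sum>i\<in>{i \<in> WW. sgn i = \<epsilon>}. eg i)"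

definition E :: "'k vvfree" where
  "E = (\<Sum>i\<in>W. eg i)"

lemma E_esum: "E = esum pls"
proof -
  have "{i \<in> WW. sgn i = pls} = W" using sgn_W W_WW by blast
  then show ?thesis by (simp add: E_def esum_def)
qed

lemma E_R: "R.eqv E 1"
  unfolding E_def using R.rel_sum by (intro R.eqvI) auto

lemma E_FA_R: "E \<in> R.Fr"
  using E_R by (rule R.eqv_FA)

text \<open>The column with all entries 1 is a test vector: on its positive row f E acts by left
  multiplication, which returns f because \<open>E\<close> is 1 in R.\<close>

lemma incl_inj:
  assumes f: "f \<in> R.Fr" and fE: "f * E \<in> V.J"
  shows "f \<in> R.J"
proof -
  have "good (\<lambda>\<epsilon>. 1)" by (simp add: good_def)
  then have "act (f * E) (\<lambda>\<epsilon>. 1) pls \<in> R.J" using fE by (intro act_J) auto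
  moreover have "f * E \<in> R.Fr" using f E_FA_R by simp
  ultimately have "R.eqv (f * E) 0" by (simp add: act_pls R.eqv_0_iff)
  moreover have "R.eqv (f * E) f" using R.eqv_multl[OF E_R f] by simp
  ultimately have "R.eqv f 0" using R.eqv_sym R.eqv_trans by blast
  then show ?thesis by (simp add: R.eqv_0_iff)
qed

section \<open>The idempotents of sign patterns in the VV algebra\<close>

lemma esum_FA: "esum \<epsilon> \<in> V.Fr"
  by (auto simp: esum_def intro!: FA_sum gens_V)

lemma E_FA: "E \<in> V.Fr"
  by (simp add: E_esum esum_FA)

lemma V_ee: "i \<in> WW \<Longrightarrow> j \<in> WW \<Longrightarrow> V.eqv (eg i * eg j) (if i = j then eg i else 0)"
  by (rule V.eqvI[OF V.rel_ee]) (auto intro: gens_V)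

lemma e_esum: "i \<in> WW \<Longrightarrow> V.eqv (eg i * esum \<epsilon>) (if sgn i = \<epsilon> then eg i else 0)"
proof -
  assume i: "i \<in> WW"
  have "V.eqv (eg i * esum \<epsilon>) (\<Sum>j\<in>{j \<in> WW. sgn j = \<epsilon>}. if i = j then eg i else 0)"
    unfolding esum_def sum_distrib_left using i by (intro V.eqv_sum V_ee) auto
  also have "(\<Sum>j\<in>{j \<in> WW. sgn j = \<epsilon>}. if i = j then eg i else 0) = (if sgn i = \<epsilon> then eg i else 0)"
    using i finite_WW by (simp add: sum.delta)
  finally show ?thesis .
qed

lemma esum_esum: "V.eqv (esum \<delta> * esum \<epsilon>) (if \<delta> = \<epsilon> then esum \<epsilon> else 0)"
proof -
  have "V.eqv (esum \<delta> * esum \<epsilon>) (\<Sum>i\<in>{i \<in> WW. sgn i = \<delta>}. if sgn i = \<epsilon> then eg i else 0)"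
    unfolding esum_def[of \<delta>] sum_distrib_right by (intro V.eqv_sum e_esum) auto
  also have "(\<Sum>i\<in>{i \<in> WW. sgn i = \<delta>}. if sgn i = \<epsilon> then eg i else 0) = (if \<delta> = \<epsilon> then esum \<epsilon> else 0)"
    by (simp add: esum_def)
  finally show ?thesis .
qed

lemma x_esum: "1 \<le> k \<Longrightarrow> k \<le> m \<Longrightarrow> V.eqv (xg k * esum \<epsilon>) (esum \<epsilon> * xg k)"
  unfolding esum_def sum_distrib_left sum_distrib_right
  by (intro V.eqv_sum V.eqvI V.rel_xe) (auto intro!: FA_mult gens_V)

lemma bij_swap:
  assumes k: "1 \<le> k" "k < m" and \<epsilon>: "length \<epsilon> = m"
  shows "bij_betw (swap_word k) {i \<in> WW. sgn i = \<epsilon>} {i \<in> WW. sgn i = swap_word k \<epsilon>}"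
proof (rule bij_betw_byWitness[where f' = "swap_word k"])
  show "swap_word k ` {i \<in> WW. sgn i = \<epsilon>} \<subseteq> {i \<in> WW. sgn i = swap_word k \<epsilon>}"
    using k by (auto simp: sgn_swap length_WW swap_WW)
  show "swap_word k ` {i \<in> WW. sgn i = swap_word k \<epsilon>} \<subseteq> {i \<in> WW. sgn i = \<epsilon>}"
    using k \<epsilon> by (auto simp: sgn_swap length_WW swap_WW swap_swap)
qed (use k in \<open>auto simp: swap_swap length_WW\<close>)

lemma s_esum: "1 \<le> k \<Longrightarrow> k < m \<Longrightarrow> length \<epsilon> = m \<Longrightarrow> V.eqv (sg k * esum \<epsilon>) (esum (swap_word k \<epsilon>) * sg k)"
proof -
  assume k: "1 \<le> k" "k < m" "length \<epsilon> = m"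
  have "esum (swap_word k \<epsilon>) * sg k = (\<Sum>i\<in>{i \<in> WW. sgn i = \<epsilon>}. eg (swap_word k i) * sg k)"
    unfolding esum_def sum_distrib_right
    by (rule sum.reindex_bij_betw[OF bij_swap[OF k], symmetric])
  moreover have "V.eqv (sg k * esum \<epsilon>) (\<Sum>i\<in>{i \<in> WW. sgn i = \<epsilon>}. eg (swap_word k i) * sg k)"
    unfolding esum_def sum_distrib_left using k
    by (intro V.eqv_sum V.eqvI V.rel_se) (auto intro!: FA_mult gens_V swap_WW)
  ultimately show ?thesis by simp
qed

lemma wflip_wflip [simp]: "wflip (wflip w) = w"
  by (cases w) (simp_all add: wflip_def)

lemma p_esum: "1 \<le> m \<Longrightarrow> V.eqv (pig * esum \<epsilon>) (esum (bflip \<epsilon>) * pig)"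
proof -
  assume m: "1 \<le> m"
  have "bij_betw wflip {i \<in> WW. sgn i = \<epsilon>} {i \<in> WW. sgn i = bflip \<epsilon>}"
    by (rule bij_betw_byWitness[where f' = wflip]) (auto simp: wflip_WW sgn_wflip WW_I)
  then have "esum (bflip \<epsilon>) * pig = (\<Sum>i\<in>{i \<in> WW. sgn i = \<epsilon>}. eg (wflip i) * pig)"
    unfolding esum_def sum_distrib_right by (rule sum.reindex_bij_betw[symmetric])
  moreover have "V.eqv (pig * esum \<epsilon>) (\<Sum>i\<in>{i \<in> WW. sgn i = \<epsilon>}. eg (wflip i) * pig)"
    unfolding esum_def sum_distrib_left using m
    by (intro V.eqv_sum V.eqvI rel_pe) (auto intro!: FA_mult gens_V wflip_WW)
  ultimately show ?thesis by simp
qed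

lemma Pos_letter: "i \<in> WW \<Longrightarrow> 1 \<le> k \<Longrightarrow> k \<le> m \<Longrightarrow> Pos (letter i k) = letter (sgn i) k"
  using letter_sgn[of k i] length_WW[of i] by simp

text \<open>\<open>Q\<close> is 1 for letters of different sign, and the sign idempotent selects
  exactly words for which this applies.\<close>

lemma ss_esum:
  assumes k: "1 \<le> k" "k < m" "letter \<epsilon> k \<noteq> letter \<epsilon> (k + 1)"
  shows "V.eqv (sg k * sg k * esum \<epsilon>) (esum \<epsilon>)"
proof -
  have "V.eqv (sg k * sg k * eg i) (eg i)" if "i \<in> WW" "sgn i = \<epsilon>" for i
  proof -
    have "Pos (letter i k) \<noteq> Pos (letter i (k + 1))" using that k by (simp add: Pos_letter)
    then show ?thesis
      using V.rel_s2[of k i] that k by (intro V.eqvI) (auto simp: Qpoly_mixed intro: gens_V)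
  qed
  then show ?thesis unfolding esum_def sum_distrib_left by (intro V.eqv_sum) auto
qed

lemma sx_esum:
  assumes k: "1 \<le> k" "k < m" "letter \<epsilon> k \<noteq> letter \<epsilon> (k + 1)" and j: "1 \<le> j" "j \<le> m"
  shows "V.eqv (sg k * xg j * esum \<epsilon>) (xg (swap_index k j) * sg k * esum \<epsilon>)"
proof -
  have sj: "1 \<le> swap_index k j" "swap_index k j \<le> m"
    using swap_index_range[of k m j] k j by auto
  have "V.eqv (sg k * xg j * eg i) (xg (swap_index k j) * sg k * eg i)" if "i \<in> WW" "sgn i = \<epsilon>" for i
  proof -
    have "Pos (letter i k) \<noteq> Pos (letter i (k + 1))" using that k by (simp add: Pos_letter)
    then have "letter i k \<noteq> letter i (k + 1)" by auto
    then show ?thesis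
      using V.rel_sx[of k j i] that k j sj
      by (intro V.eqvI) (auto simp: left_diff_distrib intro!: FA_mult gens_V)
  qed
  then show ?thesis unfolding esum_def sum_distrib_left by (intro V.eqv_sum) auto
qed

text \<open>The correction term occurs only for equal letters at k and k+2, which different signs
  exclude. On such a row the braid relation is therefore exact, whatever the sign at k+1.\<close>

lemma braid_esum:
  assumes k: "1 \<le> k" "k + 1 < m" "letter \<epsilon> k \<noteq> letter \<epsilon> (k + 2)"
  shows "V.eqv (sg (k + 1) * sg k * sg (k + 1) * esum \<epsilon>) (sg k * sg (k + 1) * sg k * esum \<epsilon>)"
proof -
  have "V.eqv (sg (k + 1) * sg k * sg (k + 1) * eg i) (sg k * sg (k + 1) * sg k * eg i)"
    if "i \<in> WW" "sgn i = \<epsilon>" for i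
  proof -
    have "Pos (letter i k) \<noteq> Pos (letter i (k + 2))" using that k by (simp add: Pos_letter)
    then have "letter i k \<noteq> letter i (k + 2)" by auto
    then show ?thesis
      using V.rel_braid[of k i] that k
      by (intro V.eqvI) (auto simp: left_diff_distrib intro!: FA_mult gens_V)
  qed
  then show ?thesis unfolding esum_def sum_distrib_left by (intro V.eqv_sum) auto
qed

sublocale incl: corner_lift R V gen E
proof
  show "E \<in> V.Fr" by (rule E_FA)
  show idem: "V.eqv (E * E) E" using esum_esum[of pls pls] by (simp add: E_esum)
  show "gen h \<in> V.Fr" if "h \<in> fst R" for h
    using that by (auto simp: fst_R klr_gens_def intro!: gens_V W_WW)
  show "V.eqv (E * gen h) (gen h * E)" if h: "h \<in> fst R" for h
  proof (cases h)
    case (gX k)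
    then show ?thesis using h x_esum[of k pls] V.eqv_sym by (simp add: E_esum fst_R klr_gens_mem)
  next
    case (gS k)
    then have k: "1 \<le> k" "k < m" using h by (simp_all add: fst_R klr_gens_mem)
    have "swap_word k pls = pls"
      using k letter_pls[of k] letter_pls[of "k + 1"] by (intro swap_same) auto
    then show ?thesis using s_esum[of k pls] k gS V.eqv_sym by (simp add: E_esum)
  next
    case (gE i)
    then have i: "i \<in> W" using h by (simp add: fst_R klr_gens_mem)
    have "V.eqv (eg i * E) (eg i)" using e_esum[of i pls] i by (simp add: W_WW sgn_W E_esum)
    moreover have "V.eqv (E * eg i) (eg i)"
    proof -
      have "V.eqv (E * eg i) (\<Sum>j\<in>W. if i = j then eg i else 0)"
        unfolding E_def sum_distrib_right
      proof (rule V.eqv_sum)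
        fix j assume "j \<in> W"
        then show "V.eqv (eg j * eg i) (if i = j then eg i else 0)"
          using V_ee[of j i] i W_WW by (cases "i = j") auto
      qed
      then show ?thesis using i by (simp add: finite_words)
    qed
    ultimately show ?thesis using gE V.eqv_sym V.eqv_trans by blast
  qed (use h in \<open>auto simp: fst_R klr_gens_mem\<close>)
  show "subst gen r * E \<in> V.J" if r: "r \<in> snd R" for r
  proof -
    \<comment> \<open>Words of R are also words of the VV algebra, so all KLR relations hold
      verbatim except the one for the unit: it reads \<open>E\<close> = 1 and holds only after
      multiplication by \<open>E\<close>.\<close>
    have "r = E - 1 \<or> r \<in> V.J"
      using r unfolding snd_R klr_rels_def E_def
      by (elim UnE CollectE singletonE exE conjE; hypsubst)
        ((rule disjI1, rule refl)
          | (rule disjI2, (rule V.rel_ee V.rel_se V.rel_xe V.rel_xx V.rel_s2 V.rel_ss V.rel_braid V.rel_sx;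
              (assumption | (rule W_WW, assumption)))))+
    then show ?thesis
    proof
      assume "r \<in> V.J"
      then show ?thesis using E_FA by (simp add: V.J_rmult)
    next
      assume "r = E - 1"
      then show ?thesis using idem by (simp add: V.eqv_def left_diff_distrib)
    qed
  qed
qed

section \<open>Surjectivity: generating the column by descents\<close>

lemma Fr_R_V: "f \<in> R.Fr \<Longrightarrow> f \<in> V.Fr"
  using incl.subst_closed by simp

lemma E_comm: "f \<in> R.Fr \<Longrightarrow> V.eqv (E * f) (f * E)"
  using incl.subst_comm by simp

lemma E_f_E: "f \<in> R.Fr \<Longrightarrow> V.eqv (E * (f * E)) (f * E)"
proof -
  assume f: "f \<in> R.Fr"
  have "V.eqv (E * f * E) (f * E * E)" using f by (intro V.eqv_multr E_comm E_FA)
  also have "V.eqv (f * E * E) (f * E)"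
    unfolding mult.assoc using f by (intro V.eqv_multl incl.E_idem Fr_R_V)
  finally show ?thesis by (simp add: mult.assoc)
qed

text \<open>
  \<open>dstep g \<epsilon> \<delta>\<close>: the generator \<open>g\<close> moves the sign pattern \<open>\<epsilon>\<close> one step closer to the positive one.
\<close>

inductive dstep :: "'k vvgen \<Rightarrow> bool list \<Rightarrow> bool list \<Rightarrow> bool" where
  pi: "1 \<le> m \<Longrightarrow> length \<epsilon> = m \<Longrightarrow> \<not> letter \<epsilon> 1 \<Longrightarrow> dstep gPi \<epsilon> (bflip \<epsilon>)"
| s: "1 \<le> k \<Longrightarrow> k < m \<Longrightarrow> length \<epsilon> = m \<Longrightarrow> letter \<epsilon> k \<Longrightarrow> \<not> letter \<epsilon> (k + 1) \<Longrightarrow>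
    dstep (gS k) \<epsilon> (swap_word k \<epsilon>)"

text \<open>The component \<open>e\<^sub>\<epsilon> W e\<close> of \<open>W e\<close>, where \<open>W\<close> is the VV algebra.\<close>

inductive T :: "bool list \<Rightarrow> 'k vvfree \<Rightarrow> bool" where
  base: "f \<in> R.Fr \<Longrightarrow> T pls (f * E)"
| step: "dstep g \<epsilon> \<delta> \<Longrightarrow> T \<delta> b \<Longrightarrow> T \<epsilon> (gen g * b)"

lemma dstep_length: "dstep g \<epsilon> \<delta> \<Longrightarrow> length \<epsilon> = m \<and> length \<delta> = m"
  by (auto elim!: dstep.cases)

lemma dstep_fun: "dstep g \<epsilon> \<delta> \<Longrightarrow> dstep g \<epsilon> \<delta>' \<Longrightarrow> \<delta> = \<delta>'"
  by (auto elim!: dstep.cases)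

lemma dstep_gen: "dstep g \<epsilon> \<delta> \<Longrightarrow> gen g \<in> V.Fr"
  by (auto elim!: dstep.cases intro: gens_V)

lemma dstep_pls: "\<not> dstep g pls \<delta>"
  using letter_pls by (auto elim!: dstep.cases)

lemma dstep_esum:
  assumes "dstep g \<epsilon> \<delta>"
  shows "V.eqv (esum \<epsilon> * gen g) (gen g * esum \<delta>)"
  using assms
proof (cases rule: dstep.cases)
  case pi
  then show ?thesis using p_esum[of \<delta>] V.eqv_sym by simp
next
  case (s k)
  then show ?thesis using s_esum[of k \<delta>] V.eqv_sym by (simp add: swap_swap)
qed

lemma swap_letter_mixed:
  "1 \<le> k \<Longrightarrow> k < m \<Longrightarrow> length \<epsilon> = m \<Longrightarrow> letter (swap_word k \<epsilon>) k = letter \<epsilon> (Suc k)"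
  "1 \<le> k \<Longrightarrow> k < m \<Longrightarrow> length \<epsilon> = m \<Longrightarrow> letter (swap_word k \<epsilon>) (Suc k) = letter \<epsilon> k"
  by (simp_all add: letter_swap swap_index_def)

text \<open>By the relation for the square of \<pi>, and by \<open>Q\<close> = 1 on mixed pairs.
  Hence climbing to a row is inverse to descending from it, with the same generator.\<close>

lemma dstep_sq:
  assumes "dstep g \<epsilon> \<delta>"
  shows "V.eqv (gen g * gen g * esum \<delta>) (esum \<delta>)"
  using assms
proof (cases rule: dstep.cases)
  case pi
  have "V.eqv (pig * pig) 1" using pi rel_pp by (intro V.eqvI) auto
  from V.eqv_multr[OF this esum_FA] show ?thesis using pi by simp
next
  case (s k)
  then show ?thesis using ss_esum[of k \<delta>] by (simp add: swap_letter_mixed)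
qed

lemma T_props: "T \<epsilon> a \<Longrightarrow> a \<in> V.Fr \<and> length \<epsilon> = m \<and> V.eqv (esum \<epsilon> * a) a"
proof (induction rule: T.induct)
  case (base f)
  then show ?case using E_f_E[of f] by (simp add: E_FA Fr_R_V flip: E_esum)
next
  case (step g \<epsilon> \<delta> b)
  have "V.eqv (esum \<epsilon> * gen g * b) (gen g * esum \<delta> * b)"
    using step by (intro V.eqv_multr dstep_esum) auto
  also have "V.eqv (gen g * esum \<delta> * b) (gen g * b)"
    unfolding mult.assoc using step by (intro V.eqv_multl) (auto intro: dstep_gen)
  finally show ?case using step dstep_length dstep_gen[of g] by (auto simp: mult.assoc)
qed

text \<open>Elements of row \<epsilon> absorb \<open>esum \<epsilon>\<close> on the left, so a
  relation known only on this row can be applied in front of them.\<close>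

lemma T_esum_mult:
  assumes "T \<epsilon> a" "V.eqv (x * esum \<epsilon>) (y * esum \<epsilon>)" "x \<in> V.Fr" "y \<in> V.Fr"
  shows "V.eqv (x * a) (y * a)"
proof -
  have a: "a \<in> V.Fr" "V.eqv a (esum \<epsilon> * a)" using T_props[OF assms(1)] V.eqv_sym by auto
  have "V.eqv (x * a) (x * esum \<epsilon> * a)" unfolding mult.assoc using assms a by (intro V.eqv_multl)
  also have "V.eqv \<dots> (y * esum \<epsilon> * a)" by (rule V.eqv_multr[OF assms(2) a(1)])
  also have "V.eqv \<dots> (y * a)" unfolding mult.assoc by (rule V.eqv_multl[OF V.eqv_sym[OF a(2)] assms(4)])
  finally show ?thesis .
qed

lemma T_sq: "dstep g \<epsilon> \<delta> \<Longrightarrow> T \<delta> b \<Longrightarrow> V.eqv (gen g * (gen g * b)) b"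
  using T_esum_mult[of \<delta> b "gen g * gen g" 1] dstep_sq[of g \<epsilon> \<delta>] dstep_gen[of g \<epsilon> \<delta>]
  by (simp add: mult.assoc)

lemma T_sc: "T \<epsilon> a \<Longrightarrow> T \<epsilon> (sc c * a)"
proof (induction rule: T.induct)
  case (base f)
  then show ?case using T.base[of "sc c * f"] by (simp add: mult.assoc)
next
  case (step g \<epsilon> \<delta> b)
  then show ?case using T.step[of g \<epsilon> \<delta> "sc c * b"] by (simp add: sc_left_commute)
qed

lemma T_uminus: "T \<epsilon> a \<Longrightarrow> T \<epsilon> (- a)"
  using T_sc[of \<epsilon> a "- 1"] by (simp add: sc_uminus)

lemma swap_far:
  assumes "1 \<le> j" "j < m" "1 \<le> k" "k < m" "j \<noteq> k + 1" "k \<noteq> j + 1" "j \<noteq> k" "length \<epsilon> = m"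
  shows "swap_word j (swap_word k \<epsilon>) = swap_word k (swap_word j \<epsilon>)"
    "letter (swap_word j \<epsilon>) k = letter \<epsilon> k" "letter (swap_word j \<epsilon>) (k + 1) = letter \<epsilon> (k + 1)"
proof -
  show "swap_word j (swap_word k \<epsilon>) = swap_word k (swap_word j \<epsilon>)"
  proof (rule letter_ext)
    fix i assume i: "1 \<le> i" "i \<le> length (swap_word k (swap_word j \<epsilon>))"
    then have "1 \<le> swap_index h i" "swap_index h i \<le> m" if "1 \<le> h" "h < m" for h
      using swap_index_range[of h m i] that assms(8) by auto
    then show "letter (swap_word j (swap_word k \<epsilon>)) i = letter (swap_word k (swap_word j \<epsilon>)) i"
      using i assms by (simp add: letter_swap) (auto simp: swap_index_def)
  qed simp
qed (use assms in \<open>simp_all add: letter_swap swap_index_def\<close>)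

lemma bflip_swap:
  assumes "1 < k" "k < m" "length \<epsilon> = m"
  shows "bflip (swap_word k \<epsilon>) = swap_word k (bflip \<epsilon>)"
proof (rule letter_ext)
  fix j assume j: "1 \<le> j" "j \<le> length (swap_word k (bflip \<epsilon>))"
  then have "1 \<le> swap_index k j" "swap_index k j \<le> m"
    using swap_index_range[of k m j] assms by auto
  then show "letter (bflip (swap_word k \<epsilon>)) j = letter (swap_word k (bflip \<epsilon>)) j"
    using j assms by (simp add: letter_swap letter_bflip) (auto simp: swap_index_def)
qed simp

lemma dstep_comm_pi:
  assumes "dstep gPi \<epsilon> \<delta>" "dstep (gS k) \<epsilon> \<delta>'"
  shows "\<exists>\<eta>. dstep gPi \<delta>' \<eta> \<and> dstep (gS k) \<delta> \<eta> \<and> V.eqv (pig * sg k) (sg k * pig)"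
proof -
  have *: "1 \<le> m" "length \<epsilon> = m" "\<not> letter \<epsilon> 1" "\<delta> = bflip \<epsilon>" "1 \<le> k" "k < m" "letter \<epsilon> k"
    "\<not> letter \<epsilon> (k + 1)" "\<delta>' = swap_word k \<epsilon>"
    using assms by (auto elim!: dstep.cases)
  \<comment> \<open>\<pi> asks for a minus at position 1 and \<sigma>_k for a plus at position
    k.\<close>
  then have k: "1 < k" by (metis le_neq_implies_less)
  have "dstep gPi \<delta>' (bflip \<delta>')" using * k by (intro dstep.pi) (auto simp: letter_swap swap_index_def)
  moreover have "dstep (gS k) \<delta> (swap_word k \<delta>)" using * k by (intro dstep.s) (auto simp: letter_bflip)
  moreover have "bflip \<delta>' = swap_word k \<delta>" using * k by (simp add: bflip_swap)
  moreover have "V.eqv (pig * sg k) (sg k * pig)"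
    using * k rel_ps[of k] by (intro V.eqvI) (auto intro!: FA_mult gens_V)
  ultimately show ?thesis by auto
qed

lemma dstep_comm_s:
  assumes "dstep (gS j) \<epsilon> \<delta>" "dstep (gS k) \<epsilon> \<delta>'" "j \<noteq> k"
  shows "\<exists>\<eta>. dstep (gS j) \<delta>' \<eta> \<and> dstep (gS k) \<delta> \<eta> \<and> V.eqv (sg j * sg k) (sg k * sg j)"
proof -
  have *: "length \<epsilon> = m" "1 \<le> j" "j < m" "letter \<epsilon> j" "\<not> letter \<epsilon> (j + 1)" "\<delta> = swap_word j \<epsilon>"
    "1 \<le> k" "k < m" "letter \<epsilon> k" "\<not> letter \<epsilon> (k + 1)" "\<delta>' = swap_word k \<epsilon>"
    using assms by (auto elim!: dstep.cases)
  \<comment> \<open>\<sigma>_k asks for a plus at k and a minus at k+1, so two adjacent indices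
    would put contradictory conditions on the sign they share.\<close>
  then have jk: "j \<noteq> k + 1" "k \<noteq> j + 1" by auto
  have "dstep (gS j) \<delta>' (swap_word j \<delta>')"
    using * jk assms(3) swap_far[of k j \<epsilon>] by (intro dstep.s) auto
  moreover have "dstep (gS k) \<delta> (swap_word k \<delta>)"
    using * jk assms(3) swap_far[of j k \<epsilon>] by (intro dstep.s) auto
  moreover have "swap_word j \<delta>' = swap_word k \<delta>" using * jk assms(3) swap_far[of j k \<epsilon>] by simp
  moreover have "V.eqv (sg j * sg k) (sg k * sg j)"
    using * jk V.rel_ss[of j k] by (intro V.eqvI) (auto intro!: FA_mult gens_V)
  ultimately show ?thesis by auto
qed

text \<open>Local confluence in its simplest form: two different descents from one pattern never
  interact, so they close up to a commuting square without a braid relation.\<close>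

lemma dstep_comm:
  assumes "dstep g \<epsilon> \<delta>" "dstep h \<epsilon> \<delta>'" "g \<noteq> h"
  shows "\<exists>\<eta>. dstep g \<delta>' \<eta> \<and> dstep h \<delta> \<eta> \<and> V.eqv (gen g * gen h) (gen h * gen g)"
proof -
  have g: "g = gPi \<or> (\<exists>k. g = gS k)" "h = gPi \<or> (\<exists>k. h = gS k)"
    using assms by (auto elim!: dstep.cases)
  then show ?thesis
    using assms dstep_comm_pi[of \<epsilon> \<delta> _ \<delta>'] dstep_comm_pi[of \<epsilon> \<delta>' _ \<delta>] dstep_comm_s[of _ \<epsilon> \<delta> _ \<delta>'] V.eqv_sym
    by (elim disjE exE) (blast+)
qed

text \<open>Independence of the route: by induction along the given route, with a commuting square
  at each step, an element is rewritten so that it begins with the prescribed descent.\<close>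

lemma T_descent: "T \<epsilon> a \<Longrightarrow> dstep g \<epsilon> \<delta> \<Longrightarrow> \<exists>b. T \<delta> b \<and> V.eqv a (gen g * b)"
proof (induction arbitrary: g \<delta> rule: T.induct)
  case (base f)
  then show ?case using dstep_pls by blast
next
  case (step h \<epsilon> \<delta>' b)
  show ?case
  proof (cases "g = h")
    case True
    then have "\<delta> = \<delta>'" using step dstep_fun by blast
    then show ?thesis using True step T_props dstep_gen by auto
  next
    case False
    obtain \<eta> where \<eta>: "dstep g \<delta>' \<eta>" "dstep h \<delta> \<eta>" "V.eqv (gen g * gen h) (gen h * gen g)"
      using dstep_comm[OF step.prems step.hyps(1) False] by blast
    obtain c where c: "T \<eta> c" "V.eqv b (gen g * c)" using step.IH[OF \<eta>(1)] by blast
    have "V.eqv (gen h * b) (gen h * (gen g * c))"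
      using c step by (intro V.eqv_multl) (auto intro: dstep_gen)
    also have "V.eqv (gen h * (gen g * c)) (gen g * (gen h * c))"
      unfolding mult.assoc[symmetric] using \<eta> c T_props V.eqv_sym by (intro V.eqv_multr) auto
    finally show ?thesis using T.step[OF \<eta>(2) c(1)] by blast
  qed
qed

text \<open>\<open>T\<close> speaks of particular representatives; this is its closure under
  equality in the algebra.\<close>

definition TT :: "bool list \<Rightarrow> 'k vvfree \<Rightarrow> bool" where
  "TT \<epsilon> a \<longleftrightarrow> (\<exists>b. T \<epsilon> b \<and> V.eqv a b)"

lemma TT_step: "dstep g \<epsilon> \<delta> \<Longrightarrow> V.eqv a (gen g * b) \<Longrightarrow> TT \<delta> b \<Longrightarrow> TT \<epsilon> a"
  unfolding TT_def using T.step dstep_gen[of g \<epsilon> \<delta>] V.eqv_multl V.eqv_trans by blast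

lemma TT_gen: "dstep g \<epsilon> \<delta> \<Longrightarrow> TT \<delta> b \<Longrightarrow> TT \<epsilon> (gen g * b)"
  using TT_step[of g \<epsilon> \<delta> "gen g * b" b] dstep_gen[of g \<epsilon> \<delta>] unfolding TT_def
  by (auto dest: V.eqv_FA)

lemma TT_T: "T \<epsilon> a \<Longrightarrow> TT \<epsilon> a"
  unfolding TT_def using T_props by force

lemma TT_uminus: "TT \<epsilon> a \<Longrightarrow> TT \<epsilon> (- a)"
  unfolding TT_def using T_uminus V.eqv_uminus by blast

text \<open>The variable is moved through the route one generator at a time: past \<pi>, with a sign
  at index 1, and past \<sigma>_k on a mixed pair, with a change of index but no correction term. At
  the end it is absorbed by R.\<close>

lemma T_x: "T \<epsilon> a \<Longrightarrow> 1 \<le> j \<Longrightarrow> j \<le> m \<Longrightarrow> TT \<epsilon> (xg j * a)"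
proof (induction arbitrary: j rule: T.induct)
  case (base f)
  then show ?case using TT_T[OF T.base[of "xg j * f"]] R.X_FA[of j] by (simp add: mult.assoc)
next
  case (step g \<epsilon> \<delta> b)
  have b: "b \<in> V.Fr" using step T_props by blast
  from step.hyps(1) show ?case
  proof (cases rule: dstep.cases)
    case pi
    show ?thesis
    proof (cases "j = 1")
      case True
      have "V.eqv (pig * xg 1) (- (xg 1 * pig))"
        using pi rel_px1 by (intro V.eqvI) (auto intro!: FA_mult gens_V FA_uminus)
      then have "V.eqv (xg 1 * pig) (pig * (- xg 1))" using V.eqv_uminus V.eqv_sym by fastforce
      from V.eqv_multr[OF this b] have "V.eqv (xg j * (gen g * b)) (gen g * (- (xg j * b)))"
        using True pi by (simp add: mult.assoc)
      then show ?thesis using step TT_step TT_uminus by blast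
    next
      case False
      then have "V.eqv (xg j * pig) (pig * xg j)"
        using pi step.prems rel_px[of j] by (intro V.eqv_sym[OF V.eqvI]) (auto intro!: FA_mult gens_V)
      from V.eqv_multr[OF this b] have "V.eqv (xg j * (gen g * b)) (gen g * (xg j * b))"
        using pi by (simp add: mult.assoc)
      then show ?thesis using step TT_step by blast
    qed
  next
    case (s k)
    have sj: "1 \<le> swap_index k j" "swap_index k j \<le> m"
      using swap_index_range[of k m j] s step.prems by auto
    have "V.eqv (sg k * xg (swap_index k j) * esum \<delta>) (xg j * sg k * esum \<delta>)"
      using sx_esum[of k \<delta> "swap_index k j"] s sj by (simp add: swap_letter_mixed)
    moreover have "sg k * xg (swap_index k j) \<in> V.Fr" "xg j * sg k \<in> V.Fr"
      using s sj step.prems by (auto intro!: FA_mult gens_V)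
    ultimately have "V.eqv (sg k * (xg (swap_index k j) * b)) (xg j * (sg k * b))"
      using T_esum_mult[OF step.hyps(2), of "sg k * xg (swap_index k j)" "xg j * sg k"]
      by (simp add: mult.assoc)
    then have "V.eqv (xg j * (gen g * b)) (gen g * (xg (swap_index k j) * b))"
      using s V.eqv_sym by simp
    then show ?thesis using step sj TT_step by blast
  qed
qed

text \<open>The idempotent passes through the route while its word is flipped or swapped. In the
  positive row it is a KLR idempotent or, for a word with a negative letter, it annihilates
  \<open>E\<close>.\<close>

lemma T_e: "T \<epsilon> a \<Longrightarrow> i \<in> WW \<Longrightarrow> TT \<epsilon> (eg i * a)"
proof -
  assume a: "T \<epsilon> a" and i: "i \<in> WW"
  note T = T_props[OF a]
  have "V.eqv (eg i * a) (eg i * (esum \<epsilon> * a))"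
    using T i V.eqv_sym by (intro V.eqv_multl gens_V) auto
  also have "V.eqv (eg i * (esum \<epsilon> * a)) ((if sgn i = \<epsilon> then eg i else 0) * a)"
    unfolding mult.assoc[symmetric] using T i by (intro V.eqv_multr e_esum) auto
  finally have *: "V.eqv (eg i * a) ((if sgn i = \<epsilon> then eg i else 0) * a)" .
  show ?thesis
    using a i
  proof (induction arbitrary: i rule: T.induct)
    case (base f)
    show ?case
    proof (cases "i \<in> W")
      case True
      then show ?thesis using TT_T[OF T.base[of "eg i * f"]] R.E_FA[of i] base by (simp add: mult.assoc)
    next
      case False
      have "V.eqv (eg i * (f * E)) (eg i * (E * (f * E)))"
        using base by (intro V.eqv_multl gens_V V.eqv_sym[OF E_f_E])
      also have "V.eqv (eg i * (E * (f * E))) (0 * (f * E))"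
        unfolding mult.assoc[symmetric, of "eg i"]
        using e_esum[of i pls] False base by (intro V.eqv_multr FA_mult E_FA Fr_R_V) (auto simp: sgn_W E_esum)
      finally show ?thesis using T.base[of 0] unfolding TT_def by auto
    qed
  next
    case (step g \<epsilon> \<delta> b)
    have b: "b \<in> V.Fr" using step T_props by blast
    from step.hyps(1) show ?case
    proof (cases rule: dstep.cases)
      case pi
      have "V.eqv (eg i * pig) (pig * eg (wflip i))"
        using rel_pe[of "wflip i"] pi step.prems
        by (intro V.eqv_sym[OF V.eqvI]) (auto intro!: FA_mult gens_V wflip_WW)
      from V.eqv_multr[OF this b] have "V.eqv (eg i * (gen g * b)) (gen g * (eg (wflip i) * b))"
        using pi by (simp add: mult.assoc)
      then show ?thesis using step wflip_WW TT_step by blast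
    next
      case (s k)
      have "V.eqv (eg i * sg k) (sg k * eg (swap_word k i))"
        using V.rel_se[of k "swap_word k i"] s step.prems
        by (intro V.eqv_sym[OF V.eqvI]) (auto intro!: FA_mult gens_V simp: swap_swap length_WW swap_WW)
      from V.eqv_multr[OF this b] have "V.eqv (eg i * (gen g * b)) (gen g * (eg (swap_word k i) * b))"
        using s by (simp add: mult.assoc)
      then show ?thesis using step s swap_WW TT_step by blast
    qed
  qed
qed

text \<open>\<pi> removes the summand 1 and \<sigma>_k lowers a summand from k+1 to k, so every
  descent decreases the value by exactly one: it is the length of each route from \<epsilon> to the
  positive pattern.\<close>

definition wgt :: "bool list \<Rightarrow> nat" where
  "wgt \<epsilon> = \<Sum>{i \<in> {1..m}. \<not> letter \<epsilon> i}"

lemma dstep_wgt: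
  assumes "dstep g \<epsilon> \<delta>"
  shows "wgt \<delta> < wgt \<epsilon>"
  using assms
proof (cases rule: dstep.cases)
  case pi
  have "{i \<in> {1..m}. \<not> letter \<epsilon> i} = insert 1 {i \<in> {1..m}. \<not> letter \<delta> i}"
    using pi by (auto simp: letter_bflip split: if_splits)
  moreover have "1 \<notin> {i \<in> {1..m}. \<not> letter \<delta> i}" using pi by (simp add: letter_bflip)
  ultimately show ?thesis unfolding wgt_def by simp
next
  case (s k)
  define N where "N = {i \<in> {1..m}. \<not> letter \<epsilon> i} - {k + 1}"
  have eq: "{i \<in> {1..m}. \<not> letter \<epsilon> i} = insert (k + 1) N"
    "{i \<in> {1..m}. \<not> letter \<delta> i} = insert k N"
    unfolding N_def using s by (auto simp: letter_swap swap_index_def split: if_splits)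
  have "k \<notin> N" "k + 1 \<notin> N" "finite N" unfolding N_def using s by auto
  then show ?thesis unfolding wgt_def eq by simp
qed

text \<open>A generator \<sigma>_k that keeps the row has to be pushed through the whole route until
  it reaches R. If it commutes with the leading descent it passes. Otherwise
  \<open>T_descent\<close> exposes further descents until a braid relation, or the relation of
  length four, carries it across as a generator that again keeps its row. The induction is on the
  length of the route because several descents may be passed at once.\<close>

lemma T_s_same:
  assumes "T \<epsilon> a" "1 \<le> k" "k < m" "letter \<epsilon> k = letter \<epsilon> (k + 1)"
  shows "TT \<epsilon> (sg k * a)"
  using assms
proof (induction "wgt \<epsilon>" arbitrary: \<epsilon> a k rule: less_induct)
  case less
  have kFA: "sg k \<in> V.Fr" using less.prems by (intro gens_V)
  from less.prems(1) show ?case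
  proof (cases rule: T.cases)
    case (base f)
    then show ?thesis
      using TT_T[OF T.base[of "sg k * f"]] R.S_FA[of k] less.prems by (simp add: mult.assoc)
  next
    case (step g \<delta> b)
    have b: "b \<in> V.Fr" "length \<epsilon> = m" using step T_props less.prems(1) by blast+
    have comm: "TT \<epsilon> (sg k * a)" if "V.eqv (sg k * gen g) (gen g * sg k)" "letter \<delta> k = letter \<delta> (k + 1)"
    proof -
      have "TT \<delta> (sg k * b)" using less.hyps[OF dstep_wgt[OF step(2)] step(3)] less.prems that by blast
      moreover have "V.eqv (sg k * a) (gen g * (sg k * b))"
        using V.eqv_multr[OF that(1) b(1)] step by (simp add: mult.assoc)
      ultimately show ?thesis using TT_step step by blast
    qed
    \<comment> \<open>Passes three descents at once; this is the shape of the relation of length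
      four, with the route \<pi>, \<sigma>_1, \<pi>. The braid cases below pass two.\<close>
    have three: "TT \<epsilon> (sg k * a)"
      if d: "dstep h \<delta> \<eta>" "dstep f \<eta> \<zeta>" and j: "1 \<le> j" "j < m" "letter \<zeta> j = letter \<zeta> (j + 1)"
        and br: "V.eqv (sg k * (gen g * gen h * gen f) * esum \<zeta>) (gen g * gen h * gen f * sg j * esum \<zeta>)"
      for h f \<eta> \<zeta> j
    proof -
      obtain c where c: "T \<eta> c" "V.eqv b (gen h * c)" using T_descent[OF step(3) d(1)] by blast
      obtain c' where c': "T \<zeta> c'" "V.eqv c (gen f * c')" using T_descent[OF c(1) d(2)] by blast
      have gFA: "gen g \<in> V.Fr" "gen h \<in> V.Fr" "gen f \<in> V.Fr" "sg j \<in> V.Fr" "c' \<in> V.Fr"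
        using dstep_gen step d j c' T_props by (auto intro: gens_V)
      have "wgt \<zeta> < wgt \<epsilon>" using dstep_wgt[OF d(2)] dstep_wgt[OF d(1)] dstep_wgt[OF step(2)] by simp
      then have TT: "TT \<zeta> (sg j * c')" using less.hyps c' j by blast
      have "V.eqv b (gen h * (gen f * c'))"
        using V.eqv_trans[OF c(2) V.eqv_multl[OF c'(2)]] gFA by simp
      then have "V.eqv (sg k * a) (sg k * (gen g * (gen h * (gen f * c'))))"
        unfolding step(1) using gFA kFA by (intro V.eqv_multl)
      also have "V.eqv \<dots> (gen g * gen h * gen f * sg j * c')"
        using T_esum_mult[OF c'(1) br] gFA kFA by (simp add: mult.assoc)
      finally have "V.eqv (sg k * a) (gen g * (gen h * (gen f * (sg j * c'))))" by (simp add: mult.assoc)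
      moreover have "TT \<epsilon> (gen g * (gen h * (gen f * (sg j * c'))))"
        using TT by (intro TT_gen[OF step(2)] TT_gen[OF d(1)] TT_gen[OF d(2)])
      ultimately show ?thesis unfolding TT_def using V.eqv_trans by blast
    qed
    from step(2) show ?thesis
    proof (cases rule: dstep.cases)
      case pi
      show ?thesis
      proof (cases "k = 1")
        case False
        then have "V.eqv (sg k * pig) (pig * sg k)"
          using rel_ps[of k] less.prems pi by (intro V.eqv_sym[OF V.eqvI]) (auto intro!: FA_mult gens_V)
        moreover have "letter \<delta> k = letter \<delta> (k + 1)"
          using less.prems False pi by (simp add: letter_bflip)
        ultimately show ?thesis using comm pi by simp
      next
        case True
        \<comment> \<open>The pattern begins with - -, and the descents \<pi>, \<sigma>_1, \<pi>
          take it through + - and - + to + +, where \<sigma>_1 again stays in the row.\<close>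
        have e2: "\<not> letter \<epsilon> 2" "2 \<le> m" using less.prems True pi by (auto simp: numeral_2_eq_2)
        let ?\<eta> = "swap_word 1 \<delta>"
        have l: "letter \<delta> 1" "\<not> letter \<delta> 2" using pi e2 by (simp_all add: letter_bflip)
        have l': "\<not> letter ?\<eta> 1" "letter ?\<eta> 2"
          using l pi e2 b by (simp_all add: letter_swap swap_index_def numeral_2_eq_2)
        have 2: "(1::nat) + 1 = 2" by simp
        have d1: "dstep (gS 1) \<delta> ?\<eta>" using l pi e2 unfolding 2[symmetric] by (intro dstep.s) auto
        have d2: "dstep gPi ?\<eta> (bflip ?\<eta>)" using l' pi e2 by (intro dstep.pi) auto
        have l'': "letter (bflip ?\<eta>) 1 = letter (bflip ?\<eta>) (1 + 1)"
          using l' e2 b pi by (simp add: letter_bflip numeral_2_eq_2)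
        have "V.eqv ((sg 1 * pig)\<^sup>2) ((pig * sg 1)\<^sup>2)"
          using rel_sp e2 by (intro V.eqvI) (auto intro!: FA_mult FA_power gens_V)
        from V.eqv_multr[OF this esum_FA]
        have "V.eqv (sg 1 * (pig * sg 1 * pig) * esum (bflip ?\<eta>)) (pig * sg 1 * pig * sg 1 * esum (bflip ?\<eta>))"
          by (simp add: power2_eq_square mult.assoc)
        then show ?thesis using three[OF d1 d2 _ _ l''] True pi e2 by simp
      qed
    next
      case (s j)
      have jk: "j \<noteq> k" using s less.prems by auto
      have le: "length \<epsilon> = m" using s by simp
      consider "j = k + 1" | "k = j + 1" | "j \<noteq> k + 1" "k \<noteq> j + 1" by blast
      then show ?thesis
      proof cases
        case 1
        \<comment> \<open>The signs at k, k+1, k+2 go from + + - through + - + to - + +, and the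
          braid relation carries \<sigma>_k across as the generator at k+1.\<close>
        let ?\<eta> = "swap_word k \<delta>"
        have l: "letter \<epsilon> k" "letter \<epsilon> (k + 1)" "\<not> letter \<epsilon> (k + 2)" "k + 1 < m"
          using s 1 less.prems by (auto simp: add.commute)
        have d: "letter \<delta> k" "\<not> letter \<delta> (k + 1)" "letter \<delta> (k + 2)"
          using s 1 l less.prems by (simp_all add: letter_swap swap_index_def)
        have e: "\<not> letter ?\<eta> k" "letter ?\<eta> (k + 1)" "letter ?\<eta> (k + 2)"
          using d l s less.prems by (simp_all add: letter_swap swap_index_def)
        have d1: "dstep (gS k) \<delta> ?\<eta>" using d l s less.prems by (intro dstep.s) auto
        obtain c where c: "T ?\<eta> c" "V.eqv b (sg k * c)" using T_descent[OF step(3) d1] by blast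
        have cFA: "c \<in> V.Fr" using T_props c by blast
        have kk: "sg (k + 1) \<in> V.Fr" using l by (intro gens_V) auto
        have "wgt ?\<eta> < wgt \<epsilon>" using dstep_wgt[OF d1] dstep_wgt[OF step(2)] by simp
        then have TT: "TT ?\<eta> (sg (k + 1) * c)"
          using less.hyps[of ?\<eta> c "k + 1"] c e l by (simp add: add.assoc)
        have "V.eqv (sg k * a) (sg k * (sg (k + 1) * (sg k * c)))"
          unfolding step(1) s(1) 1 using c kk kFA by (intro V.eqv_multl)
        also have "V.eqv \<dots> (sg (k + 1) * (sg k * (sg (k + 1) * c)))"
          using T_esum_mult[OF c(1) V.eqv_sym[OF braid_esum[of k ?\<eta>]]] e l less.prems kk kFA
          by (simp add: mult.assoc)
        finally have "V.eqv (sg k * a) (gen g * (sg k * (sg (k + 1) * c)))" using s 1 by simp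
        moreover have "TT \<delta> (sg k * (sg (k + 1) * c))"
          by (rule TT_gen[OF d1 TT])
        ultimately show ?thesis using TT_step step by blast
      next
        case 2
        \<comment> \<open>The signs at j, j+1, j+2 go from + - - through - + - to - - +, and the
          generator at k = j+1 comes out as \<sigma>_j.\<close>
        let ?\<eta> = "swap_word k \<delta>"
        have l: "letter \<epsilon> j" "\<not> letter \<epsilon> (j + 1)" "\<not> letter \<epsilon> (j + 2)" "j + 1 < m"
          using s 2 less.prems by (auto simp: add.commute)
        have d: "\<not> letter \<delta> j" "letter \<delta> (j + 1)" "\<not> letter \<delta> (j + 2)"
          using s l by (simp_all add: letter_swap swap_index_def)
        have e: "\<not> letter ?\<eta> j" "\<not> letter ?\<eta> (j + 1)" "letter ?\<eta> (j + 2)"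
          using d l s 2 by (simp_all add: letter_swap swap_index_def)
        have d1: "dstep (gS k) \<delta> ?\<eta>" using d l s 2 by (intro dstep.s) auto
        obtain c where c: "T ?\<eta> c" "V.eqv b (sg k * c)" using T_descent[OF step(3) d1] by blast
        have cFA: "c \<in> V.Fr" using T_props c by blast
        have jj: "sg j \<in> V.Fr" using s by (intro gens_V) auto
        have "wgt ?\<eta> < wgt \<epsilon>" using dstep_wgt[OF d1] dstep_wgt[OF step(2)] by simp
        then have TT: "TT ?\<eta> (sg j * c)"
          using less.hyps[of ?\<eta> c j] c e s by simp
        have "V.eqv (sg k * a) (sg k * (sg j * (sg k * c)))"
          unfolding step(1) s(1) using c jj kFA by (intro V.eqv_multl)
        also have "V.eqv \<dots> (sg j * (sg k * (sg j * c)))"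
          using T_esum_mult[OF c(1) braid_esum[of j ?\<eta>]] e l s jj kFA
          unfolding 2 by (simp add: mult.assoc)
        finally have "V.eqv (sg k * a) (gen g * (sg k * (sg j * c)))" using s by simp
        moreover have "TT \<delta> (sg k * (sg j * c))"
          by (rule TT_gen[OF d1 TT])
        ultimately show ?thesis using TT_step step by blast
      next
        case 3
        then have "V.eqv (sg k * sg j) (sg j * sg k)"
          using V.rel_ss[of k j] less.prems s by (intro V.eqvI) (auto intro!: FA_mult gens_V)
        moreover have "letter \<delta> k = letter \<delta> (k + 1)"
          using swap_far[of j k \<epsilon>] 3 jk s less.prems by simp
        ultimately show ?thesis using comm s by simp
      qed
    qed
  qed
qed

text \<open>A generator keeps the row, descends from it, or climbs to a row from which it descends.
  Climbing prolongs the route; descending cancels the leading generator, which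
  \<open>T_descent\<close> may assume to be the same one, by \<open>T_sq\<close>.\<close>

lemma T_gen:
  assumes T: "T \<epsilon> a" and g: "g \<in> fst V"
  shows "\<exists>\<delta>. TT \<delta> (gen g * a)"
proof -
  note P = T_props[OF T]
  have descent: ?thesis if d: "dstep g \<epsilon> \<delta>" for \<delta>
  proof -
    obtain b where b: "T \<delta> b" "V.eqv a (gen g * b)" using T_descent[OF T d] by blast
    have "V.eqv (gen g * a) (gen g * (gen g * b))" using b dstep_gen[OF d] by (intro V.eqv_multl)
    also have "V.eqv \<dots> b" using T_sq[OF d b(1)] .
    finally show ?thesis unfolding TT_def using b by blast
  qed
  have ascent: ?thesis if d: "dstep g \<delta> \<epsilon>" for \<delta>
    using TT_T[OF T.step[OF d T]] by blast
  show ?thesis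
  proof (cases g)
    case (gX k)
    then show ?thesis using T_x[OF T, of k] g by (auto simp: fst_V klr_gens_mem split: if_splits)
  next
    case (gE i)
    then show ?thesis using T_e[OF T, of i] g by (auto simp: fst_V klr_gens_mem split: if_splits)
  next
    case gPi
    then have m: "1 \<le> m" using g by (auto simp: fst_V klr_gens_mem split: if_splits)
    show ?thesis
    proof (cases "letter \<epsilon> 1")
      case True
      then have "dstep gPi (bflip \<epsilon>) (bflip (bflip \<epsilon>))"
        using m P by (intro dstep.pi) (auto simp: letter_bflip)
      then show ?thesis using ascent gPi by simp
    next
      case False
      then show ?thesis using descent gPi m P dstep.pi by blast
    qed
  next
    case (gS k)
    then have k: "1 \<le> k" "k < m" using g by (auto simp: fst_V klr_gens_mem split: if_splits)
    show ?thesis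
    proof (cases "letter \<epsilon> k = letter \<epsilon> (k + 1)")
      case True
      then show ?thesis using T_s_same[OF T k True] gS by auto
    next
      case mixed: False
      show ?thesis
      proof (cases "letter \<epsilon> k")
        case True
        then show ?thesis using descent gS k P mixed dstep.s by blast
      next
        case False
        then have "dstep (gS k) (swap_word k \<epsilon>) (swap_word k (swap_word k \<epsilon>))"
          using k P mixed by (intro dstep.s) (auto simp: swap_letter_mixed)
        then show ?thesis using ascent gS k P by (simp add: swap_swap)
      qed
    qed
  qed
qed

text \<open>Sums of elements of the various rows; by \<open>Sp_spans\<close> they exhaust W e up to
  equality in the algebra.\<close>

inductive Sp :: "'k vvfree \<Rightarrow> bool" where
  T: "T \<epsilon> a \<Longrightarrow> Sp a"
| add: "Sp a \<Longrightarrow> Sp b \<Longrightarrow> Sp (a + b)"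

lemma Sp_gen: "Sp a \<Longrightarrow> g \<in> fst V \<Longrightarrow> \<exists>b. Sp b \<and> V.eqv (gen g * a) b"
proof (induction rule: Sp.induct)
  case (T \<epsilon> a)
  then show ?case using T_gen[of \<epsilon> a g] Sp.T unfolding TT_def by blast
next
  case (add a b)
  then obtain a' b' where "Sp a'" "V.eqv (gen g * a) a'" "Sp b'" "V.eqv (gen g * b) b'" by blast
  then show ?case using Sp.add[of a' b'] V.eqv_add[of "gen g * a" a' "gen g * b" b']
    by (auto simp: distrib_left)
qed

lemma Sp_sc: "Sp a \<Longrightarrow> Sp (sc c * a)"
  by (induction rule: Sp.induct) (auto simp: distrib_left intro: Sp.intros T_sc)

lemma Sp_spans: "f \<in> V.Fr \<Longrightarrow> \<exists>b. Sp b \<and> V.eqv (f * E) b"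
proof (induction f rule: FA_induct)
  case one
  have "Sp (1 * E)" using Sp.T[OF T.base[of 1]] by simp
  then show ?case using E_FA by fastforce
next
  case (add f g)
  then obtain a b where "Sp a" "V.eqv (f * E) a" "Sp b" "V.eqv (g * E) b" by blast
  then show ?case using Sp.add[of a b] V.eqv_add[of "f * E" a "g * E" b]
    by (auto simp: distrib_right)
next
  case (scale c f)
  then obtain b where "Sp b" "V.eqv (f * E) b" by blast
  then show ?case using Sp_sc[of b c] V.eqv_multl[of "f * E" b "sc c"] by (auto simp: mult.assoc)
next
  case (gen g f)
  then obtain b where b: "Sp b" "V.eqv (f * E) b" by blast
  obtain c where c: "Sp c" "V.eqv (gen g * b) c" using Sp_gen[OF b(1) gen.hyps(1)] by blast
  have "V.eqv (gen g * (f * E)) (gen g * b)" using b gen by (intro V.eqv_multl FA_gen)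
  then show ?case using c V.eqv_trans by (auto simp: mult.assoc)
qed

text \<open>Multiplication by \<open>E\<close> kills every other row, and from the positive pattern
  no descent starts, so there only the base elements f E with f from R occur.\<close>

lemma Sp_E: "Sp a \<Longrightarrow> \<exists>f\<in>R.Fr. V.eqv (E * a) (f * E)"
proof (induction rule: Sp.induct)
  case (T \<epsilon> a)
  show ?case
  proof (cases "\<epsilon> = pls")
    case True
    with T have "\<exists>f\<in>R.Fr. a = f * E" using dstep_pls by (auto elim: T.cases)
    then show ?thesis using E_f_E by blast
  next
    case False
    note P = T_props[OF T]
    have "V.eqv (E * a) (E * (esum \<epsilon> * a))" using P E_FA V.eqv_sym by (intro V.eqv_multl) auto
    also have "V.eqv (E * (esum \<epsilon> * a)) (0 * a)"
      unfolding mult.assoc[symmetric] using P esum_esum[of pls \<epsilon>] False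
      by (intro V.eqv_multr) (auto simp: E_esum)
    finally show ?thesis by (intro bexI[of _ 0]) auto
  qed
next
  case (add a b)
  then obtain f g where "f \<in> R.Fr" "V.eqv (E * a) (f * E)" "g \<in> R.Fr" "V.eqv (E * b) (g * E)" by blast
  then show ?case using V.eqv_add[of "E * a" "f * E" "E * b" "g * E"]
    by (intro bexI[of _ "f + g"]) (auto simp: algebra_simps)
qed

lemma incl_surj:
  assumes "f \<in> V.Fr"
  shows "\<exists>g\<in>R.Fr. V.eqv (E * f * E) (g * E)"
proof -
  obtain b where b: "Sp b" "V.eqv (f * E) b" using Sp_spans[OF assms] by blast
  have "V.eqv (E * (f * E)) (E * b)" using b E_FA by (intro V.eqv_multl)
  then show ?thesis using Sp_E[OF b(1)] V.eqv_trans by (auto simp: mult.assoc)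
qed

lemma e_plus_eq: "e_plus p l (theta \<gamma>) = cls V E"
  by (simp add: e_plus_def plus_part_theta E_def)

lemma incl_cls: "f \<in> R.Fr \<Longrightarrow> incl p l (theta \<gamma>) (cls R f) = cls V (f * E)"
  using incl.alg_lift_cls[of f] by (simp add: incl_def e_plus_eq vv_def)

end

section \<open>Juxtaposition\<close>

text \<open>Both factors of a juxtaposition have the same shape: \<open>Bl i\<close> stands for the
  words whose block after the first \<open>off\<close> letters is i, with the other block arbitrary,
  and e(i) goes to the sum of e(w) over \<open>Bl i\<close>. The instances have offset 0 and offset
  the size of the first weight.\<close>

locale juxt_half = K: klr_like \<Xi> p m W
  for \<Xi> :: "('k::field vvgen, 'k) presentation" and p m W +
  fixes \<nu> :: "'k multiset" and Bl :: "'k list \<Rightarrow> 'k list set" and off :: nat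
    and \<psi> :: "'k vvgen \<Rightarrow> 'k vvfree" and E :: "'k vvfree"
  assumes off: "off + size \<nu> \<le> m"
    and Bl_W: "i \<in> words \<nu> \<Longrightarrow> Bl i \<subseteq> W"
    and Bl_letter: "\<lbrakk>i \<in> words \<nu>; w \<in> Bl i; 1 \<le> k; k \<le> size \<nu>\<rbrakk> \<Longrightarrow> letter w (off + k) = letter i k"
    and Bl_swap: "\<lbrakk>i \<in> words \<nu>; 1 \<le> k; k < size \<nu>\<rbrakk> \<Longrightarrow> Bl (swap_word k i) = swap_word (off + k) ` Bl i"
    and \<psi>X: "\<psi> (gX k) = xg (off + k)" and \<psi>S: "\<psi> (gS k) = sg (off + k)"
    and \<psi>E: "i \<in> words \<nu> \<Longrightarrow> \<psi> (gE i) = (\<Sum>w\<in>Bl i. eg w)"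
    and E_eq: "E = (\<Sum>i\<in>words \<nu>. \<Sum>w\<in>Bl i. eg w)"
begin

definition es :: "'k list set \<Rightarrow> 'k vvfree" where
  "es A = (\<Sum>w\<in>A. eg w)"

lemma es_FA: "A \<subseteq> W \<Longrightarrow> es A \<in> K.Fr"
  by (auto simp: es_def intro!: FA_sum K.E_FA)

lemma K_ee: "i \<in> W \<Longrightarrow> j \<in> W \<Longrightarrow> K.eqv (eg i * eg j) (if i = j then eg i else 0)"
  by (rule K.eqvI[OF K.rel_ee]) (auto intro: K.E_FA)

lemma es_es: "A \<subseteq> W \<Longrightarrow> A' \<subseteq> W \<Longrightarrow> K.eqv (es A * es A') (es (A \<inter> A'))"
proof -
  assume A: "A \<subseteq> W" "A' \<subseteq> W"
  have fin: "finite A" "finite A'" using A K.finW finite_subset by blast+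
  have "K.eqv (es A * es A') (\<Sum>i\<in>A. \<Sum>j\<in>A'. if i = j then eg i else 0)"
    unfolding es_def sum_distrib_left sum_distrib_right
    by (subst sum.swap) (use A in \<open>intro K.eqv_sum K_ee; auto\<close>)
  also have "(\<Sum>i\<in>A. \<Sum>j\<in>A'. if i = j then eg i else 0) = (\<Sum>i\<in>A. if i \<in> A' then eg i else (0 :: 'k vvfree))"
    using fin by (intro sum.cong) auto
  also have "\<dots> = es (A \<inter> A')"
    unfolding es_def using fin by (simp add: sum.inter_restrict)
  finally show ?thesis .
qed

lemma x_es: "A \<subseteq> W \<Longrightarrow> 1 \<le> k \<Longrightarrow> k \<le> m \<Longrightarrow> K.eqv (xg k * es A) (es A * xg k)"
  unfolding es_def sum_distrib_left sum_distrib_right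
  by (intro K.eqv_sum K.eqvI K.rel_xe) (auto intro!: FA_mult K.gen_FA)

lemma s_es: "A \<subseteq> W \<Longrightarrow> 1 \<le> k \<Longrightarrow> k < m \<Longrightarrow> K.eqv (sg k * es A) (es (swap_word k ` A) * sg k)"
proof -
  assume A: "A \<subseteq> W" and k: "1 \<le> k" "k < m"
  have "inj_on (swap_word k) A"
    using A k K.lenW by (intro inj_on_inverseI[where g = "swap_word k"]) (auto simp: swap_swap)
  then have "es (swap_word k ` A) * sg k = (\<Sum>w\<in>A. eg (swap_word k w) * sg k)"
    unfolding es_def sum_distrib_right by (simp add: sum.reindex)
  moreover have "K.eqv (sg k * es A) (\<Sum>w\<in>A. eg (swap_word k w) * sg k)"
    unfolding es_def sum_distrib_left using A k
    by (intro K.eqv_sum K.eqvI K.rel_se) (auto intro!: FA_mult K.gen_FA K.swapW)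
  ultimately show ?thesis by simp
qed

definition U :: "'k list set" where
  "U = (\<Union>i\<in>words \<nu>. Bl i)"

text \<open>A word determines its block letter by letter; this makes the idempotents belonging to
  different \<open>Bl i\<close> orthogonal.\<close>

lemma Bl_disj: "i \<in> words \<nu> \<Longrightarrow> j \<in> words \<nu> \<Longrightarrow> w \<in> Bl i \<Longrightarrow> w \<in> Bl j \<Longrightarrow> i = j"
  by (rule letter_ext) (auto simp: length_words Bl_letter[symmetric])

lemma E_U: "E = es U"
  unfolding E_eq es_def U_def
  by (rule sum.UNION_disjoint[symmetric])
    (auto simp: finite_words intro: finite_subset[OF Bl_W K.finW] dest: Bl_disj)

lemma U_W: "U \<subseteq> W"
  using Bl_W by (auto simp: U_def)

lemma swap_U: "1 \<le> k \<Longrightarrow> k < size \<nu> \<Longrightarrow> swap_word (off + k) ` U = U"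
proof -
  assume k: "1 \<le> k" "k < size \<nu>"
  have "swap_word (off + k) ` U = (\<Union>i\<in>words \<nu>. Bl (swap_word k i))"
    unfolding U_def using k by (auto simp: Bl_swap)
  also have "\<dots> = (\<Union>i\<in>swap_word k ` words \<nu>. Bl i)" by blast
  also have "swap_word k ` words \<nu> = words \<nu>"
  proof (intro equalityI subsetI)
    fix i assume "i \<in> words \<nu>"
    then have "i = swap_word k (swap_word k i)" "swap_word k i \<in> words \<nu>"
      using k by (auto simp: swap_swap length_words swap_words)
    then show "i \<in> swap_word k ` words \<nu>" by blast
  qed (use k in \<open>auto simp: swap_words\<close>)
  finally show ?thesis unfolding U_def .
qed

lemma E_idem': "K.eqv (E * E) E"
  using es_es[of U U] U_W by (simp add: E_U)

lemma E_FA': "E \<in> K.Fr"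
  using es_FA U_W by (simp add: E_U)

lemma J_sumE: "r \<in> K.J \<Longrightarrow> r * E \<in> K.J"
  by (rule K.J_rmult[OF _ E_FA'])

text \<open>A relation involving e(i) is summed over the words of \<open>Bl i\<close>: each summand
  is a relation of \<Xi> at indices shifted by \<open>off\<close>, since the letters that enter it
  are those of i. The unit relation holds because the sum over all blocks is the corner
  idempotent.\<close>

lemma subst_rel:
  assumes "r \<in> klr_rels p (size \<nu>) (words \<nu>)"
  shows "subst \<psi> r * E \<in> K.J"
proof -
  note sub = \<psi>X \<psi>S \<psi>E subst_Qpoly subst_Qquot
  have W: "w \<in> W" if "i \<in> words \<nu>" "w \<in> Bl i" for i w using that Bl_W by blast
  from assms show ?thesis
    unfolding klr_rels_def
  proof (elim UnE CollectE singletonE exE conjE; hypsubst)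
    fix i j assume ij: "i \<in> words \<nu>" "j \<in> words \<nu>"
    have "Bl i \<inter> Bl j = (if i = j then Bl i else {})" using Bl_disj ij by auto
    then have "K.eqv (es (Bl i) * es (Bl j)) (if i = j then es (Bl i) else 0)"
      using es_es[of "Bl i" "Bl j"] Bl_W ij by (auto simp: es_def)
    then have "subst \<psi> (eg i * eg j - (if i = j then eg i else 0)) \<in> K.J"
      using ij by (cases "i = j") (auto simp: sub es_def K.eqv_def)
    then show "subst \<psi> (eg i * eg j - (if i = j then eg i else 0)) * E \<in> K.J" by (rule J_sumE)
  next
    have "subst \<psi> ((\<Sum>i\<in>words \<nu>. eg i) - 1) = E - 1" by (simp add: sub E_eq)
    then show "subst \<psi> ((\<Sum>i\<in>words \<nu>. eg i) - 1) * E \<in> K.J"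
      using E_idem' by (simp add: K.eqv_def left_diff_distrib)
  next
    fix k i assume a: "1 \<le> k" "k < size \<nu>" "i \<in> words \<nu>"
    have "K.eqv (sg (off + k) * es (Bl i)) (es (Bl (swap_word k i)) * sg (off + k))"
      using s_es[of "Bl i" "off + k"] a off Bl_W by (simp add: Bl_swap)
    then have "subst \<psi> (sg k * eg i - eg (swap_word k i) * sg k) \<in> K.J"
      using a by (simp add: sub swap_words es_def K.eqv_def)
    then show "subst \<psi> (sg k * eg i - eg (swap_word k i) * sg k) * E \<in> K.J" by (rule J_sumE)
  next
    fix l i assume a: "1 \<le> l" "l \<le> size \<nu>" "i \<in> words \<nu>"
    have "K.eqv (xg (off + l) * es (Bl i)) (es (Bl i) * xg (off + l))"
      using x_es[of "Bl i" "off + l"] a off Bl_W by simp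
    then have "subst \<psi> (xg l * eg i - eg i * xg l) \<in> K.J"
      using a by (simp add: sub es_def K.eqv_def)
    then show "subst \<psi> (xg l * eg i - eg i * xg l) * E \<in> K.J" by (rule J_sumE)
  next
    fix r s assume a: "1 \<le> r" "r \<le> size \<nu>" "1 \<le> s" "s \<le> size \<nu>"
    then have "subst \<psi> (xg r * xg s - xg s * xg r) \<in> K.J"
      using K.rel_xx[of "off + r" "off + s"] off by (simp add: sub)
    then show "subst \<psi> (xg r * xg s - xg s * xg r) * E \<in> K.J" by (rule J_sumE)
  next
    fix k i assume a: "1 \<le> k" "k < size \<nu>" "i \<in> words \<nu>"
    have "sg (off + k) * sg (off + k) * eg w -
        Qpoly p (letter i k) (letter i (k + 1)) (xg (off + k + 1)) (xg (off + k)) * eg w \<in> K.J"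
      if "w \<in> Bl i" for w
      using K.rel_s2[of "off + k" w] a off that W[of i w] Bl_letter[of i w k] Bl_letter[of i w "k + 1"] by simp
    then have "(\<Sum>w\<in>Bl i. sg (off + k) * sg (off + k) * eg w -
        Qpoly p (letter i k) (letter i (k + 1)) (xg (off + k + 1)) (xg (off + k)) * eg w) \<in> K.J"
      by (rule K.J_sum)
    then have "subst \<psi> (sg k * sg k * eg i - Qpoly p (letter i k) (letter i (k + 1)) (xg (k + 1)) (xg k) * eg i) \<in> K.J"
      using a by (simp add: sub sum_distrib_left sum_subtractf)
    then show "subst \<psi> (sg k * sg k * eg i - Qpoly p (letter i k) (letter i (k + 1)) (xg (k + 1)) (xg k) * eg i) * E
      \<in> K.J" by (rule J_sumE)
  next
    fix j k assume a: "1 \<le> j" "j < size \<nu>" "1 \<le> k" "k < size \<nu>" "j \<noteq> k + 1" "k \<noteq> j + 1"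
    then have "subst \<psi> (sg j * sg k - sg k * sg j) \<in> K.J"
      using K.rel_ss[of "off + j" "off + k"] off by (simp add: sub)
    then show "subst \<psi> (sg j * sg k - sg k * sg j) * E \<in> K.J" by (rule J_sumE)
  next
    fix k i assume a: "1 \<le> k" "k + 1 < size \<nu>" "i \<in> words \<nu>"
    let ?L = "letter i k = letter i (k + 2)"
    let ?Q = "Qquot p (letter i k) (letter i (k + 1)) (xg (off + k)) (xg (off + k + 1)) (xg (off + k + 2))"
    have "(sg (off + k + 1) * sg (off + k) * sg (off + k + 1) - sg (off + k) * sg (off + k + 1) * sg (off + k)) * eg w
        - (if ?L then ?Q * eg w else 0) \<in> K.J" if w: "w \<in> Bl i" for w
    proof -
      have "letter w (off + k) = letter i k" "letter w (off + k + 1) = letter i (k + 1)"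
        "letter w (off + k + 2) = letter i (k + 2)"
        using a w Bl_letter[of i w k] Bl_letter[of i w "k + 1"] Bl_letter[of i w "k + 2"] by simp_all
      note l = this
      have "1 \<le> off + k" "off + k + 1 < m" "w \<in> W" using a off w W by auto
      from K.rel_braid[OF this] show ?thesis unfolding l .
    qed
    then have "(\<Sum>w\<in>Bl i. (sg (off + k + 1) * sg (off + k) * sg (off + k + 1) -
        sg (off + k) * sg (off + k + 1) * sg (off + k)) * eg w - (if ?L then ?Q * eg w else 0)) \<in> K.J"
      by (rule K.J_sum)
    then have "subst \<psi> ((sg (k + 1) * sg k * sg (k + 1) - sg k * sg (k + 1) * sg k) * eg i
        - (if ?L then Qquot p (letter i k) (letter i (k + 1)) (xg k) (xg (k + 1)) (xg (k + 2)) * eg i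
           else 0)) \<in> K.J"
      using a by (cases ?L) (simp_all add: sub sum_distrib_left sum_subtractf del: subst_simps(3) add: subst_simps(3))
    then show "subst \<psi> ((sg (k + 1) * sg k * sg (k + 1) - sg k * sg (k + 1) * sg k) * eg i
        - (if ?L then Qquot p (letter i k) (letter i (k + 1)) (xg k) (xg (k + 1)) (xg (k + 2)) * eg i
           else 0)) * E \<in> K.J" by (rule J_sumE)
  next
    fix k l i assume a: "1 \<le> k" "k < size \<nu>" "1 \<le> l" "l \<le> size \<nu>" "i \<in> words \<nu>"
    let ?L1 = "l = k \<and> letter i k = letter i (k + 1)" and ?L2 = "l = k + 1 \<and> letter i k = letter i (k + 1)"
    have sw: "swap_index (off + k) (off + l) = off + swap_index k l"
      by (simp add: swap_index_def)
    have "(sg (off + k) * xg (off + l) - xg (off + swap_index k l) * sg (off + k)) * eg w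
        - (if ?L1 then - eg w else if ?L2 then eg w else 0) \<in> K.J" if w: "w \<in> Bl i" for w
    proof -
      have "letter w (off + k) = letter i k" "letter w (off + k + 1) = letter i (k + 1)"
        using a w Bl_letter[of i w k] Bl_letter[of i w "k + 1"] by simp_all
      moreover have "off + l = off + k \<longleftrightarrow> l = k" "off + l = off + k + 1 \<longleftrightarrow> l = k + 1" by auto
      moreover have "1 \<le> off + k" "off + k < m" "1 \<le> off + l" "off + l \<le> m" "w \<in> W" using a off w W by auto
      ultimately show ?thesis using K.rel_sx[of "off + k" "off + l" w] by (simp only: sw)
    qed
    then have "(\<Sum>w\<in>Bl i. (sg (off + k) * xg (off + l) - xg (off + swap_index k l) * sg (off + k)) * eg w
        - (if ?L1 then - eg w else if ?L2 then eg w else 0)) \<in> K.J"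
      by (rule K.J_sum)
    then have "subst \<psi> ((sg k * xg l - xg (swap_index k l) * sg k) * eg i
        - (if ?L1 then - eg i else if ?L2 then eg i else 0)) \<in> K.J"
    proof -
      have "subst \<psi> (X * eg i - (if b then - eg i else if b' then eg i else 0)) =
          (\<Sum>w\<in>Bl i. subst \<psi> X * eg w - (if b then - eg w else if b' then eg w else 0))" for X b b'
        using a by (cases b; cases b') (simp_all add: sub sum_distrib_left sum_subtractf sum_negf sum.distrib)
      moreover have "subst \<psi> (sg k * xg l - xg (swap_index k l) * sg k) =
          sg (off + k) * xg (off + l) - xg (off + swap_index k l) * sg (off + k)"
        by (simp add: sub)
      moreover assume "(\<Sum>w\<in>Bl i. (sg (off + k) * xg (off + l) - xg (off + swap_index k l) * sg (off + k)) * eg w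
        - (if ?L1 then - eg w else if ?L2 then eg w else 0)) \<in> K.J"
      ultimately show ?thesis by (simp only:)
    qed
    then show "subst \<psi> ((sg k * xg l - xg (swap_index k l) * sg k) * eg i
        - (if ?L1 then - eg i else if ?L2 then eg i else 0)) * E \<in> K.J" by (rule J_sumE)
  qed
qed

lemma corner_lift: "corner_lift (klr_pres p \<nu>) \<Xi> \<psi> E"
proof -
  interpret src: klr_like "klr_pres p \<nu>" p "size \<nu>" "words \<nu>" by (rule klr_like_klr)
  show ?thesis
  proof
    show "E \<in> K.Fr" "K.eqv (E * E) E" by (rule E_FA', rule E_idem')
    show "subst \<psi> r * E \<in> K.J" if "r \<in> snd (klr_pres p \<nu>)" for r
      using that by (intro subst_rel) (simp add: klr_pres_def)
    fix h assume "h \<in> fst (klr_pres p \<nu>)"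
    then have h: "h \<in> klr_gens (size \<nu>) (words \<nu>)" by (simp add: klr_pres_def)
    show "\<psi> h \<in> K.Fr"
      using h off by (cases h) (auto simp: klr_gens_mem \<psi>X \<psi>S \<psi>E intro!: K.gen_FA es_FA[unfolded es_def] Bl_W)
    show "K.eqv (E * \<psi> h) (\<psi> h * E)"
    proof (cases h)
      case (gX k)
      then show ?thesis using h off x_es[OF U_W, of "off + k"] K.eqv_sym
        by (simp add: klr_gens_mem \<psi>X E_U)
    next
      case (gS k)
      then show ?thesis using h off s_es[OF U_W, of "off + k"] swap_U[of k] K.eqv_sym
        by (simp add: klr_gens_mem \<psi>S E_U)
    next
      case (gE i)
      then have i: "i \<in> words \<nu>" using h by (simp add: klr_gens_mem)
      then have "U \<inter> Bl i = Bl i" "Bl i \<inter> U = Bl i" by (auto simp: U_def)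
      then have "K.eqv (es U * es (Bl i)) (es (Bl i))" "K.eqv (es (Bl i) * es U) (es (Bl i))"
        using es_es[OF U_W Bl_W[OF i]] es_es[OF Bl_W[OF i] U_W] by simp_all
      then have "K.eqv (es U * es (Bl i)) (es (Bl i) * es U)" using K.eqv_trans K.eqv_sym by blast
      then show ?thesis using gE i by (simp only: \<psi>E E_U) (simp only: es_def)
    qed (use h in \<open>simp add: klr_gens_mem\<close>)
  qed
qed

end

lemma (in klr_like) juxt_halves:
  fixes \<gamma> \<delta> :: "'k multiset"
  assumes m: "m = size \<gamma> + size \<delta>"
    and W: "\<And>i j. i \<in> words \<gamma> \<Longrightarrow> j \<in> words \<delta> \<Longrightarrow> i @ j \<in> W"
  defines "Ep \<equiv> \<Sum>i\<in>words \<gamma>. \<Sum>j\<in>words \<delta>. eg (i @ j)"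
  shows "corner_lift (klr_pres p \<gamma>) \<Xi> (juxt_gen1 \<delta>) Ep"
    and "corner_lift (klr_pres p \<delta>) \<Xi> (juxt_gen2 \<gamma>) Ep"
proof -
  have s1: "(\<Sum>w\<in>(@) i ` words \<delta>. eg w) = (\<Sum>j\<in>words \<delta>. eg (i @ j) :: 'k vvfree)" for i
    by (simp add: sum.reindex inj_on_def)
  have s2: "(\<Sum>w\<in>(\<lambda>i. i @ j) ` words \<gamma>. eg w) = (\<Sum>i\<in>words \<gamma>. eg (i @ j) :: 'k vvfree)" for j
    by (simp add: sum.reindex inj_on_def)
  interpret h1: juxt_half \<Xi> p m W \<gamma> "\<lambda>i. (@) i ` words \<delta>" 0 "juxt_gen1 \<delta>" Ep
  proof
    fix i k assume "i \<in> words \<gamma>" "1 \<le> k" "k < size \<gamma>"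
    then show "(@) (swap_word k i) ` words \<delta> = swap_word (0 + k) ` (@) i ` words \<delta>"
      by (auto simp: image_image swap_word_append1 length_words)
  qed (auto simp: m W Ep_def s1 letter_append1 length_words)
  show "corner_lift (klr_pres p \<gamma>) \<Xi> (juxt_gen1 \<delta>) Ep" by (rule h1.corner_lift)
  interpret h2: juxt_half \<Xi> p m W \<delta> "\<lambda>j. (\<lambda>i. i @ j) ` words \<gamma>" "size \<gamma>" "juxt_gen2 \<gamma>" Ep
  proof
    fix i k assume "i \<in> words \<delta>" "1 \<le> k" "k < size \<delta>"
    then show "(\<lambda>w. w @ swap_word k i) ` words \<gamma> = swap_word (size \<gamma> + k) ` (\<lambda>w. w @ i) ` words \<gamma>"
    proof -
      have "swap_word (size \<gamma> + k) (w @ i) = w @ swap_word k i" if "w \<in> words \<gamma>" for w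
        using swap_word_append2[of k w i] length_words[OF that] \<open>1 \<le> k\<close> by simp
      then show ?thesis unfolding image_image by (intro image_cong) auto
    qed
  next
    fix j w k assume "j \<in> words \<delta>" "w \<in> (\<lambda>i. i @ j) ` words \<gamma>" "1 \<le> k" "k \<le> size \<delta>"
    then show "letter w (size \<gamma> + k) = letter j k"
      using letter_append2[of k _ j] by (auto simp flip: length_words)
  next
    show "Ep = (\<Sum>j\<in>words \<delta>. \<Sum>w\<in>(\<lambda>i. i @ j) ` words \<gamma>. eg w)"
      unfolding s2 Ep_def by (rule sum.swap)
  qed (auto simp: m W s2)
  show "corner_lift (klr_pres p \<delta>) \<Xi> (juxt_gen2 \<gamma>) Ep" by (rule h2.corner_lift)
qed

text \<open>The ambient algebra is left open: with the KLR or the VV algebra of the total weight,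
  both convolutions become instances.\<close>

locale conv_setup = K: klr_like \<Xi> p m W
  for \<Xi> :: "('k::field vvgen, 'k) presentation" and p m W +
  fixes \<gamma> \<delta> :: "'k multiset"
  assumes m_eq: "m = size \<gamma> + size \<delta>"
    and app_W: "i \<in> words \<gamma> \<Longrightarrow> j \<in> words \<delta> \<Longrightarrow> i @ j \<in> W"
begin

definition Ep :: "'k vvfree" where
  "Ep = (\<Sum>i\<in>words \<gamma>. \<Sum>j\<in>words \<delta>. eg (i @ j))"

sublocale h1: corner_lift "klr_pres p \<gamma>" \<Xi> "juxt_gen1 \<delta>" Ep
  unfolding Ep_def using m_eq app_W by (rule K.juxt_halves)

sublocale h2: corner_lift "klr_pres p \<delta>" \<Xi> "juxt_gen2 \<gamma>" Ep
  unfolding Ep_def using m_eq app_W by (rule K.juxt_halves)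

lemma e_pair_eq: "e_pair \<Xi> \<gamma> \<delta> = cls \<Xi> Ep"
  by (simp add: e_pair_def Ep_def)

abbreviation "A \<equiv> alg \<Xi>"
abbreviation "e \<equiv> e_pair \<Xi> \<gamma> \<delta>"

sublocale A: ring A by (rule K.ring_alg)
sublocale B: ring "corner A e" using h1.ring_B by (simp add: e_pair_eq)

lemma e_closed: "e \<in> carrier A" and e_idem: "e \<otimes>\<^bsub>A\<^esub> e = e"
  using h1.E_FA h1.E_idem by (simp_all add: e_pair_eq K.mult_cls K.cls_eqI)

lemma kalg_\<gamma>: "kalg (klr p \<gamma>)" and kalg_\<delta>: "kalg (klr p \<delta>)"
  unfolding klr_def by (rule h1.src.kalg_alg, rule h2.src.kalg_alg)

sublocale T: tens_data UNIV "\<lambda>x c. c \<odot>\<^bsub>klr p \<gamma>\<^esub> x" "klr p \<gamma>" "klr p \<delta>"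
proof -
  interpret kg: kalg "klr p \<gamma>" by (rule kalg_\<gamma>)
  interpret kd: kalg "klr p \<delta>" by (rule kalg_\<delta>)
  show "tens_data UNIV (\<lambda>x c. c \<odot>\<^bsub>klr p \<gamma>\<^esub> x) (klr p \<gamma>) (klr p \<delta>)"
    by (intro tens_data.intro kg.abelian_group_axioms kd.abelian_group_axioms)
      (auto simp: kg.ksmult_closed kd.ksmult_closed)
qed

abbreviation "S \<equiv> alg_tensor (klr p \<gamma>) (klr p \<delta>)"

lemma is_tens_S: "T.is_tens S"
  by (simp add: T.is_tens_def alg_tensor_def Let_def)

definition jf :: "'k vvfree set \<times> 'k vvfree set \<Rightarrow> 'k vvfree set" where
  "jf = (\<lambda>(r, s).
        alg_lift (corner A e) (\<lambda>g. cls \<Xi> (juxt_gen1 \<delta> g) \<otimes>\<^bsub>A\<^esub> e) r \<otimes>\<^bsub>corner A e\<^esub>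
        alg_lift (corner A e) (\<lambda>g. cls \<Xi> (juxt_gen2 \<gamma> g) \<otimes>\<^bsub>A\<^esub> e) s)"

lemma juxt_eq: "juxt \<Xi> \<gamma> \<delta> = tens_lift (corner A e) jf"
  by (simp add: juxt_def Let_def jf_def)

lemma corner_simps: "x \<otimes>\<^bsub>corner A e\<^esub> y = x \<otimes>\<^bsub>A\<^esub> y" "x \<oplus>\<^bsub>corner A e\<^esub> y = x \<oplus>\<^bsub>A\<^esub> y"
  by (simp_all add: corner_def)

lemma jf_cls:
  assumes f: "f \<in> h1.src.Fr" and g: "g \<in> h2.src.Fr"
  shows "jf (cls (klr_pres p \<gamma>) f, cls (klr_pres p \<delta>) g) =
      cls \<Xi> (subst (juxt_gen1 \<delta>) f * Ep * (subst (juxt_gen2 \<gamma>) g * Ep))"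
  using h1.alg_lift_cls[OF f] h2.alg_lift_cls[OF g] h1.subst_closed[OF f] h2.subst_closed[OF g] h1.E_FA
  by (simp add: jf_def e_pair_eq corner_simps[unfolded e_pair_eq] K.mult_cls)

lemma jf_closed:
  assumes "r \<in> carrier (klr p \<gamma>)" "s \<in> carrier (klr p \<delta>)"
  shows "jf (r, s) \<in> carrier (corner A e)"
proof -
  obtain f g where "f \<in> h1.src.Fr" "r = cls (klr_pres p \<gamma>) f" "g \<in> h2.src.Fr" "s = cls (klr_pres p \<delta>) g"
    using assms by (auto simp: klr_def h1.src.carrier_alg h2.src.carrier_alg)
  then show ?thesis
    using h1.alg_lift_cls[of f] h2.alg_lift_cls[of g] h1.subst_B[of f] h2.subst_B[of g]
    by (auto simp: jf_def e_pair_eq intro!: B.m_closed[unfolded e_pair_eq])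
qed

text \<open>Substitution fixes scalars, and scalars are central in the free algebra, so a scalar can
  be moved from one factor to the other.\<close>

lemma jf_balanced: "T.balanced (corner A e) jf"
  unfolding T.balanced_def
proof (intro conjI ballI)
  show "abelian_group (corner A e)" by (rule B.abelian_group_axioms)
  fix r s assume rs: "r \<in> carrier (klr p \<gamma>)" "s \<in> carrier (klr p \<delta>)"
  then show "jf (r, s) \<in> carrier (corner A e)" by (rule jf_closed)
  obtain f g where f: "f \<in> h1.src.Fr" "r = cls (klr_pres p \<gamma>) f"
    and g: "g \<in> h2.src.Fr" "s = cls (klr_pres p \<delta>) g"
    using rs by (auto simp: klr_def h1.src.carrier_alg h2.src.carrier_alg)
  note cl = h1.subst_closed h2.subst_closed h1.E_FA
  show "jf (r \<oplus>\<^bsub>klr p \<gamma>\<^esub> r', s) = jf (r, s) \<oplus>\<^bsub>corner A e\<^esub> jf (r', s)" if r': "r' \<in> carrier (klr p \<gamma>)" for r'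
  proof -
    obtain f' where f': "f' \<in> h1.src.Fr" "r' = cls (klr_pres p \<gamma>) f'"
      using r' by (auto simp: klr_def h1.src.carrier_alg)
    show ?thesis
      using f f' g cl by (simp add: klr_def h1.src.add_cls jf_cls corner_simps K.add_cls distrib_right)
  qed
  show "jf (r, s \<oplus>\<^bsub>klr p \<delta>\<^esub> s') = jf (r, s) \<oplus>\<^bsub>corner A e\<^esub> jf (r, s')" if s': "s' \<in> carrier (klr p \<delta>)" for s'
  proof -
    obtain g' where g': "g' \<in> h2.src.Fr" "s' = cls (klr_pres p \<delta>) g'"
      using s' by (auto simp: klr_def h2.src.carrier_alg)
    show ?thesis
      using f g g' cl by (simp add: klr_def h2.src.add_cls jf_cls corner_simps K.add_cls distrib_left distrib_right)
  qed
  show "jf (c \<odot>\<^bsub>klr p \<gamma>\<^esub> r, s) = jf (r, c \<odot>\<^bsub>klr p \<delta>\<^esub> s)" for c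
    using f g cl by (simp add: klr_def h1.src.smult_cls h2.src.smult_cls jf_cls sc_left_commute mult.assoc)
qed

abbreviation "jx \<equiv> juxt \<Xi> \<gamma> \<delta>"

lemma jx_corner: "t \<in> carrier S \<Longrightarrow> jx t \<in> carrier (corner A e)"
  unfolding juxt_eq by (rule T.tens_lift_closed[OF jf_balanced is_tens_S])

lemma jx_closed: "t \<in> carrier S \<Longrightarrow> jx t \<in> carrier A"
  and e_jx: "t \<in> carrier S \<Longrightarrow> e \<otimes>\<^bsub>A\<^esub> jx t = jx t" and jx_e: "t \<in> carrier S \<Longrightarrow> jx t \<otimes>\<^bsub>A\<^esub> e = jx t"
  using jx_corner carrier_corner[OF A.ring_axioms e_closed e_idem] by blast+

lemma jx_add: "t \<in> carrier S \<Longrightarrow> t' \<in> carrier S \<Longrightarrow> jx (t \<oplus>\<^bsub>S\<^esub> t') = jx t \<oplus>\<^bsub>A\<^esub> jx t'"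
  unfolding juxt_eq using T.tens_lift_add[OF jf_balanced is_tens_S] by (simp add: corner_simps)

lemma jx_pure: "f \<in> h1.src.Fr \<Longrightarrow> g \<in> h2.src.Fr \<Longrightarrow>
    jx (T.tp (cls (klr_pres p \<gamma>) f) (cls (klr_pres p \<delta>) g)) =
    cls \<Xi> (subst (juxt_gen1 \<delta>) f * Ep * (subst (juxt_gen2 \<gamma>) g * Ep))"
  unfolding juxt_eq
  by (subst T.tens_lift_pure[OF jf_balanced]) (auto simp: jf_cls klr_def)

end

section \<open>Left ideals generated by idempotents\<close>

lemma left_ideal_simps [simp]:
  "\<zero>\<^bsub>left_ideal A e\<^esub> = \<zero>\<^bsub>A\<^esub>" "x \<oplus>\<^bsub>left_ideal A e\<^esub> y = x \<oplus>\<^bsub>A\<^esub> y" "x \<odot>\<^bsub>left_ideal A e\<^esub> y = x \<otimes>\<^bsub>A\<^esub> y"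
  by (simp_all add: left_ideal_def)

lemma (in ring) carrier_left_ideal:
  assumes "e \<in> carrier R" "e \<otimes> e = e"
  shows "x \<in> carrier (left_ideal R e) \<longleftrightarrow> x \<in> carrier R \<and> x \<otimes> e = x"
  using assms unfolding left_ideal_def by (auto simp: m_assoc) metis

lemma (in ring) left_module_left_ideal:
  assumes e: "e \<in> carrier R" "e \<otimes> e = e"
  shows "left_module R (left_ideal R e)"
proof (intro left_module.intro left_module_axioms.intro ring_axioms)
  note c = carrier_left_ideal[OF e]
  show "abelian_group (left_ideal R e)"
  proof (rule abelian_groupI)
    fix x assume "x \<in> carrier (left_ideal R e)"
    then have "\<ominus> x \<in> carrier (left_ideal R e)" "\<ominus> x \<oplus> x = \<zero>"
      unfolding c using e by (auto simp: l_minus l_neg)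
    then show "\<exists>y\<in>carrier (left_ideal R e). y \<oplus>\<^bsub>left_ideal R e\<^esub> x = \<zero>\<^bsub>left_ideal R e\<^esub>" by auto
  qed (use e in \<open>auto simp: c l_distr a_ac\<close>)
qed (use e in \<open>auto simp: carrier_left_ideal[OF e] l_distr r_distr m_assoc\<close>)

section \<open>Convolution modules\<close>

locale conv_mod = conv_setup \<Xi> p m W \<gamma> \<delta> +
  PQ: kmods "klr p \<gamma>" "klr p \<delta>" P Q
  for \<Xi> :: "('k::field vvgen, 'k) presentation" and p m W \<gamma> \<delta>
    and P :: "('k vvfree set, 'm, 'z) module_scheme" and Q :: "('k vvfree set, 'n, 'z1) module_scheme"
begin

abbreviation "X \<equiv> left_ideal A e"

lemma carrier_X: "x \<in> carrier X \<longleftrightarrow> x \<in> carrier A \<and> x \<otimes>\<^bsub>A\<^esub> e = x"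
  by (rule A.carrier_left_ideal[OF e_closed e_idem])

lemma left_module_X: "left_module A X"
  by (rule A.left_module_left_ideal[OF e_closed e_idem])

abbreviation cact :: "'k vvfree set \<Rightarrow> ('k vvfree set, 'k vvfree set) tens \<Rightarrow> 'k vvfree set" where
  "cact \<equiv> \<lambda>a t. a \<otimes>\<^bsub>A\<^esub> jx t"

sublocale C: tens_data "carrier S" cact X PQ.PQ
proof (rule tens_data.intro)
  show "abelian_group X" by (rule left_module.axioms(2)[OF left_module_X])
  show "abelian_group PQ.PQ" by (rule PQ.abelian_group_PQ)
  show "x \<otimes>\<^bsub>A\<^esub> jx s \<in> carrier X" if "x \<in> carrier X" "s \<in> carrier S" for x s
    using that jx_closed jx_e e_closed by (auto simp: carrier_X A.m_assoc)
  show "s \<odot>\<^bsub>PQ.PQ\<^esub> y \<in> carrier PQ.PQ" if "y \<in> carrier PQ.PQ" "s \<in> carrier S" for y s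
    using that by (simp add: PQ.smult_PQ_closed)
qed

lemma conv_eq: "conv p \<Xi> \<gamma> \<delta> P Q = C.TM"
  by (simp add: conv_def)

lemma conv_pure_eq: "conv_pure p \<Xi> \<gamma> \<delta> P Q a x y = C.tp a (PQ.pM x y)"
  by (simp add: conv_pure_def)

lemma ra_lin: "a \<in> carrier A \<Longrightarrow> x \<in> carrier X \<Longrightarrow> s \<in> carrier S \<Longrightarrow>
    a \<odot>\<^bsub>X\<^esub> (x \<otimes>\<^bsub>A\<^esub> jx s) = (a \<odot>\<^bsub>X\<^esub> x) \<otimes>\<^bsub>A\<^esub> jx s"
  by (simp add: carrier_X A.m_assoc jx_closed)

lemmas left_module_C = C.left_module_TM(1)[OF left_module_X ra_lin]
lemmas C_smult = C.left_module_TM(2)[OF left_module_X ra_lin]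
lemmas C_tp_closed = C.tp_closed[OF C.is_tens_TM]
lemmas C_tp_add = C.tp_add[OF C.is_tens_TM, unfolded left_ideal_simps]
lemmas C_lift_closed = C.tens_lift_closed[OF _ C.is_tens_TM]
lemmas C_lift_add = C.tens_lift_add[OF _ C.is_tens_TM]
lemmas C_ext = C.T_ext[OF C.is_tens_TM]

end

section \<open>Restriction and induction along a corner\<close>

text \<open>An isomorphism \<iota> of R onto the corner e A e, stated elementwise. Restriction and
  the unit and counit of induction are treated at this level, without presentations.\<close>

locale corner_iso = R: ring R + A: ring A
  for R :: "('k, 'r, 'z) module_scheme" and A :: "('k, 'a, 'z1) module_scheme" +
  fixes e :: 'a and \<iota> :: "'r \<Rightarrow> 'a"
  assumes e: "e \<in> carrier A" "e \<otimes>\<^bsub>A\<^esub> e = e"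
    and \<iota>_closed: "r \<in> carrier R \<Longrightarrow> \<iota> r \<in> carrier A"
    and e_\<iota>: "r \<in> carrier R \<Longrightarrow> e \<otimes>\<^bsub>A\<^esub> \<iota> r = \<iota> r" and \<iota>_e: "r \<in> carrier R \<Longrightarrow> \<iota> r \<otimes>\<^bsub>A\<^esub> e = \<iota> r"
    and \<iota>_add: "r \<in> carrier R \<Longrightarrow> s \<in> carrier R \<Longrightarrow> \<iota> (r \<oplus>\<^bsub>R\<^esub> s) = \<iota> r \<oplus>\<^bsub>A\<^esub> \<iota> s"
    and \<iota>_mult: "r \<in> carrier R \<Longrightarrow> s \<in> carrier R \<Longrightarrow> \<iota> (r \<otimes>\<^bsub>R\<^esub> s) = \<iota> r \<otimes>\<^bsub>A\<^esub> \<iota> s"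
    and \<iota>_one: "\<iota> \<one>\<^bsub>R\<^esub> = e"
    and \<iota>_inj: "inj_on \<iota> (carrier R)"
    and \<iota>_surj: "a \<in> carrier A \<Longrightarrow> \<exists>r\<in>carrier R. \<iota> r = e \<otimes>\<^bsub>A\<^esub> a \<otimes>\<^bsub>A\<^esub> e"
begin

definition j :: "'a \<Rightarrow> 'r" where
  "j a = inv_into (carrier R) \<iota> a"

lemma jI: "r \<in> carrier R \<Longrightarrow> \<iota> r = a \<Longrightarrow> j a = r"
  unfolding j_def using \<iota>_inj by (auto simp: inv_into_f_f)

lemma j_\<iota> [simp]: "r \<in> carrier R \<Longrightarrow> j (\<iota> r) = r"
  by (simp add: jI)

abbreviation "X \<equiv> left_ideal A e"

lemma carrier_X: "x \<in> carrier X \<longleftrightarrow> x \<in> carrier A \<and> x \<otimes>\<^bsub>A\<^esub> e = x"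
  by (rule A.carrier_left_ideal[OF e])

lemma left_module_X: "left_module A X"
  by (rule A.left_module_left_ideal[OF e])

text \<open>On the left ideal A e this is the projection to the corner e A e, read in R. By
  \<open>pr_mult\<close> it is right linear over R and hence defines the counit.\<close>

definition pr :: "'a \<Rightarrow> 'r" where
  "pr a = j (e \<otimes>\<^bsub>A\<^esub> a)"

lemma pr:
  assumes "a \<in> carrier X"
  shows "pr a \<in> carrier R" "\<iota> (pr a) = e \<otimes>\<^bsub>A\<^esub> a"
proof -
  obtain r where "r \<in> carrier R" "\<iota> r = e \<otimes>\<^bsub>A\<^esub> a \<otimes>\<^bsub>A\<^esub> e" using \<iota>_surj assms carrier_X by blast
  then have r: "r \<in> carrier R" "\<iota> r = e \<otimes>\<^bsub>A\<^esub> a" using assms e by (auto simp: carrier_X A.m_assoc)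
  moreover have "pr a = r" unfolding pr_def using r by (rule jI)
  ultimately show "pr a \<in> carrier R" "\<iota> (pr a) = e \<otimes>\<^bsub>A\<^esub> a" by simp_all
qed

lemma prI: "r \<in> carrier R \<Longrightarrow> \<iota> r = e \<otimes>\<^bsub>A\<^esub> a \<Longrightarrow> pr a = r"
  unfolding pr_def by (rule jI)

lemma pr_add: "a \<in> carrier X \<Longrightarrow> b \<in> carrier X \<Longrightarrow> pr (a \<oplus>\<^bsub>A\<^esub> b) = pr a \<oplus>\<^bsub>R\<^esub> pr b"
  using pr[of a] pr[of b] e by (intro prI) (auto simp: \<iota>_add carrier_X A.r_distr)

lemma pr_mult: "a \<in> carrier X \<Longrightarrow> r \<in> carrier R \<Longrightarrow> pr (a \<otimes>\<^bsub>A\<^esub> \<iota> r) = pr a \<otimes>\<^bsub>R\<^esub> r"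
  using pr[of a] e by (intro prI) (auto simp: \<iota>_mult \<iota>_closed carrier_X A.m_assoc)

lemma \<iota>_X: "r \<in> carrier R \<Longrightarrow> \<iota> r \<in> carrier X"
  by (simp add: carrier_X \<iota>_closed \<iota>_e)

lemma e_X: "e \<in> carrier X"
  by (simp add: carrier_X e)

lemma mult_X: "a \<in> carrier A \<Longrightarrow> x \<in> carrier X \<Longrightarrow> a \<otimes>\<^bsub>A\<^esub> x \<in> carrier X"
  using e by (simp add: carrier_X A.m_assoc)

lemma mult_\<iota>_X: "a \<in> carrier A \<Longrightarrow> r \<in> carrier R \<Longrightarrow> a \<otimes>\<^bsub>A\<^esub> \<iota> r \<in> carrier X"
  by (intro mult_X \<iota>_X)

lemma pr_\<iota>_mult: "a \<in> carrier X \<Longrightarrow> r \<in> carrier R \<Longrightarrow> pr (\<iota> r \<otimes>\<^bsub>A\<^esub> a) = r \<otimes>\<^bsub>R\<^esub> pr a"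
proof -
  assume a: "a \<in> carrier X" and r: "r \<in> carrier R"
  have "\<iota> r \<otimes>\<^bsub>A\<^esub> (e \<otimes>\<^bsub>A\<^esub> a) = \<iota> r \<otimes>\<^bsub>A\<^esub> a" "e \<otimes>\<^bsub>A\<^esub> (\<iota> r \<otimes>\<^bsub>A\<^esub> a) = \<iota> r \<otimes>\<^bsub>A\<^esub> a"
    using a r e \<iota>_closed \<iota>_e e_\<iota> by (simp_all add: carrier_X flip: A.m_assoc)
  then show ?thesis using pr[OF a] r by (intro prI) (auto simp: \<iota>_mult)
qed

lemma pr_\<iota>: "r \<in> carrier R \<Longrightarrow> pr (\<iota> r) = r"
  by (rule prI) (auto simp: e_\<iota>)

lemma pr_e: "pr e = \<one>\<^bsub>R\<^esub>"
  by (rule prI) (auto simp: \<iota>_one e)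

definition res :: "('a, 'm, 'z2) module_scheme \<Rightarrow> ('r, 'm) module" where
  "res M = \<lparr>carrier = {e \<odot>\<^bsub>M\<^esub> x | x. x \<in> carrier M},
      monoid.mult = monoid.mult M, one = one M,
       ring.zero = ring.zero M, ring.add = ring.add M,
      smult = (\<lambda>r x. \<iota> r \<odot>\<^bsub>M\<^esub> x)\<rparr>"

lemma res_simps [simp]: "\<zero>\<^bsub>res M\<^esub> = \<zero>\<^bsub>M\<^esub>" "x \<oplus>\<^bsub>res M\<^esub> y = x \<oplus>\<^bsub>M\<^esub> y" "r \<odot>\<^bsub>res M\<^esub> x = \<iota> r \<odot>\<^bsub>M\<^esub> x"
  by (simp_all add: res_def)

lemma carrier_res:
  assumes "left_module A M"
  shows "x \<in> carrier (res M) \<longleftrightarrow> x \<in> carrier M \<and> e \<odot>\<^bsub>M\<^esub> x = x"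
proof -
  interpret M: left_module A M by fact
  have "e \<odot>\<^bsub>M\<^esub> (e \<odot>\<^bsub>M\<^esub> y) = e \<odot>\<^bsub>M\<^esub> y" if "y \<in> carrier M" for y
    using M.lsmult_assoc[of e e y] e that by simp
  then show ?thesis using e M.lsmult_closed by (auto simp: res_def) metis
qed

lemma left_module_res:
  assumes "left_module A M"
  shows "left_module R (res M)"
proof -
  interpret M: left_module A M by fact
  note c = carrier_res[OF assms]
  have e0: "a \<odot>\<^bsub>M\<^esub> \<zero>\<^bsub>M\<^esub> = \<zero>\<^bsub>M\<^esub>" if "a \<in> carrier A" for a
    using M.lsmult_r_distr[OF that, of "\<zero>\<^bsub>M\<^esub>" "\<zero>\<^bsub>M\<^esub>"] M.lsmult_closed[OF that, of "\<zero>\<^bsub>M\<^esub>"]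
    by simp
  have e\<iota>: "e \<odot>\<^bsub>M\<^esub> (\<iota> r \<odot>\<^bsub>M\<^esub> x) = \<iota> r \<odot>\<^bsub>M\<^esub> x" if "r \<in> carrier R" "x \<in> carrier M" for r x
    using M.lsmult_assoc[of e "\<iota> r" x] e that by (simp add: \<iota>_closed e_\<iota>)
  show ?thesis
  proof (intro left_module.intro left_module_axioms.intro R.ring_axioms)
    show "abelian_group (res M)"
    proof (rule abelian_groupI)
      fix x assume "x \<in> carrier (res M)"
      then have x: "x \<in> carrier M" "e \<odot>\<^bsub>M\<^esub> x = x" by (auto simp: c)
      have "e \<odot>\<^bsub>M\<^esub> (\<ominus>\<^bsub>M\<^esub> x) \<oplus>\<^bsub>M\<^esub> x = \<zero>\<^bsub>M\<^esub>"
        using M.lsmult_r_distr[OF e(1), of "\<ominus>\<^bsub>M\<^esub> x" x] x e0[OF e(1)] by (simp add: M.l_neg)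
      then have "e \<odot>\<^bsub>M\<^esub> (\<ominus>\<^bsub>M\<^esub> x) = \<ominus>\<^bsub>M\<^esub> x"
        using M.minus_equality[of "e \<odot>\<^bsub>M\<^esub> (\<ominus>\<^bsub>M\<^esub> x)" x] x M.lsmult_closed[OF e(1)] by simp
      then have "\<ominus>\<^bsub>M\<^esub> x \<in> carrier (res M)" "\<ominus>\<^bsub>M\<^esub> x \<oplus>\<^bsub>res M\<^esub> x = \<zero>\<^bsub>res M\<^esub>" using x by (auto simp: c M.l_neg)
      then show "\<exists>y\<in>carrier (res M). y \<oplus>\<^bsub>res M\<^esub> x = \<zero>\<^bsub>res M\<^esub>" by blast
    qed (use e in \<open>auto simp: c e0 M.lsmult_r_distr M.a_ac\<close>)
  qed (auto simp: c \<iota>_closed M.lsmult_closed \<iota>_add \<iota>_mult \<iota>_one M.lsmult_l_distr M.lsmult_r_distr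
      M.lsmult_assoc e\<iota>)
qed

end

locale ind_mod = corner_iso R A e \<iota> + P: left_module R P
  for R :: "('k, 'r, 'z) module_scheme" and A :: "('k, 'a, 'z1) module_scheme" and e \<iota>
    and P :: "('r, 'm, 'z2) module_scheme"
begin

sublocale I: tens_data "carrier R" "\<lambda>w r. w \<otimes>\<^bsub>A\<^esub> \<iota> r" X P
proof (rule tens_data.intro)
  show "abelian_group X" by (rule left_module.axioms(2)[OF left_module_X])
  show "w \<otimes>\<^bsub>A\<^esub> \<iota> r \<in> carrier X" if "w \<in> carrier X" "r \<in> carrier R" for w r
    using that by (auto simp: carrier_X intro!: mult_\<iota>_X[unfolded carrier_X])
qed (auto intro: P.abelian_group_axioms P.lsmult_closed)

lemma ra_lin: "a \<in> carrier A \<Longrightarrow> x \<in> carrier X \<Longrightarrow> r \<in> carrier R \<Longrightarrow>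
    a \<odot>\<^bsub>X\<^esub> (x \<otimes>\<^bsub>A\<^esub> \<iota> r) = (a \<odot>\<^bsub>X\<^esub> x) \<otimes>\<^bsub>A\<^esub> \<iota> r"
  by (simp add: carrier_X A.m_assoc \<iota>_closed)

lemmas left_module_I = I.left_module_TM(1)[OF left_module_X ra_lin]
lemmas I_smult = I.left_module_TM(2)[OF left_module_X ra_lin]
lemmas I_tp_closed = I.tp_closed[OF I.is_tens_TM]
lemmas I_tp_add = I.tp_add[OF I.is_tens_TM, unfolded left_ideal_simps]
lemmas I_lift_closed = I.tens_lift_closed[OF _ I.is_tens_TM]
lemmas I_lift_add = I.tens_lift_add[OF _ I.is_tens_TM]
lemmas I_ext = I.T_ext[OF I.is_tens_TM]

sublocale IM: left_module A I.TM by (rule left_module_I)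

definition unit :: "'m \<Rightarrow> ('a, 'm) tens" where
  "unit x = I.tp e x"

text \<open>Inverse to the unit on the restriction: it identifies e (A e \<otimes> P) with P by
  sending a \<otimes> x to (e a) x, with e a read in R.\<close>

definition counit :: "('a, 'm) tens \<Rightarrow> 'm" where
  "counit = tens_lift P (\<lambda>(a, x). pr a \<odot>\<^bsub>P\<^esub> x)"

lemma counit_balanced: "I.balanced P (\<lambda>(a, x). pr a \<odot>\<^bsub>P\<^esub> x)"
  unfolding I.balanced_def
  by (auto simp: P.abelian_group_axioms pr pr_add pr_mult P.lsmult_closed P.lsmult_l_distr
      P.lsmult_r_distr P.lsmult_assoc)

lemma counit_tp: "a \<in> carrier X \<Longrightarrow> x \<in> carrier P \<Longrightarrow> counit (I.tp a x) = pr a \<odot>\<^bsub>P\<^esub> x"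
  unfolding counit_def by (subst I.tens_lift_pure[OF counit_balanced]) auto

lemma counit_closed: "c \<in> carrier I.TM \<Longrightarrow> counit c \<in> carrier P"
  unfolding counit_def by (rule I_lift_closed[OF counit_balanced])

lemma counit_add: "c \<in> carrier I.TM \<Longrightarrow> d \<in> carrier I.TM \<Longrightarrow>
    counit (c \<oplus>\<^bsub>I.TM\<^esub> d) = counit c \<oplus>\<^bsub>P\<^esub> counit d"
  unfolding counit_def by (rule I_lift_add[OF counit_balanced])

lemma counit_smult: "r \<in> carrier R \<Longrightarrow> c \<in> carrier I.TM \<Longrightarrow> counit (\<iota> r \<odot>\<^bsub>I.TM\<^esub> c) = r \<odot>\<^bsub>P\<^esub> counit c"
proof -
  assume r: "r \<in> carrier R" and c: "c \<in> carrier I.TM"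
  show ?thesis
    by (rule I_ext[OF c, where f = "\<lambda>c. counit (\<iota> r \<odot>\<^bsub>I.TM\<^esub> c)" and g = "\<lambda>c. r \<odot>\<^bsub>P\<^esub> counit c" and B = P])
      (use r in \<open>auto simp: I_smult \<iota>_closed counit_tp mult_X pr_\<iota>_mult pr P.lsmult_assoc
        IM.lsmult_r_distr IM.lsmult_closed counit_add counit_closed P.lsmult_r_distr\<close>)
qed

lemma counit_unit: "x \<in> carrier P \<Longrightarrow> counit (unit x) = x"
  by (simp add: unit_def counit_tp e_X pr_e P.lsmult_one)

lemma unit_closed: "x \<in> carrier P \<Longrightarrow> unit x \<in> carrier (res I.TM)"
  by (simp add: unit_def carrier_res[OF left_module_I] I_tp_closed e_X I_smult e)

lemma unit_add: "x \<in> carrier P \<Longrightarrow> y \<in> carrier P \<Longrightarrow> unit (x \<oplus>\<^bsub>P\<^esub> y) = unit x \<oplus>\<^bsub>I.TM\<^esub> unit y"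
  by (simp add: unit_def I_tp_add e_X)

lemma unit_smult: "r \<in> carrier R \<Longrightarrow> x \<in> carrier P \<Longrightarrow> unit (r \<odot>\<^bsub>P\<^esub> x) = \<iota> r \<odot>\<^bsub>I.TM\<^esub> unit x"
  using I.tp_balanced[of e r x] by (simp add: unit_def I_smult e_X \<iota>_closed e_\<iota> \<iota>_e)

text \<open>The element e a comes from R, so it can be moved across the tensor sign: e \<otimes> (e
  a) x = e a \<otimes> x. On elements fixed by e the two maps are therefore inverse to each
  other.\<close>

lemma unit_counit: "c \<in> carrier I.TM \<Longrightarrow> unit (counit c) = e \<odot>\<^bsub>I.TM\<^esub> c"
proof (rule I_ext[where f = "\<lambda>c. unit (counit c)" and g = "\<lambda>c. e \<odot>\<^bsub>I.TM\<^esub> c" and B = I.TM])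
  fix a x assume a: "a \<in> carrier X" "x \<in> carrier P"
  have "unit (counit (I.tp a x)) = I.tp (e \<otimes>\<^bsub>A\<^esub> \<iota> (pr a)) x"
    using I.tp_balanced[of e "pr a" x] a by (simp add: unit_def counit_tp e_X pr)
  also have "e \<otimes>\<^bsub>A\<^esub> \<iota> (pr a) = e \<otimes>\<^bsub>A\<^esub> a"
    using a e by (simp add: pr carrier_X flip: A.m_assoc)
  also have "I.tp (e \<otimes>\<^bsub>A\<^esub> a) x = e \<odot>\<^bsub>I.TM\<^esub> I.tp a x"
    using a e by (simp add: I_smult)
  finally show "unit (counit (I.tp a x)) = e \<odot>\<^bsub>I.TM\<^esub> I.tp a x" .
qed (auto simp: counit_add unit_add counit_closed IM.lsmult_r_distr e)

end

section \<open>Functoriality of the outer tensor product\<close>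

text \<open>Serves induction, where P and Q are replaced by the isomorphic modules Res Ind P and Res
  Ind Q: the pair of units, or of counits, has to induce a map of outer tensor products.\<close>

locale kmods_hom = src: kmods A B P Q + tgt: kmods A B P' Q'
  for A :: "('k, 'a, 'z) module_scheme" and B :: "('k, 'b, 'z1) module_scheme"
    and P :: "('a, 'm, 'z2) module_scheme" and Q :: "('b, 'n, 'z3) module_scheme"
    and P' :: "('a, 'm1, 'z4) module_scheme" and Q' :: "('b, 'n1, 'z5) module_scheme" +
  fixes f :: "'m \<Rightarrow> 'm1" and g :: "'n \<Rightarrow> 'n1"
  assumes f_closed: "x \<in> carrier P \<Longrightarrow> f x \<in> carrier P'"
    and f_add: "x \<in> carrier P \<Longrightarrow> y \<in> carrier P \<Longrightarrow> f (x \<oplus>\<^bsub>P\<^esub> y) = f x \<oplus>\<^bsub>P'\<^esub> f y"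
    and f_smult: "a \<in> carrier A \<Longrightarrow> x \<in> carrier P \<Longrightarrow> f (a \<odot>\<^bsub>P\<^esub> x) = a \<odot>\<^bsub>P'\<^esub> f x"
    and g_closed: "z \<in> carrier Q \<Longrightarrow> g z \<in> carrier Q'"
    and g_add: "z \<in> carrier Q \<Longrightarrow> w \<in> carrier Q \<Longrightarrow> g (z \<oplus>\<^bsub>Q\<^esub> w) = g z \<oplus>\<^bsub>Q'\<^esub> g w"
    and g_smult: "b \<in> carrier B \<Longrightarrow> z \<in> carrier Q \<Longrightarrow> g (b \<odot>\<^bsub>Q\<^esub> z) = b \<odot>\<^bsub>Q'\<^esub> g z"
begin

definition mt :: "('m, 'n) tens \<Rightarrow> ('m1, 'n1) tens" where
  "mt = tens_lift tgt.PQ (\<lambda>(x, y). tgt.pM (f x) (g y))"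

lemma mt_balanced: "src.mod.balanced tgt.PQ (\<lambda>(x, y). tgt.pM (f x) (g y))"
  unfolding src.mod.balanced_def
proof (intro conjI ballI)
  show "abelian_group tgt.PQ" by (rule tgt.abelian_group_PQ)
  fix x y assume "x \<in> carrier (vspace A P)" "y \<in> carrier (vspace B Q)"
  then have xy: "x \<in> carrier P" "y \<in> carrier Q" by simp_all
  then show "(case (x, y) of (x, y) \<Rightarrow> tgt.pM (f x) (g y)) \<in> carrier tgt.PQ"
    by (simp add: tgt.pM_closed f_closed g_closed)
  fix c :: 'k
  have "f (c \<odot>\<^bsub>vspace A P\<^esub> x) = c \<odot>\<^bsub>vspace A P'\<^esub> f x" "g (c \<odot>\<^bsub>vspace B Q\<^esub> y) = c \<odot>\<^bsub>vspace B Q'\<^esub> g y"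
    using xy by (simp_all add: vspace_smult f_smult g_smult src.A.ksmult_closed src.B.ksmult_closed)
  then show "(case (c \<odot>\<^bsub>vspace A P\<^esub> x, y) of (x, y) \<Rightarrow> tgt.pM (f x) (g y)) =
      (case (x, c \<odot>\<^bsub>vspace B Q\<^esub> y) of (x, y) \<Rightarrow> tgt.pM (f x) (g y))"
    using tgt.mod.tp_balanced[of "f x" c "g y"] xy by (simp add: tgt.pM_def f_closed g_closed)
qed (auto simp: f_add g_add f_closed g_closed tgt.pM_add)

lemma mt_pure: "x \<in> carrier P \<Longrightarrow> y \<in> carrier Q \<Longrightarrow> mt (src.pM x y) = tgt.pM (f x) (g y)"
  unfolding mt_def src.pM_def by (subst src.mod.tens_lift_pure[OF mt_balanced]) auto

lemma mt_closed: "z \<in> carrier src.PQ \<Longrightarrow> mt z \<in> carrier tgt.PQ"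
  unfolding mt_def by (rule src.mod.tens_lift_closed[OF mt_balanced src.is_tens_PQ])

lemma mt_add: "z \<in> carrier src.PQ \<Longrightarrow> z' \<in> carrier src.PQ \<Longrightarrow> mt (z \<oplus>\<^bsub>src.PQ\<^esub> z') = mt z \<oplus>\<^bsub>tgt.PQ\<^esub> mt z'"
  unfolding mt_def by (rule src.mod.tens_lift_add[OF mt_balanced src.is_tens_PQ])

lemma mt_smult: "s \<in> carrier src.AB \<Longrightarrow> z \<in> carrier src.PQ \<Longrightarrow> mt (s \<odot>\<^bsub>src.PQ\<^esub> z) = s \<odot>\<^bsub>tgt.PQ\<^esub> mt z"
proof (induction arbitrary: z rule: src.AB_induct)
  case (pure a b)
  from pure(3,1,2) show ?case
  proof (induction rule: src.PQ_induct)
    case (pure x y)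
    then show ?case
      by (simp add: src.smult_pure tgt.smult_pure mt_pure src.P.lsmult_closed src.Q.lsmult_closed
          f_smult g_smult f_closed g_closed)
  next
    case (add C D)
    then show ?case
      by (simp add: src.smult_PQ_add tgt.smult_PQ_add src.pA_closed mt_add mt_closed src.smult_PQ_closed)
  qed
next
  case (add C D)
  then show ?case
    by (simp add: src.smult_PQ_add tgt.smult_PQ_add mt_add mt_closed src.smult_PQ_closed)
qed

end

section \<open>Convolution over an algebra and over a corner of it\<close>

text \<open>Compares the convolution over R with the one over A for modules whose outer tensor
  products are identified by mutually inverse maps \<eta> and \<zeta>. For restriction these are the
  identity, for induction they come from unit and counit.\<close>

locale conv_pair =
  CR: conv_mod \<Xi> p m W \<gamma> \<delta> P Q + CV: conv_mod \<Xi>' p m W' \<gamma> \<delta> P' Q' +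
  CI: corner_iso "alg \<Xi>" "alg \<Xi>'" e0 \<iota>
  for \<Xi> :: "('k::field vvgen, 'k) presentation" and p m W \<gamma> \<delta>
    and P :: "('k vvfree set, 'm, 'z) module_scheme" and Q :: "('k vvfree set, 'n, 'z1) module_scheme"
    and \<Xi>' :: "('k vvgen, 'k) presentation" and W'
    and P' :: "('k vvfree set, 'm1, 'z2) module_scheme" and Q' :: "('k vvfree set, 'n1, 'z3) module_scheme"
    and e0 \<iota> +
  fixes \<eta> :: "('m, 'n) tens \<Rightarrow> ('m1, 'n1) tens" and \<zeta> :: "('m1, 'n1) tens \<Rightarrow> ('m, 'n) tens"
  assumes \<iota>_pair: "\<iota> CR.e = CV.e"
    and \<iota>_jx: "t \<in> carrier CR.S \<Longrightarrow> \<iota> (CR.jx t) = CV.jx t"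
    and \<eta>_closed: "z \<in> carrier (mod_tensor (klr p \<gamma>) (klr p \<delta>) P Q) \<Longrightarrow>
      \<eta> z \<in> carrier (mod_tensor (klr p \<gamma>) (klr p \<delta>) P' Q')"
    and \<eta>_add: "z \<in> carrier (mod_tensor (klr p \<gamma>) (klr p \<delta>) P Q) \<Longrightarrow>
      z' \<in> carrier (mod_tensor (klr p \<gamma>) (klr p \<delta>) P Q) \<Longrightarrow>
      \<eta> (z \<oplus>\<^bsub>mod_tensor (klr p \<gamma>) (klr p \<delta>) P Q\<^esub> z') = \<eta> z \<oplus>\<^bsub>mod_tensor (klr p \<gamma>) (klr p \<delta>) P' Q'\<^esub> \<eta> z'"
    and \<eta>_smult: "s \<in> carrier (alg_tensor (klr p \<gamma>) (klr p \<delta>)) \<Longrightarrow>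
      z \<in> carrier (mod_tensor (klr p \<gamma>) (klr p \<delta>) P Q) \<Longrightarrow>
      \<eta> (s \<odot>\<^bsub>mod_tensor (klr p \<gamma>) (klr p \<delta>) P Q\<^esub> z) = s \<odot>\<^bsub>mod_tensor (klr p \<gamma>) (klr p \<delta>) P' Q'\<^esub> \<eta> z"
    and \<zeta>_closed: "u \<in> carrier (mod_tensor (klr p \<gamma>) (klr p \<delta>) P' Q') \<Longrightarrow>
      \<zeta> u \<in> carrier (mod_tensor (klr p \<gamma>) (klr p \<delta>) P Q)"
    and \<zeta>_add: "u \<in> carrier (mod_tensor (klr p \<gamma>) (klr p \<delta>) P' Q') \<Longrightarrow>
      u' \<in> carrier (mod_tensor (klr p \<gamma>) (klr p \<delta>) P' Q') \<Longrightarrow>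
      \<zeta> (u \<oplus>\<^bsub>mod_tensor (klr p \<gamma>) (klr p \<delta>) P' Q'\<^esub> u') = \<zeta> u \<oplus>\<^bsub>mod_tensor (klr p \<gamma>) (klr p \<delta>) P Q\<^esub> \<zeta> u'"
    and \<zeta>_smult: "s \<in> carrier (alg_tensor (klr p \<gamma>) (klr p \<delta>)) \<Longrightarrow>
      u \<in> carrier (mod_tensor (klr p \<gamma>) (klr p \<delta>) P' Q') \<Longrightarrow>
      \<zeta> (s \<odot>\<^bsub>mod_tensor (klr p \<gamma>) (klr p \<delta>) P' Q'\<^esub> u) = s \<odot>\<^bsub>mod_tensor (klr p \<gamma>) (klr p \<delta>) P Q\<^esub> \<zeta> u"
    and \<zeta>_\<eta>: "z \<in> carrier (mod_tensor (klr p \<gamma>) (klr p \<delta>) P Q) \<Longrightarrow> \<zeta> (\<eta> z) = z"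
    and \<eta>_\<zeta>: "u \<in> carrier (mod_tensor (klr p \<gamma>) (klr p \<delta>) P' Q') \<Longrightarrow> \<eta> (\<zeta> u) = u"
begin

abbreviation "Y \<equiv> mod_tensor (klr p \<gamma>) (klr p \<delta>) P Q"
abbreviation "Y' \<equiv> mod_tensor (klr p \<gamma>) (klr p \<delta>) P' Q'"
abbreviation "SS \<equiv> alg_tensor (klr p \<gamma>) (klr p \<delta>)"
abbreviation "A \<equiv> alg \<Xi>'"
abbreviation "R \<equiv> alg \<Xi>"


sublocale MR: left_module R CR.C.TM by (rule CR.left_module_C)
sublocale MV: left_module A CV.C.TM by (rule CV.left_module_C)

section \<open>Restricting a convolution to the corner\<close>

lemma XA: "w \<in> carrier CI.X \<Longrightarrow> w \<in> carrier A"
  by (simp add: CI.carrier_X)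

lemma e0_e: "e0 \<otimes>\<^bsub>A\<^esub> CV.e = CV.e" "CV.e \<otimes>\<^bsub>A\<^esub> e0 = CV.e"
  using CI.e_\<iota>[OF CR.e_closed] CI.\<iota>_e[OF CR.e_closed] \<iota>_pair by simp_all

text \<open>e(\<gamma>,\<delta>) is fixed by e on both sides, so the left ideal it generates lies in
  A e.\<close>

lemma XV_X: "a \<in> carrier CV.X \<Longrightarrow> a \<in> carrier CI.X"
proof -
  assume "a \<in> carrier CV.X"
  then have a: "a \<in> carrier A" "a \<otimes>\<^bsub>A\<^esub> CV.e = a" by (simp_all add: CV.carrier_X)
  then have "a \<otimes>\<^bsub>A\<^esub> e0 = a" using CV.A.m_assoc[of a CV.e e0] CI.e CV.e_closed e0_e by simp
  then show ?thesis using a by (simp add: CI.carrier_X)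
qed

lemma \<iota>_XR: "w \<in> carrier CI.X \<Longrightarrow> r \<in> carrier CR.X \<Longrightarrow> w \<otimes>\<^bsub>A\<^esub> \<iota> r \<in> carrier CV.X"
  using CI.\<iota>_mult[of r CR.e] CR.e_closed CI.\<iota>_closed[of r] CV.e_closed
  by (auto simp: CR.carrier_X CV.carrier_X CI.carrier_X \<iota>_pair CV.A.m_assoc)

lemma \<iota>_XR': "r \<in> carrier CR.X \<Longrightarrow> \<iota> r \<in> carrier CV.X"
  using \<iota>_XR[OF CI.e_X] by (simp add: CR.carrier_X CI.e_\<iota>)

lemma pr_XV: "a \<in> carrier CV.X \<Longrightarrow> CI.pr a \<in> carrier CR.X"
  using CI.pr_mult[OF XV_X CR.e_closed] CI.pr[OF XV_X] by (simp add: CR.carrier_X CV.carrier_X \<iota>_pair)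

lemma pr_jx: "a \<in> carrier CV.X \<Longrightarrow> t \<in> carrier SS \<Longrightarrow> CI.pr (a \<otimes>\<^bsub>A\<^esub> CV.jx t) = CI.pr a \<otimes>\<^bsub>R\<^esub> CR.jx t"
  using CI.pr_mult[OF XV_X, of a "CR.jx t"] CR.jx_closed[of t] by (simp add: \<iota>_jx)

text \<open>Multiplies the left factor by e and reads the result in R e(\<gamma>,\<delta>). The map
  is defined on the whole convolution over A and becomes bijective on the part fixed by e.\<close>

definition L :: "('k vvfree set, ('m1, 'n1) tens) tens \<Rightarrow> ('k vvfree set, ('m, 'n) tens) tens" where
  "L = tens_lift CR.C.TM (\<lambda>(a, z). CR.C.tp (CI.pr a) (\<zeta> z))"

definition \<Theta> :: "('k vvfree set, ('m, 'n) tens) tens \<Rightarrow> ('k vvfree set, ('m1, 'n1) tens) tens" where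
  "\<Theta> = tens_lift CV.C.TM (\<lambda>(r, z). CV.C.tp (\<iota> r) (\<eta> z))"

lemma L_balanced: "CV.C.balanced CR.C.TM (\<lambda>(a, z). CR.C.tp (CI.pr a) (\<zeta> z))"
  unfolding CV.C.balanced_def
  by (auto simp: MR.abelian_group_axioms CR.C_tp_closed CR.C_tp_add pr_XV \<zeta>_closed \<zeta>_add \<zeta>_smult
      CI.pr_add XV_X pr_jx CR.C.tp_balanced)

lemma \<Theta>_balanced: "CR.C.balanced CV.C.TM (\<lambda>(r, z). CV.C.tp (\<iota> r) (\<eta> z))"
  unfolding CR.C.balanced_def
proof (intro conjI ballI)
  show "abelian_group CV.C.TM" by (rule MV.abelian_group_axioms)
  fix r z s assume a: "r \<in> carrier CR.X" "z \<in> carrier Y" "s \<in> carrier SS"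
  then have "\<iota> (r \<otimes>\<^bsub>R\<^esub> CR.jx s) = \<iota> r \<otimes>\<^bsub>A\<^esub> CV.jx s"
    using CI.\<iota>_mult[of r "CR.jx s"] CR.jx_closed[of s] by (simp add: \<iota>_jx CR.carrier_X)
  then show "(case (r \<otimes>\<^bsub>R\<^esub> CR.jx s, z) of (r, z) \<Rightarrow> CV.C.tp (\<iota> r) (\<eta> z)) =
      (case (r, s \<odot>\<^bsub>Y\<^esub> z) of (r, z) \<Rightarrow> CV.C.tp (\<iota> r) (\<eta> z))"
    using a CV.C.tp_balanced[of "\<iota> r" s "\<eta> z"] by (simp add: \<iota>_XR' \<eta>_closed \<eta>_smult)
next
  fix r z r' assume a: "r \<in> carrier CR.X" "z \<in> carrier Y" "r' \<in> carrier CR.X"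
  then show "(case (r \<oplus>\<^bsub>CR.X\<^esub> r', z) of (r, z) \<Rightarrow> CV.C.tp (\<iota> r) (\<eta> z)) =
      (case (r, z) of (r, z) \<Rightarrow> CV.C.tp (\<iota> r) (\<eta> z)) \<oplus>\<^bsub>CV.C.TM\<^esub>
      (case (r', z) of (r, z) \<Rightarrow> CV.C.tp (\<iota> r) (\<eta> z))"
    using CI.\<iota>_add[of r r'] CV.C_tp_add(1)[of "\<iota> r" "\<iota> r'" "\<eta> z"]
    by (simp add: \<iota>_XR' \<eta>_closed CR.carrier_X)
qed (auto simp: CV.C_tp_closed CV.C_tp_add \<iota>_XR' \<eta>_closed \<eta>_add)

lemma L_tp: "a \<in> carrier CV.X \<Longrightarrow> z \<in> carrier Y' \<Longrightarrow> L (CV.C.tp a z) = CR.C.tp (CI.pr a) (\<zeta> z)"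
  unfolding L_def by (subst CV.C.tens_lift_pure[OF L_balanced]) auto

lemma \<Theta>_tp: "r \<in> carrier CR.X \<Longrightarrow> z \<in> carrier Y \<Longrightarrow> \<Theta> (CR.C.tp r z) = CV.C.tp (\<iota> r) (\<eta> z)"
  unfolding \<Theta>_def by (subst CR.C.tens_lift_pure[OF \<Theta>_balanced]) auto

lemmas L_closed = CV.C_lift_closed[OF L_balanced, folded L_def]
lemmas L_add = CV.C_lift_add[OF L_balanced, folded L_def]
lemmas \<Theta>_closed = CR.C_lift_closed[OF \<Theta>_balanced, folded \<Theta>_def]
lemmas \<Theta>_add = CR.C_lift_add[OF \<Theta>_balanced, folded \<Theta>_def]

lemma L_\<Theta>: "c \<in> carrier CR.C.TM \<Longrightarrow> L (\<Theta> c) = c"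
  by (rule CR.C_ext[where f = "\<lambda>c. L (\<Theta> c)" and g = "\<lambda>c. c" and B = CR.C.TM])
    (auto simp: L_tp \<Theta>_tp L_add \<Theta>_add \<Theta>_closed \<iota>_XR' \<eta>_closed \<zeta>_\<eta> CI.pr_\<iota> CR.carrier_X)

text \<open>The composition replaces a \<otimes> z by e a \<otimes> z, so it is the projection onto
  the restriction.\<close>

lemma \<Theta>_L: "c \<in> carrier CV.C.TM \<Longrightarrow> \<Theta> (L c) = e0 \<odot>\<^bsub>CV.C.TM\<^esub> c"
  by (rule CV.C_ext[where f = "\<lambda>c. \<Theta> (L c)" and g = "\<lambda>c. e0 \<odot>\<^bsub>CV.C.TM\<^esub> c" and B = CV.C.TM])
    (auto simp: L_tp \<Theta>_tp L_add \<Theta>_add L_closed pr_XV \<zeta>_closed \<eta>_\<zeta> CI.pr XV_X CV.C_smult CI.e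
      MV.lsmult_r_distr)

lemma L_smult: "r \<in> carrier R \<Longrightarrow> c \<in> carrier CV.C.TM \<Longrightarrow> L (\<iota> r \<odot>\<^bsub>CV.C.TM\<^esub> c) = r \<odot>\<^bsub>CR.C.TM\<^esub> L c"
proof -
  assume r: "r \<in> carrier R" and c: "c \<in> carrier CV.C.TM"
  have X: "\<iota> r \<otimes>\<^bsub>A\<^esub> a \<in> carrier CV.X" if "a \<in> carrier CV.X" for a
    using that r CI.\<iota>_closed CV.e_closed by (auto simp: CV.carrier_X CV.A.m_assoc)
  show ?thesis
    by (rule CV.C_ext[OF c, where f = "\<lambda>c. L (\<iota> r \<odot>\<^bsub>CV.C.TM\<^esub> c)" and g = "\<lambda>c. r \<odot>\<^bsub>CR.C.TM\<^esub> L c"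
          and B = CR.C.TM])
      (use r in \<open>auto simp: CV.C_smult CI.\<iota>_closed X L_tp CI.pr_\<iota>_mult XV_X CR.C_smult pr_XV \<zeta>_closed
        MV.lsmult_r_distr MV.lsmult_closed L_add L_closed MR.lsmult_r_distr\<close>)
qed

theorem res_conv:
  shows "left_module_iso R (CI.res CV.C.TM) CR.C.TM L"
    and "r \<in> carrier CR.X \<Longrightarrow> z \<in> carrier Y \<Longrightarrow> L (CV.C.tp (\<iota> r) (\<eta> z)) = CR.C.tp r z"
proof -
  note c = CI.carrier_res[OF CV.left_module_C]
  have "bij_betw L (carrier (CI.res CV.C.TM)) (carrier CR.C.TM)"
  proof (rule bij_betw_byWitness[where f' = \<Theta>])
    show "\<Theta> ` carrier CR.C.TM \<subseteq> carrier (CI.res CV.C.TM)"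
    proof (intro image_subsetI)
      fix x assume x: "x \<in> carrier CR.C.TM"
      then have "\<Theta> (L (\<Theta> x)) = e0 \<odot>\<^bsub>CV.C.TM\<^esub> \<Theta> x" by (intro \<Theta>_L \<Theta>_closed)
      then show "\<Theta> x \<in> carrier (CI.res CV.C.TM)" using x by (simp add: c L_\<Theta> \<Theta>_closed)
    qed
  qed (auto simp: c \<Theta>_L L_\<Theta> L_closed)
  then show "left_module_iso R (CI.res CV.C.TM) CR.C.TM L"
    using CI.left_module_res[OF CV.left_module_C] CR.left_module_C
    by (auto simp: left_module_iso_def c L_add L_smult)
  show "r \<in> carrier CR.X \<Longrightarrow> z \<in> carrier Y \<Longrightarrow> L (CV.C.tp (\<iota> r) (\<eta> z)) = CR.C.tp r z"
    using L_\<Theta>[of "CR.C.tp r z"] by (simp add: \<Theta>_tp CR.C_tp_closed)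
qed

section \<open>Inducing a convolution: associativity of the tensor product\<close>

sublocale In: ind_mod R A e0 \<iota> CR.C.TM
  by (intro ind_mod.intro CI.corner_iso_axioms MR.left_module_axioms)

text \<open>The multiplication map. Writing e' for e(\<gamma>,\<delta>), it realises A e \<otimes>
  (R e' \<otimes> Y) as A e' \<otimes> Y', once \<open>\<Theta>\<close> has carried the inner factor
  into the convolution over A.\<close>

definition \<Psi>1 :: "'k vvfree set \<Rightarrow> ('k vvfree set, ('m, 'n) tens) tens \<Rightarrow> ('k vvfree set, ('m1, 'n1) tens) tens"
  where "\<Psi>1 w c = w \<odot>\<^bsub>CV.C.TM\<^esub> \<Theta> c"

lemma \<Psi>1_tp: "w \<in> carrier CI.X \<Longrightarrow> r \<in> carrier CR.X \<Longrightarrow> z \<in> carrier Y \<Longrightarrow>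
    \<Psi>1 w (CR.C.tp r z) = CV.C.tp (w \<otimes>\<^bsub>A\<^esub> \<iota> r) (\<eta> z)"
  by (simp add: \<Psi>1_def \<Theta>_tp CV.C_smult CI.carrier_X \<iota>_XR' \<eta>_closed)

lemma \<Theta>_smult: "r \<in> carrier R \<Longrightarrow> c \<in> carrier CR.C.TM \<Longrightarrow> \<Theta> (r \<odot>\<^bsub>CR.C.TM\<^esub> c) = \<iota> r \<odot>\<^bsub>CV.C.TM\<^esub> \<Theta> c"
proof -
  assume r: "r \<in> carrier R" and c: "c \<in> carrier CR.C.TM"
  have X: "r \<otimes>\<^bsub>R\<^esub> a \<in> carrier CR.X" if "a \<in> carrier CR.X" for a
    using that r CR.e_closed by (auto simp: CR.carrier_X CR.A.m_assoc)
  have "\<iota> (r \<otimes>\<^bsub>R\<^esub> a) = \<iota> r \<otimes>\<^bsub>A\<^esub> \<iota> a" if "a \<in> carrier CR.X" for a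
    using that r CI.\<iota>_mult by (simp add: CR.carrier_X)
  then show ?thesis
    by (intro CR.C_ext[OF c, where f = "\<lambda>c. \<Theta> (r \<odot>\<^bsub>CR.C.TM\<^esub> c)" and g = "\<lambda>c. \<iota> r \<odot>\<^bsub>CV.C.TM\<^esub> \<Theta> c"
          and B = CV.C.TM])
      (use r in \<open>auto simp: CR.C_smult X \<Theta>_tp CV.C_smult CI.\<iota>_closed \<iota>_XR' \<eta>_closed
        MR.lsmult_r_distr MR.lsmult_closed \<Theta>_add \<Theta>_closed MV.lsmult_r_distr\<close>)
qed

lemma \<Psi>_balanced: "In.I.balanced CV.C.TM (\<lambda>(w, c). \<Psi>1 w c)"
  unfolding In.I.balanced_def
  by (auto simp: MV.abelian_group_axioms \<Psi>1_def MV.lsmult_closed \<Theta>_closed CI.carrier_X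
      MV.lsmult_l_distr MV.lsmult_r_distr \<Theta>_add \<Theta>_smult MV.lsmult_assoc CI.\<iota>_closed)

definition \<Psi> :: "('k vvfree set, ('k vvfree set, ('m, 'n) tens) tens) tens \<Rightarrow> ('k vvfree set, ('m1, 'n1) tens) tens"
  where "\<Psi> = tens_lift CV.C.TM (\<lambda>(w, c). \<Psi>1 w c)"

text \<open>The inverse of \<open>\<Psi>\<close> inserts the idempotent e(\<gamma>,\<delta>) of R as
  the middle factor.\<close>

definition \<Omega> :: "('k vvfree set, ('m1, 'n1) tens) tens \<Rightarrow> ('k vvfree set, ('k vvfree set, ('m, 'n) tens) tens) tens"
  where "\<Omega> = tens_lift In.I.TM (\<lambda>(a, z). In.I.tp a (CR.C.tp CR.e (\<zeta> z)))"

lemma e_XR: "CR.e \<in> carrier CR.X"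
  by (simp add: CR.carrier_X CR.e_closed CR.e_idem)

lemma \<Omega>_balanced: "CV.C.balanced In.I.TM (\<lambda>(a, z). In.I.tp a (CR.C.tp CR.e (\<zeta> z)))"
  unfolding CV.C.balanced_def
proof (intro conjI ballI)
  show "abelian_group In.I.TM" by (rule In.IM.abelian_group_axioms)
  fix a z s assume a: "a \<in> carrier CV.X" "z \<in> carrier Y'" "s \<in> carrier SS"
  have j: "CR.jx s \<in> carrier R" "CR.jx s \<otimes>\<^bsub>R\<^esub> CR.e = CR.jx s" "CR.e \<otimes>\<^bsub>R\<^esub> CR.jx s = CR.jx s"
    using a CR.jx_closed CR.jx_e CR.e_jx by auto
  \<comment> \<open>Balancing over the tensor product algebra is obtained in two stages: the image
    of s in R crosses the outer tensor sign, commutes with the inserted idempotent, and crosses the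
    inner tensor sign.\<close>
  have "In.I.tp (a \<otimes>\<^bsub>A\<^esub> \<iota> (CR.jx s)) (CR.C.tp CR.e (\<zeta> z)) =
      In.I.tp a (CR.jx s \<odot>\<^bsub>CR.C.TM\<^esub> CR.C.tp CR.e (\<zeta> z))"
    using a j by (intro In.I.tp_balanced) (auto simp: XV_X CR.C_tp_closed e_XR \<zeta>_closed)
  also have "CR.jx s \<odot>\<^bsub>CR.C.TM\<^esub> CR.C.tp CR.e (\<zeta> z) = CR.C.tp (CR.e \<otimes>\<^bsub>R\<^esub> CR.jx s) (\<zeta> z)"
    using a j by (simp add: CR.C_smult e_XR \<zeta>_closed)
  also have "\<dots> = CR.C.tp CR.e (\<zeta> (s \<odot>\<^bsub>Y'\<^esub> z))"
    using a CR.C.tp_balanced[of CR.e s "\<zeta> z"] by (simp add: e_XR \<zeta>_closed \<zeta>_smult)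
  finally show "(case (a \<otimes>\<^bsub>A\<^esub> CV.jx s, z) of (a, z) \<Rightarrow> In.I.tp a (CR.C.tp CR.e (\<zeta> z))) =
      (case (a, s \<odot>\<^bsub>Y'\<^esub> z) of (a, z) \<Rightarrow> In.I.tp a (CR.C.tp CR.e (\<zeta> z)))"
    using a by (simp add: \<iota>_jx)
qed (auto simp: In.I_tp_closed In.I_tp_add XV_X CR.C_tp_closed CR.C_tp_add e_XR \<zeta>_closed \<zeta>_add)

lemma \<Psi>_tp: "w \<in> carrier CI.X \<Longrightarrow> c \<in> carrier CR.C.TM \<Longrightarrow> \<Psi> (In.I.tp w c) = \<Psi>1 w c"
  unfolding \<Psi>_def by (subst In.I.tens_lift_pure[OF \<Psi>_balanced]) auto

lemma \<Omega>_tp: "a \<in> carrier CV.X \<Longrightarrow> z \<in> carrier Y' \<Longrightarrow> \<Omega> (CV.C.tp a z) = In.I.tp a (CR.C.tp CR.e (\<zeta> z))"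
  unfolding \<Omega>_def by (subst CV.C.tens_lift_pure[OF \<Omega>_balanced]) auto

lemmas \<Psi>_closed = In.I_lift_closed[OF \<Psi>_balanced, folded \<Psi>_def]
lemmas \<Psi>_add = In.I_lift_add[OF \<Psi>_balanced, folded \<Psi>_def]
lemmas \<Omega>_closed = CV.C_lift_closed[OF \<Omega>_balanced, folded \<Omega>_def]
lemmas \<Omega>_add = CV.C_lift_add[OF \<Omega>_balanced, folded \<Omega>_def]

lemma \<Psi>_\<Omega>: "c \<in> carrier CV.C.TM \<Longrightarrow> \<Psi> (\<Omega> c) = c"
proof (rule CV.C_ext[where f = "\<lambda>c. \<Psi> (\<Omega> c)" and g = "\<lambda>c. c" and B = CV.C.TM])
  fix a z assume a: "a \<in> carrier CV.X" "z \<in> carrier Y'"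
  then have "\<Psi> (\<Omega> (CV.C.tp a z)) = CV.C.tp (a \<otimes>\<^bsub>A\<^esub> \<iota> CR.e) (\<eta> (\<zeta> z))"
    by (simp add: \<Omega>_tp \<Psi>_tp \<Psi>1_tp XV_X CR.C_tp_closed e_XR \<zeta>_closed)
  then show "\<Psi> (\<Omega> (CV.C.tp a z)) = CV.C.tp a z"
    using a by (simp add: \<iota>_pair \<eta>_\<zeta> CV.carrier_X)
qed (auto simp: \<Psi>_add \<Omega>_add \<Omega>_closed)

text \<open>Since r e(\<gamma>,\<delta>) = r, the factor \<iota>(r) can cross the outer tensor sign
  back to its original place.\<close>

lemma \<Omega>_\<Psi>1: "c \<in> carrier CR.C.TM \<Longrightarrow> w \<in> carrier CI.X \<Longrightarrow> \<Omega> (\<Psi>1 w c) = In.I.tp w c"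
proof (rule CR.C_ext[where f = "\<lambda>c. \<Omega> (\<Psi>1 w c)" and g = "\<lambda>c. In.I.tp w c" and B = In.I.TM])
  assume w: "w \<in> carrier CI.X"
  fix r z assume a: "r \<in> carrier CR.X" "z \<in> carrier Y"
  have r: "r \<in> carrier R" "r \<otimes>\<^bsub>R\<^esub> CR.e = r" using a by (simp_all add: CR.carrier_X)
  have "\<Omega> (\<Psi>1 w (CR.C.tp r z)) = In.I.tp (w \<otimes>\<^bsub>A\<^esub> \<iota> r) (CR.C.tp CR.e z)"
    using a w by (simp add: \<Psi>1_tp \<Omega>_tp \<iota>_XR \<eta>_closed \<zeta>_\<eta>)
  also have "\<dots> = In.I.tp w (r \<odot>\<^bsub>CR.C.TM\<^esub> CR.C.tp CR.e z)"
    using a w r by (intro In.I.tp_balanced) (auto simp: CR.C_tp_closed e_XR)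
  also have "r \<odot>\<^bsub>CR.C.TM\<^esub> CR.C.tp CR.e z = CR.C.tp r z"
    using a r by (simp add: CR.C_smult e_XR)
  finally show "\<Omega> (\<Psi>1 w (CR.C.tp r z)) = In.I.tp w (CR.C.tp r z)" .
qed (auto simp: \<Psi>1_def \<Theta>_add \<Theta>_closed MV.lsmult_r_distr MV.lsmult_closed \<Omega>_add In.I_tp_add CI.carrier_X)

lemma \<Omega>_\<Psi>: "c \<in> carrier In.I.TM \<Longrightarrow> \<Omega> (\<Psi> c) = c"
  by (rule In.I_ext[where f = "\<lambda>c. \<Omega> (\<Psi> c)" and g = "\<lambda>c. c" and B = In.I.TM])
    (auto simp: \<Psi>_tp \<Omega>_\<Psi>1 \<Psi>_add \<Omega>_add \<Psi>_closed)

lemma \<Psi>_smult: "a \<in> carrier A \<Longrightarrow> c \<in> carrier In.I.TM \<Longrightarrow> \<Psi> (a \<odot>\<^bsub>In.I.TM\<^esub> c) = a \<odot>\<^bsub>CV.C.TM\<^esub> \<Psi> c"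
proof -
  assume a: "a \<in> carrier A" and c: "c \<in> carrier In.I.TM"
  show ?thesis
    by (rule In.I_ext[OF c, where f = "\<lambda>c. \<Psi> (a \<odot>\<^bsub>In.I.TM\<^esub> c)" and g = "\<lambda>c. a \<odot>\<^bsub>CV.C.TM\<^esub> \<Psi> c" and B = CV.C.TM])
      (use a in \<open>auto simp: In.I_smult \<Psi>_tp CI.mult_X \<Psi>1_def MV.lsmult_assoc \<Theta>_closed XA
        In.IM.lsmult_r_distr In.IM.lsmult_closed \<Psi>_add \<Psi>_closed MV.lsmult_r_distr\<close>)
qed

theorem ind_conv:
  shows "left_module_iso A In.I.TM CV.C.TM \<Psi>"
    and "w \<in> carrier CI.X \<Longrightarrow> r \<in> carrier CR.X \<Longrightarrow> z \<in> carrier Y \<Longrightarrow>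
      \<Psi> (In.I.tp w (CR.C.tp r z)) = CV.C.tp (w \<otimes>\<^bsub>A\<^esub> \<iota> r) (\<eta> z)"
proof -
  have "bij_betw \<Psi> (carrier In.I.TM) (carrier CV.C.TM)"
    by (rule bij_betw_byWitness[where f' = \<Omega>]) (auto simp: \<Psi>_\<Omega> \<Omega>_\<Psi> \<Psi>_closed \<Omega>_closed)
  then show "left_module_iso A In.I.TM CV.C.TM \<Psi>"
    using In.left_module_I CV.left_module_C by (auto simp: left_module_iso_def \<Psi>_add \<Psi>_smult)
qed (simp add: \<Psi>_tp \<Psi>1_tp CR.C_tp_closed)

end

section \<open>Restriction and induction commute with convolution\<close>

context wt
begin

text \<open>The outcome of the analysis of the VV algebra, \<open>incl_inj\<close> and
  \<open>incl_surj\<close>, translated from representatives to classes; the formal part builds on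
  this statement.\<close>

lemma incl_corner_iso:
  "corner_iso (klr p \<gamma>) (vv p (theta \<gamma>)) (e_plus p l (theta \<gamma>)) (incl p l (theta \<gamma>))"
proof -
  let ?\<iota> = "incl p l (theta \<gamma>)"
  have klr: "klr p \<gamma> = alg R" and vv: "vv p (theta \<gamma>) = alg V" by (simp_all add: klr_def vv_def)
  interpret RR: ring "alg R" by (rule R.ring_alg)
  interpret VV: ring "alg V" by (rule V.ring_alg)
  note E = e_plus_eq
  have cl: "f * E \<in> V.Fr" "f \<in> V.Fr" if "f \<in> R.Fr" for f using that Fr_R_V E_FA by auto
  show ?thesis
    unfolding klr vv
  proof
    show "e_plus p l (theta \<gamma>) \<in> carrier (alg V)" by (simp add: E E_FA)
    show "e_plus p l (theta \<gamma>) \<otimes>\<^bsub>alg V\<^esub> e_plus p l (theta \<gamma>) = e_plus p l (theta \<gamma>)"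
      by (simp add: E E_FA V.mult_cls V.cls_eqI incl.E_idem)
    show "inj_on ?\<iota> (carrier (alg R))"
    proof (rule inj_onI)
      fix r s assume "r \<in> carrier (alg R)" "s \<in> carrier (alg R)" and eq: "?\<iota> r = ?\<iota> s"
      then obtain f g where f: "f \<in> R.Fr" "r = cls R f" and g: "g \<in> R.Fr" "s = cls R g"
        by (auto simp: R.carrier_alg)
      have "V.eqv (f * E) (g * E)" using eq f g cl by (simp add: incl_cls V.cls_eq_iff)
      then have "(f - g) * E \<in> V.J" by (simp add: V.eqv_def left_diff_distrib)
      then have "f - g \<in> R.J" using f g by (intro incl_inj) auto
      then show "r = s" using f g by (auto intro!: R.cls_eqI R.eqvI)
    qed
    fix a assume "a \<in> carrier (alg V)"
    then obtain f where f: "f \<in> V.Fr" "a = cls V f" by (auto simp: V.carrier_alg)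
    obtain g where g: "g \<in> R.Fr" "V.eqv (E * f * E) (g * E)" using incl_surj[OF f(1)] by blast
    have "?\<iota> (cls R g) = e_plus p l (theta \<gamma>) \<otimes>\<^bsub>alg V\<^esub> a \<otimes>\<^bsub>alg V\<^esub> e_plus p l (theta \<gamma>)"
      using f g E_FA by (simp add: incl_cls E V.mult_cls V.cls_eqI V.eqv_sym)
    then show "\<exists>r\<in>carrier (alg R). ?\<iota> r = e_plus p l (theta \<gamma>) \<otimes>\<^bsub>alg V\<^esub> a \<otimes>\<^bsub>alg V\<^esub> e_plus p l (theta \<gamma>)"
      using g R.cls_closed by blast
  next
    show "?\<iota> \<one>\<^bsub>alg R\<^esub> = e_plus p l (theta \<gamma>)" by (simp add: R.one_alg incl_cls E)
    fix r assume "r \<in> carrier (alg R)"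
    then obtain f where f: "f \<in> R.Fr" "r = cls R f" by (auto simp: R.carrier_alg)
    show "?\<iota> r \<in> carrier (alg V)" using f cl by (simp add: incl_cls)
    have "V.eqv (f * E * E) (f * E)"
      unfolding mult.assoc using f cl by (intro V.eqv_multl incl.E_idem)
    then show "?\<iota> r \<otimes>\<^bsub>alg V\<^esub> e_plus p l (theta \<gamma>) = ?\<iota> r"
      "e_plus p l (theta \<gamma>) \<otimes>\<^bsub>alg V\<^esub> ?\<iota> r = ?\<iota> r"
      using f cl E_FA E_f_E[OF f(1)] by (simp_all add: incl_cls E V.mult_cls V.cls_eqI)
    fix s assume "s \<in> carrier (alg R)"
    then obtain g where g: "g \<in> R.Fr" "s = cls R g" by (auto simp: R.carrier_alg)
    show "?\<iota> (r \<oplus>\<^bsub>alg R\<^esub> s) = ?\<iota> r \<oplus>\<^bsub>alg V\<^esub> ?\<iota> s"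
      using f g cl by (simp add: incl_cls R.add_cls V.add_cls distrib_right)
    show "?\<iota> (r \<otimes>\<^bsub>alg R\<^esub> s) = ?\<iota> r \<otimes>\<^bsub>alg V\<^esub> ?\<iota> s"
      using f g cl incl.subst_mult[of f g]
      by (simp add: incl_cls R.mult_cls V.mult_cls V.cls_eqI V.eqv_sym)
  qed
qed

end

section \<open>Two weights: comparing the juxtapositions in R and in W\<close>

context params
begin

lemma wt_add: "\<gamma> \<in> NI_plus p l \<Longrightarrow> \<delta> \<in> NI_plus p l \<Longrightarrow> \<gamma> + \<delta> \<in> NI_plus p l"
  by (auto simp: NI_plus_def)

lemma theta_add: "theta (\<gamma> + \<delta>) = theta \<gamma> + theta \<delta>"
  by (simp add: theta_def)

lemma theta_plus_part: "\<alpha> \<in> theta_NI p l \<Longrightarrow> theta (plus_part p l \<alpha>) = \<alpha> \<and> plus_part p l \<alpha> \<in> NI_plus p l"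
proof -
  assume \<alpha>: "\<alpha> \<in> theta_NI p l"
  note b = plus_part_bij[OF p0 l0 I1 I2 I3 I4]
  have g: "plus_part p l \<alpha> \<in> NI_plus p l" using b(1) \<alpha> by (auto simp: bij_betw_def)
  then have "theta (plus_part p l \<alpha>) = \<alpha>"
    using b(1) b(2)[OF g] \<alpha> by (metis bij_betw_imp_inj_on inj_onD)
  then show ?thesis using g by simp
qed

context
  fixes \<gamma> \<delta> :: "'k multiset"
  assumes \<gamma>: "\<gamma> \<in> NI_plus p l" and \<delta>: "\<delta> \<in> NI_plus p l"
begin

interpretation wN: wt p l "\<gamma> + \<delta>"
  by unfold_locales (rule wt_add[OF \<gamma> \<delta>])

lemma conv_setup_R: "conv_setup wN.R p (size (\<gamma> + \<delta>)) (words (\<gamma> + \<delta>)) \<gamma> \<delta>"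
  by (intro conv_setup.intro wN.R.klr_like_axioms conv_setup_axioms.intro)
    (auto simp: words_def)

lemma conv_setup_V: "conv_setup wN.V p (size (\<gamma> + \<delta>)) (theta_words (theta (\<gamma> + \<delta>))) \<gamma> \<delta>"
proof (intro conv_setup.intro wN.V.klr_like_axioms conv_setup_axioms.intro)
  fix i k assume "i \<in> words \<gamma>" "k \<in> words \<delta>"
  then have "i @ k \<in> words (\<gamma> + \<delta>)" by (auto simp: words_def)
  then show "i @ k \<in> theta_words (theta (\<gamma> + \<delta>))" by (rule wN.W_WW)
qed simp

interpretation cR: conv_setup wN.R p "size (\<gamma> + \<delta>)" "words (\<gamma> + \<delta>)" \<gamma> \<delta> by (rule conv_setup_R)
interpretation cV: conv_setup wN.V p "size (\<gamma> + \<delta>)" "theta_words (theta (\<gamma> + \<delta>))" \<gamma> \<delta> by (rule conv_setup_V)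
interpretation cI: corner_iso "alg wN.R" "alg wN.V" "e_plus p l (theta (\<gamma> + \<delta>))" "incl p l (theta (\<gamma> + \<delta>))"
  using wN.incl_corner_iso by (simp add: klr_def vv_def)

text \<open>Concatenations of positive words are positive, so each of their idempotents is fixed by
  e.\<close>

lemma Ep_E: "wN.V.eqv (cV.Ep * wN.E) cV.Ep"
proof -
  have "wN.V.eqv (eg (i @ k) * wN.E) (eg (i @ k))" if "i \<in> words \<gamma>" "k \<in> words \<delta>" for i k
  proof -
    have "i @ k \<in> words (\<gamma> + \<delta>)" using that by (auto simp: words_def)
    then show ?thesis
      using wN.e_esum[of "i @ k" wN.pls] wN.W_WW wN.sgn_W by (simp add: wN.E_esum)
  qed
  then show ?thesis
    unfolding cV.Ep_def sum_distrib_right by (intro wN.V.eqv_sum)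
qed

lemma incl_pair: "incl p l (theta (\<gamma> + \<delta>)) cR.e = cV.e"
  using Ep_E cR.h1.E_FA
  by (simp add: cR.e_pair_eq cV.e_pair_eq wN.incl_cls wN.V.cls_eqI)

text \<open>On pure tensors both juxtaposition maps are given by the same element of the free
  algebra. The inclusion appends \<open>E\<close>, which the trailing \<open>Ep\<close> absorbs by
  \<open>Ep_E\<close>.\<close>

lemma incl_juxt:
  assumes "t \<in> carrier cR.S"
  shows "incl p l (theta (\<gamma> + \<delta>)) (cR.jx t) = cV.jx t"
proof (rule cR.T.T_ext[OF cR.is_tens_S assms, where f = "\<lambda>t. incl p l (theta (\<gamma> + \<delta>)) (cR.jx t)"
      and g = cV.jx and B = "alg wN.V"])
  fix r s assume "r \<in> carrier (klr p \<gamma>)" "s \<in> carrier (klr p \<delta>)"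
  then obtain f g where f: "f \<in> cR.h1.src.Fr" "r = cls (klr_pres p \<gamma>) f"
    and g: "g \<in> cR.h2.src.Fr" "s = cls (klr_pres p \<delta>) g"
    by (auto simp: klr_def cR.h1.src.carrier_alg cR.h2.src.carrier_alg)
  let ?a = "subst (juxt_gen1 \<delta>) f" and ?b = "subst (juxt_gen2 \<gamma>) g"
  let ?h = "?a * cV.Ep * (?b * cV.Ep)"
  have "wN.V.eqv (?a * cV.Ep * (?b * (cV.Ep * wN.E))) ?h"
    using cV.h1.subst_closed[OF f(1)] cV.h2.subst_closed[OF g(1)] cV.h1.E_FA
    by (intro wN.V.eqv_multl Ep_E) auto
  then have e: "cls wN.V (?h * wN.E) = cls wN.V ?h" by (intro wN.V.cls_eqI) (simp add: mult.assoc)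
  have h: "?h \<in> wN.R.Fr"
    using cR.h1.subst_closed[OF f(1)] cR.h2.subst_closed[OF g(1)] cR.h1.E_FA by simp
  show "incl p l (theta (\<gamma> + \<delta>)) (cR.jx (cR.T.tp r s)) = cV.jx (cR.T.tp r s)"
    unfolding f g cR.jx_pure[OF f(1) g(1)] cV.jx_pure[OF f(1) g(1)] wN.incl_cls[OF h] by (rule e)
next
  show "incl p l (theta (\<gamma> + \<delta>)) (cR.jx (C \<oplus>\<^bsub>cR.S\<^esub> D)) =
      incl p l (theta (\<gamma> + \<delta>)) (cR.jx C) \<oplus>\<^bsub>alg wN.V\<^esub> incl p l (theta (\<gamma> + \<delta>)) (cR.jx D)"
    if "C \<in> carrier cR.S" "D \<in> carrier cR.S" for C D
    using that by (simp add: cR.jx_add cI.\<iota>_add cR.jx_closed)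
qed (rule cV.jx_add)

lemma conv_mods:
  assumes "left_module (klr p \<gamma>) P" "left_module (klr p \<delta>) Q"
  shows "kmods (klr p \<gamma>) (klr p \<delta>) P Q"
    and "conv_mod wN.R p (size (\<gamma> + \<delta>)) (words (\<gamma> + \<delta>)) \<gamma> \<delta> P Q"
    and "conv_mod wN.V p (size (\<gamma> + \<delta>)) (theta_words (theta (\<gamma> + \<delta>))) \<gamma> \<delta> P Q"
proof -
  show "kmods (klr p \<gamma>) (klr p \<delta>) P Q"
    by (intro kmods.intro cR.kalg_\<gamma> cR.kalg_\<delta> assms)
  then show "conv_mod wN.R p (size (\<gamma> + \<delta>)) (words (\<gamma> + \<delta>)) \<gamma> \<delta> P Q"
    and "conv_mod wN.V p (size (\<gamma> + \<delta>)) (theta_words (theta (\<gamma> + \<delta>))) \<gamma> \<delta> P Q"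
    by (intro conv_mod.intro conv_setup_R conv_setup_V; assumption)+
qed

text \<open>Both convolutions are built from the same outer tensor product, so
  \<open>conv_pair\<close> is taken with identities. The formula on pure tensors expresses that the
  isomorphism is the canonical one.\<close>

lemma Res_conv:
  fixes P :: "('k vvfree set, 'm) module" and Q :: "('k vvfree set, 'n) module"
  assumes P: "left_module (klr p \<gamma>) P" and Q: "left_module (klr p \<delta>) Q"
  shows "\<exists>\<Phi>. left_module_iso (klr p (\<gamma> + \<delta>))
      (Res p l (theta (\<gamma> + \<delta>)) (conv p wN.V \<gamma> \<delta> P Q)) (conv p wN.R \<gamma> \<delta> P Q) \<Phi> \<and>
    (\<forall>r x y. r \<in> carrier (left_ideal (klr p (\<gamma> + \<delta>)) cR.e) \<longrightarrow> x \<in> carrier P \<longrightarrow> y \<in> carrier Q \<longrightarrow>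
      \<Phi> (conv_pure p wN.V \<gamma> \<delta> P Q (incl p l (theta (\<gamma> + \<delta>)) r) x y) = conv_pure p wN.R \<gamma> \<delta> P Q r x y)"
proof -
  interpret PQ: kmods "klr p \<gamma>" "klr p \<delta>" P Q by (rule conv_mods[OF P Q])
  interpret CR: conv_mod wN.R p "size (\<gamma> + \<delta>)" "words (\<gamma> + \<delta>)" \<gamma> \<delta> P Q by (rule conv_mods[OF P Q])
  interpret CV: conv_mod wN.V p "size (\<gamma> + \<delta>)" "theta_words (theta (\<gamma> + \<delta>))" \<gamma> \<delta> P Q
    by (rule conv_mods[OF P Q])
  interpret cp: conv_pair wN.R p "size (\<gamma> + \<delta>)" "words (\<gamma> + \<delta>)" \<gamma> \<delta> P Q wN.V
    "theta_words (theta (\<gamma> + \<delta>))" P Q "e_plus p l (theta (\<gamma> + \<delta>))" "incl p l (theta (\<gamma> + \<delta>))" id id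
    by unfold_locales (auto simp: incl_pair incl_juxt)
  have res: "Res p l (theta (\<gamma> + \<delta>)) (conv p wN.V \<gamma> \<delta> P Q) = cI.res CV.C.TM"
    by (simp add: Res_def cI.res_def CV.conv_eq)
  show ?thesis
    unfolding res CR.conv_eq CR.conv_pure_eq CV.conv_pure_eq klr_def[of p "\<gamma> + \<delta>"]
    using cp.res_conv PQ.pM_closed by (intro exI[of _ cp.L] conjI allI impI) auto
qed

text \<open>The target is built from Res Ind P and Res Ind Q, which the units identify with P and Q;
  on outer tensor products the units and counits give the mutually inverse maps \<open>u.mt\<close>
  and \<open>c.mt\<close>.\<close>

lemma Ind_conv:
  fixes P :: "('k vvfree set, 'm) module" and Q :: "('k vvfree set, 'n) module"
  assumes P: "left_module (klr p \<gamma>) P" and Q: "left_module (klr p \<delta>) Q"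
  defines "IP \<equiv> Ind p l (theta \<gamma>) P" and "IQ \<equiv> Ind p l (theta \<delta>) Q"
  shows "\<exists>\<Psi>. left_module_iso (vv p (theta (\<gamma> + \<delta>)))
      (Ind p l (theta (\<gamma> + \<delta>)) (conv p wN.R \<gamma> \<delta> P Q))
      (conv p wN.V \<gamma> \<delta> (Res p l (theta \<gamma>) IP) (Res p l (theta \<delta>) IQ)) \<Psi> \<and>
    (\<forall>w r x y. w \<in> carrier (left_ideal (vv p (theta (\<gamma> + \<delta>))) (e_plus p l (theta (\<gamma> + \<delta>)))) \<longrightarrow>
      r \<in> carrier (left_ideal (klr p (\<gamma> + \<delta>)) cR.e) \<longrightarrow> x \<in> carrier P \<longrightarrow> y \<in> carrier Q \<longrightarrow>
      \<Psi> (Ind_pure p l (theta (\<gamma> + \<delta>)) (conv p wN.R \<gamma> \<delta> P Q) w (conv_pure p wN.R \<gamma> \<delta> P Q r x y)) =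
      conv_pure p wN.V \<gamma> \<delta> (Res p l (theta \<gamma>) IP) (Res p l (theta \<delta>) IQ)
        (w \<otimes>\<^bsub>vv p (theta (\<gamma> + \<delta>))\<^esub> incl p l (theta (\<gamma> + \<delta>)) r)
        (Ind_pure p l (theta \<gamma>) P (e_plus p l (theta \<gamma>)) x)
        (Ind_pure p l (theta \<delta>) Q (e_plus p l (theta \<delta>)) y))"
proof -
  interpret wG: wt p l \<gamma> by unfold_locales (rule \<gamma>)
  interpret wD: wt p l \<delta> by unfold_locales (rule \<delta>)
  interpret IG: ind_mod "klr p \<gamma>" "vv p (theta \<gamma>)" "e_plus p l (theta \<gamma>)" "incl p l (theta \<gamma>)" P
    by (intro ind_mod.intro wG.incl_corner_iso P)
  interpret ID: ind_mod "klr p \<delta>" "vv p (theta \<delta>)" "e_plus p l (theta \<delta>)" "incl p l (theta \<delta>)" Q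
    by (intro ind_mod.intro wD.incl_corner_iso Q)
  let ?RP = "IG.res IG.I.TM" and ?RQ = "ID.res ID.I.TM"
  have R: "Res p l (theta \<gamma>) IP = ?RP" "Res p l (theta \<delta>) IQ = ?RQ"
    by (simp_all add: IP_def IQ_def Res_def Ind_def IG.res_def ID.res_def wG.plus_part_theta wD.plus_part_theta)
  note RP = IG.left_module_res[OF IG.left_module_I] ID.left_module_res[OF ID.left_module_I]
  interpret PQ: kmods "klr p \<gamma>" "klr p \<delta>" P Q by (rule conv_mods[OF P Q])
  interpret RPQ: kmods "klr p \<gamma>" "klr p \<delta>" ?RP ?RQ by (rule conv_mods[OF RP])
  note cG = IG.carrier_res[OF IG.left_module_I] and cD = ID.carrier_res[OF ID.left_module_I]
  interpret u: kmods_hom "klr p \<gamma>" "klr p \<delta>" P Q ?RP ?RQ IG.unit ID.unit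
    by unfold_locales (auto simp: IG.unit_closed ID.unit_closed IG.unit_add ID.unit_add IG.unit_smult ID.unit_smult)
  interpret c: kmods_hom "klr p \<gamma>" "klr p \<delta>" ?RP ?RQ P Q IG.counit ID.counit
    by unfold_locales (auto simp: cG cD IG.counit_closed ID.counit_closed IG.counit_add ID.counit_add
        IG.counit_smult ID.counit_smult)
  have cu: "c.mt (u.mt z) = z" if "z \<in> carrier PQ.PQ" for z
    using that
  proof (induction rule: PQ.PQ_induct)
    case (pure x y)
    then show ?case
      by (simp add: u.mt_pure c.mt_pure IG.unit_closed ID.unit_closed IG.counit_unit ID.counit_unit)
  qed (simp add: u.mt_add c.mt_add u.mt_closed)
  have uc: "u.mt (c.mt z) = z" if "z \<in> carrier RPQ.PQ" for z
    using that
  proof (induction rule: RPQ.PQ_induct)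
    case (pure x y)
    then have "x \<in> carrier IG.I.TM" "y \<in> carrier ID.I.TM" "IG.unit (IG.counit x) = x" "ID.unit (ID.counit y) = y"
      by (simp_all add: cG cD IG.unit_counit ID.unit_counit)
    then show ?case
      using pure by (simp add: u.mt_pure c.mt_pure IG.counit_closed ID.counit_closed)
  qed (simp add: u.mt_add c.mt_add c.mt_closed)
  interpret CR: conv_mod wN.R p "size (\<gamma> + \<delta>)" "words (\<gamma> + \<delta>)" \<gamma> \<delta> P Q by (rule conv_mods[OF P Q])
  interpret CV: conv_mod wN.V p "size (\<gamma> + \<delta>)" "theta_words (theta (\<gamma> + \<delta>))" \<gamma> \<delta> ?RP ?RQ
    by (rule conv_mods[OF RP])
  interpret cp: conv_pair wN.R p "size (\<gamma> + \<delta>)" "words (\<gamma> + \<delta>)" \<gamma> \<delta> P Q wN.V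
    "theta_words (theta (\<gamma> + \<delta>))" ?RP ?RQ "e_plus p l (theta (\<gamma> + \<delta>))" "incl p l (theta (\<gamma> + \<delta>))" u.mt c.mt
    by unfold_locales
      (auto simp: incl_pair incl_juxt u.mt_closed u.mt_add u.mt_smult c.mt_closed c.mt_add c.mt_smult cu uc)
  have ind: "Ind p l (theta (\<gamma> + \<delta>)) CR.C.TM = cp.In.I.TM"
    "Ind_pure p l (theta (\<gamma> + \<delta>)) CR.C.TM w z = cp.In.I.tp w z" for w z
    by (simp_all add: Ind_def Ind_pure_def wN.plus_part_theta klr_def vv_def)
  have unit: "Ind_pure p l (theta \<gamma>) P (e_plus p l (theta \<gamma>)) x = IG.unit x"
    "Ind_pure p l (theta \<delta>) Q (e_plus p l (theta \<delta>)) y = ID.unit y" for x y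
    by (simp_all add: Ind_pure_def wG.plus_part_theta wD.plus_part_theta IG.unit_def ID.unit_def)
  show ?thesis
    unfolding R unit ind CR.conv_eq CV.conv_eq CR.conv_pure_eq CV.conv_pure_eq klr_def[of p "\<gamma> + \<delta>"]
      vv_def[of p "theta (\<gamma> + \<delta>)"]
    using cp.ind_conv PQ.pM_closed u.mt_pure
    by (intro exI[of _ cp.\<Psi>] conjI allI impI) auto
qed

end

end

theorem lemma2p13:
  fixes p q l :: "'k::field"
    and \<alpha> \<beta> \<gamma> \<delta> :: "'k multiset"
    and M :: "('k vvfree set, 'm) module"
    and N :: "('k vvfree set, 'n) module"
    and P :: "('k vvfree set, 'p) module"
    and Q :: "('k vvfree set, 'q) module"
  assumes "(2::'k) \<noteq> 0"
    and "p \<noteq> 0" and "q \<noteq> 0" and "l \<noteq> 0"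
    and "\<forall>n::int. p \<noteq> q powi n" and "\<forall>n::int. q \<noteq> p powi n"
    and "p \<noteq> 1" and "p \<noteq> - 1"
    and "1 \<notin> I_set p l" and "- 1 \<notin> I_set p l"
    and "p \<notin> I_set p l" and "- p \<notin> I_set p l"
    and "q \<notin> I_set p l" and "- q \<notin> I_set p l"
    and "\<alpha> \<in> theta_NI p l" and "\<beta> \<in> theta_NI p l"
    and "left_module (vv p \<alpha>) M" and "left_module (vv p \<beta>) N"
    and "\<gamma> \<in> NI_plus p l" and "\<delta> \<in> NI_plus p l"
    and "left_module (klr p \<gamma>) P" and "left_module (klr p \<delta>) Q"
  shows "(\<exists>\<Phi>. left_module_iso (klr p (plus_part p l (\<alpha> + \<beta>)))
             (Res p l (\<alpha> + \<beta>) (convB p l \<alpha> \<beta> M N))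
             (convA p (plus_part p l \<alpha>) (plus_part p l \<beta>) (Res p l \<alpha> M) (Res p l \<beta> N)) \<Phi> \<and>
           (\<forall>r x y.
              r \<in> carrier (left_ideal (klr p (plus_part p l (\<alpha> + \<beta>)))
                     (e_pair (klr_pres p (plus_part p l (\<alpha> + \<beta>)))
                       (plus_part p l \<alpha>) (plus_part p l \<beta>))) \<longrightarrow>
              x \<in> carrier (Res p l \<alpha> M) \<longrightarrow> y \<in> carrier (Res p l \<beta> N) \<longrightarrow>
              \<Phi> (convB_pure p l \<alpha> \<beta> M N (incl p l (\<alpha> + \<beta>) r) x y) =
              convA_pure p (plus_part p l \<alpha>) (plus_part p l \<beta>) (Res p l \<alpha> M) (Res p l \<beta> N) r x y))
      \<and> (\<exists>\<Psi>. left_module_iso (vv p (theta (\<gamma> + \<delta>)))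
             (Ind p l (theta (\<gamma> + \<delta>)) (convA p \<gamma> \<delta> P Q))
             (convB p l (theta \<gamma>) (theta \<delta>) (Ind p l (theta \<gamma>) P) (Ind p l (theta \<delta>) Q)) \<Psi> \<and>
           (\<forall>w r x y.
              w \<in> carrier (left_ideal (vv p (theta (\<gamma> + \<delta>))) (e_plus p l (theta (\<gamma> + \<delta>)))) \<longrightarrow>
              r \<in> carrier (left_ideal (klr p (\<gamma> + \<delta>))
                     (e_pair (klr_pres p (\<gamma> + \<delta>)) \<gamma> \<delta>)) \<longrightarrow>
              x \<in> carrier P \<longrightarrow> y \<in> carrier Q \<longrightarrow>
              \<Psi> (Ind_pure p l (theta (\<gamma> + \<delta>)) (convA p \<gamma> \<delta> P Q) w
                    (convA_pure p \<gamma> \<delta> P Q r x y)) =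
              convB_pure p l (theta \<gamma>) (theta \<delta>) (Ind p l (theta \<gamma>) P) (Ind p l (theta \<delta>) Q)
                (w \<otimes>\<^bsub>vv p (theta (\<gamma> + \<delta>))\<^esub> incl p l (theta (\<gamma> + \<delta>)) r)
                (Ind_pure p l (theta \<gamma>) P (e_plus p l (theta \<gamma>)) x)
                (Ind_pure p l (theta \<delta>) Q (e_plus p l (theta \<delta>)) y)))"
proof -
  interpret params p l by unfold_locales (use assms in auto)
  show ?thesis
  proof (rule conjI, goal_cases)
    case 1
    \<comment> \<open>The symmetric weights are rewritten as \<open>theta a\<close> and
      \<open>theta b\<close>, the form in which the results on a single weight are stated.\<close>
    define a where "a = plus_part p l \<alpha>"
    define b where "b = plus_part p l \<beta>"
    note a_b_def = a_def b_def
    have ab: "\<alpha> = theta a" "\<beta> = theta b" "a \<in> NI_plus p l" "b \<in> NI_plus p l"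
      using theta_plus_part assms by (simp_all add: a_b_def)
    interpret wa: wt p l a by unfold_locales (rule ab)
    interpret wb: wt p l b by unfold_locales (rule ab)
    have sum: "\<alpha> + \<beta> = theta (a + b)" "plus_part p l (\<alpha> + \<beta>) = a + b"
      by (simp_all add: ab(1,2) theta_add plus_part_def filter_union_mset wa.plus_part_theta[unfolded plus_part_def]
          wb.plus_part_theta[unfolded plus_part_def])
    interpret ca: corner_iso "klr p a" "vv p \<alpha>" "e_plus p l \<alpha>" "incl p l \<alpha>"
      unfolding ab(1) by (rule wa.incl_corner_iso)
    interpret cb: corner_iso "klr p b" "vv p \<beta>" "e_plus p l \<beta>" "incl p l \<beta>"
      unfolding ab(2) by (rule wb.incl_corner_iso)
    have "Res p l \<alpha> M = ca.res M" "Res p l \<beta> N = cb.res N"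
      by (simp_all add: Res_def ca.res_def cb.res_def)
    then have "left_module (klr p a) (Res p l \<alpha> M)" "left_module (klr p b) (Res p l \<beta> N)"
      using ca.left_module_res cb.left_module_res assms by auto
    from Res_conv[OF ab(3,4) this] show ?case
      unfolding convA_def convB_def convA_pure_def convB_pure_def sum(2) a_b_def[symmetric]
      unfolding sum(1) .
  next
    case 2
    interpret wc: wt p l \<gamma> by unfold_locales (rule assms)
    interpret wd: wt p l \<delta> by unfold_locales (rule assms)
    from Ind_conv[OF assms(19-22)] show ?case
      unfolding convA_def convB_def convA_pure_def convB_pure_def wc.plus_part_theta wd.plus_part_theta
        theta_add[symmetric] .
  qed
qed

end
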